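(* Let $0<H<\frac12$ and $f\in\mathscr H$. Then the integral $\int_{\mathbb R}f(x)\,\mathscr L^H(dx,t)$ exists in $L^2$ (that is, the $L^2$-limit defining it exists and does not depend on the choice of the approximating sequence of elementary functions), and the Bouleau-Yor identity $$\left[f(B^H),B^H\right]^{(W)}_t=-\int_{\mathbb R}f(x)\,\mathscr L^H(dx,t)$$ holds for all $t\in[0,T]$.
   Context: Fix $T>0$. $B^H=\{B^H_t,\ t\ge 0\}$ is a one-dimensional fractional Brownian motion with Hurst index $H$: a mean zero Gaussian process with $E[B^H_tB^H_s]=\frac12\left[t^{2H}+s^{2H}-|t-s|^{2H}\right]$. The generalized quadratic covariation of $f(B^H)$ and $B^H$ is $$[f(B^H),B^H]^{(W)}_t:=\lim_{\varepsilon\downarrow0}\frac{2H}{\varepsilon^{2H}}\int_0^t\{f(B^H_{s+\varepsilon})-f(B^H_s)\}(B^H_{s+\varepsilon}-B^H_s)s^{2H-1}\,ds,$$ the limit being uniform in probability; it exists for $f\in\mathscr H$. $\mathscr H$ is the Banach space of measurable functions $f$ on $\mathbb R$ such that $\|f\|_{\mathscr H}<\infty$, where $$\|f\|_{\mathscr H}=\sqrt{\int_0^T\int_{\mathbb R}|f(x)|^2e^{-\frac{x^2}{2s^{2H}}}\frac{dx\,ds}{\sqrt{2\pi}s^{1-H}}}+\sqrt{\int_0^T\int_{\mathbb R}|f(x)|^2e^{-\frac{x^2}{2s^{2H}}}\frac{dx\,ds}{\sqrt{2\pi}(T-s)^{1-H}}}.$$ Let $\mathcal L^H(x,t)=\int_0^t\delta(B^H_s-x)\,ds$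 be the local time of $B^H$, jointly continuous in $(x,t)$, with $\delta$ the Dirac delta function. The weighted local time is $\mathscr L^H(x,t)=2H\int_0^ts^{2H-1}\mathcal L^H(x,ds)$. $\mathscr E$ is the set of elementary functions $f_\triangle(x)=\sum_jf_j1_{(a_{j-1},a_j]}(x)$ with $a_0<a_1<\cdots<a_l$ a finite sequence of reals and $f_j\in\mathbb R$; it is dense in $\mathscr H$. For $f_\triangle\in\mathscr E$, $$\int_{\mathbb R}f_\triangle(x)\,\mathscr L^H(dx,t):=\sum_jf_j\left[\mathscr L^H(a_j,t)-\mathscr L^H(a_{j-1},t)\right].$$ For $f\in\mathscr H$, $\int_{\mathbb R}f(x)\,\mathscr L^H(dx,t):=\lim_{n\to\infty}\int_{\mathbb R}f_{\triangle,n}(x)\,\mathscr L^H(dx,t)$ in $L^2$, where $\{f_{\triangle,n}\}\subset\mathscr E$ and $f_{\triangle,n}\to f$ in $\mathscr H$. *)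

theory Defs
  imports "HOL-Probability.Probability"
begin

text \<open>Point masses count as Gaussian, so that e.g. the value at time 0 is covered.\<close>

definition gaussian_rv :: "'a measure \<Rightarrow> ('a \<Rightarrow> real) \<Rightarrow> bool" where
  "gaussian_rv M X \<longleftrightarrow> X \<in> borel_measurable M \<and>
     ((\<exists>m. AE \<omega> in M. X \<omega> = m) \<or>
      (\<exists>m \<sigma>. 0 < \<sigma> \<and> distributed M lborel X (\<lambda>x. ennreal (normal_density m \<sigma> x))))"

text \<open>Processes are indexed by all reals; only their values at times \<open>t \<ge> 0\<close> are constrained or used.\<close>

definition gaussian_process :: "'a measure \<Rightarrow> (real \<Rightarrow> 'a \<Rightarrow> real) \<Rightarrow> bool" where
  "gaussian_process M B \<longleftrightarrow>
     (\<forall>J c. finite J \<and> J \<subseteq> {0..} \<longrightarrow> gaussian_rv M (\<lambda>\<omega>. \<Sum>t\<in>J. c t * B t \<omega>))"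

text \<open>Almost sure path continuity is the usual convention; it gives a meaning to the pathwise
  \<open>ds\<close>-integrals below.\<close>

definition fractional_brownian_motion :: "'a measure \<Rightarrow> real \<Rightarrow> (real \<Rightarrow> 'a \<Rightarrow> real) \<Rightarrow> bool" where
  "fractional_brownian_motion M H B \<longleftrightarrow>
     gaussian_process M B \<and>
     (\<forall>t\<ge>0. (\<integral>\<omega>. B t \<omega> \<partial>M) = 0) \<and>
     (\<forall>t\<ge>0. \<forall>s\<ge>0. (\<integral>\<omega>. B t \<omega> * B s \<omega> \<partial>M) =
        1/2 * (t powr (2*H) + s powr (2*H) - \<bar>t - s\<bar> powr (2*H))) \<and>
     (AE \<omega> in M. continuous_on {0..} (\<lambda>t. B t \<omega>))"

definition ennreal_sqrt :: "ennreal \<Rightarrow> ennreal" where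
  "ennreal_sqrt a = (if a = \<infinity> then \<infinity> else ennreal (sqrt (enn2real a)))"

definition H_norm :: "real \<Rightarrow> real \<Rightarrow> (real \<Rightarrow> real) \<Rightarrow> ennreal" where
  "H_norm H T f =
     ennreal_sqrt (\<integral>\<^sup>+s\<in>{0..T}. (\<integral>\<^sup>+x. ennreal (\<bar>f x\<bar>\<^sup>2 * exp (- (x\<^sup>2 / (2 * s powr (2*H))))
         / (sqrt (2*pi) * s powr (1 - H))) \<partial>lborel) \<partial>lborel)
   + ennreal_sqrt (\<integral>\<^sup>+s\<in>{0..T}. (\<integral>\<^sup>+x. ennreal (\<bar>f x\<bar>\<^sup>2 * exp (- (x\<^sup>2 / (2 * s powr (2*H))))
         / (sqrt (2*pi) * (T - s) powr (1 - H))) \<partial>lborel) \<partial>lborel)"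

definition H_space :: "real \<Rightarrow> real \<Rightarrow> (real \<Rightarrow> real) set" where
  "H_space H T = {f \<in> borel_measurable borel. H_norm H T f < \<infinity>}"

definition qc_approx ::
  "real \<Rightarrow> (real \<Rightarrow> 'a \<Rightarrow> real) \<Rightarrow> (real \<Rightarrow> real) \<Rightarrow> real \<Rightarrow> real \<Rightarrow> 'a \<Rightarrow> real" where
  "qc_approx H B f \<epsilon> t \<omega> =
     2*H / \<epsilon> powr (2*H) *
     (LINT s:{0..t}|lborel. (f (B (s + \<epsilon>) \<omega>) - f (B s \<omega>)) * (B (s + \<epsilon>) \<omega> - B s \<omega>) * s powr (2*H - 1))"

text \<open>Convergence in probability, uniformly on \<open>[0,T]\<close>, as \<open>\<epsilon>\<close> decreases to 0. The outer measure
  avoids presupposing that the supremum over uncountably many times is measurable.\<close>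

definition ucp_limit ::
  "'a measure \<Rightarrow> real \<Rightarrow> (real \<Rightarrow> real \<Rightarrow> 'a \<Rightarrow> real) \<Rightarrow> (real \<Rightarrow> 'a \<Rightarrow> real) \<Rightarrow> bool" where
  "ucp_limit M T X Q \<longleftrightarrow>
     (\<forall>\<eta>>0. ((\<lambda>\<epsilon>. outer_measure_of M
         {\<omega>\<in>space M. (SUP t\<in>{0..T}. ennreal \<bar>X \<epsilon> t \<omega> - Q t \<omega>\<bar>) > ennreal \<eta>}) \<longlongrightarrow> 0) (at_right 0))"

definition is_generalized_qc ::
  "'a measure \<Rightarrow> real \<Rightarrow> real \<Rightarrow> (real \<Rightarrow> 'a \<Rightarrow> real) \<Rightarrow> (real \<Rightarrow> real) \<Rightarrow> (real \<Rightarrow> 'a \<Rightarrow> real) \<Rightarrow> bool" where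
  "is_generalized_qc M H T B f Q \<longleftrightarrow>
     (\<forall>t\<in>{0..T}. Q t \<in> borel_measurable M) \<and> ucp_limit M T (qc_approx H B f) Q"

text \<open>\<open>\<integral>\<^sub>0\<^sup>t \<delta>(B\<^sub>s - x) ds\<close> is read as the density at \<open>x\<close> of the occupation measure of \<open>B\<close> on \<open>[0,t]\<close>;
  joint continuity makes the density unique at every point.\<close>

definition is_local_time ::
  "'a measure \<Rightarrow> (real \<Rightarrow> 'a \<Rightarrow> real) \<Rightarrow> (real \<Rightarrow> real \<Rightarrow> 'a \<Rightarrow> real) \<Rightarrow> bool" where
  "is_local_time M B L \<longleftrightarrow>
     (\<forall>x. \<forall>t\<ge>0. L x t \<in> borel_measurable M) \<and>
     (AE \<omega> in M.
        continuous_on (UNIV \<times> {0..}) (\<lambda>(x, t). L x t \<omega>) \<and>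
        (\<forall>x. \<forall>t\<ge>0. 0 \<le> L x t \<omega>) \<and>
        (\<forall>t\<ge>0. \<forall>A\<in>sets borel.
           emeasure lborel {s\<in>{0..t}. B s \<omega> \<in> A} = (\<integral>\<^sup>+x\<in>A. ennreal (L x t \<omega>) \<partial>lborel)))"

text \<open>\<open>\<integral>\<^sub>0\<^sup>t \<dots> L(x,ds)\<close> is the Lebesgue-Stieltjes integral; the integrator is extended by its value
  at time 0 to negative times.\<close>

definition weighted_local_time ::
  "real \<Rightarrow> (real \<Rightarrow> real \<Rightarrow> 'a \<Rightarrow> real) \<Rightarrow> real \<Rightarrow> real \<Rightarrow> 'a \<Rightarrow> real" where
  "weighted_local_time H L x t \<omega> =
     2*H * (LINT s:{0..t}|interval_measure (\<lambda>s. L x (max 0 s) \<omega>). s powr (2*H - 1))"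

text \<open>A triple \<open>(l, a, c)\<close> represents the elementary function \<open>\<Sum>\<^sub>j c\<^sub>j 1\<^bsub>(a\<^sub>j\<^sub>-\<^sub>1, a\<^sub>j]\<^esub>\<close>, \<open>1 \<le> j \<le> l\<close>.\<close>

type_synonym elementary = "nat \<times> (nat \<Rightarrow> real) \<times> (nat \<Rightarrow> real)"

definition is_elementary :: "elementary \<Rightarrow> bool" where
  "is_elementary = (\<lambda>(l, a, c). strict_mono_on {..l} a)"

definition elem_fun :: "elementary \<Rightarrow> real \<Rightarrow> real" where
  "elem_fun = (\<lambda>(l, a, c) x. \<Sum>j=1..l. c j * indicator {a (j - 1)<..a j} x)"

definition elem_integral ::
  "real \<Rightarrow> (real \<Rightarrow> real \<Rightarrow> 'a \<Rightarrow> real) \<Rightarrow> elementary \<Rightarrow> real \<Rightarrow> 'a \<Rightarrow> real" where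
  "elem_integral H L = (\<lambda>(l, a, c) t \<omega>.
     \<Sum>j=1..l. c j * (weighted_local_time H L (a j) t \<omega> - weighted_local_time H L (a (j - 1)) t \<omega>))"

text \<open>The local time is only controlled almost surely, so its functionals are random variables
  up to null sets; hence the completion.\<close>

definition square_integrable :: "'a measure \<Rightarrow> ('a \<Rightarrow> real) \<Rightarrow> bool" where
  "square_integrable M X \<longleftrightarrow>
     X \<in> borel_measurable (completion M) \<and> (\<integral>\<^sup>+\<omega>. ennreal ((X \<omega>)\<^sup>2) \<partial>completion M) < \<infinity>"

definition L2_limit :: "'a measure \<Rightarrow> (nat \<Rightarrow> 'a \<Rightarrow> real) \<Rightarrow> ('a \<Rightarrow> real) \<Rightarrow> bool" where
  "L2_limit M X Y \<longleftrightarrow>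
     (\<forall>n. square_integrable M (X n)) \<and> square_integrable M Y \<and>
     (\<lambda>n. \<integral>\<^sup>+\<omega>. ennreal ((X n \<omega> - Y \<omega>)\<^sup>2) \<partial>completion M) \<longlonglongrightarrow> 0"

definition approximates :: "real \<Rightarrow> real \<Rightarrow> (nat \<Rightarrow> elementary) \<Rightarrow> (real \<Rightarrow> real) \<Rightarrow> bool" where
  "approximates H T g f \<longleftrightarrow>
     (\<forall>n. is_elementary (g n)) \<and> (\<lambda>n. H_norm H T (\<lambda>x. elem_fun (g n) x - f x)) \<longlonglongrightarrow> 0"

text \<open>\<open>I\<close> is (a version of) the integral of \<open>f\<close>: approximating sequences exist, and along each of
  them the elementary integrals converge to the same \<open>I\<close>.\<close>

definition has_local_time_integral ::
  "'a measure \<Rightarrow> real \<Rightarrow> real \<Rightarrow> (real \<Rightarrow> real \<Rightarrow> 'a \<Rightarrow> real) \<Rightarrow> (real \<Rightarrow> real) \<Rightarrow> real \<Rightarrow> ('a \<Rightarrow> real) \<Rightarrow> bool" where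
  "has_local_time_integral M H T L f t I \<longleftrightarrow>
     (\<exists>g. approximates H T g f) \<and>
     (\<forall>g. approximates H T g f \<longrightarrow> L2_limit M (\<lambda>n. elem_integral H L (g n) t) I)"

end

theory Submission
  imports Defs
begin

text \<open>For the increments \<open>D\<^sub>s = B(s + \<epsilon>) - B(s)\<close>, conditioning on the pair \<open>(B(s), B(r))\<close> bounds
  \<open>E[h(B(s)) h(B(r)) D\<^sub>s D\<^sub>r]\<close> by a kernel whose singularity \<open>|s - r| powr (-2H)\<close> is integrable because
  \<open>H < 1/2\<close>. Dyadic chaining turns the kernel bound into a maximal inequality in \<open>t\<close>, uniform in \<open>\<epsilon>\<close>;
  hence the approximations of the covariation depend continuously on \<open>f\<close>, and the covariation exists for
  every locally square integrable \<open>f\<close> as soon as it exists for a dense class. For a smoothed step function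
  \<open>g\<close> it is \<open>2H \<integral> g'(B(s)) s powr (2H - 1) ds\<close>, by a law of large numbers for the squared increments.
  Sharpening the step and using the occupation density identifies the covariation of the step
  \<open>1\<^bsub>(a, \<infinity>)\<^esub>\<close> with the weighted local time at \<open>a\<close>, which is the identity for elementary functions.
  A weighted form of the kernel bound dominates the second moment of the covariation by the squared norm
  of \<open>f\<close>, and density of the elementary functions carries the identity over to all \<open>f\<close>.\<close>

section \<open>Uniqueness of weighted characteristic functions\<close>

text \<open>The main obstacle: \<open>f (B (s + \<epsilon>))\<close> and \<open>f (B s)\<close> are
  multiplied by an increment of size \<open>\<epsilon> powr H\<close> and divided by
  \<open>\<epsilon> powr (2*H)\<close>, while \<open>f\<close> is merely square integrable. For
  \<open>H < 1/2\<close> the covariance of an increment with any value of \<open>B\<close> is at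
  most \<open>\<epsilon> powr (2*H)\<close>, exactly the normalisation, so after conditioning each
  half of the difference has a second moment bounded in \<open>\<epsilon>\<close> on its own,
  without cancellation between the halves. A second obstacle: regression costs a factor
  \<open>1 + x^2 / v\<close> under the Gaussian density of variance \<open>v\<close>, which the
  density at the same time cannot absorb. The density at a later time \<open>P\<close> absorbs it,
  at a price of order \<open>P / (P - p)\<close>. Near the end of \<open>{0..T}\<close> little later
  time is left, and the weight \<open>(T - s) powr (H - 1)\<close> in the norm pays for this. As
  \<open>s + \<epsilon>\<close> may even pass \<open>T\<close>, where the norm sees nothing,
  existence of the covariation comes from localising to bounded paths, and the second moment bound
  is proved for \<open>t + \<epsilon> < T\<close> and carried up to \<open>T\<close> by Fatou and
  continuity in \<open>t\<close>.\<close>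

lemma char_distr:
 assumes [measurable]: "X \<in> borel_measurable M"
 shows "char (distr M borel X) a = (CLINT w|M. iexp (a * X w))"
 unfolding char_def by (subst integral_distr) auto

text \<open>At \<open>a = 0\<close> the hypothesis equates the total masses of the two weights. If
  the common mass \<open>c\<close> is positive, dividing by it turns the weighted measures into
  probability measures, to which Levy's uniqueness theorem applies; if it is zero, both weights
  vanish almost everywhere.\<close>

lemma weighted_char_uniqueness:
 fixes M :: "'a measure" and N :: "'b measure" and X v :: "'a \<Rightarrow> real" and Y w :: "'b \<Rightarrow> real"
 assumes M: "prob_space M" and N: "prob_space N"
  and [measurable]: "X \<in> borel_measurable M" "v \<in> borel_measurable M"
   "Y \<in> borel_measurable N" "w \<in> borel_measurable N"
  and v: "\<And>x. 0 \<le> v x" "\<And>x. v x \<le> K" and w: "\<And>x. 0 \<le> w x" "\<And>x. w x \<le> K"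
  and eq: "\<And>a. (CLINT x|M. v x * iexp (a * X x)) = (CLINT x|N. w x * iexp (a * Y x))"
  and [measurable]: "A \<in> sets borel"
 shows "(LINT x|M. v x * indicator A (X x)) = (LINT x|N. w x * indicator A (Y x))"
proof -
 interpret M: prob_space M by fact
 interpret N: prob_space N by fact
 have iv: "integrable M v" by (rule M.integrable_const_bound[of _ K]) (use v in auto)
 have iw: "integrable N w" by (rule N.integrable_const_bound[of _ K]) (use w in auto)
 define c where "c = (LINT x|M. v x)"
 have cN: "c = (LINT x|N. w x)" using eq[of 0] by (simp add: c_def integral_of_real[symmetric])
 have c0: "0 \<le> c" unfolding c_def using v by (simp add: integral_nonneg_AE)
 show ?thesis
 proof (cases "c = 0")
  case True
  then have "AE x in M. v x = 0" "AE x in N. w x = 0"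
   using integral_nonneg_eq_0_iff_AE[OF iv] integral_nonneg_eq_0_iff_AE[OF iw] v w
   by (auto simp: c_def cN[symmetric])
  then have "(LINT x|M. v x * indicator A (X x)) = (LINT x|M. 0)"
   "(LINT x|N. w x * indicator A (Y x)) = (LINT x|N. 0)"
   by (auto intro!: integral_eq_zero_AE elim: eventually_mono)
  then show ?thesis by simp
 next
  case False
  then have c: "0 < c" using c0 by simp
  define M' where "M' = density M (\<lambda>x. ennreal (v x / c))"
  define N' where "N' = density N (\<lambda>x. ennreal (w x / c))"
  have "emeasure M' (space M') = ennreal (LINT x|M. v x / c)"
   unfolding M'_def by (subst emeasure_density) (use v c iv in \<open>auto simp: nn_integral_eq_integral cong: nn_integral_cong\<close>)
  then have M'p: "prob_space M'" using c by (intro prob_spaceI) (simp add: c_def)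
  have "emeasure N' (space N') = ennreal (LINT x|N. w x / c)"
   unfolding N'_def by (subst emeasure_density) (use w c iw in \<open>auto simp: nn_integral_eq_integral cong: nn_integral_cong\<close>)
  then have N'p: "prob_space N'" using c by (intro prob_spaceI) (simp add: cN)
  have [measurable]: "X \<in> borel_measurable M'" "Y \<in> borel_measurable N'" unfolding M'_def N'_def by simp_all
  have "char (distr M' borel X) a = char (distr N' borel Y) a" for a
  proof -
   have "char (distr M' borel X) a = (CLINT x|M. v x / c * iexp (a * X x))"
    unfolding char_distr[OF \<open>X \<in> borel_measurable M'\<close>] unfolding M'_def
    using v c by (subst integral_density) (auto simp: scaleR_conv_of_real)
   also have "... = (CLINT x|M. v x * iexp (a * X x)) / c" by (subst integral_divide_zero[symmetric]) simp
   also have "... = (CLINT x|N. w x * iexp (a * Y x)) / c" by (simp only: eq)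
   also have "... = (CLINT x|N. w x / c * iexp (a * Y x))" by (subst integral_divide_zero[symmetric]) simp
   also have "... = char (distr N' borel Y) a" unfolding char_distr[OF \<open>Y \<in> borel_measurable N'\<close>] unfolding N'_def
    using w c by (subst integral_density) (auto simp: scaleR_conv_of_real)
   finally show ?thesis .
  qed
  then have "distr M' borel X = distr N' borel Y"
   using M'p N'p by (intro Levy_uniqueness) (auto intro!: prob_space.real_distribution_distr)
  moreover have "(LINT x|distr M' borel X. indicator A x) = (LINT x|M. v x / c * indicat_real A (X x))"
   unfolding M'_def using v c by (subst integral_distr) (auto simp: integral_density)
  moreover have "(LINT x|distr N' borel Y. indicator A x) = (LINT x|N. w x / c * indicat_real A (Y x))"
   unfolding N'_def using w c by (subst integral_distr) (auto simp: integral_density)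
  ultimately have "(LINT x|M. v x / c * indicator A (X x)) = (LINT x|N. w x / c * indicator A (Y x))" by (simp only:)
  then show ?thesis using c by simp
 qed
qed

text \<open>The weights \<open>1 + cos (b Y)\<close> and \<open>1 + sin (b Y)\<close> reduce the plane to the line.\<close>

theorem char_uniqueness_pair:
 fixes M :: "'a measure" and N :: "'b measure"
 assumes M: "prob_space M" and N: "prob_space N"
  and [measurable]: "X \<in> borel_measurable M" "Y \<in> borel_measurable M"
   "X' \<in> borel_measurable N" "Y' \<in> borel_measurable N"
  and eq: "\<And>a b. (CLINT x|M. iexp (a * X x + b * Y x)) = (CLINT x|N. iexp (a * X' x + b * Y' x))"
 shows "distr M (borel \<Otimes>\<^sub>M borel) (\<lambda>x. (X x, Y x)) = distr N (borel \<Otimes>\<^sub>M borel) (\<lambda>x. (X' x, Y' x))"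
  (is "?D = ?D'")
proof -
 interpret M: prob_space M by fact
 interpret N: prob_space N by fact
 have iM: "complex_integrable M (\<lambda>x. iexp (a * X x + b * Y x))" for a b by (rule M.integrable_const_bound[of _ 1]) auto
 have iN: "complex_integrable N (\<lambda>x. iexp (a * X' x + b * Y' x))" for a b
  by (rule N.integrable_const_bound[of _ 1]) auto
 have cosid: "of_real (1 + cos y) * iexp x = iexp (x + 0 * y) + (iexp (x + y) + iexp (x + - y)) / 2" for x y :: real
  by (simp add: cos_exp_eq exp_add[symmetric] algebra_simps cos_of_real[symmetric] add_divide_distrib)
 have sinid: "of_real (1 + sin y) * iexp x = iexp (x + 0 * y) + (iexp (x + y) - iexp (x + - y)) / (2*\<i>)" for x y :: real
  by (simp add: sin_exp_eq exp_add[symmetric] algebra_simps sin_of_real[symmetric] diff_divide_distrib)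
 have cosM: "(CLINT x|M. of_real (1 + cos (b * Y x)) * iexp (a * X x))
  = (CLINT x|M. iexp (a * X x + 0 * Y x))
   + ((CLINT x|M. iexp (a * X x + b * Y x)) + (CLINT x|M. iexp (a * X x + - b * Y x))) / 2" for a b
  unfolding cosid using iM[of a 0] iM[of a b] iM[of a "-b"] by simp
 have cosN: "(CLINT x|N. of_real (1 + cos (b * Y' x)) * iexp (a * X' x))
  = (CLINT x|N. iexp (a * X' x + 0 * Y' x))
   + ((CLINT x|N. iexp (a * X' x + b * Y' x)) + (CLINT x|N. iexp (a * X' x + - b * Y' x))) / 2" for a b
  unfolding cosid using iN[of a 0] iN[of a b] iN[of a "-b"] by simp
 have sinM: "(CLINT x|M. of_real (1 + sin (b * Y x)) * iexp (a * X x))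
  = (CLINT x|M. iexp (a * X x + 0 * Y x))
   + ((CLINT x|M. iexp (a * X x + b * Y x)) - (CLINT x|M. iexp (a * X x + - b * Y x))) / (2*\<i>)" for a b
  unfolding sinid using iM[of a 0] iM[of a b] iM[of a "-b"] by simp
 have sinN: "(CLINT x|N. of_real (1 + sin (b * Y' x)) * iexp (a * X' x))
  = (CLINT x|N. iexp (a * X' x + 0 * Y' x))
   + ((CLINT x|N. iexp (a * X' x + b * Y' x)) - (CLINT x|N. iexp (a * X' x + - b * Y' x))) / (2*\<i>)" for a b
  unfolding sinid using iN[of a 0] iN[of a b] iN[of a "-b"] by simp
 have cs: "0 \<le> 1 + cos y" "1 + cos y \<le> 2" "0 \<le> 1 + sin y" "1 + sin y \<le> 2" for y :: real
  using cos_ge_minus_one[of y] cos_le_one[of y] sin_ge_minus_one[of y] sin_le_one[of y] by linarith+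
 \<comment> \<open>Two rounds on the line. The first, for \<open>X\<close>, equates the integrals of
   \<open>cos (b * Y)\<close> and \<open>sin (b * Y)\<close> over \<open>X\<close> in
   \<open>A\<close>. Together they form the characteristic function of \<open>Y\<close> with weight
   \<open>indicator A (X x)\<close>, and the second round, for \<open>Y\<close>, tests it on
   \<open>C\<close>.\<close>
 have rect: "(LINT x|M. indicator A (X x) * indicat_real C (Y x))
   = (LINT x|N. indicator A (X' x) * indicator C (Y' x))"
  if [measurable]: "A \<in> sets borel" "C \<in> sets borel" for A C
 proof -
  have 1: "(LINT x|M. 1 * indicat_real A (X x)) = (LINT x|N. 1 * indicator A (X' x))"
   by (rule weighted_char_uniqueness[OF M N, where K=1]) (use eq[of _ 0] in auto)
  have c: "(LINT x|M. (1 + cos (b * Y x)) * indicat_real A (X x))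
    = (LINT x|N. (1 + cos (b * Y' x)) * indicator A (X' x))" for b
   by (rule weighted_char_uniqueness[OF M N, where K=2])
    (simp_all only: cosM cosN eq cs, simp_all)
  have s: "(LINT x|M. (1 + sin (b * Y x)) * indicat_real A (X x))
    = (LINT x|N. (1 + sin (b * Y' x)) * indicator A (X' x))" for b
   by (rule weighted_char_uniqueness[OF M N, where K=2])
    (simp_all only: sinM sinN eq cs, simp_all)
  have ci: "integrable M (\<lambda>x. cos (b * Y x) * indicat_real A (X x))"
   "integrable M (\<lambda>x. sin (b * Y x) * indicat_real A (X x))"
   "integrable M (\<lambda>x. indicat_real A (X x))" for b
   by (rule M.integrable_const_bound[of _ 1]; auto simp: abs_mult mult_le_one split: split_indicator)+
  have ci': "integrable N (\<lambda>x. cos (b * Y' x) * indicat_real A (X' x))"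
   "integrable N (\<lambda>x. sin (b * Y' x) * indicat_real A (X' x))"
   "integrable N (\<lambda>x. indicat_real A (X' x))" for b
   by (rule N.integrable_const_bound[of _ 1]; auto simp: abs_mult mult_le_one split: split_indicator)+
  have ceq: "(LINT x|M. cos (b * Y x) * indicat_real A (X x))
    = (LINT x|N. cos (b * Y' x) * indicator A (X' x))" for b
   using c[of b] 1 ci(1)[of b] ci'(1)[of b] ci(3) ci'(3) by (simp add: distrib_right)
  have seq: "(LINT x|M. sin (b * Y x) * indicat_real A (X x))
    = (LINT x|N. sin (b * Y' x) * indicator A (X' x))" for b
   using s[of b] 1 ci(2)[of b] ci'(2)[of b] ci(3) ci'(3) by (simp add: distrib_right)
  have id: "of_real i * iexp y = of_real (cos y * i) + \<i> * of_real (sin y * i)" for i y :: real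
   by (simp add: cis_conv_exp[symmetric] complex_eq_iff)
  have "(CLINT x|M. indicat_real A (X x) * iexp (b * Y x))
    = of_real (LINT x|M. cos (b * Y x) * indicat_real A (X x))
     + \<i> * of_real (LINT x|M. sin (b * Y x) * indicat_real A (X x))" for b
   unfolding id using ci(1,2)[of b] by (subst Bochner_Integration.integral_add) (auto simp del: of_real_mult)
  moreover have "(CLINT x|N. indicat_real A (X' x) * iexp (b * Y' x))
    = of_real (LINT x|N. cos (b * Y' x) * indicat_real A (X' x))
     + \<i> * of_real (LINT x|N. sin (b * Y' x) * indicat_real A (X' x))" for b
   unfolding id using ci'(1,2)[of b] by (subst Bochner_Integration.integral_add) (auto simp del: of_real_mult)
  ultimately show ?thesis by (intro weighted_char_uniqueness[OF M N, where K=1])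
    (auto simp: ceq seq split: split_indicator)
 qed
 interpret D: prob_space ?D by (rule M.prob_space_distr) simp
 interpret D': prob_space ?D' by (rule N.prob_space_distr) simp
 show ?thesis
 proof (rule measure_eqI_generator_eq[OF Int_stable_pair_measure_generator[where A=borel and B=borel]])
  show "{a \<times> b |a b. a \<in> sets borel \<and> b \<in> sets borel} \<subseteq> Pow (UNIV :: (real \<times> real) set)" by auto
  show "sets ?D = sigma_sets UNIV {a \<times> b |a b. a \<in> sets borel \<and> b \<in> sets borel}"
   "sets ?D' = sigma_sets UNIV {a \<times> b |a b. a \<in> sets borel \<and> b \<in> sets borel}"
   by (simp_all add: sets_pair_measure)
  show "emeasure ?D Z = emeasure ?D' Z"
   if "Z \<in> {a \<times> b |a b. a \<in> sets borel \<and> b \<in> sets borel}" for Z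
  proof -
   from that obtain A C where Z: "Z = A \<times> C" and [measurable]: "A \<in> sets borel" "C \<in> sets borel" by auto
   have "measure ?D Z = (LINT x|?D. indicator Z x)" unfolding Z by simp
   also have "... = (LINT x|M. indicator A (X x) * indicat_real C (Y x))"
    unfolding Z by (subst integral_distr) (auto simp: indicator_times)
   also have "... = (LINT x|N. indicator A (X' x) * indicat_real C (Y' x))" by (rule rect) auto
   also have "... = (LINT x|?D'. indicator Z x)" unfolding Z by (subst integral_distr) (auto simp: indicator_times)
   also have "... = measure ?D' Z" unfolding Z by simp
   finally show ?thesis by (simp add: D.emeasure_eq_measure D'.emeasure_eq_measure)
  qed
  show "range (\<lambda>i::nat. UNIV) \<subseteq> {a \<times> b |a b. a \<in> sets borel \<and> b \<in> sets borel}" by (auto intro!: exI[of _ UNIV])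
  show "emeasure ?D UNIV \<noteq> \<infinity>" for i :: nat by simp
 qed simp
qed

section \<open>Centred Gaussian spaces\<close>

text \<open>Joint Gaussianity is encoded by closure under linear combinations: every combination is
  again a centred Gaussian variable, possibly degenerate, so no joint density has to be written
  down.\<close>

locale gaussian_space = prob_space M for M :: "'a measure" +
 fixes G :: "('a \<Rightarrow> real) set"
 assumes lin: "X \<in> G \<Longrightarrow> Y \<in> G \<Longrightarrow> (\<lambda>w. c * X w + d * Y w) \<in> G"
  and gaussian: "X \<in> G \<Longrightarrow> gaussian_rv M X"
  and centered: "X \<in> G \<Longrightarrow> expectation X = 0"
begin

abbreviation cov :: "('a \<Rightarrow> real) \<Rightarrow> ('a \<Rightarrow> real) \<Rightarrow> real" where
 "cov X Y \<equiv> expectation (\<lambda>w. X w * Y w)"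

lemma measurable_G [measurable_dest]: "X \<in> G \<Longrightarrow> X \<in> borel_measurable M"
 using gaussian by (auto simp: gaussian_rv_def)

lemma lin1: "X \<in> G \<Longrightarrow> (\<lambda>w. c * X w) \<in> G"
 using lin[of X X c 0] by simp

lemma gaussian_cases:
 assumes "X \<in> G"
 obtains "AE w in M. X w = 0" "cov X X = 0"
 | "0 < cov X X" "distributed M lborel X (\<lambda>x. ennreal (normal_density 0 (sqrt (cov X X)) x))"
proof -
 note [measurable] = assms
 from gaussian[OF assms] consider m where "AE w in M. X w = m"
  | m \<sigma> where "0 < \<sigma>" "distributed M lborel X (\<lambda>x. ennreal (normal_density m \<sigma> x))" by (auto simp: gaussian_rv_def)
 then show ?thesis
 proof cases
  case 1
  then have "expectation X = expectation (\<lambda>_. m)" by (intro integral_cong_AE) auto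
  then have m: "m = 0" using centered[OF assms] by (simp add: prob_space)
  then have "cov X X = expectation (\<lambda>_. 0)" using 1 by (intro integral_cong_AE) auto
  then show ?thesis using 1 m by (intro that(1)) auto
 next
  case 2
  have m: "m = 0" using normal_distributed_expectation[OF 2] centered[OF assms] by simp
  have "cov X X = \<sigma>^2" using normal_distributed_variance[OF 2] centered[OF assms] by (simp add: power2_eq_square)
  then show ?thesis using 2 m by (intro that(2)) auto
 qed
qed

lemma integrable_power:
 assumes "X \<in> G"
 shows "integrable M (\<lambda>w. X w ^ k)"
proof -
 note [measurable] = assms
 show ?thesis
 proof (cases rule: gaussian_cases[OF assms])
  case 1
  then have "integrable M (\<lambda>w. X w ^ k) \<longleftrightarrow> integrable M (\<lambda>w. 0 ^ k :: real)" by (intro integrable_cong_AE) auto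
  then show ?thesis by simp
 next
  case 2
  have "integrable lborel (\<lambda>x. normal_density 0 (sqrt (cov X X)) x * x ^ k)"
   using integrable_normal_moment[of "sqrt (cov X X)" 0 k] 2(1) by simp
  then show ?thesis using distributed_integrable[OF 2(2), of "\<lambda>x. x ^ k"] by simp
 qed
qed

lemma integrable_G: "X \<in> G \<Longrightarrow> integrable M X"
 using integrable_power[of X 1] by simp

lemma integrable_mult_G:
 assumes "X \<in> G" "Y \<in> G"
 shows "integrable M (\<lambda>w. X w * Y w)"
proof -
 have "(\<lambda>w. X w * Y w) = (\<lambda>w. ((1 * X w + 1 * Y w)^2 - (X w)^2 - (Y w)^2) / 2)"
  by (auto simp: power2_eq_square algebra_simps)
 then show ?thesis using integrable_power[OF lin[OF assms, of 1 1], of 2] integrable_power[OF assms(1), of 2]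
   integrable_power[OF assms(2), of 2] by simp
qed

lemma cov_lin:
 assumes "X \<in> G" "Y \<in> G" "Z \<in> G"
 shows "cov (\<lambda>w. c * X w + d * Y w) Z = c * cov X Z + d * cov Y Z"
  and "cov Z (\<lambda>w. c * X w + d * Y w) = c * cov Z X + d * cov Z Y"
 using integrable_mult_G[OF assms(1,3)] integrable_mult_G[OF assms(2,3)]
  integrable_mult_G[OF assms(3,1)] integrable_mult_G[OF assms(3,2)] by (simp_all add: algebra_simps)

lemma cov_commute: "cov X Y = cov Y X"
 by (simp add: mult.commute)

lemma cov_nonneg: "0 \<le> cov X X"
 by (simp add: integral_nonneg_AE)

lemma fourth_moment_G:
 assumes "X \<in> G"
 shows "expectation (\<lambda>w. X w ^ 4) = 3 * (cov X X)^2"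
proof (cases rule: gaussian_cases[OF assms])
 case 1
 note [measurable] = assms
 have "expectation (\<lambda>w. X w ^ 4) = expectation (\<lambda>w. 0)" using 1 by (intro integral_cong_AE) auto
 then show ?thesis using 1 by simp
next
 case 2
 have "expectation (\<lambda>w. X w ^ 4) = (LBINT x. normal_density 0 (sqrt (cov X X)) x * x ^ 4)"
  using distributed_integral[OF 2(2), of "\<lambda>x. x ^ 4"] by simp
 also have "... = 3 * (cov X X)^2" using integral_normal_moment_even[of "sqrt (cov X X)" 0 2] 2(1)
  by (simp add: fact_numeral power2_eq_square)
 finally show ?thesis .
qed

lemma expectation_iexp:
 assumes "X \<in> G"
 shows "(CLINT w|M. iexp (X w)) = of_real (exp (- cov X X / 2))"
proof (cases rule: gaussian_cases[OF assms])
 case 1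
 note [measurable] = assms
 have "(CLINT w|M. iexp (X w)) = (CLINT w|M. 1)" using 1 by (intro integral_cong_AE) auto
 then show ?thesis using 1 by (simp add: prob_space)
next
 case 2
 let ?s = "sqrt (cov X X)"
 have s: "0 < ?s" using 2 by simp
 note [measurable] = assms
 have d: "distributed M lborel (\<lambda>w. X w / ?s) std_normal_density"
  using 2(2) normal_standard_normal_convert[OF s, of X 0] by simp
 have "distr M borel (\<lambda>w. X w / ?s) = distr M lborel (\<lambda>w. X w / ?s)" by (rule distr_cong) auto
 also have "... = std_normal_distribution" using distributed_distr_eq_density[OF d] by simp
 finally have D: "distr M borel (\<lambda>w. X w / ?s) = std_normal_distribution" .
 have "(CLINT w|M. iexp (X w)) = char (distr M borel (\<lambda>w. X w / ?s)) ?s" using s by (subst char_distr) auto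
 also have "... = of_real (exp (- (?s^2) / 2))" unfolding D char_std_normal_distribution ..
 finally show ?thesis using 2(1) by simp
qed

text \<open>The characteristic function of \<open>(X, V)\<close> at \<open>(a, b)\<close> is
  \<open>exp (- v / 2)\<close> with \<open>v\<close> the variance of \<open>a * X + b * V\<close>;
  without a covariance term \<open>v\<close> is a sum and the exponential a product.\<close>

lemma indep_pair_aux:
 assumes X: "X \<in> G" and V: "V \<in> G" and c: "cov X V = 0"
 shows "indep_var borel X borel V"
proof -
 note [measurable] = X V
 interpret DX: prob_space "distr M borel X" by (rule prob_space_distr) simp
 interpret DV: prob_space "distr M borel V" by (rule prob_space_distr) simp
 interpret P: pair_prob_space "distr M borel X" "distr M borel V" ..
 have "distr M (borel \<Otimes>\<^sub>M borel) (\<lambda>x. (X x, V x))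
  = distr (distr M borel X \<Otimes>\<^sub>M distr M borel V) (borel \<Otimes>\<^sub>M borel) (\<lambda>x. (fst x, snd x))"
 proof (rule char_uniqueness_pair)
  fix a b
  have i: "complex_integrable (distr M borel X \<Otimes>\<^sub>M distr M borel V) (\<lambda>x. iexp (a * fst x) * iexp (b * snd x))"
   by (rule P.integrable_const_bound[of _ 1]) (auto simp: norm_mult)
  have "(CLINT x|distr M borel X \<Otimes>\<^sub>M distr M borel V. iexp (a * fst x + b * snd x))
   = (CLINT x|distr M borel X \<Otimes>\<^sub>M distr M borel V. iexp (a * fst x) * iexp (b * snd x))"
   by (simp add: exp_add[symmetric] algebra_simps)
  also have "... = (CLINT x|distr M borel X. (CLINT y|distr M borel V. iexp (a * x) * iexp (b * y)))"
   using P.integral_fst'[OF i] by simp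
  also have "... = char (distr M borel X) a * char (distr M borel V) b" by (simp add: char_def)
  also have "... = of_real (exp (- cov (\<lambda>w. a * X w) (\<lambda>w. a * X w) / 2)) * of_real (exp (- cov (\<lambda>w. b * V w) (\<lambda>w. b * V w) / 2))"
   using expectation_iexp[OF lin1[OF X, of a]] expectation_iexp[OF lin1[OF V, of b]] by (simp add: char_distr)
  also have "... = of_real (exp (- (a^2 * cov X X + b^2 * cov V V) / 2))"
  proof -
   have "cov (\<lambda>w. a * X w) (\<lambda>w. a * X w) = a^2 * cov X X"
    "cov (\<lambda>w. b * V w) (\<lambda>w. b * V w) = b^2 * cov V V"
    by (simp_all add: power2_eq_square mult.assoc mult.left_commute)
   moreover have "- (p + q) / 2 = - p / 2 + - q / 2" for p q :: real by (simp add: field_simps)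
   ultimately show ?thesis by (simp only: of_real_mult[symmetric] exp_add)
  qed
  also have "a^2 * cov X X + b^2 * cov V V = cov (\<lambda>w. a * X w + b * V w) (\<lambda>w. a * X w + b * V w)"
  proof -
   have c': "cov V X = 0" using c cov_commute[of V X] by simp
   show ?thesis by (simp only: cov_lin X V lin c c') (simp add: power2_eq_square)
  qed
  also have "of_real (exp (- ... / 2)) = (CLINT w|M. iexp (a * X w + b * V w))"
   using expectation_iexp[OF lin[OF X V, of a b]] by simp
  finally show "(CLINT w|M. iexp (a * X w + b * V w))
   = (CLINT x|distr M borel X \<Otimes>\<^sub>M distr M borel V. iexp (a * fst x + b * snd x))" ..
 qed (auto simp: prob_space_axioms P.prob_space_axioms)
 also have "... = distr M borel X \<Otimes>\<^sub>M distr M borel V"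
  unfolding prod.collapse by (rule distr_id2) (intro sets_pair_measure_cong; simp)
 finally show ?thesis by (simp add: indep_var_distribution_eq)
qed

text \<open>Conditioning on the event that \<open>V\<close> lies in \<open>C\<close> leaves the
  characteristic function of \<open>(X, Y)\<close> unchanged, since each
  \<open>a * X + b * Y\<close> is uncorrelated with \<open>V\<close> and hence independent of it by
  \<open>indep_pair_aux\<close>. Uniqueness for pairs then suffices, although three variables are
  involved.\<close>

theorem indep_uncorrelated:
 assumes X: "X \<in> G" and Y: "Y \<in> G" and V: "V \<in> G" and cX: "cov X V = 0" and cY: "cov Y V = 0"
  and [measurable]: "\<phi> \<in> borel_measurable (borel \<Otimes>\<^sub>M borel)" "g \<in> borel_measurable borel"
 shows "indep_var borel (\<lambda>w. \<phi> (X w, Y w) :: real) borel (\<lambda>w. g (V w) :: real)"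
proof -
 note [measurable] = X Y V
 have key: "prob {w\<in>space M. (X w, Y w) \<in> D \<and> V w \<in> C}
   = prob {w\<in>space M. (X w, Y w) \<in> D} * prob {w\<in>space M. V w \<in> C}"
  if [measurable]: "D \<in> sets (borel \<Otimes>\<^sub>M borel)" "C \<in> sets borel" for D C
 proof (cases "prob {w\<in>space M. V w \<in> C} = 0")
  case True
  have "prob {w\<in>space M. (X w, Y w) \<in> D \<and> V w \<in> C} \<le> prob {w\<in>space M. V w \<in> C}" by (rule finite_measure_mono) auto
  then show ?thesis using True measure_nonneg[of M] by (simp add: antisym)
 next
  case False
  let ?E = "{w\<in>space M. V w \<in> C}"
  let ?N = "uniform_measure M ?E"
  have E [measurable]: "?E \<in> sets M" by simp
  have ne: "emeasure M ?E \<noteq> 0" "emeasure M ?E \<noteq> \<infinity>" using False by (auto simp: emeasure_eq_measure)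
  have pN: "prob_space ?N" by (rule prob_space_uniform_measure) (use ne in auto)
  have "distr M (borel \<Otimes>\<^sub>M borel) (\<lambda>x. (X x, Y x)) = distr ?N (borel \<Otimes>\<^sub>M borel) (\<lambda>x. (X x, Y x))"
  proof (rule char_uniqueness_pair)
   fix a b
   let ?Z = "\<lambda>w. a * X w + b * Y w"
   have Z: "?Z \<in> G" by (rule lin[OF X Y])
   have "indep_var borel ?Z borel V" by (rule indep_pair_aux[OF Z V]) (simp add: cov_lin X Y V cX cY)
   then have iv: "indep_var borel ((\<lambda>z. iexp z) \<circ> ?Z) borel ((\<lambda>v. indicator C v :: complex) \<circ> V)"
    by (rule indep_var_compose) auto
   have I: "complex_integrable M (\<lambda>w. iexp (?Z w))"
    "complex_integrable M (\<lambda>w. indicator C (V w))"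
    by (rule integrable_const_bound[of _ 1]; simp split: split_indicator)+
   have "(CLINT w|M. iexp (?Z w) * indicator C (V w))
     = (CLINT w|M. iexp (?Z w)) * (CLINT w|M. indicator C (V w))"
    using indep_var_lebesgue_integral[OF iv] I by (simp add: o_def)
   also have "(CLINT w|M. indicator C (V w)) = (CLINT w|M. of_real (indicat_real ?E w))"
    by (intro Bochner_Integration.integral_cong) (auto split: split_indicator)
   also have "... = of_real (prob ?E)" by (subst integral_complex_of_real) simp
   also have "(CLINT w|M. iexp (?Z w) * indicator C (V w)) = (CLINT w|M. indicator ?E w *\<^sub>R iexp (?Z w))"
    by (intro Bochner_Integration.integral_cong) (auto split: split_indicator)
   finally show "(CLINT w|M. iexp (?Z w)) = (CLINT w|?N. iexp (?Z w))"
   proof -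
    assume eq: "(CLINT w|M. indicator ?E w *\<^sub>R iexp (?Z w)) = (CLINT w|M. iexp (?Z w)) * of_real (prob ?E)"
    have "?N = density M (\<lambda>w. ennreal (indicator ?E w / prob ?E))" unfolding uniform_measure_def using False
     by (intro density_cong)
      (auto simp: emeasure_eq_measure divide_ennreal zero_less_measure_iff ennreal_1[symmetric] simp del: ennreal_1 split: split_indicator)
    then have "(CLINT w|?N. iexp (?Z w)) = (CLINT w|M. (indicator ?E w / prob ?E) *\<^sub>R iexp (?Z w))"
     by (simp only:) (subst integral_density, auto)
    also have "... = (CLINT w|M. (1 / prob ?E) *\<^sub>R (indicator ?E w *\<^sub>R iexp (?Z w)))"
     by (intro Bochner_Integration.integral_cong) (auto split: split_indicator)
    also have "... = (1 / prob ?E) *\<^sub>R (CLINT w|M. indicator ?E w *\<^sub>R iexp (?Z w))" by (rule integral_scaleR_right)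
    finally show ?thesis using eq False by (simp add: scaleR_conv_of_real)
   qed
  qed (auto simp: prob_space_axioms pN)
  then have "measure (distr M (borel \<Otimes>\<^sub>M borel) (\<lambda>x. (X x, Y x))) D
   = measure (distr ?N (borel \<Otimes>\<^sub>M borel) (\<lambda>x. (X x, Y x))) D" by simp
  then have "prob {w\<in>space M. (X w, Y w) \<in> D} = measure ?N {w\<in>space M. (X w, Y w) \<in> D}"
   by (simp add: measure_distr vimage_def Int_def conj_commute)
  also have "... = prob (?E \<inter> {w\<in>space M. (X w, Y w) \<in> D}) / prob ?E"
   by (rule measure_uniform_measure) (use ne in auto)
  also have "?E \<inter> {w\<in>space M. (X w, Y w) \<in> D} = {w\<in>space M. (X w, Y w) \<in> D \<and> V w \<in> C}" by auto
  finally show ?thesis using False by simp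
 qed
 have "indep_set {(\<lambda>w. \<phi> (X w, Y w)) -` A \<inter> space M |A. A \<in> sets borel}
   {(\<lambda>w. g (V w)) -` A \<inter> space M |A. A \<in> sets borel}"
 proof (safe intro!: indep_setI)
  fix A C :: "real set" assume [measurable]: "A \<in> sets borel" "C \<in> sets borel"
  show "(\<lambda>w. \<phi> (X w, Y w)) -` A \<inter> space M \<in> events" "(\<lambda>w. g (V w)) -` C \<inter> space M \<in> events" by measurable
  have sets_eq: "(\<lambda>w. \<phi> (X w, Y w)) -` A \<inter> space M = {w\<in>space M. (X w, Y w) \<in> \<phi> -` A}"
   "(\<lambda>w. g (V w)) -` C \<inter> space M = {w\<in>space M. V w \<in> g -` C}"
   "{w\<in>space M. (X w, Y w) \<in> \<phi> -` A} \<inter> {w\<in>space M. V w \<in> g -` C}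
    = {w\<in>space M. (X w, Y w) \<in> \<phi> -` A \<and> V w \<in> g -` C}" by auto
  have "\<phi> -` A \<in> sets (borel \<Otimes>\<^sub>M borel)"
   using measurable_sets[of \<phi> "borel \<Otimes>\<^sub>M borel" borel A] by (simp add: space_pair_measure)
  moreover have "g -` C \<in> sets borel" using measurable_sets[of g borel borel C] by simp
  ultimately show "prob ((\<lambda>w. \<phi> (X w, Y w)) -` A \<inter> space M \<inter> ((\<lambda>w. g (V w)) -` C \<inter> space M))
   = prob ((\<lambda>w. \<phi> (X w, Y w)) -` A \<inter> space M) * prob ((\<lambda>w. g (V w)) -` C \<inter> space M)"
   using key[of "\<phi> -` A" "g -` C"] unfolding sets_eq by simp
 qed
 moreover have "Int_stable {f -` A \<inter> space M |A. A \<in> sets borel}" for f :: "'a \<Rightarrow> real" unfolding Int_stable_def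
 proof clarify
  fix A B :: "real set" assume [measurable]: "A \<in> sets borel" "B \<in> sets borel"
  show "\<exists>C. f -` A \<inter> space M \<inter> (f -` B \<inter> space M) = f -` C \<inter> space M \<and> C \<in> sets borel"
   by (intro exI[of _ "A \<inter> B"]) auto
 qed
 ultimately show ?thesis unfolding indep_var_eq by (intro conjI indep_set_sigma_sets) simp_all
qed

end

section \<open>Kernel bounds by Gaussian regression\<close>

context gaussian_space
begin

lemma cov_comb:
 assumes "V = (\<lambda>w. c * X w + d * Y w)" "X \<in> G" "Y \<in> G" "Z \<in> G"
 shows "cov V Z = c * cov X Z + d * cov Y Z" "cov Z V = c * cov Z X + d * cov Z Y"
 unfolding assms(1) using cov_lin[OF assms(2-4)] by simp_all

text \<open>The term \<open>(X w)^2 / cov X X\<close> is what regression on \<open>X\<close>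
  produces: it makes \<open>expectation (\<lambda>w. (h (X w))^2 * (Z w)^2)\<close> at most the
  variance of \<open>Z\<close> times this quantity, for every \<open>Z\<close> in the space
  (\<open>square_bound\<close>).\<close>

definition weighted_square :: "(real \<Rightarrow> real) \<Rightarrow> ('a \<Rightarrow> real) \<Rightarrow> real" where
 "weighted_square h X = expectation (\<lambda>w. (h (X w))^2 * (1 + (X w)^2 / cov X X))"

definition admissible :: "(real \<Rightarrow> real) \<Rightarrow> ('a \<Rightarrow> real) \<Rightarrow> bool" where
 "admissible h X \<longleftrightarrow> X \<in> G \<and> 0 < cov X X \<and> h \<in> borel_measurable borel
   \<and> integrable M (\<lambda>w. (h (X w))^2 * (1 + (X w)^2))"

lemma uncorrelated_expectation:
 assumes "X \<in> G" "Y \<in> G" "V \<in> G" "cov X V = 0" "cov Y V = 0"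
  and [measurable]: "(\<lambda>(x, y). \<phi> x y) \<in> borel_measurable (borel \<Otimes>\<^sub>M borel)" "g \<in> borel_measurable borel"
  and "integrable M (\<lambda>w. \<phi> (X w) (Y w))" "integrable M (\<lambda>w. g (V w))"
 shows "integrable M (\<lambda>w. \<phi> (X w) (Y w) * g (V w) :: real)"
  and "expectation (\<lambda>w. \<phi> (X w) (Y w) * g (V w))
   = expectation (\<lambda>w. \<phi> (X w) (Y w)) * expectation (\<lambda>w. g (V w))"
 using indep_var_integrable[OF indep_uncorrelated[OF assms(1-5), of "\<lambda>(x, y). \<phi> x y" g]]
  indep_var_lebesgue_integral[OF indep_uncorrelated[OF assms(1-5), of "\<lambda>(x, y). \<phi> x y" g]] assms(6-) by simp_all

lemma admissible_integrable:
 assumes "admissible h X"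
 shows "integrable M (\<lambda>w. (h (X w))^2)" "integrable M (\<lambda>w. (h (X w))^2 * X w)"
  "integrable M (\<lambda>w. (h (X w))^2 * (X w)^2)"
proof -
 from assms have [measurable]: "X \<in> G" "h \<in> borel_measurable borel"
  and i: "integrable M (\<lambda>w. (h (X w))^2 * (1 + (X w)^2))"
  by (auto simp: admissible_def)
 have ab: "\<bar>x\<bar> \<le> 1 + x^2" for x :: real
 proof -
  have "0 \<le> (\<bar>x\<bar> - 1/2)^2" by simp
  then show ?thesis unfolding power2_diff by (simp add: power2_eq_square)
 qed
 show "integrable M (\<lambda>w. (h (X w))^2)"
  by (rule Bochner_Integration.integrable_bound[OF i]) (auto simp: mult_le_cancel_left1)
 show "integrable M (\<lambda>w. (h (X w))^2 * X w)"
  by (rule Bochner_Integration.integrable_bound[OF i]) (auto simp: abs_mult intro!: mult_left_mono ab)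
 show "integrable M (\<lambda>w. (h (X w))^2 * (X w)^2)"
  by (rule Bochner_Integration.integrable_bound[OF i]) (auto simp: abs_mult intro!: mult_left_mono)
qed

lemma weighted_square_eq:
 assumes "admissible h X"
 shows "weighted_square h X = expectation (\<lambda>w. (h (X w))^2) + expectation (\<lambda>w. (h (X w))^2 * (X w)^2) / cov X X"
 using admissible_integrable[OF assms] by (simp add: weighted_square_def distrib_left)

text \<open>Write \<open>Z = k * X + V\<close> with \<open>V\<close> uncorrelated with
  \<open>X\<close>, hence independent of it. The cross term vanishes because \<open>V\<close> is
  centred, and both \<open>k^2 * cov X X\<close> and \<open>cov V V\<close> are at most
  \<open>cov Z Z\<close>.\<close>

lemma square_bound:
 assumes a: "admissible h X" and Z: "Z \<in> G"
 shows "integrable M (\<lambda>w. (h (X w))^2 * (Z w)^2)"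
  and "expectation (\<lambda>w. (h (X w))^2 * (Z w)^2) \<le> cov Z Z * weighted_square h X"
proof -
 from a have X: "X \<in> G" and s: "0 < cov X X" and [measurable]: "h \<in> borel_measurable borel"
  by (auto simp: admissible_def)
 note [measurable] = X Z
 note ai = admissible_integrable[OF a]
 define k where "k = cov X Z / cov X X"
 define V where "V = (\<lambda>w. 1 * Z w + (-k) * X w)"
 have V: "V \<in> G" unfolding V_def by (rule lin[OF Z X])
 have XV: "cov X V = 0" unfolding V_def using s by (simp only: cov_lin X Z) (simp add: k_def)
 have ZX: "cov Z X = k * cov X X" using s by (simp add: k_def cov_commute[of Z X])
 have VV: "cov V V = cov Z Z - k^2 * cov X X"
 proof -
  have "cov V V = cov Z V" using cov_comb(1)[OF V_def Z X V] XV by simp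
  also have "... = cov Z Z - k * cov Z X" using cov_comb(2)[OF V_def Z X Z] by simp
  finally show ?thesis unfolding ZX by (simp add: power2_eq_square)
 qed
 have eq: "(h (X w))^2 * (Z w)^2 = k^2 * ((h (X w))^2 * (X w)^2)
   + 2 * k * ((h (X w))^2 * X w * V w) + (h (X w))^2 * (V w)^2" for w
 proof -
  have "a * z^2 = k^2 * (a * x^2) + 2 * k * (a * x * (1 * z + (-k) * x)) + a * (1 * z + (-k) * x)^2" for a z x :: real
   by algebra
  then show ?thesis unfolding V_def .
 qed
 note A = uncorrelated_expectation[OF X X V XV XV, of "\<lambda>x _. (h x)^2 * x" "\<lambda>v. v"]
 note B = uncorrelated_expectation[OF X X V XV XV, of "\<lambda>x _. (h x)^2" "\<lambda>v. v^2"]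
 have i1: "integrable M (\<lambda>w. (h (X w))^2 * X w * V w)" using ai(2) integrable_G[OF V] by (intro A(1)) simp_all
 have "expectation (\<lambda>w. (h (X w))^2 * X w * V w) = expectation (\<lambda>w. (h (X w))^2 * X w) * expectation V"
  using ai(2) integrable_G[OF V] by (intro A(2)) simp_all
 then have e1: "expectation (\<lambda>w. (h (X w))^2 * X w * V w) = 0" using centered[OF V] by simp
 have i2: "integrable M (\<lambda>w. (h (X w))^2 * (V w)^2)" using ai(1) integrable_power[OF V, of 2] by (intro B(1)) simp_all
 have e2: "expectation (\<lambda>w. (h (X w))^2 * (V w)^2) = expectation (\<lambda>w. (h (X w))^2) * cov V V"
  unfolding power2_eq_square[of "V _", symmetric] using ai(1) integrable_power[OF V, of 2] by (intro B(2)) simp_all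
 show "integrable M (\<lambda>w. (h (X w))^2 * (Z w)^2)" unfolding eq using i1 i2 ai(3) by simp
 let ?a = "expectation (\<lambda>w. (h (X w))^2)" and ?b = "expectation (\<lambda>w. (h (X w))^2 * (X w)^2)"
 have "expectation (\<lambda>w. (h (X w))^2 * (Z w)^2) = k^2 * ?b + ?a * cov V V" unfolding eq using i1 i2 ai(3) e1 e2 by simp
 also have "... \<le> cov Z Z * (?a + ?b / cov X X)"
 proof -
  have "0 \<le> ?a" "0 \<le> ?b" by (auto intro!: integral_nonneg_AE)
  moreover have "k^2 * cov X X \<le> cov Z Z" using VV cov_nonneg[of V] by simp
  moreover have "k^2 * cov X X * (?b / cov X X) \<le> cov Z Z * (?b / cov X X)"
   using calculation s by (intro mult_right_mono divide_nonneg_pos)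
  moreover have "0 \<le> ?a * (k^2 * cov X X)" using calculation s by (intro mult_nonneg_nonneg) simp_all
  moreover have "k^2 * cov X X * (?b / cov X X) = k^2 * ?b" using s by simp
  ultimately have "k^2 * ?b \<le> cov Z Z * (?b / cov X X)" "0 \<le> ?a * (k^2 * cov X X)" by linarith+
  then show ?thesis unfolding VV distrib_left right_diff_distrib mult.commute[of ?a "cov Z Z"] by linarith
 qed
 finally show "expectation (\<lambda>w. (h (X w))^2 * (Z w)^2) \<le> cov Z Z * weighted_square h X"
  using weighted_square_eq[OF a] by simp
qed

text \<open>The linear regression of \<open>Z\<close> on \<open>X\<close> and \<open>Y\<close>.\<close>

definition proj :: "('a \<Rightarrow> real) \<Rightarrow> ('a \<Rightarrow> real) \<Rightarrow> ('a \<Rightarrow> real) \<Rightarrow> 'a \<Rightarrow> real" where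
 "proj X Y Z = (\<lambda>w. (cov Y Y * cov Z X - cov X Y * cov Z Y) / (cov X X * cov Y Y - (cov X Y)^2) * X w
   + (cov X X * cov Z Y - cov X Y * cov Z X) / (cov X X * cov Y Y - (cov X Y)^2) * Y w)"

lemma proj_swap: "proj Y X Z = proj X Y Z"
 unfolding proj_def by (simp add: cov_commute[of Y X] ac_simps)

lemma proj_G: "X \<in> G \<Longrightarrow> Y \<in> G \<Longrightarrow> proj X Y Z \<in> G"
 unfolding proj_def by (rule lin)

lemma cov_proj:
 assumes X: "X \<in> G" and Y: "Y \<in> G" and Z: "Z \<in> G" and r: "cov X X * cov Y Y - (cov X Y)^2 \<noteq> 0"
 shows "cov (proj X Y Z) X = cov Z X" "cov (proj X Y Z) Y = cov Z Y"
proof -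
 have *: "p / q * x + p' / q * y = z" if "q \<noteq> 0" "p * x + p' * y = z * q" for p q x p' y z :: real
  using that by (simp add: add_divide_distrib[symmetric] divide_eq_eq)
 show "cov (proj X Y Z) X = cov Z X" unfolding cov_comb(1)[OF proj_def X Y X] cov_commute[of Y X]
  by (rule *[OF r]) (simp add: algebra_simps power2_eq_square)
 show "cov (proj X Y Z) Y = cov Z Y" unfolding cov_comb(1)[OF proj_def X Y Y]
  by (rule *[OF r]) (simp add: algebra_simps power2_eq_square)
qed

text \<open>Gram-Schmidt: \<open>U = Y - k * X\<close> is independent of \<open>X\<close> and has
  variance \<open>u\<close>, the Gram determinant divided by \<open>cov X X\<close>. In the basis
  \<open>X\<close>, \<open>U\<close> each regression has coefficients at most \<open>m / s1\<close>
  and \<open>2 * m / u\<close>; the 2 uses \<open>0 \<le> k \<le> 1\<close>, which the hypotheses on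
  \<open>cov X Y\<close> provide. Under the weight \<open>(h (X w))^2\<close> the variable
  \<open>U\<close> then enters only through its variance.\<close>

lemma regression_bound:
 assumes a: "admissible h X" and Y: "Y \<in> G" and Z: "Z \<in> G" and W: "W \<in> G"
  and c: "0 \<le> cov X Y" "cov X Y \<le> cov X X" and r: "0 < cov X X * cov Y Y - (cov X Y)^2"
  and m: "\<bar>cov Z X\<bar> \<le> m" "\<bar>cov Z Y\<bar> \<le> m" "\<bar>cov W X\<bar> \<le> m" "\<bar>cov W Y\<bar> \<le> m"
  and e: "\<bar>cov Z W\<bar> \<le> e"
 shows "integrable M (\<lambda>w. (h (X w))^2 * \<bar>proj X Y Z w * proj X Y W w + (cov Z W - cov (proj X Y Z) (proj X Y W))\<bar>)"
   (is "integrable M ?F")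
  and "expectation (\<lambda>w. (h (X w))^2 * \<bar>proj X Y Z w * proj X Y W w + (cov Z W - cov (proj X Y Z) (proj X Y W))\<bar>)
   \<le> 2 * m^2 / cov X X * weighted_square h X
    + (12 * m^2 * cov X X / (cov X X * cov Y Y - (cov X Y)^2) + e) * expectation (\<lambda>w. (h (X w))^2)"
proof -
 from a have X: "X \<in> G" and s: "0 < cov X X" and [measurable]: "h \<in> borel_measurable borel"
  by (auto simp: admissible_def)
 note [measurable] = X Y Z W proj_G[OF X Y]
 note ai = admissible_integrable[OF a]
 define s1 where "s1 = cov X X"
 define s2 where "s2 = cov Y Y"
 define k where "k = cov X Y / s1"
 define U where "U = (\<lambda>w. 1 * Y w + (-k) * X w)"
 define u where "u = (s1 * s2 - (cov X Y)^2) / s1"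
 have s1: "0 < s1" and u: "0 < u" using s r by (auto simp: s1_def s2_def u_def)
 have k: "0 \<le> k" "k \<le> 1" "cov X Y = k * s1" using c s by (auto simp: k_def s1_def)
 have U: "U \<in> G" unfolding U_def by (rule lin[OF Y X])
 have XU: "cov X U = 0" "cov U X = 0"
  unfolding U_def by (simp_all only: cov_lin X Y cov_commute[of Y X]) (simp_all add: k s1_def)
 have UU: "cov U U = u"
 proof -
  have "cov U U = cov U Y" using cov_comb(2)[OF U_def Y X U] XU by simp
  also have "... = cov Y Y - k * cov X Y" using cov_comb(1)[OF U_def Y X Y] by simp
  also have "... = u" using s1 unfolding u_def k s2_def[symmetric] by (simp add: field_simps power2_eq_square)
  finally show ?thesis .
 qed
 have L: "proj X Y R = (\<lambda>w. (cov R X / s1) * X w + ((cov R Y - k * cov R X) / u) * U w)" for R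
 proof
  fix w
  have d: "s1 * s2 - (cov X Y)^2 = s1 * u" using s1 by (simp add: u_def)
  have s2: "s2 = u + k * k * s1" unfolding u_def k(3) using s1 by (simp add: diff_divide_distrib power2_eq_square)
  have *: "((u + k * k * s1) * rx - k * s1 * ry) / (s1 * u) * x + (s1 * ry - k * s1 * rx) / (s1 * u) * y
    = rx / s1 * x + (ry - k * rx) / u * (1 * y + - k * x)" for rx ry x y
   using s1 u by (simp add: divide_simps) (simp add: algebra_simps)
  show "proj X Y R w = (cov R X / s1) * X w + ((cov R Y - k * cov R X) / u) * U w"
   unfolding proj_def U_def s1_def[symmetric] s2_def[symmetric] d unfolding k(3) s2 by (rule *)
 qed
 define z where "z = cov Z X"
 define t where "t = cov W X"
 define z' where "z' = cov Z Y - k * cov Z X"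
 define w' where "w' = cov W Y - k * cov W X"
 have m0: "0 \<le> m" using m(1) by linarith
 have le2: "\<bar>p - k * q\<bar> \<le> 2 * m" if "\<bar>p\<bar> \<le> m" "\<bar>q\<bar> \<le> m" for p q
 proof -
  have "\<bar>k * q\<bar> \<le> 1 * m" unfolding abs_mult using k that by (intro mult_mono) auto
  then show ?thesis using that by linarith
 qed
 have zw: "\<bar>z\<bar> \<le> m" "\<bar>t\<bar> \<le> m" "\<bar>z'\<bar> \<le> 2 * m" "\<bar>w'\<bar> \<le> 2 * m"
  unfolding z_def t_def z'_def w'_def using m by (auto intro!: le2)
 have Lz: "proj X Y Z = (\<lambda>w. (z / s1) * X w + (z' / u) * U w)"
  and Lw: "proj X Y W = (\<lambda>w. (t / s1) * X w + (w' / u) * U w)"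
  unfolding L z_def t_def z'_def w'_def by simp_all
 have cL: "cov (proj X Y Z) (proj X Y W) = z * t / s1 + z' * w' / u"
 proof -
  have "cov (proj X Y Z) (proj X Y W) = (z / s1) * cov X (proj X Y W) + (z' / u) * cov U (proj X Y W)"
   unfolding Lz using cov_lin(1)[OF X U proj_G[OF X Y]] .
  also have "cov X (proj X Y W) = (t / s1) * s1" unfolding Lw by (simp only: cov_lin X U XU s1_def mult_zero_right add_0_right)
  also have "cov U (proj X Y W) = (w' / u) * u" unfolding Lw by (simp only: cov_lin X U XU UU mult_zero_right add_0_left)
  finally show ?thesis using s1 u by simp
 qed
 have bm: "\<bar>p * q\<bar> \<le> n^2" if "\<bar>p\<bar> \<le> n" "\<bar>q\<bar> \<le> n" for p q n :: real
  unfolding abs_mult power2_eq_square using that by (intro mult_mono) auto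
 define C where "C = m^2 / s1 + 4 * m^2 / u + e"
 have C: "\<bar>cov Z W - cov (proj X Y Z) (proj X Y W)\<bar> \<le> C"
 proof -
  have "\<bar>z * t / s1\<bar> \<le> m^2 / s1" "\<bar>z' * w' / u\<bar> \<le> (2 * m)^2 / u"
   using bm[OF zw(1,2)] bm[OF zw(3,4)] s1 u by (auto simp: abs_divide divide_right_mono)
  moreover have "\<bar>r - (p + q)\<bar> \<le> a + b + e" if "\<bar>p\<bar> \<le> a" "\<bar>q\<bar> \<le> b" "\<bar>r\<bar> \<le> e" for p q r a b :: real
   using that by linarith
  ultimately show ?thesis unfolding cL C_def using e by (metis four_x_squared)
 qed
 have pt: "\<bar>proj X Y Z w * proj X Y W w + (cov Z W - cov (proj X Y Z) (proj X Y W))\<bar>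
   \<le> 2 * m^2 / s1^2 * (X w)^2 + 8 * m^2 / u^2 * (U w)^2 + C" (is "?q w \<le> ?B w") for w
 proof -
  define p where "p = \<bar>X w\<bar> / s1"
  define q where "q = \<bar>U w\<bar> / u"
  have pq: "0 \<le> p" "0 \<le> q" using s1 u by (auto simp: p_def q_def)
  have n: "\<bar>(x / s1) * X w + (x' / u) * U w\<bar> \<le> m * (p + 2 * q)" if "\<bar>x\<bar> \<le> m" "\<bar>x'\<bar> \<le> 2 * m" for x x'
  proof -
   have "\<bar>(x / s1) * X w + (x' / u) * U w\<bar> \<le> \<bar>x\<bar> * p + \<bar>x'\<bar> * q"
    using s1 u by (intro order_trans[OF abs_triangle_ineq]) (simp add: abs_mult p_def q_def abs_divide)
   also have "... \<le> m * p + (2 * m) * q" using that pq by (intro add_mono mult_right_mono)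
   finally show ?thesis by (simp add: algebra_simps)
  qed
  have "\<bar>proj X Y Z w * proj X Y W w\<bar> \<le> (m * (p + 2 * q))^2" unfolding Lz Lw by (intro bm n zw)
  also have "... \<le> m^2 * (2 * p^2 + 8 * q^2)"
  proof -
   have "0 \<le> (p - 2 * q)^2" by simp
   then have "(p + 2 * q)^2 \<le> 2 * p^2 + 8 * q^2" by (simp add: power2_eq_square algebra_simps)
   then show ?thesis by (simp add: power_mult_distrib mult_left_mono)
  qed
  also have "... = 2 * m^2 / s1^2 * (X w)^2 + 8 * m^2 / u^2 * (U w)^2"
   by (simp add: p_def q_def power_divide algebra_simps)
  finally show ?thesis using C abs_triangle_ineq[of "proj X Y Z w * proj X Y W w" "cov Z W - cov (proj X Y Z) (proj X Y W)"]
   by linarith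
 qed
 note B = uncorrelated_expectation[OF X X U XU(1) XU(1), of "\<lambda>x _. (h x)^2" "\<lambda>v. v^2"]
 have iU: "integrable M (\<lambda>w. (h (X w))^2 * (U w)^2)" using ai(1) integrable_power[OF U, of 2] by (intro B(1)) simp_all
 have eU: "expectation (\<lambda>w. (h (X w))^2 * (U w)^2) = expectation (\<lambda>w. (h (X w))^2) * u"
  unfolding UU[symmetric] power2_eq_square[of "U _", symmetric]
  using ai(1) integrable_power[OF U, of 2] by (intro B(2)) simp_all
 have eqB: "(h (X w))^2 * ?B w = 2 * m^2 / s1^2 * ((h (X w))^2 * (X w)^2)
   + 8 * m^2 / u^2 * ((h (X w))^2 * (U w)^2) + C * (h (X w))^2" for w by (simp add: algebra_simps)
 have iB: "integrable M (\<lambda>w. (h (X w))^2 * ?B w)" unfolding eqB using iU ai by simp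
 show iF: "integrable M ?F" by (rule Bochner_Integration.integrable_bound[OF iB])
   (auto intro!: mult_left_mono order_trans[OF pt] simp: abs_mult)
 have "expectation ?F \<le> expectation (\<lambda>w. (h (X w))^2 * ?B w)" by (intro integral_mono iF iB mult_left_mono pt) simp
 also have "... = 2 * m^2 / s1^2 * expectation (\<lambda>w. (h (X w))^2 * (X w)^2)
   + 8 * m^2 / u^2 * expectation (\<lambda>w. (h (X w))^2 * (U w)^2) + C * expectation (\<lambda>w. (h (X w))^2)"
  unfolding eqB using iU ai by simp
 \<comment> \<open>The 12 collects 8 from the square of \<open>U\<close> and 4 from the projected
   covariance inside \<open>C\<close>; one copy of \<open>m^2 / s1 * A\<close> is given away to
   reach \<open>weighted_square\<close>.\<close>
 also have "... \<le> 2 * m^2 / s1 * weighted_square h X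
    + (12 * m^2 / u + e) * expectation (\<lambda>w. (h (X w))^2)"
 proof -
  define A where "A = expectation (\<lambda>w. (h (X w))^2)"
  define D where "D = expectation (\<lambda>w. (h (X w))^2 * (X w)^2)"
  have "0 \<le> A" unfolding A_def by (auto intro!: integral_nonneg_AE)
  then have "0 \<le> m^2 / s1 * A" using s1 by (intro mult_nonneg_nonneg) auto
  moreover have "2 * m^2 / s1 * (A + D / s1) + (12 * m^2 / u + e) * A
    - (2 * m^2 / s1^2 * D + 8 * m^2 / u^2 * (A * u) + C * A) = m^2 / s1 * A"
   using s1 u unfolding C_def by (simp add: field_simps power2_eq_square)
  ultimately show ?thesis
   unfolding weighted_square_eq[OF a] eU s1_def[symmetric] A_def[symmetric] D_def[symmetric] by linarith
 qed
 finally show "expectation ?F \<le> 2 * m^2 / cov X X * weighted_square h X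
    + (12 * m^2 * cov X X / (cov X X * cov Y Y - (cov X Y)^2) + e) * expectation (\<lambda>w. (h (X w))^2)"
  unfolding s1_def[symmetric] s2_def[symmetric] u_def by simp
qed

end

lemma abs_mult_le_sum_squares: "\<bar>x * y\<bar> \<le> x^2 + y^2" for x y :: real
proof -
 have "2 * (\<bar>x\<bar> * \<bar>y\<bar>) \<le> x^2 + y^2" using sum_squares_bound[of "\<bar>x\<bar>" "\<bar>y\<bar>"] by simp
 moreover have "0 \<le> \<bar>x\<bar> * \<bar>y\<bar>" by simp
 ultimately show ?thesis unfolding abs_mult by linarith
qed

context gaussian_space
begin

lemma residual:
 assumes X: "X \<in> G" and Y: "Y \<in> G" and Z: "Z \<in> G" and r: "cov X X * cov Y Y - (cov X Y)^2 \<noteq> 0"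
 defines "V \<equiv> \<lambda>w. 1 * Z w + (-1) * proj X Y Z w"
 shows "V \<in> G" "cov X V = 0" "cov Y V = 0"
proof -
 note P = proj_G[OF X Y, of Z]
 show "V \<in> G" unfolding V_def by (rule lin[OF Z P])
 note V = V_def[THEN meta_eq_to_obj_eq]
 show "cov X V = 0" "cov Y V = 0" using cov_comb(2)[OF V Z P X] cov_comb(2)[OF V Z P Y] cov_proj[OF X Y Z r]
  by (simp_all add: cov_commute[of X] cov_commute[of Y])
qed

lemma integrable_abs_product:
 assumes "integrable M (\<lambda>w. (f w)^2)" "integrable M (\<lambda>w. (g w)^2)"
  and [measurable]: "f \<in> borel_measurable M" "g \<in> borel_measurable M"
 shows "integrable M (\<lambda>w. f w * g w :: real)"
 by (rule Bochner_Integration.integrable_bound[OF Bochner_Integration.integrable_add[OF assms(1,2)]])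
  (use assms(3,4) in \<open>auto intro: abs_mult_le_sum_squares\<close>)

text \<open>\<open>Z\<close> and \<open>W\<close> split into their regressions plus residuals
  \<open>V\<close>, \<open>V'\<close>, each independent of the pair \<open>(X, Y)\<close>. Mixed
  terms vanish and the product of the residuals contributes only its mean, the conditional
  covariance \<open>cov Z W - cov (proj X Y Z) (proj X Y W)\<close>.\<close>

lemma regression:
 assumes aX: "admissible h X" and aY: "admissible h Y" and Z: "Z \<in> G" and W: "W \<in> G"
  and r: "cov X X * cov Y Y - (cov X Y)^2 \<noteq> 0"
 shows "integrable M (\<lambda>w. h (X w) * h (Y w) * (Z w * W w))"
  and "expectation (\<lambda>w. h (X w) * h (Y w) * (Z w * W w))
   = expectation (\<lambda>w. h (X w) * h (Y w) *
    (proj X Y Z w * proj X Y W w + (cov Z W - cov (proj X Y Z) (proj X Y W))))"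
proof -
 from aX aY have X: "X \<in> G" and Y: "Y \<in> G" and [measurable]: "h \<in> borel_measurable borel"
  by (auto simp: admissible_def)
 let ?P = "proj X Y Z" and ?Q = "proj X Y W"
 have P: "?P \<in> G" and Q: "?Q \<in> G" by (rule proj_G[OF X Y])+
 define V where "V = (\<lambda>w. 1 * Z w + (-1) * ?P w)"
 define V' where "V' = (\<lambda>w. 1 * W w + (-1) * ?Q w)"
 have rV: "V \<in> G" "cov X V = 0" "cov Y V = 0" unfolding V_def by (rule residual[OF X Y Z r])+
 have rV': "V' \<in> G" "cov X V' = 0" "cov Y V' = 0" unfolding V'_def by (rule residual[OF X Y W r])+
 note V = rV(1) and V' = rV'(1)
 note [measurable] = X Y Z W P Q V V'
 have prod: "integrable M (\<lambda>w. h (X w) * h (Y w) * (R w * S w))" if "R \<in> G" "S \<in> G" for R S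
 proof -
  note [measurable] = that
  have "integrable M (\<lambda>w. (h (X w) * R w) * (h (Y w) * S w))" by (rule integrable_abs_product)
    (use square_bound(1)[OF aX that(1)] square_bound(1)[OF aY that(2)] in \<open>simp_all add: power_mult_distrib\<close>)
  then show ?thesis by (simp add: ac_simps)
 qed
 have prod0: "integrable M (\<lambda>w. h (X w) * h (Y w))"
  by (rule integrable_abs_product) (use admissible_integrable[OF aX] admissible_integrable[OF aY] in auto)
 have prod1: "integrable M (\<lambda>w. h (X w) * h (Y w) * R w)" if "R \<in> G" for R
 proof -
  note [measurable] = that
  have "integrable M (\<lambda>w. (h (X w) * R w) * h (Y w))" by (rule integrable_abs_product)
    (use square_bound(1)[OF aX that] admissible_integrable[OF aY] in \<open>simp_all add: power_mult_distrib\<close>)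
  then show ?thesis by (simp add: ac_simps)
 qed
 show "integrable M (\<lambda>w. h (X w) * h (Y w) * (Z w * W w))" by (rule prod[OF Z W])
 have cross: "expectation (\<lambda>w. h (X w) * h (Y w) * (proj X Y R w * S w)) = 0"
  if S: "S \<in> G" "cov X S = 0" "cov Y S = 0" for R S
 proof -
  let ?a = "(cov Y Y * cov R X - cov X Y * cov R Y) / (cov X X * cov Y Y - (cov X Y)^2)"
  let ?b = "(cov X X * cov R Y - cov X Y * cov R X) / (cov X X * cov Y Y - (cov X Y)^2)"
  have e: "proj X Y R w = ?a * X w + ?b * Y w" for w unfolding proj_def ..
  have i: "integrable M (\<lambda>w. h (X w) * h (Y w) * (?a * X w + ?b * Y w))"
   unfolding e[symmetric] by (rule prod1) (rule proj_G[OF X Y])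
  have "expectation (\<lambda>w. h (X w) * h (Y w) * (?a * X w + ?b * Y w) * S w)
   = expectation (\<lambda>w. h (X w) * h (Y w) * (?a * X w + ?b * Y w)) * expectation S"
   by (rule uncorrelated_expectation(2)[OF X Y S, where \<phi>="\<lambda>x y. h x * h y * (?a * x + ?b * y)" and g="\<lambda>v. v"])
    (use i integrable_G[OF S(1)] in simp_all)
  then show ?thesis unfolding e using centered[OF S(1)] by (simp add: mult.assoc)
 qed
 have sq: "expectation (\<lambda>w. h (X w) * h (Y w) * (S w * S w)) = expectation (\<lambda>w. h (X w) * h (Y w)) * cov S S"
  if S: "S \<in> G" "cov X S = 0" "cov Y S = 0" for S
  by (rule uncorrelated_expectation(2)[OF X Y S, where \<phi>="\<lambda>x y. h x * h y" and g="\<lambda>v. v * v"])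
   (use prod0 integrable_mult_G[OF S(1) S(1)] in simp_all)
 define S where "S = (\<lambda>w. 1 * V w + 1 * V' w)"
 define D where "D = (\<lambda>w. 1 * V w + (-1) * V' w)"
 have S: "S \<in> G" "cov X S = 0" "cov Y S = 0"
  using cov_comb(2)[OF S_def V V' X] cov_comb(2)[OF S_def V V' Y] rV rV' lin[OF V V', of 1 1, folded S_def]
  by simp_all
 have D: "D \<in> G" "cov X D = 0" "cov Y D = 0"
  using cov_comb(2)[OF D_def V V' X] cov_comb(2)[OF D_def V V' Y] rV rV' lin[OF V V', of 1 "-1", folded D_def]
  by simp_all
 \<comment> \<open>Independence is available for one residual at a time, not for the pair
   \<open>(V, V')\<close>; polarisation expresses the product through the squares of
   \<open>S\<close> and \<open>D\<close>, each a single variable.\<close>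
 have pol: "V w * V' w = (S w * S w - D w * D w) / 4" for w unfolding S_def D_def by (simp add: algebra_simps)
 have "cov V V' = (cov S S - cov D D) / 4"
  unfolding pol using integrable_mult_G[OF S(1) S(1)] integrable_mult_G[OF D(1) D(1)] by simp
 moreover have "expectation (\<lambda>w. h (X w) * h (Y w) * (V w * V' w))
   = (expectation (\<lambda>w. h (X w) * h (Y w) * (S w * S w)) - expectation (\<lambda>w. h (X w) * h (Y w) * (D w * D w))) / 4"
  unfolding pol times_divide_eq_right right_diff_distrib using prod[OF S(1) S(1)] prod[OF D(1) D(1)] by simp
 moreover have "x = a * u" if "u = (s - d) / 4" "x = (a * s - a * d) / 4" for a s d u x :: real
  unfolding that by algebra
 ultimately have VV: "expectation (\<lambda>w. h (X w) * h (Y w) * (V w * V' w))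
   = expectation (\<lambda>w. h (X w) * h (Y w)) * cov V V'" unfolding sq[OF S] sq[OF D] by blast
 have PV': "cov ?P V' = 0" using cov_comb(1)[OF proj_def X Y V'] rV' by simp
 have VQ: "cov V ?Q = 0" using cov_comb(2)[OF proj_def X Y V] rV by (simp add: cov_commute[of V])
 have Zeq: "Z = (\<lambda>w. 1 * ?P w + 1 * V w)" and Weq: "W = (\<lambda>w. 1 * ?Q w + 1 * V' w)" by (simp_all add: V_def V'_def)
 have "cov Z W = cov ?P W + cov V W" using cov_comb(1)[OF Zeq P V W] by simp
 also have "cov ?P W = cov ?P ?Q" using cov_comb(2)[OF Weq Q V' P] PV' by simp
 also have "cov V W = cov V V'" using cov_comb(2)[OF Weq Q V' V] VQ by simp
 finally have cVV: "cov V V' = cov Z W - cov ?P ?Q" by simp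
 let ?H = "\<lambda>w. h (X w) * h (Y w)"
 have ZW: "?H w * (Z w * W w) = ?H w * (?P w * ?Q w) + ?H w * (?P w * V' w)
   + ?H w * (?Q w * V w) + ?H w * (V w * V' w)" for w
 proof -
  have "Z w = ?P w + V w" "W w = ?Q w + V' w" by (simp_all add: V_def V'_def)
  moreover have "H * ((p + v) * (q + v')) = H * (p * q) + H * (p * v') + H * (q * v) + H * (v * v')"
   for H p q v v' :: real by algebra
  ultimately show ?thesis by (simp only:)
 qed
 have "expectation (\<lambda>w. ?H w * (Z w * W w)) = expectation (\<lambda>w. ?H w * (?P w * ?Q w)) + expectation ?H * cov V V'"
  unfolding ZW using prod[OF P Q] prod[OF P V'] prod[OF Q V] prod[OF V V']
  by (simp add: cross[OF rV] cross[OF rV'] VV)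
 also have "... = expectation (\<lambda>w. ?H w * (?P w * ?Q w) + ?H w * cov V V')" using prod[OF P Q] prod0 by simp
 finally show "expectation (\<lambda>w. ?H w * (Z w * W w))
   = expectation (\<lambda>w. ?H w * (?P w * ?Q w + (cov Z W - cov ?P ?Q)))" unfolding cVV distrib_left .
qed

text \<open>Given the pair, \<open>Z * W\<close> has conditional mean \<open>?q\<close>, and Young's
  inequality with parameter \<open>l\<close> separates \<open>h (X w) * h (Y w)\<close> into two
  squares, each covered by \<open>regression_bound\<close>, once with \<open>X\<close> and
  \<open>Y\<close> exchanged. The parameter \<open>l\<close> stays free so that it can later be
  fitted to the weight in the norm.\<close>

theorem kernel_bound:
 assumes aX: "admissible h X" and aY: "admissible h Y" and Z: "Z \<in> G" and W: "W \<in> G"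
  and c: "0 \<le> cov X Y" "cov X Y \<le> cov X X" "cov X Y \<le> cov Y Y"
  and r: "0 < cov X X * cov Y Y - (cov X Y)^2"
  and m: "\<bar>cov Z X\<bar> \<le> m" "\<bar>cov Z Y\<bar> \<le> m" "\<bar>cov W X\<bar> \<le> m" "\<bar>cov W Y\<bar> \<le> m"
  and e: "\<bar>cov Z W\<bar> \<le> e" and l: "0 < l"
 shows "\<bar>expectation (\<lambda>w. h (X w) * h (Y w) * (Z w * W w))\<bar>
  \<le> l / 2 * (2 * m^2 / cov X X * weighted_square h X
    + (12 * m^2 * cov X X / (cov X X * cov Y Y - (cov X Y)^2) + e) * expectation (\<lambda>w. (h (X w))^2))
   + 1 / (2 * l) * (2 * m^2 / cov Y Y * weighted_square h Y
    + (12 * m^2 * cov Y Y / (cov X X * cov Y Y - (cov X Y)^2) + e) * expectation (\<lambda>w. (h (Y w))^2))"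
proof -
 from aX aY have X: "X \<in> G" and Y: "Y \<in> G" and [measurable]: "h \<in> borel_measurable borel"
  by (auto simp: admissible_def)
 note [measurable] = X Y proj_G[OF X Y]
 let ?q = "\<lambda>w. proj X Y Z w * proj X Y W w + (cov Z W - cov (proj X Y Z) (proj X Y W))"
 have r': "0 < cov Y Y * cov X X - (cov Y X)^2" using r by (simp only: cov_commute[of Y X] mult.commute)
 note BX = regression_bound[OF aX Y Z W c(1,2) r m e]
 note BY = regression_bound[OF aY X Z W _ _ r' m(2,1,4,3) e, unfolded proj_swap[of Y X] cov_commute[of Y X] mult.commute[of "cov Y Y" "cov X X"], OF c(1,3)]
 have young: "\<bar>x * y\<bar> * q \<le> l / 2 * (x^2 * q) + 1 / (2 * l) * (y^2 * q)" if "0 \<le> q" for x y q :: real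
 proof -
  have "0 \<le> (l * \<bar>x\<bar> - \<bar>y\<bar>)^2" by simp
  then have "2 * l * \<bar>x * y\<bar> \<le> l^2 * x^2 + y^2" unfolding power2_diff by (simp add: power_mult_distrib abs_mult)
  then have "\<bar>x * y\<bar> \<le> l / 2 * x^2 + 1 / (2 * l) * y^2" using l by (simp add: field_simps power2_eq_square)
  then have "\<bar>x * y\<bar> * q \<le> (l / 2 * x^2 + 1 / (2 * l) * y^2) * q" using that by (rule mult_right_mono)
  then show ?thesis by (simp add: algebra_simps)
 qed
 have "\<bar>expectation (\<lambda>w. h (X w) * h (Y w) * (Z w * W w))\<bar> = \<bar>expectation (\<lambda>w. h (X w) * h (Y w) * ?q w)\<bar>"
  using regression(2)[OF aX aY Z W] r by simp
 also have "... \<le> expectation (\<lambda>w. \<bar>h (X w) * h (Y w) * ?q w\<bar>)" by (rule integral_abs_bound)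
 also have "... \<le> expectation (\<lambda>w. l / 2 * ((h (X w))^2 * \<bar>?q w\<bar>) + 1 / (2 * l) * ((h (Y w))^2 * \<bar>?q w\<bar>))"
 proof (rule integral_mono')
  show "integrable M (\<lambda>w. l / 2 * ((h (X w))^2 * \<bar>?q w\<bar>) + 1 / (2 * l) * ((h (Y w))^2 * \<bar>?q w\<bar>))"
   using BX(1) BY(1) by (intro Bochner_Integration.integrable_add integrable_mult_right)
  show "\<bar>h (X w) * h (Y w) * ?q w\<bar> \<le> l / 2 * ((h (X w))^2 * \<bar>?q w\<bar>) + 1 / (2 * l) * ((h (Y w))^2 * \<bar>?q w\<bar>)" for w
   unfolding abs_mult[of "_ * _" "?q w"] by (rule young) simp
  show "0 \<le> l / 2 * ((h (X w))^2 * \<bar>?q w\<bar>) + 1 / (2 * l) * ((h (Y w))^2 * \<bar>?q w\<bar>)" for w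
   using l by (intro add_nonneg_nonneg mult_nonneg_nonneg) auto
 qed
 also have "... = l / 2 * expectation (\<lambda>w. (h (X w))^2 * \<bar>?q w\<bar>) + 1 / (2 * l) * expectation (\<lambda>w. (h (Y w))^2 * \<bar>?q w\<bar>)"
  using BX(1) BY(1) by (subst Bochner_Integration.integral_add) (simp_all only: integrable_mult_right integral_mult_right_zero)
 also have "... \<le> l / 2 * (2 * m^2 / cov X X * weighted_square h X
    + (12 * m^2 * cov X X / (cov X X * cov Y Y - (cov X Y)^2) + e) * expectation (\<lambda>w. (h (X w))^2))
   + 1 / (2 * l) * (2 * m^2 / cov Y Y * weighted_square h Y
    + (12 * m^2 * cov Y Y / (cov X X * cov Y Y - (cov X Y)^2) + e) * expectation (\<lambda>w. (h (Y w))^2))"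
  using l by (intro add_mono mult_left_mono BX(2) BY(2)) auto
 finally show ?thesis .
qed

text \<open>Isserlis' formula, by polarisation of the fourth moments of \<open>X + Y\<close> and
  \<open>X - Y\<close>.\<close>

lemma fourth_moment_pair:
 assumes X: "X \<in> G" and Y: "Y \<in> G"
 shows "integrable M (\<lambda>w. (X w)^2 * (Y w)^2)"
  and "expectation (\<lambda>w. (X w)^2 * (Y w)^2) = cov X X * cov Y Y + 2 * (cov X Y)^2"
proof -
 let ?S = "\<lambda>w. 1 * X w + 1 * Y w" and ?D = "\<lambda>w. 1 * X w + (-1) * Y w"
 have S: "?S \<in> G" and D: "?D \<in> G" by (rule lin[OF X Y])+
 have eq: "(X w)^2 * (Y w)^2 = (?S w ^ 4 + ?D w ^ 4 - 2 * X w ^ 4 - 2 * Y w ^ 4) / 12" for w by algebra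
 note i = integrable_power[OF S, of 4] integrable_power[OF D, of 4] integrable_power[OF X, of 4] integrable_power[OF Y, of 4]
 show "integrable M (\<lambda>w. (X w)^2 * (Y w)^2)"
  unfolding eq using i by (intro integrable_divide Bochner_Integration.integrable_diff Bochner_Integration.integrable_add integrable_mult_right)
 have SS: "cov ?S ?S = cov X X + 2 * cov X Y + cov Y Y"
  using cov_lin(1)[OF X Y S, of 1 1] cov_lin(2)[OF X Y X, of 1 1] cov_lin(2)[OF X Y Y, of 1 1] cov_commute[of Y X] by linarith
 have DD: "cov ?D ?D = cov X X - 2 * cov X Y + cov Y Y"
  using cov_lin(1)[OF X Y D, of 1 "-1"] cov_lin(2)[OF X Y X, of 1 "-1"] cov_lin(2)[OF X Y Y, of 1 "-1"] cov_commute[of Y X] by linarith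
 have "expectation (\<lambda>w. (X w)^2 * (Y w)^2) = (expectation (\<lambda>w. ?S w ^ 4) + expectation (\<lambda>w. ?D w ^ 4)
   - 2 * expectation (\<lambda>w. X w ^ 4) - 2 * expectation (\<lambda>w. Y w ^ 4)) / 12"
  unfolding eq using i by (simp del: mult_1 mult_minus1)
 also have "... = cov X X * cov Y Y + 2 * (cov X Y)^2"
  unfolding fourth_moment_G[OF S] fourth_moment_G[OF D] fourth_moment_G[OF X] fourth_moment_G[OF Y] SS DD by algebra
 finally show "expectation (\<lambda>w. (X w)^2 * (Y w)^2) = cov X X * cov Y Y + 2 * (cov X Y)^2" .
qed

end

section \<open>Dyadic chaining and the maximal inequality\<close>

text \<open>The dyadic points just left of \<open>t\<close> at successive levels differ by at most
  one cell of the finer level, so the way from \<open>b\<close> to \<open>t\<close> costs a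
  geometric series; continuity passes to the limit.\<close>

lemma dyadic_chaining:
 fixes A :: "real \<Rightarrow> real"
 assumes A: "continuous_on {b..2*b} A" and b: "0 < b" and q: "0 \<le> q" "q < 1" and D: "0 \<le> D"
  and step: "\<And>n k. k < 2 ^ n \<Longrightarrow>
   \<bar>A (b * (1 + real (Suc k) / 2 ^ n)) - A (b * (1 + real k / 2 ^ n))\<bar> \<le> D * q ^ n"
  and t: "t \<in> {b..2*b}"
 shows "\<bar>A t - A b\<bar> \<le> D / (1 - q)"
proof (cases "t = 2 * b")
 case True
 have "D * (1 - q) \<le> D * 1" using q D by (intro mult_left_mono) auto
 then have "D \<le> D / (1 - q)" using q by (simp add: pos_le_divide_eq)
 then show ?thesis using step[of 0 0] True by (simp add: algebra_simps)
next
 case False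
 define \<tau> where "\<tau> = t / b - 1"
 have \<tau>: "0 \<le> \<tau>" "\<tau> < 1" "t = b * (1 + \<tau>)" using t b False by (auto simp: \<tau>_def field_simps)
 define k where "k n = nat \<lfloor>2 ^ n * \<tau>\<rfloor>" for n
 define tn where "tn n = b * (1 + real (k n) / 2 ^ n)" for n
 have rk: "real (k n) = of_int \<lfloor>2 ^ n * \<tau>\<rfloor>" for n using \<tau> by (simp add: k_def)
 have k_le: "real (k n) \<le> 2 ^ n * \<tau>" and k_gt: "2 ^ n * \<tau> < real (k n) + 1" for n unfolding rk by linarith+
 have k_lt: "k n < 2 ^ n" for n
 proof -
  have "2 ^ n * \<tau> < 2 ^ n * 1" using \<tau> by (intro mult_strict_left_mono) auto
  then have "real (k n) < 2 ^ n" using k_le[of n] by linarith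
  then show ?thesis by simp
 qed
 have inc: "\<bar>A (tn (Suc n)) - A (tn n)\<bar> \<le> D * q ^ Suc n" for n
 proof -
  have "real (k (Suc n)) < 2 * real (k n) + 2" "2 * real (k n) < real (k (Suc n)) + 1"
   using k_le[of n] k_gt[of n] k_le[of "Suc n"] k_gt[of "Suc n"] by auto
  then have "k (Suc n) = 2 * k n \<or> k (Suc n) = Suc (2 * k n)" by linarith
  then show ?thesis
  proof
   assume "k (Suc n) = 2 * k n"
   then have "tn (Suc n) = tn n" by (simp add: tn_def)
   then show ?thesis using q D by simp
  next
   assume e: "k (Suc n) = Suc (2 * k n)"
   then have "2 * k n < 2 ^ Suc n" using k_lt[of "Suc n"] by simp
   from step[OF this] show ?thesis by (simp add: tn_def e)
  qed
 qed
 have geo: "\<bar>A (tn n) - A b\<bar> \<le> D * (\<Sum>i\<le>n. q ^ i)" for n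
 proof (induction n)
  case 0
  have "k 0 = 0" using k_lt[of 0] by simp
  then show ?case using D by (simp add: tn_def)
 next
  case (Suc n)
  then show ?case using inc[of n] by (simp add: distrib_left)
 qed
 have bound: "\<bar>A (tn n) - A b\<bar> \<le> D / (1 - q)" for n
 proof -
  have "(\<Sum>i\<le>n. q ^ i) \<le> 1 / (1 - q)" using q by (auto simp: sum_gp0 divide_right_mono)
  then have "D * (\<Sum>i\<le>n. q ^ i) \<le> D * (1 / (1 - q))" using D by (rule mult_left_mono)
  then show ?thesis using geo[of n] by simp
 qed
 have lim: "tn \<longlonglongrightarrow> t"
 proof (rule Lim_transform_bound[where g="\<lambda>n. b * (1/2) ^ n", THEN Lim_null[THEN iffD2]])
  show "eventually (\<lambda>n. norm (tn n - t) \<le> norm (b * (1/2) ^ n)) sequentially"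
  proof (rule always_eventually, rule allI)
   fix n
   have "tn n - t = b * (real (k n) / 2 ^ n - \<tau>)" by (simp add: tn_def \<tau>(3) algebra_simps)
   moreover have "\<bar>real (k n) / 2 ^ n - \<tau>\<bar> \<le> (1/2) ^ n"
   proof -
    have "real (k n) / 2 ^ n - \<tau> = (real (k n) - 2 ^ n * \<tau>) / 2 ^ n" by (simp add: diff_divide_distrib)
    moreover have "\<bar>real (k n) - 2 ^ n * \<tau>\<bar> \<le> 1" using k_le[of n] k_gt[of n] by linarith
    ultimately show ?thesis by (simp add: power_one_over divide_right_mono)
   qed
   ultimately show "norm (tn n - t) \<le> norm (b * (1/2) ^ n)" using b by (simp add: abs_mult)
  qed
  show "(\<lambda>n. b * (1/2) ^ n) \<longlonglongrightarrow> 0" using tendsto_mult_right_zero[OF LIMSEQ_power_zero[of "1/2::real"], of b] by simp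
 qed
 have tnin: "tn n \<in> {b..2*b}" for n
 proof -
  have "real (k n) / 2 ^ n \<le> 1" using k_lt[of n] by (simp add: less_imp_le)
  then have "b * (1 + real (k n) / 2 ^ n) \<le> b * 2" using b by (intro mult_left_mono) auto
  moreover have "b * 1 \<le> b * (1 + real (k n) / 2 ^ n)" using b by (intro mult_left_mono) auto
  ultimately show ?thesis by (simp add: tn_def)
 qed
 have "(\<lambda>n. A (tn n)) \<longlonglongrightarrow> A t" using continuous_on_tendsto_compose[OF A lim t] tnin by simp
 then have "(\<lambda>n. \<bar>A (tn n) - A b\<bar>) \<longlonglongrightarrow> \<bar>A t - A b\<bar>" by (intro tendsto_intros)
 then show ?thesis by (rule LIMSEQ_le_const2) (use bound in auto)
qed

text \<open>The kernel estimate used later is singular at time 0 and holds only for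
  \<open>r \<le> 2 * s\<close>, so \<open>{0..T}\<close> is cut into blocks from
  \<open>T / 2 ^ Suc i\<close> to \<open>T / 2 ^ i\<close>. Chaining inside a block and then along
  the block endpoints down to 0 gives a double geometric series, with ratio \<open>x\<close> across
  blocks and \<open>q\<close> inside.\<close>

lemma dyadic_block_chaining:
 fixes A :: "real \<Rightarrow> real"
 assumes A: "continuous_on {0..T} A" "A 0 = 0" and T: "0 < T"
  and q: "0 \<le> q" "q < 1" and x: "0 \<le> x" "x < 1" and D: "0 \<le> D"
  and step: "\<And>i n k. k < 2 ^ n \<Longrightarrow>
   \<bar>A (T / 2 ^ Suc i * (1 + real (Suc k) / 2 ^ n)) - A (T / 2 ^ Suc i * (1 + real k / 2 ^ n))\<bar> \<le> D * x ^ i * q ^ n"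
  and t: "t \<in> {0..T}"
 shows "\<bar>A t\<bar> \<le> D / ((1 - x) * (1 - q))"
proof (cases "t = 0")
 case True
 then show ?thesis using A D x q by simp
next
 case False
 then have t0: "0 < t" using t by simp
 define b where "b i = T / 2 ^ Suc i" for i
 have b: "0 < b i" "2 * b i \<le> T" for i
 proof -
  show "0 < b i" using T by (simp add: b_def)
  have "T / 2 ^ i \<le> T / 1" using T by (intro divide_left_mono) auto
  then show "2 * b i \<le> T" by (simp add: b_def)
 qed
 have block: "\<bar>A s - A (b i)\<bar> \<le> D / (1 - q) * x ^ i" if "s \<in> {b i..2 * b i}" for s i
 proof -
  have "\<bar>A s - A (b i)\<bar> \<le> (D * x ^ i) / (1 - q)"
  proof (rule dyadic_chaining[OF _ b(1) q _ _ that])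
   show "continuous_on {b i..2 * b i} A" by (rule continuous_on_subset[OF A(1)]) (use b[of i] in auto)
   show "0 \<le> D * x ^ i" using D x by simp
  qed (use step in \<open>simp add: b_def\<close>)
  then show ?thesis by simp
 qed
 define K where "K = D / (1 - q)"
 have K: "0 \<le> K" using D q by (simp add: K_def)
 obtain i0 where "(1/2) ^ i0 < t / T" using real_arch_pow_inv[of "t / T" "1/2"] t0 T by auto
 then have "\<exists>i. T / 2 ^ Suc i \<le> t" using T t0 by (intro exI[of _ i0]) (simp add: field_simps power_one_over)
 define i where "i = (LEAST i. b i \<le> t)"
 have i1: "b i \<le> t" unfolding i_def using \<open>\<exists>i. T / 2 ^ Suc i \<le> t\<close>[folded b_def] by (rule LeastI_ex)
 have i2: "t \<le> 2 * b i"
 proof (cases i)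
  case 0 then show ?thesis using t by (simp add: b_def)
 next
  case (Suc j)
  then have "\<not> b j \<le> t" unfolding i_def by (intro not_less_Least) simp
  then show ?thesis using Suc by (simp add: b_def)
 qed
 have tel: "\<bar>A (b i) - A (b (i + n))\<bar> \<le> K * (\<Sum>j<n. x ^ (Suc i + j))" for n
 proof (induction n)
  case (Suc n)
  have "\<bar>A (b (i + n)) - A (b (i + Suc n))\<bar> \<le> K * x ^ (Suc i + n)"
   using block[of "b (i + n)" "Suc (i + n)"] b(1)[of "i + n"] by (simp add: K_def b_def field_simps)
  then show ?case using Suc.IH by (simp add: distrib_left)
 qed simp
 have all: "\<bar>A t - A (b (i + n))\<bar> \<le> K / (1 - x)" for n
 proof -
  have "(\<Sum>j<n. x ^ (Suc i + j)) + x ^ i \<le> (\<Sum>j<Suc i + n. x ^ j)"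
  proof -
   have "(\<Sum>j<Suc i + n. x ^ j) = (\<Sum>j<Suc i. x ^ j) + (\<Sum>j<n. x ^ (Suc i + j))"
    by (induction n) (simp_all add: ac_simps)
   moreover have "x ^ i \<le> (\<Sum>j<Suc i. x ^ j)" using x by (simp add: sum_nonneg)
   ultimately show ?thesis by linarith
  qed
  also have "(\<Sum>j<N. x ^ j) \<le> 1 / (1 - x)" for N using x by (auto simp: sum_gp_strict divide_right_mono)
  finally have "K * ((\<Sum>j<n. x ^ (Suc i + j)) + x ^ i) \<le> K * (1 / (1 - x))" using K by (rule mult_left_mono)
  moreover have "\<bar>A t - A (b i)\<bar> \<le> K * x ^ i" using block[of t i] i1 i2 by (simp add: K_def)
  ultimately show ?thesis using tel[of n] unfolding distrib_left times_divide_eq_right mult_1_right by linarith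
 qed
 have "(\<lambda>n. T / 2 * (1/2) ^ (n + i)) \<longlonglongrightarrow> T / 2 * 0"
  by (intro tendsto_intros LIMSEQ_ignore_initial_segment LIMSEQ_power_zero) simp
 then have "(\<lambda>n. b (i + n)) \<longlonglongrightarrow> 0" by (simp add: b_def power_add power_one_over field_simps)
 moreover have "b (i + n) \<in> {0..T}" for n using b[of "i + n"] by auto
 ultimately have "(\<lambda>n. A (b (i + n))) \<longlonglongrightarrow> A 0" using T by (intro continuous_on_tendsto_compose[OF A(1)]) auto
 then have "(\<lambda>n. \<bar>A t - A (b (i + n))\<bar>) \<longlonglongrightarrow> \<bar>A t - A 0\<bar>" by (intro tendsto_intros)
 then have "\<bar>A t - A 0\<bar> \<le> K / (1 - x)" by (rule LIMSEQ_le_const2) (use all in auto)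
 then show ?thesis using A(2) by (simp add: K_def mult.commute)
qed

section \<open>Second moments of time integrals\<close>

lemma set_lebesgue_integral_continuous:
 fixes f :: "real \<Rightarrow> real"
 assumes "set_integrable lborel {0..T} f"
 shows "continuous_on {0..T} (\<lambda>t. LINT s:{0..t}|lborel. f s)"
  and "\<And>u v. 0 \<le> u \<Longrightarrow> u \<le> v \<Longrightarrow> v \<le> T \<Longrightarrow>
   (LINT s:{0..v}|lborel. f s) - (LINT s:{0..u}|lborel. f s) = (LINT s:{u..v}|lborel. f s)"
proof -
 have sub: "set_integrable lborel {u..v} f" if "0 \<le> u" "v \<le> T" for u v
  by (rule set_integrable_subset[OF assms]) (use that in auto)
 have eq: "(LINT s:{u..v}|lborel. f s) = integral {u..v} f" "f integrable_on {u..v}" if "0 \<le> u" "v \<le> T" for u v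
  using set_borel_integral_eq_integral[OF sub[OF that]] by auto
 have "continuous_on {0..T} (\<lambda>t. integral {0..t} f)" by (rule indefinite_integral_continuous_1) (simp add: eq(2))
 then show "continuous_on {0..T} (\<lambda>t. LINT s:{0..t}|lborel. f s)" by (rule continuous_on_eq) (simp add: eq)
 show "(LINT s:{0..v}|lborel. f s) - (LINT s:{0..u}|lborel. f s) = (LINT s:{u..v}|lborel. f s)"
  if "0 \<le> u" "u \<le> v" "v \<le> T" for u v using Henstock_Kurzweil_Integration.integral_combine[of 0 u v f] eq that by simp
qed

context prob_space
begin

lemma expectation_abs_mult_le:
 assumes [measurable]: "X \<in> borel_measurable M" "Y \<in> borel_measurable M"
  and X: "(\<integral>\<^sup>+w. ennreal ((X w)^2) \<partial>M) \<le> ennreal (a^2)"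
  and Y: "(\<integral>\<^sup>+w. ennreal ((Y w)^2) \<partial>M) \<le> ennreal (b^2)" and ab: "0 \<le> a" "0 \<le> b"
 shows "(\<integral>\<^sup>+w. ennreal \<bar>X w * Y w\<bar> \<partial>M) \<le> ennreal (a * b)"
proof -
 have "(\<integral>\<^sup>+w. ennreal \<bar>X w * Y w\<bar> \<partial>M)^2 = (\<integral>\<^sup>+w. ennreal \<bar>X w\<bar> * ennreal \<bar>Y w\<bar> \<partial>M)^2"
  by (simp add: abs_mult ennreal_mult)
 also have "... \<le> (\<integral>\<^sup>+w. (ennreal \<bar>X w\<bar>)^2 \<partial>M) * (\<integral>\<^sup>+w. (ennreal \<bar>Y w\<bar>)^2 \<partial>M)"
  by (rule Cauchy_Schwarz_nn_integral) auto
 also have "... = (\<integral>\<^sup>+w. ennreal ((X w)^2) \<partial>M) * (\<integral>\<^sup>+w. ennreal ((Y w)^2) \<partial>M)" by (simp add: ennreal_power)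
 also have "... \<le> ennreal (a^2) * ennreal (b^2)" by (intro mult_mono X Y) auto
 also have "... = (ennreal (a * b))^2" using ab by (simp add: ennreal_power ennreal_mult[symmetric] power_mult_distrib)
 finally have le: "(\<integral>\<^sup>+w. ennreal \<bar>X w * Y w\<bar> \<partial>M)^2 \<le> (ennreal (a * b))^2" .
 show ?thesis
 proof (cases "\<integral>\<^sup>+w. ennreal \<bar>X w * Y w\<bar> \<partial>M")
  case (real x)
  have "x^2 \<le> (a * b)^2" using le real ab by (simp add: ennreal_power)
  then have "x \<le> a * b" by (rule power2_le_imp_le) (use ab in simp)
  then show ?thesis using real by (simp add: ennreal_leI)
 next
  case top
  then show ?thesis using le ab by (simp add: ennreal_power top_unique)
 qed
qed

text \<open>Fubini turns the second moment into a double integral of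
  \<open>expectation (\<lambda>w. F s w * F r w)\<close>. The function \<open>\<psi>\<close> secures
  absolute integrability through Cauchy-Schwarz; the quantitative bound uses the signed
  expectations, through \<open>K\<close>. The diagonal is a null set, so a kernel singular there is
  allowed.\<close>

lemma second_moment_set_integral_le:
 fixes F :: "real \<Rightarrow> 'a \<Rightarrow> real"
 assumes F [measurable]: "(\<lambda>(s, w). F s w) \<in> borel_measurable (lborel \<Otimes>\<^sub>M M)"
  and \<psi>: "\<And>s. s \<in> {a..b} \<Longrightarrow> 0 \<le> \<psi> s" "set_integrable lborel {a..b} \<psi>"
  and sq: "\<And>s. s \<in> {a..b} \<Longrightarrow> (\<integral>\<^sup>+w. ennreal ((F s w)^2) \<partial>M) \<le> ennreal ((\<psi> s)^2)"
  and K: "\<And>s r. s \<in> {a..b} \<Longrightarrow> r \<in> {a..b} \<Longrightarrow> s \<noteq> r \<Longrightarrow> ennreal \<bar>expectation (\<lambda>w. F s w * F r w)\<bar> \<le> K s r"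
 shows "AE w in M. set_integrable lborel {a..b} (\<lambda>s. F s w)"
  and "(\<integral>\<^sup>+w. ennreal ((LINT s:{a..b}|lborel. F s w)^2) \<partial>M) \<le> (\<integral>\<^sup>+s\<in>{a..b}. (\<integral>\<^sup>+r\<in>{a..b}. K s r \<partial>lborel) \<partial>lborel)"
proof -
 interpret P: pair_sigma_finite "lborel :: real measure" M ..
 interpret N: sigma_finite_measure "lborel \<Otimes>\<^sub>M lborel :: (real \<times> real) measure" ..
 interpret NP: pair_sigma_finite "lborel \<Otimes>\<^sub>M lborel :: (real \<times> real) measure" M ..
 define F' where "F' s w = indicator {a..b} s * F s w" for s w
 define \<psi>' where "\<psi>' s = indicator {a..b} s * \<psi> s" for s
 have F'm [measurable]: "(\<lambda>(s, w). F' s w) \<in> borel_measurable (lborel \<Otimes>\<^sub>M M)" unfolding F'_def by measurable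
 have [measurable]: "(\<lambda>(w, s). F' s w) \<in> borel_measurable (M \<Otimes>\<^sub>M lborel)" using measurable_pair_swap[OF F'm] by simp
 have Fs [measurable]: "F' s \<in> borel_measurable M" for s
  using measurable_compose[OF measurable_Pair1' F'm, of s] by simp
 have Fw: "(\<lambda>s. F' s w) \<in> borel_measurable lborel" if "w \<in> space M" for w
  using measurable_compose[OF measurable_Pair2'[OF that] F'm] by simp
 have \<psi>': "0 \<le> \<psi>' s" "integrable lborel \<psi>'" for s
  using \<psi> by (auto simp: \<psi>'_def[abs_def] set_integrable_def split: split_indicator)
 have [measurable]: "\<psi>' \<in> borel_measurable lborel" using \<psi>'(2) by auto
 have I\<psi>: "(\<integral>\<^sup>+s. ennreal (\<psi>' s) \<partial>lborel) < \<infinity>" using \<psi>' by (simp add: nn_integral_eq_integral)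
 have sq': "(\<integral>\<^sup>+w. ennreal ((F' s w)^2) \<partial>M) \<le> ennreal ((\<psi>' s)^2)" for s
  using sq[of s] by (simp add: F'_def \<psi>'_def split: split_indicator)
 have prod: "(\<integral>\<^sup>+w. ennreal \<bar>F' s w * F' r w\<bar> \<partial>M) \<le> ennreal (\<psi>' s) * ennreal (\<psi>' r)" for s r
  using expectation_abs_mult_le[OF Fs Fs sq' sq' \<psi>'(1) \<psi>'(1), of s r] \<psi>' by (simp add: ennreal_mult)
 have one: "(\<integral>\<^sup>+w. ennreal \<bar>F' s w\<bar> \<partial>M) \<le> ennreal (\<psi>' s)" for s
  using expectation_abs_mult_le[OF Fs _ sq' _ \<psi>'(1), of "\<lambda>_. 1" 1 s] by (simp add: emeasure_space_1)
 have "(\<integral>\<^sup>+w. (\<integral>\<^sup>+s. ennreal \<bar>F' s w\<bar> \<partial>lborel) \<partial>M) = (\<integral>\<^sup>+s. (\<integral>\<^sup>+w. ennreal \<bar>F' s w\<bar> \<partial>M) \<partial>lborel)"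
  by (rule P.Fubini') measurable
 also have "... \<le> (\<integral>\<^sup>+s. ennreal (\<psi>' s) \<partial>lborel)" by (intro nn_integral_mono one)
 finally have "(\<integral>\<^sup>+w. (\<integral>\<^sup>+s. ennreal \<bar>F' s w\<bar> \<partial>lborel) \<partial>M) \<noteq> \<infinity>" using I\<psi> by auto
 then have "AE w in M. (\<integral>\<^sup>+s. ennreal \<bar>F' s w\<bar> \<partial>lborel) \<noteq> \<infinity>" by (intro nn_integral_PInf_AE) measurable
 then have int: "AE w in M. integrable lborel (\<lambda>s. F' s w)"
  using AE_space by eventually_elim (use Fw in \<open>auto simp: integrable_iff_bounded top.not_eq_extremum\<close>)
 then show "AE w in M. set_integrable lborel {a..b} (\<lambda>s. F s w)"
  by eventually_elim (simp add: set_integrable_def F'_def)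
 have eqL: "(LINT s:{a..b}|lborel. F s w) = (LINT s|lborel. F' s w)" for w
  by (simp add: set_lebesgue_integral_def F'_def)
 define g where "g z = F' (fst (fst z)) (snd z) * F' (snd (fst z)) (snd z)" for z
 have m1: "(\<lambda>z. F' (fst (fst z)) (snd z)) \<in> borel_measurable ((lborel \<Otimes>\<^sub>M lborel) \<Otimes>\<^sub>M M)"
  using measurable_compose[OF _ F'm, of "\<lambda>z. (fst (fst z), snd z)"] by simp
 have m2: "(\<lambda>z. F' (snd (fst z)) (snd z)) \<in> borel_measurable ((lborel \<Otimes>\<^sub>M lborel) \<Otimes>\<^sub>M M)"
  using measurable_compose[OF _ F'm, of "\<lambda>z. (snd (fst z), snd z)"] by simp
 have gm [measurable]: "g \<in> borel_measurable ((lborel \<Otimes>\<^sub>M lborel) \<Otimes>\<^sub>M M)" unfolding g_def using m1 m2 by simp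
 have "(\<integral>\<^sup>+z. ennreal (norm (g z)) \<partial>((lborel \<Otimes>\<^sub>M lborel) \<Otimes>\<^sub>M M))
   = (\<integral>\<^sup>+p. (\<integral>\<^sup>+w. ennreal (norm (g (p, w))) \<partial>M) \<partial>(lborel \<Otimes>\<^sub>M lborel))"
  by (rule nn_integral_fst[symmetric]) measurable
 also have "... \<le> (\<integral>\<^sup>+p. ennreal (\<psi>' (fst p)) * ennreal (\<psi>' (snd p)) \<partial>(lborel \<Otimes>\<^sub>M lborel))"
  by (intro nn_integral_mono) (use prod in \<open>simp add: g_def\<close>)
 also have "... = (\<integral>\<^sup>+s. (\<integral>\<^sup>+r. ennreal (\<psi>' s) * ennreal (\<psi>' r) \<partial>lborel) \<partial>lborel)"
  by (subst lborel.nn_integral_fst[symmetric]) simp_all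
 also have "... = (\<integral>\<^sup>+s. ennreal (\<psi>' s) \<partial>lborel) * (\<integral>\<^sup>+s. ennreal (\<psi>' s) \<partial>lborel)"
  by (simp add: nn_integral_cmult nn_integral_multc)
 also have "... < \<infinity>" using I\<psi> by (simp add: ennreal_mult_less_top)
 finally have gi: "integrable ((lborel \<Otimes>\<^sub>M lborel) \<Otimes>\<^sub>M M) g" by (intro integrableI_bounded gm)
 have sqeq: "AE w in M. (LINT p|(lborel \<Otimes>\<^sub>M lborel). g (p, w)) = (LINT s|lborel. F' s w)^2"
  using NP.AE_integrable_snd[of "\<lambda>p w. g (p, w)"] gi
 proof -
  have "AE w in M. integrable (lborel \<Otimes>\<^sub>M lborel) (\<lambda>p. g (p, w))"
   using NP.AE_integrable_snd[of "\<lambda>p w. g (p, w)"] gi by simp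
  then show ?thesis
  proof eventually_elim
   case (elim w)
   have "(LINT p|(lborel \<Otimes>\<^sub>M lborel). g (p, w)) = (LINT s|lborel. LINT r|lborel. g ((s, r), w))"
    using lborel_pair.integral_fst'[OF elim] by simp
   also have "... = (LINT s|lborel. F' s w)^2" by (simp add: g_def power2_eq_square)
   finally show ?case .
  qed
 qed
 have iR: "integrable M (\<lambda>w. LINT p|(lborel \<Otimes>\<^sub>M lborel). g (p, w))"
  using NP.integrable_snd[of "\<lambda>p w. g (p, w)"] gi by simp
 have "(\<integral>\<^sup>+w. ennreal ((LINT s:{a..b}|lborel. F s w)^2) \<partial>M) = (\<integral>\<^sup>+w. ennreal (LINT p|(lborel \<Otimes>\<^sub>M lborel). g (p, w)) \<partial>M)"
  unfolding eqL by (rule nn_integral_cong_AE) (use sqeq in eventually_elim, simp)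
 also have "... = ennreal (expectation (\<lambda>w. LINT p|(lborel \<Otimes>\<^sub>M lborel). g (p, w)))"
  by (rule nn_integral_eq_integral[OF iR]) (use sqeq in eventually_elim, simp)
 also have "expectation (\<lambda>w. LINT p|(lborel \<Otimes>\<^sub>M lborel). g (p, w)) = (LINT p|(lborel \<Otimes>\<^sub>M lborel). expectation (\<lambda>w. g (p, w)))"
  using NP.Fubini_integral[of "\<lambda>p w. g (p, w)"] gi by simp
 also have "ennreal ... \<le> (\<integral>\<^sup>+p. ennreal \<bar>expectation (\<lambda>w. g (p, w))\<bar> \<partial>(lborel \<Otimes>\<^sub>M lborel))"
  using integral_norm_bound_ennreal[OF NP.integrable_fst'[OF gi]] by (auto intro: order_trans[rotated] ennreal_leI)
 also have "... = (\<integral>\<^sup>+s. (\<integral>\<^sup>+r. ennreal \<bar>expectation (\<lambda>w. g ((s, r), w))\<bar> \<partial>lborel) \<partial>lborel)"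
  using NP.integrable_fst'[OF gi] by (subst lborel.nn_integral_fst[symmetric]) auto
 also have "... \<le> (\<integral>\<^sup>+s\<in>{a..b}. (\<integral>\<^sup>+r\<in>{a..b}. K s r \<partial>lborel) \<partial>lborel)"
 proof (rule nn_integral_mono)
  fix s
  show "(\<integral>\<^sup>+r. ennreal \<bar>expectation (\<lambda>w. g ((s, r), w))\<bar> \<partial>lborel) \<le> (\<integral>\<^sup>+r\<in>{a..b}. K s r \<partial>lborel) * indicator {a..b} s"
  proof (cases "s \<in> {a..b}")
   case True
   have "AE r in lborel. r \<noteq> s" by (rule AE_lborel_singleton)
   then have "AE r in lborel. ennreal \<bar>expectation (\<lambda>w. g ((s, r), w))\<bar> \<le> K s r * indicator {a..b} r"
    by eventually_elim (use True K[of s] in \<open>auto simp: g_def F'_def split: split_indicator\<close>)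
   then show ?thesis using True by (simp add: nn_integral_mono_AE)
  qed (simp add: g_def F'_def)
 qed
 finally show "(\<integral>\<^sup>+w. ennreal ((LINT s:{a..b}|lborel. F s w)^2) \<partial>M) \<le> (\<integral>\<^sup>+s\<in>{a..b}. (\<integral>\<^sup>+r\<in>{a..b}. K s r \<partial>lborel) \<partial>lborel)" .
qed

end

lemma nn_integral_powr_from_0:
 fixes p c :: real
 assumes "-1 < p" "0 \<le> c"
 shows "(\<integral>\<^sup>+x\<in>{0..c}. ennreal (x powr p) \<partial>lborel) = ennreal (c powr (p + 1) / (p + 1))"
proof -
 have "((\<lambda>x. if x \<in> {0..c} then x powr p else 0) has_integral c powr (p + 1) / (p + 1)) UNIV"
  using has_integral_powr_from_0[OF assms] by (subst has_integral_restrict_UNIV)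
 then have "(\<integral>\<^sup>+x. ennreal (if x \<in> {0..c} then x powr p else 0) \<partial>lborel) = ennreal (c powr (p + 1) / (p + 1))"
  by (rule nn_integral_has_integral_lborel[rotated 2]) auto
 moreover have "(\<integral>\<^sup>+x\<in>{0..c}. ennreal (x powr p) \<partial>lborel)
   = (\<integral>\<^sup>+x. ennreal (if x \<in> {0..c} then x powr p else 0) \<partial>lborel)"
  by (intro nn_integral_cong) (auto split: split_indicator)
 ultimately show ?thesis by simp
qed

lemma nn_integral_abs_powr_le:
 fixes p s u v :: real
 assumes p: "-1 < p" and s: "s \<in> {u..v}"
 shows "(\<integral>\<^sup>+r\<in>{u..v}. ennreal (\<bar>s - r\<bar> powr p) \<partial>lborel) \<le> ennreal (2 * (v - u) powr (p + 1) / (p + 1))"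
proof -
 define c where "c = v - u"
 have c: "0 \<le> c" using s by (simp add: c_def)
 define f where "f y = ennreal (\<bar>y\<bar> powr p) * indicator {0..c} y" for y :: real
 have [measurable]: "f \<in> borel_measurable borel" unfolding f_def by measurable
 have I: "(\<integral>\<^sup>+y. f y \<partial>lborel) = ennreal (c powr (p + 1) / (p + 1))"
  unfolding nn_integral_powr_from_0[OF p c, symmetric] f_def by (intro nn_integral_cong) (auto split: split_indicator)
 have "(\<integral>\<^sup>+r\<in>{u..v}. ennreal (\<bar>s - r\<bar> powr p) \<partial>lborel) \<le> (\<integral>\<^sup>+r. f (- s + 1 * r) + f (s + (-1) * r) \<partial>lborel)"
  using s by (intro nn_integral_mono) (auto simp: f_def c_def abs_minus_commute split: split_indicator)
 also have "... = (\<integral>\<^sup>+r. f (- s + 1 * r) \<partial>lborel) + (\<integral>\<^sup>+r. f (s + (-1) * r) \<partial>lborel)"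
  by (rule nn_integral_add) measurable
 also have "(\<integral>\<^sup>+r. f (- s + 1 * r) \<partial>lborel) = (\<integral>\<^sup>+y. f y \<partial>lborel)" using nn_integral_real_affine[of f 1 "-s"] by simp
 also have "(\<integral>\<^sup>+r. f (s + (-1) * r) \<partial>lborel) = (\<integral>\<^sup>+y. f y \<partial>lborel)" using nn_integral_real_affine[of f "-1" s] by simp
 finally show ?thesis
  using p unfolding I c_def[symmetric] by (simp add: ennreal_plus[symmetric] divide_nonneg_pos del: ennreal_plus)
qed

text \<open>On block \<open>i\<close> the squared increments of level \<open>n\<close> have
  expectations summing to order \<open>x ^ (4 * i) * y ^ (4 * n)\<close>. Half of each exponent is
  spent on the convergence of a weighted sum (\<open>1 - x^2\<close>, \<open>1 - y^2\<close>), the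
  other half, after a square root, on the chaining series (\<open>1 - x\<close>,
  \<open>1 - y\<close>); hence the quarters in the exponents of \<open>x\<close> and
  \<open>y\<close>. The factor \<open>2 / (1 - 2*H)\<close> bounds the kernel integral.\<close>

definition max_const :: "real \<Rightarrow> real \<Rightarrow> real" where
 "max_const H T = (let x = 2 powr (- H / 4); y = 2 powr (- (1 - 2*H) / 4) in
   2 / (1 - 2*H) * (T / 2) powr H / ((1 - x^2) * (1 - y^2)) / ((1 - x) * (1 - y))^2)"

context prob_space
begin

text \<open>Over an interval of length \<open>b / 2 ^ n\<close> inside \<open>{b..2*b}\<close> the
  kernel bound integrates to order \<open>b powr H * 2 powr (- n * (2 - 2*H))\<close>. Summing over
  \<open>2 ^ n\<close> intervals leaves \<open>2 powr (- n * (1 - 2*H))\<close>, summable in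
  \<open>n\<close> because \<open>H < 1/2\<close>; the factor \<open>b powr H\<close> is summable
  over the blocks because \<open>0 < H\<close>. The outcome is one integrable variable
  \<open>S\<close> that dominates all times at once.\<close>

theorem maximal_inequality:
 fixes F :: "real \<Rightarrow> 'a \<Rightarrow> real"
 assumes H: "0 < H" "H < 1/2" and T: "0 < T" and G: "0 \<le> G"
  and F [measurable]: "(\<lambda>(s, w). F s w) \<in> borel_measurable (lborel \<Otimes>\<^sub>M M)"
  and \<psi>: "\<And>s. s \<in> {0..T} \<Longrightarrow> 0 \<le> \<psi> s" "set_integrable lborel {0..T} \<psi>"
  and sq: "\<And>s. s \<in> {0..T} \<Longrightarrow> (\<integral>\<^sup>+w. ennreal ((F s w)^2) \<partial>M) \<le> ennreal ((\<psi> s)^2)"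
  and K: "\<And>s r. 0 < s \<Longrightarrow> s < r \<Longrightarrow> r \<le> 2 * s \<Longrightarrow> r \<le> T \<Longrightarrow>
   \<bar>expectation (\<lambda>w. F s w * F r w)\<bar> \<le> G * s powr (3*H - 2) * (r - s) powr (-2*H)"
 shows "\<exists>S\<in>borel_measurable M. (\<integral>\<^sup>+w. S w \<partial>M) \<le> ennreal (max_const H T * G) \<and>
  (AE w in M. set_integrable lborel {0..T} (\<lambda>s. F s w) \<and>
   (\<forall>t\<in>{0..T}. ennreal ((LINT s:{0..t}|lborel. F s w)^2) \<le> S w))"
proof -
 define c0 where "c0 = 2 / (1 - 2*H)"
 have c0: "0 < c0" using H by (simp add: c0_def)
 have int: "AE w in M. set_integrable lborel {0..T} (\<lambda>s. F s w)"
  by (rule second_moment_set_integral_le(1)[OF F \<psi> sq, where K="\<lambda>s r. ennreal \<bar>expectation (\<lambda>w. F s w * F r w)\<bar>"]) auto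
 have block: "(\<integral>\<^sup>+w. ennreal ((LINT s:{u..v}|lborel. F s w)^2) \<partial>M)
   \<le> ennreal (c0 * G * b powr (3*H - 2) * (v - u) powr (2 - 2*H))"
  if b: "0 < b" "b \<le> u" "u \<le> v" "v \<le> 2 * b" "v \<le> T" for b u v
 proof -
  define g where "g = G * b powr (3*H - 2)"
  have g: "0 \<le> g" using G by (simp add: g_def)
  have K': "\<bar>expectation (\<lambda>w. F s w * F r w)\<bar> \<le> g * \<bar>s - r\<bar> powr (-2*H)"
   if "s \<in> {u..v}" "r \<in> {u..v}" "s < r" for s r
  proof -
   have "\<bar>expectation (\<lambda>w. F s w * F r w)\<bar> \<le> G * s powr (3*H - 2) * (r - s) powr (-2*H)"
    using that b by (intro K) auto
   also have "... \<le> g * (r - s) powr (-2*H)"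
    unfolding g_def using that b H G by (intro mult_right_mono mult_left_mono powr_mono2') auto
   finally show ?thesis using that by (simp add: abs_minus_commute)
  qed
  have K2: "ennreal \<bar>expectation (\<lambda>w. F s w * F r w)\<bar> \<le> ennreal g * ennreal (\<bar>s - r\<bar> powr (-2*H))"
   if "s \<in> {u..v}" "r \<in> {u..v}" "s \<noteq> r" for s r
  proof -
   have "\<bar>expectation (\<lambda>w. F s w * F r w)\<bar> \<le> g * \<bar>s - r\<bar> powr (-2*H)" using K'[of s r] K'[of r s] that
    by (cases "s < r") (auto simp: abs_minus_commute mult.commute[of "F s _"])
   then show ?thesis using g by (simp add: ennreal_mult'[symmetric] ennreal_leI)
  qed
  have sub: "{u..v} \<subseteq> {0..T}" using b by auto
  have "(\<integral>\<^sup>+w. ennreal ((LINT s:{u..v}|lborel. F s w)^2) \<partial>M)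
   \<le> (\<integral>\<^sup>+s\<in>{u..v}. (\<integral>\<^sup>+r\<in>{u..v}. ennreal g * ennreal (\<bar>s - r\<bar> powr (-2*H)) \<partial>lborel) \<partial>lborel)"
   by (rule second_moment_set_integral_le(2)[OF F _ set_integrable_subset[OF \<psi>(2)] _ K2])
    (use sub \<psi> sq in auto)
  also have "... \<le> (\<integral>\<^sup>+s\<in>{u..v}. ennreal (g * (c0 * (v - u) powr (1 - 2*H))) \<partial>lborel)"
  proof (rule nn_integral_mono)
   fix s
   have "(\<integral>\<^sup>+r\<in>{u..v}. ennreal g * ennreal (\<bar>s - r\<bar> powr (-2*H)) \<partial>lborel)
    \<le> ennreal (g * (c0 * (v - u) powr (1 - 2*H)))" if "s \<in> {u..v}"
   proof -
    have "(\<integral>\<^sup>+r\<in>{u..v}. ennreal g * ennreal (\<bar>s - r\<bar> powr (-2*H)) \<partial>lborel)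
     = ennreal g * (\<integral>\<^sup>+r\<in>{u..v}. ennreal (\<bar>s - r\<bar> powr (-2*H)) \<partial>lborel)"
     by (subst nn_integral_cmult[symmetric]) (simp_all add: mult.assoc)
    also have "... \<le> ennreal g * ennreal (2 * (v - u) powr (-2*H + 1) / (-2*H + 1))"
     using H by (intro mult_left_mono nn_integral_abs_powr_le that) auto
    also have "... = ennreal (g * (c0 * (v - u) powr (1 - 2*H)))"
     using g H by (simp add: ennreal_mult'[symmetric] c0_def)
    finally show ?thesis .
   qed
   then show "(\<integral>\<^sup>+r\<in>{u..v}. ennreal g * ennreal (\<bar>s - r\<bar> powr (-2*H)) \<partial>lborel) * indicator {u..v} s
    \<le> ennreal (g * (c0 * (v - u) powr (1 - 2*H))) * indicator {u..v} s" by (simp split: split_indicator)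
  qed
  also have "... = ennreal (g * (c0 * (v - u) powr (1 - 2*H))) * ennreal (v - u)"
   using b by (subst nn_integral_cmult_indicator) auto
  also have "... = ennreal (g * (c0 * ((v - u) powr (1 - 2*H) * (v - u))))"
   using g c0 b by (simp add: ennreal_mult''[symmetric] mult.assoc)
  also have "(v - u) powr (1 - 2*H) * (v - u) = (v - u) powr (2 - 2*H)"
   using b powr_add[of "v - u" "1 - 2*H" 1] by (cases "u = v") auto
  finally show ?thesis by (simp add: g_def ac_simps)
 qed
 define x where "x = 2 powr (- H / 4)"
 define y where "y = 2 powr (- (1 - 2*H) / 4)"
 have x: "0 < x" "x < 1" and y: "0 < y" "y < 1" using H by (auto simp: x_def y_def powr_less_one)
 have xp: "x ^ (4 * i) = 2 powr (- (H * real i))" for i by (simp add: x_def powr_realpow[symmetric] powr_powr)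
 have yp: "y ^ (4 * n) = 2 powr ((2 * H - 1) * real n)" for n
 proof -
  have "- (1 - 2 * H) / 4 * real (4 * n) = (2 * H - 1) * real n" by (simp add: field_simps)
  moreover have "(2 powr e) ^ m = 2 powr (e * real m)" for e :: real and m
   by (simp add: powr_realpow[symmetric] powr_powr)
  ultimately show ?thesis unfolding y_def by (simp only:)
 qed
 define p where "p i n k = T / 2 ^ Suc i * (1 + real k / 2 ^ n)" for i n k :: nat
 define \<Delta> where "\<Delta> i n k w = (LINT s:{p i n k..p i n (Suc k)}|lborel. F s w)" for i n k :: nat and w
 define C where "C = c0 * G * (T / 2) powr H"
 have C: "0 \<le> C" using c0 G by (simp add: C_def)
 have [measurable]: "(\<lambda>(w, s). F s w) \<in> borel_measurable (M \<Otimes>\<^sub>M lborel)" using measurable_pair_swap[OF F] by simp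
 have \<Delta>m [measurable]: "\<Delta> i n k \<in> borel_measurable M" for i n k
  unfolding \<Delta>_def[abs_def] set_lebesgue_integral_def by measurable
 have pb: "T / 2 ^ Suc i \<le> p i n k" "p i n k \<le> p i n (Suc k)" for i n k
 proof -
  have "T / 2 ^ Suc i * 1 \<le> T / 2 ^ Suc i * (1 + real k / 2 ^ n)" using T by (intro mult_left_mono) auto
  then show "T / 2 ^ Suc i \<le> p i n k" by (simp add: p_def)
  show "p i n k \<le> p i n (Suc k)"
   unfolding p_def using T by (intro mult_left_mono add_left_mono divide_right_mono) auto
 qed
 have pe: "p i n (Suc k) \<le> 2 * (T / 2 ^ Suc i)" if "k < 2 ^ n" for i n k
 proof -
  have "real (Suc k) \<le> 2 ^ n" using that by (metis Suc_leI of_nat_le_iff of_nat_numeral of_nat_power)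
  then have "T / 2 ^ Suc i * (1 + real (Suc k) / 2 ^ n) \<le> T / 2 ^ Suc i * 2"
   using T by (intro mult_left_mono) (auto simp: divide_le_eq)
  then show ?thesis by (simp add: p_def)
 qed
 have TT: "2 * (T / 2 ^ Suc i) \<le> T" for i
 proof -
  have "T / 2 ^ i \<le> T / 1" using T by (intro divide_left_mono) auto
  then show ?thesis by simp
 qed
 have E\<Delta>: "(\<integral>\<^sup>+w. ennreal ((\<Delta> i n k w)^2) \<partial>M) \<le> ennreal (C * x ^ (4 * i) * y ^ (4 * n) / 2 ^ n)"
  if "k < 2 ^ n" for i n k
 proof -
  define b where "b = T / 2 ^ Suc i"
  have b: "0 < b" using T by (simp add: b_def)
  have bH: "b powr H = (T / 2) powr H * x ^ (4 * i)"
  proof -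
   have bb: "b = (T / 2) * 2 powr (- real i)" by (simp add: b_def powr_minus powr_realpow field_simps)
   show ?thesis unfolding bb xp using T by (subst powr_mult) (auto simp: powr_powr mult.commute)
  qed
  have "p i n (Suc k) - p i n k = b / 2 ^ n" by (simp add: p_def b_def algebra_simps add_divide_distrib)
  also have "... = b * 2 powr (- real n)" by (simp add: powr_minus powr_realpow field_simps)
  finally have "(p i n (Suc k) - p i n k) powr (2 - 2*H) = b powr (2 - 2*H) * 2 powr (- real n * (2 - 2*H))"
   using b by (simp add: powr_mult powr_powr)
  moreover have "2 powr (- real n * (2 - 2*H)) = y ^ (4 * n) / 2 ^ n"
   unfolding yp by (simp add: powr_realpow[symmetric] powr_diff[symmetric] algebra_simps)
  moreover have "b powr (3*H - 2) * b powr (2 - 2*H) = b powr H" using b by (simp add: powr_add[symmetric])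
  moreover have "(\<integral>\<^sup>+w. ennreal ((\<Delta> i n k w)^2) \<partial>M)
    \<le> ennreal (c0 * G * b powr (3*H - 2) * (p i n (Suc k) - p i n k) powr (2 - 2*H))"
   unfolding \<Delta>_def using b pb[of i n k] pe[OF that, of i] TT[of i] by (intro block) (auto simp: b_def)
  ultimately show ?thesis by (simp add: C_def bH ac_simps)
 qed
 define Q where "Q i n w = (\<Sum>k<2^n. ennreal ((\<Delta> i n k w)^2))" for i n :: nat and w
 have [measurable]: "Q i n \<in> borel_measurable M" for i n unfolding Q_def[abs_def] by measurable
 have EQ: "(\<integral>\<^sup>+w. Q i n w \<partial>M) \<le> ennreal (C * x ^ (4 * i) * y ^ (4 * n))" for i n
 proof -
  have "(\<integral>\<^sup>+w. Q i n w \<partial>M) = (\<Sum>k<2^n. \<integral>\<^sup>+w. ennreal ((\<Delta> i n k w)^2) \<partial>M)"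
   unfolding Q_def by (rule nn_integral_sum) simp
  also have "... \<le> (\<Sum>k<(2::nat)^n. ennreal (C * x ^ (4 * i) * y ^ (4 * n) / 2 ^ n))" by (intro sum_mono E\<Delta>) auto
  also have "... = ennreal (\<Sum>k<(2::nat)^n. C * x ^ (4 * i) * y ^ (4 * n) / 2 ^ n)"
   using C x y by (intro sum_ennreal) auto
  also have "(\<Sum>k<(2::nat)^n. C * x ^ (4 * i) * y ^ (4 * n) / 2 ^ n) = C * x ^ (4 * i) * y ^ (4 * n)" by simp
  finally show ?thesis .
 qed
 \<comment> \<open>The variable \<open>S\<close> is a weighted sum of all squared dyadic increments.
   Where it has a finite value \<open>r\<close>, each increment is at most
   \<open>sqrt r * x ^ i * y ^ n\<close> in absolute value, the hypothesis of
   \<open>dyadic_block_chaining\<close>.\<close>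
 define W where "W i n = ennreal (1 / (x ^ (2 * i) * y ^ (2 * n)))" for i n :: nat
 define S where "S w = (\<Sum>i. \<Sum>n. W i n * Q i n w)" for w
 have [measurable]: "S \<in> borel_measurable M" unfolding S_def[abs_def] by measurable
 define z where "z = ennreal C"
 have geo: "(\<Sum>n. ennreal (q ^ (2 * n))) = ennreal (1 / (1 - q^2))" if "0 < q" "q < 1" for q :: real
 proof -
  have q2: "q^2 < 1" using that by (simp add: power_less_one_iff)
  have "(\<Sum>n. ennreal ((q^2) ^ n)) = ennreal (\<Sum>n. (q^2) ^ n)"
   using q2 that by (intro suminf_ennreal2 summable_geometric) auto
  then show ?thesis using q2 that by (simp add: suminf_geometric power_mult)
 qed
 have ES: "(\<integral>\<^sup>+w. S w \<partial>M) \<le> ennreal (C / ((1 - x^2) * (1 - y^2)))"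
 proof -
  have "(\<integral>\<^sup>+w. S w \<partial>M) = (\<Sum>i. \<Sum>n. W i n * (\<integral>\<^sup>+w. Q i n w \<partial>M))"
   unfolding S_def by (simp add: nn_integral_suminf nn_integral_cmult)
  also have "... \<le> (\<Sum>i. \<Sum>n. z * (ennreal (x ^ (2 * i)) * ennreal (y ^ (2 * n))))"
  proof (intro suminf_le allI summableI)
   fix i n
   have "W i n * (\<integral>\<^sup>+w. Q i n w \<partial>M) \<le> W i n * ennreal (C * x ^ (4 * i) * y ^ (4 * n))"
    by (intro mult_left_mono EQ) auto
   also have "... = ennreal (1 / (x ^ (2 * i) * y ^ (2 * n)) * (C * x ^ (4 * i) * y ^ (4 * n)))"
    unfolding W_def using x y C by (intro ennreal_mult[symmetric]) auto
   also have "1 / (x ^ (2 * i) * y ^ (2 * n)) * (C * x ^ (4 * i) * y ^ (4 * n)) = C * (x ^ (2 * i) * y ^ (2 * n))"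
   proof -
    have "x ^ (4 * i) = x ^ (2 * i) * x ^ (2 * i)" "y ^ (4 * n) = y ^ (2 * n) * y ^ (2 * n)"
     by (simp_all add: power_add[symmetric])
    then show ?thesis using x y by simp
   qed
   finally show "W i n * (\<integral>\<^sup>+w. Q i n w \<partial>M) \<le> z * (ennreal (x ^ (2 * i)) * ennreal (y ^ (2 * n)))"
    using x y C by (simp add: z_def ennreal_mult)
  qed
  also have "... = z * ((\<Sum>i. ennreal (x ^ (2 * i))) * (\<Sum>n. ennreal (y ^ (2 * n))))" by simp
  also have "... = z * (ennreal (1 / (1 - x^2)) * ennreal (1 / (1 - y^2)))" using x y by (simp only: geo)
  also have "... = ennreal (C * (1 / (1 - x^2) * (1 / (1 - y^2))))"
  proof -
   have "x^2 < 1" "y^2 < 1" using x y by (simp_all add: power_less_one_iff)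
   then have "0 \<le> 1 / (1 - x^2)" "0 \<le> 1 / (1 - y^2)" by simp_all
   moreover have "ennreal C * (ennreal a * ennreal b) = ennreal (C * (a * b))" if "0 \<le> a" "0 \<le> b" for a b
    using C that by (simp add: ennreal_mult)
   ultimately show ?thesis unfolding z_def by blast
  qed
  finally show ?thesis by simp
 qed
 define c where "c = 1 / ((1 - x) * (1 - y))^2"
 have c: "0 < c" using x y by (simp add: c_def)
 show ?thesis
 proof (intro bexI[of _ "\<lambda>w. ennreal c * S w"] conjI)
  have "(\<integral>\<^sup>+w. ennreal c * S w \<partial>M) = ennreal c * (\<integral>\<^sup>+w. S w \<partial>M)" by (rule nn_integral_cmult) simp
  also have "... \<le> ennreal c * ennreal (C / ((1 - x^2) * (1 - y^2)))" by (intro mult_left_mono ES) simp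
  also have "... = ennreal (c * (C / ((1 - x^2) * (1 - y^2))))" by (rule ennreal_mult'[symmetric]) (use c in simp)
  also have "c * (C / ((1 - x^2) * (1 - y^2))) = max_const H T * G"
  proof -
   have "max_const H T = 2 / (1 - 2*H) * (T / 2) powr H / ((1 - x^2) * (1 - y^2)) / ((1 - x) * (1 - y))^2"
    unfolding max_const_def Let_def x_def y_def ..
   then show ?thesis by (simp add: c_def C_def c0_def ac_simps)
  qed
  finally show "(\<integral>\<^sup>+w. ennreal c * S w \<partial>M) \<le> ennreal (max_const H T * G)" .
  have bnd: "ennreal ((LINT s:{0..t}|lborel. F s w)^2) \<le> ennreal c * S w"
   if i: "set_integrable lborel {0..T} (\<lambda>s. F s w)" and t: "t \<in> {0..T}" for w t
  proof (cases "S w")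
   case top
   then show ?thesis using c by (simp add: ennreal_mult_top)
  next
   case (real r)
   let ?A = "\<lambda>t. LINT s:{0..t}|lborel. F s w"
   have "\<bar>?A t\<bar> \<le> sqrt r / ((1 - x) * (1 - y))"
   proof (rule dyadic_block_chaining[where A="?A" and t=t, OF _ _ T])
    show "continuous_on {0..T} ?A" by (rule set_lebesgue_integral_continuous(1)[OF i])
    show "?A 0 = 0" using set_borel_integral_eq_integral(2)[OF set_integrable_subset[OF i, of "{0..0}"]] T by simp
    show "0 \<le> y" "y < 1" "0 \<le> x" "x < 1" "0 \<le> sqrt r" using x y real by auto
    show "t \<in> {0..T}" by fact
    fix i n k :: nat assume k: "k < 2 ^ n"
    have "?A (p i n (Suc k)) - ?A (p i n k) = \<Delta> i n k w" unfolding \<Delta>_def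
    proof (rule set_lebesgue_integral_continuous(2)[OF i])
     have "0 \<le> T / 2 ^ Suc i" using T by simp
     then show "0 \<le> p i n k" using pb(1)[of i n k] by linarith
     show "p i n (Suc k) \<le> T" using pe[OF k, of i] TT[of i] by linarith
    qed (rule pb)
    moreover have "\<bar>\<Delta> i n k w\<bar> \<le> sqrt r * x ^ i * y ^ n"
    proof -
     have "W i n * ennreal ((\<Delta> i n k w)^2) \<le> W i n * Q i n w"
      unfolding Q_def using k by (intro mult_left_mono member_le_sum) auto
     also have "... \<le> (\<Sum>n. W i n * Q i n w)" using sum_le_suminf[of "\<lambda>n. W i n * Q i n w" "{n}"] by simp
     also have "... \<le> S w" unfolding S_def using sum_le_suminf[of "\<lambda>i. \<Sum>n. W i n * Q i n w" "{i}"] by simp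
     finally have "ennreal (1 / (x ^ (2 * i) * y ^ (2 * n)) * (\<Delta> i n k w)^2) \<le> ennreal r"
     proof -
      assume "W i n * ennreal ((\<Delta> i n k w)^2) \<le> S w"
      moreover have "W i n * ennreal ((\<Delta> i n k w)^2)
        = ennreal (1 / (x ^ (2 * i) * y ^ (2 * n)) * (\<Delta> i n k w)^2)"
       unfolding W_def by (rule ennreal_mult'[symmetric]) (use x y in simp)
      ultimately show ?thesis using real by simp
     qed
     then have "1 / (x ^ (2 * i) * y ^ (2 * n)) * (\<Delta> i n k w)^2 \<le> r"
      by (subst (asm) ennreal_le_iff) (use real in auto)
     then have "(\<Delta> i n k w)^2 \<le> r * (x ^ (2 * i) * y ^ (2 * n))" using x y by (simp add: field_simps)
     also have "... = (sqrt r * x ^ i * y ^ n)^2" using real by (simp add: power_mult_distrib power_even_eq)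
     finally show ?thesis
      using x y real by (intro abs_le_square_iff[THEN iffD2, THEN order_trans, OF _ eq_refl]) (auto simp: abs_mult)
    qed
    ultimately show "\<bar>?A (T / 2 ^ Suc i * (1 + real (Suc k) / 2 ^ n)) - ?A (T / 2 ^ Suc i * (1 + real k / 2 ^ n))\<bar>
     \<le> sqrt r * x ^ i * y ^ n" by (simp only: p_def)
   qed
   then have "(?A t)^2 \<le> (sqrt r / ((1 - x) * (1 - y)))^2" by (metis power2_abs power_mono abs_ge_zero)
   also have "... = c * r" using real by (simp add: c_def power_divide)
   finally show ?thesis using real c by (simp add: ennreal_mult'[symmetric] ennreal_leI)
  qed
  show "AE w in M. set_integrable lborel {0..T} (\<lambda>s. F s w) \<and>
   (\<forall>t\<in>{0..T}. ennreal ((LINT s:{0..t}|lborel. F s w)^2) \<le> ennreal c * S w)"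
   using int by (rule eventually_mono) (simp add: bnd)
 qed measurable
qed

end

section \<open>Fractional Brownian motion\<close>

lemma powr_le_tangent:
 fixes a u :: real
 assumes "0 \<le> a" "a \<le> 1" "0 \<le> u"
 shows "u powr a \<le> 1 + a * (u - 1)"
proof (cases "u = 0")
 case False
 then have u: "0 < u" using assms by simp
 have "exp ((1 - a) *\<^sub>R 0 + a *\<^sub>R ln u) \<le> (1 - a) * exp 0 + a * exp (ln u)"
  using assms by (intro convex_onD[OF exp_convex]) auto
 then show ?thesis using u by (simp add: powr_def algebra_simps)
qed (use assms in simp)

lemma le_powr_self:
 fixes a u :: real
 assumes "0 \<le> a" "a \<le> 1" "0 \<le> u" "u \<le> 1"
 shows "u \<le> u powr a"
proof (cases "u = 0")
 case False
 then show ?thesis using powr_mono'[of a 1 u] assms by simp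
qed simp

lemma powr_add_le:
 fixes a x y :: real
 assumes a: "0 \<le> a" "a \<le> 1" and xy: "0 \<le> x" "0 \<le> y"
 shows "(x + y) powr a \<le> x powr a + y powr a"
proof (cases "x + y = 0")
 case False
 then have p: "0 < x + y" using xy by simp
 have "1 = x / (x + y) + y / (x + y)" using p by (simp add: add_divide_distrib[symmetric])
 also have "... \<le> (x / (x + y)) powr a + (y / (x + y)) powr a" using xy p a by (intro add_mono le_powr_self) auto
 also have "... = (x powr a + y powr a) / (x + y) powr a" using xy p by (simp add: powr_divide add_divide_distrib)
 finally show ?thesis using p by (simp add: pos_le_divide_eq)
qed simp

lemma abs_powr_diff_le:
 fixes a x y :: real
 assumes a: "0 \<le> a" "a \<le> 1" and xy: "0 \<le> x" "0 \<le> y"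
 shows "\<bar>x powr a - y powr a\<bar> \<le> \<bar>x - y\<bar> powr a"
proof -
 have *: "\<bar>x powr a - y powr a\<bar> \<le> \<bar>x - y\<bar> powr a" if "0 \<le> y" "y \<le> x" for x y
  using powr_add_le[OF a, of y "x - y"] powr_mono2[of a y x] a that by simp
 show ?thesis using *[of y x] *[of x y] xy by (cases "y \<le> x") (simp_all add: abs_minus_commute)
qed

text \<open>For \<open>\<epsilon> \<le> d\<close>, scaling reduces to
  \<open>x = \<epsilon> / d\<close>: the tangent bound gives the upper estimate 2, the
  arithmetic-geometric mean inequality the lower estimate \<open>2 - 2 * x^2\<close>, and
  \<open>x^2 \<le> x powr (2 * a)\<close>. Otherwise the bound \<open>\<epsilon> powr a\<close>
  suffices. The exponents, weaker than the true order for small \<open>x\<close>, are chosen to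
  match the factor \<open>(q - p) powr (- a)\<close> of \<open>fbm_determinant\<close>.\<close>

lemma second_difference_powr:
 fixes a d \<epsilon> :: real
 assumes a: "0 < a" "a < 1" and d: "0 < d" and e: "0 < \<epsilon>"
 shows "\<bar>(d + \<epsilon>) powr a + \<bar>d - \<epsilon>\<bar> powr a - 2 * d powr a\<bar> / 2 \<le> \<epsilon> powr (2 * a) * d powr (- a)"
proof (cases "\<epsilon> \<le> d")
 case True
 define x where "x = \<epsilon> / d"
 have x: "0 < x" "x \<le> 1" "\<epsilon> = d * x" using True d e by (auto simp: x_def)
 have w: "0 \<le> 1 - x^2" "1 - x^2 \<le> 1" using x by (auto simp: power_le_one)
 have up: "(1 + x) powr a + (1 - x) powr a \<le> 2"
  using powr_le_tangent[of a "1 + x"] powr_le_tangent[of a "1 - x"] a x by simp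
 have "1 - x^2 \<le> sqrt ((1 - x^2) powr a)"
 proof (rule real_le_rsqrt)
  have "(1 - x^2)^2 \<le> 1 - x^2" using w by (simp add: power2_eq_square mult_left_le)
  also have "... \<le> (1 - x^2) powr a" using w a by (intro le_powr_self) auto
  finally show "(1 - x^2)^2 \<le> (1 - x^2) powr a" .
 qed
 also have "(1 - x^2) powr a = (1 + x) powr a * (1 - x) powr a"
  using x by (subst powr_mult[symmetric]) (auto simp: power2_eq_square algebra_simps)
 also have "sqrt ... \<le> ((1 + x) powr a + (1 - x) powr a) / 2" by (rule arith_geo_mean_sqrt) auto
 finally have lo: "2 - 2 * x^2 \<le> (1 + x) powr a + (1 - x) powr a" by simp
 have "x^2 = x powr 2" using x by (simp add: powr_numeral)
 also have "... \<le> x powr (2 * a)" using x a by (intro powr_mono') auto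
 finally have "\<bar>(1 + x) powr a + (1 - x) powr a - 2\<bar> \<le> 2 * x powr (2 * a)" using up lo by simp
 then have "d powr a * \<bar>(1 + x) powr a + (1 - x) powr a - 2\<bar> \<le> d powr a * (2 * x powr (2 * a))"
  by (rule mult_left_mono) simp
 also have "d powr a * \<bar>(1 + x) powr a + (1 - x) powr a - 2\<bar> = \<bar>(d + \<epsilon>) powr a + \<bar>d - \<epsilon>\<bar> powr a - 2 * d powr a\<bar>"
 proof -
  have "(d + \<epsilon>) powr a = d powr a * (1 + x) powr a" "\<bar>d - \<epsilon>\<bar> powr a = d powr a * (1 - x) powr a"
   using d x True by (simp_all add: powr_mult[symmetric] algebra_simps)
  then show ?thesis by (simp add: abs_mult[of "d powr a", simplified, symmetric] algebra_simps)
 qed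
 finally have 1: "\<bar>(d + \<epsilon>) powr a + \<bar>d - \<epsilon>\<bar> powr a - 2 * d powr a\<bar> \<le> d powr a * (2 * x powr (2 * a))" .
 have "d powr a * x powr (2 * a) = d powr (- a) * (d powr (2 * a) * x powr (2 * a))"
  by (simp add: powr_add[symmetric] mult.assoc[symmetric])
 also have "... = \<epsilon> powr (2 * a) * d powr (- a)" using x d by (simp add: powr_mult)
 finally show ?thesis using 1 by simp
next
 case False
 then have ed: "d < \<epsilon>" by simp
 have "(d + \<epsilon>) powr a \<le> d powr a + \<epsilon> powr a" using powr_add_le[of a d \<epsilon>] a d e by simp
 moreover have "d powr a \<le> (d + \<epsilon>) powr a" using a d e by (intro powr_mono2) auto
 moreover have "\<bar>d - \<epsilon>\<bar> powr a \<le> \<epsilon> powr a" using a d ed by (intro powr_mono2) auto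
 moreover have de: "d powr a \<le> \<epsilon> powr a" using a d ed by (intro powr_mono2) auto
 moreover have "0 \<le> \<bar>d - \<epsilon>\<bar> powr a" "0 \<le> d powr a" by simp_all
 moreover have "\<bar>p + q - 2 * x\<bar> / 2 \<le> y" if "p \<le> x + y" "x \<le> p" "q \<le> y" "x \<le> y" "0 \<le> q" "0 \<le> x"
  for p q x y :: real using that by (simp add: abs_le_iff)
 ultimately have "\<bar>(d + \<epsilon>) powr a + \<bar>d - \<epsilon>\<bar> powr a - 2 * d powr a\<bar> / 2 \<le> \<epsilon> powr a" by blast
 also have "... = \<epsilon> powr a * (d powr a * d powr (- a))" using d by (simp add: powr_add[symmetric])
 also have "... \<le> \<epsilon> powr a * (\<epsilon> powr a * d powr (- a))" by (intro mult_left_mono mult_right_mono de) auto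
 also have "... = \<epsilon> powr (2 * a) * d powr (- a)" by (simp add: powr_add[symmetric])
 finally show ?thesis .
qed

text \<open>With \<open>s1\<close>, \<open>s2\<close>, \<open>d\<close> the powers of
  \<open>p\<close>, \<open>q\<close>, \<open>q - p\<close>, four times the determinant is
  \<open>2 * d * (s1 + s2) - d^2 - (s2 - s1)^2\<close>; as
  \<open>s2 - s1 \<le> d \<le> s1 \<le> s2\<close>, this is at least \<open>3 * d * s1\<close>. The
  hypothesis \<open>q \<le> 2 * p\<close> gives \<open>s2 \<le> 2 * s1\<close>, whence
  \<open>8 / 3\<close>.\<close>

lemma fbm_determinant:
 fixes p q a :: real
 assumes a: "0 < a" "a < 1" and pq: "0 < p" "p < q" "q \<le> 2 * p"
 defines "c \<equiv> (p powr a + q powr a - (q - p) powr a) / 2"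
 shows "0 \<le> c" "c \<le> p powr a" "c \<le> q powr a"
  and "0 < p powr a * q powr a - c^2"
  and "p powr a / (p powr a * q powr a - c^2) \<le> 8 / 3 * (q - p) powr (- a)"
  and "q powr a / (p powr a * q powr a - c^2) \<le> 8 / 3 * (q - p) powr (- a)"
proof -
 define s1 where "s1 = p powr a"
 define s2 where "s2 = q powr a"
 define d where "d = (q - p) powr a"
 have s1: "0 < s1" and d: "0 < d" using pq by (simp_all add: s1_def d_def)
 have ds1: "d \<le> s1" unfolding d_def s1_def using a pq by (intro powr_mono2) auto
 have s12: "s1 \<le> s2" unfolding s1_def s2_def using a pq by (intro powr_mono2) auto
 have s21: "s2 - s1 \<le> d" using abs_powr_diff_le[of a q p] a pq by (simp add: s1_def s2_def d_def)
 have s2le: "s2 \<le> 2 * s1"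
 proof -
  have "s2 \<le> (2 * p) powr a" unfolding s2_def using a pq by (intro powr_mono2) auto
  also have "... = 2 powr a * s1" using pq by (simp add: powr_mult s1_def)
  also have "... \<le> 2 powr 1 * s1" using a s1 by (intro mult_right_mono powr_mono) auto
  finally show ?thesis by simp
 qed
 show "0 \<le> c" "c \<le> p powr a" "c \<le> q powr a"
  unfolding c_def s1_def[symmetric] s2_def[symmetric] d_def[symmetric] using s12 s21 ds1 s1 by auto
 have "4 * (s1 * s2 - ((s1 + s2 - d) / 2)^2) = 2 * d * (s1 + s2) - d * d - (s2 - s1) * (s2 - s1)"
  by (simp add: power2_eq_square field_simps)
 moreover have "d * d \<le> d * s1" using ds1 d by simp
 moreover have "(s2 - s1) * (s2 - s1) \<le> d * (s2 - s1)" using s21 s12 by (intro mult_right_mono) auto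
 moreover have "d * s1 \<le> d * s2" using s12 d by simp
 ultimately have r: "3 / 4 * (d * s1) \<le> s1 * s2 - ((s1 + s2 - d) / 2)^2" by (simp add: algebra_simps)
 have r0: "0 < 3 / 4 * (d * s1)" using d s1 by simp
 show "0 < p powr a * q powr a - c^2"
  unfolding c_def s1_def[symmetric] s2_def[symmetric] d_def[symmetric] using r r0 by linarith
 have "x / (s1 * s2 - ((s1 + s2 - d) / 2)^2) \<le> 8 / 3 * (1 / d)" if "0 \<le> x" "x \<le> 2 * s1" for x
 proof -
  have "x / (s1 * s2 - ((s1 + s2 - d) / 2)^2) \<le> (2 * s1) / (3 / 4 * (d * s1))" using that r r0 by (intro frac_le) auto
  then show ?thesis using s1 d by (simp add: field_simps)
 qed
 moreover have "(q - p) powr (- a) = 1 / d" using pq by (simp add: d_def powr_minus_divide)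
 ultimately show "p powr a / (p powr a * q powr a - c^2) \<le> 8 / 3 * (q - p) powr (- a)"
  "q powr a / (p powr a * q powr a - c^2) \<le> 8 / 3 * (q - p) powr (- a)"
  unfolding c_def s1_def[symmetric] s2_def[symmetric] d_def[symmetric] using s1 s12 s2le by auto
qed

text \<open>Every path is continuous on the whole line and every \<open>B t\<close> is measurable,
  so joint measurability and pathwise arguments are free of exceptional sets;
  \<open>fbm_regular_version\<close> reduces the general case to this one.\<close>

locale fbm = prob_space M for M :: "'a measure" +
 fixes H :: real and B :: "real \<Rightarrow> 'a \<Rightarrow> real"
 assumes H: "0 < H" "H < 1/2"
  and gaussian_sum: "finite J \<Longrightarrow> J \<subseteq> {0..} \<Longrightarrow> gaussian_rv M (\<lambda>w. \<Sum>t\<in>J. c t * B t w)"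
  and mean0: "0 \<le> t \<Longrightarrow> expectation (B t) = 0"
  and covariance: "0 \<le> t \<Longrightarrow> 0 \<le> s \<Longrightarrow> expectation (\<lambda>w. B t w * B s w) =
    1/2 * (t powr (2*H) + s powr (2*H) - \<bar>t - s\<bar> powr (2*H))"
  and paths: "continuous_on UNIV (\<lambda>t. B t w)"
  and B_measurable [measurable]: "B t \<in> borel_measurable M"
begin

definition \<G> :: "('a \<Rightarrow> real) set" where
 "\<G> = {\<lambda>w. \<Sum>t\<in>J. c t * B t w |J c. finite J \<and> J \<subseteq> {0..}}"

lemma B_in_\<G>: "0 \<le> t \<Longrightarrow> B t \<in> \<G>"
 unfolding \<G>_def by (auto intro!: exI[of _ "{t}"] exI[of _ "\<lambda>_. 1"])

lemma gaussian_rv_integrable: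
 assumes "gaussian_rv M X"
 shows "integrable M X"
proof -
 from assms have [measurable]: "X \<in> borel_measurable M" by (simp add: gaussian_rv_def)
 from assms consider m where "AE w in M. X w = m"
  | m \<sigma> where "0 < \<sigma>" "distributed M lborel X (\<lambda>x. ennreal (normal_density m \<sigma> x))" by (auto simp: gaussian_rv_def)
 then show ?thesis
 proof cases
  case 1
  then have "integrable M X \<longleftrightarrow> integrable M (\<lambda>_. m)" by (intro integrable_cong_AE) auto
  then show ?thesis by simp
 next
  case 2
  then show ?thesis
   using distributed_integrable[OF 2(2), of "\<lambda>x. x"] integrable_normal_moment_nz_1[OF 2(1), of m] by simp
 qed
qed

sublocale gaussian_space M \<G>
proof
 fix X Y c d assume "X \<in> \<G>" "Y \<in> \<G>"
 then obtain J1 c1 J2 c2 where J: "finite J1" "J1 \<subseteq> {0..}" "finite J2" "J2 \<subseteq> {0..}"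
  and X: "X = (\<lambda>w. \<Sum>t\<in>J1. c1 t * B t w)" and Y: "Y = (\<lambda>w. \<Sum>t\<in>J2. c2 t * B t w)"
  unfolding \<G>_def by auto
 have "(\<Sum>t\<in>J1. c1 t * B t w) = (\<Sum>t\<in>J1 \<union> J2. (if t \<in> J1 then c1 t else 0) * B t w)"
  "(\<Sum>t\<in>J2. c2 t * B t w) = (\<Sum>t\<in>J1 \<union> J2. (if t \<in> J2 then c2 t else 0) * B t w)" for w
  using J by (auto intro!: sum.mono_neutral_cong_left)
 then have "(\<lambda>w. c * X w + d * Y w)
   = (\<lambda>w. \<Sum>t\<in>J1 \<union> J2. (c * (if t \<in> J1 then c1 t else 0) + d * (if t \<in> J2 then c2 t else 0)) * B t w)"
  unfolding X Y by (simp add: sum_distrib_left sum.distrib[symmetric] algebra_simps)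
 then show "(\<lambda>w. c * X w + d * Y w) \<in> \<G>" unfolding \<G>_def using J by (auto intro!: exI[of _ "J1 \<union> J2"])
next
 fix X assume "X \<in> \<G>"
 then obtain J c where J: "finite J" "J \<subseteq> {0..}" and X: "X = (\<lambda>w. \<Sum>t\<in>J. c t * B t w)" unfolding \<G>_def by auto
 show "gaussian_rv M X" unfolding X by (rule gaussian_sum[OF J])
 have "integrable M (B t)" if "t \<in> J" for t
  using gaussian_rv_integrable[OF gaussian_sum[of "{t}" "\<lambda>_. 1"]] that J by auto
 then show "expectation X = 0" unfolding X using J mean0 by (simp add: subset_iff)
qed

definition D :: "real \<Rightarrow> real \<Rightarrow> 'a \<Rightarrow> real" where
 "D \<epsilon> s = (\<lambda>w. 1 * B (s + \<epsilon>) w + (-1) * B s w)"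

lemma D_eq: "D \<epsilon> s w = B (s + \<epsilon>) w - B s w"
 by (simp add: D_def)

lemma D_measurable [measurable]: "D \<epsilon> s \<in> borel_measurable M"
 unfolding D_def by measurable

lemma D_in_\<G>: "0 \<le> s \<Longrightarrow> 0 \<le> \<epsilon> \<Longrightarrow> D \<epsilon> s \<in> \<G>"
 unfolding D_def by (intro lin B_in_\<G>) auto

lemma variance_B: "0 \<le> t \<Longrightarrow> cov (B t) (B t) = t powr (2*H)"
 by (simp add: covariance)

lemma variance_D:
 assumes "0 \<le> s" "0 < \<epsilon>"
 shows "cov (D \<epsilon> s) (D \<epsilon> s) = \<epsilon> powr (2*H)"
proof -
 have B: "B (s + \<epsilon>) \<in> \<G>" "B s \<in> \<G>" using assms by (auto intro: B_in_\<G>)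
 show ?thesis
  unfolding cov_comb[OF D_def B D_in_\<G>[OF assms(1) less_imp_le[OF assms(2)]]] cov_comb[OF D_def B B(1)] cov_comb[OF D_def B B(2)]
  using assms by (simp add: covariance) (simp add: field_simps)
qed

text \<open>Since \<open>2 * H \<le> 1\<close>, the function \<open>u powr (2*H)\<close> changes by
  at most \<open>\<epsilon> powr (2*H)\<close> over a step of length \<open>\<epsilon>\<close>. The
  square of this bound cancels the normalisation \<open>\<epsilon> powr (4*H)\<close> of a product
  of two integrands.\<close>

lemma cov_D_B:
 assumes "0 \<le> s" "0 < \<epsilon>" "0 \<le> p"
 shows "\<bar>cov (D \<epsilon> s) (B p)\<bar> \<le> \<epsilon> powr (2*H)"
proof -
 have B: "B (s + \<epsilon>) \<in> \<G>" "B s \<in> \<G>" "B p \<in> \<G>" using assms by (auto intro: B_in_\<G>)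
 have "cov (D \<epsilon> s) (B p) = (((s + \<epsilon>) powr (2*H) - s powr (2*H)) - (\<bar>s + \<epsilon> - p\<bar> powr (2*H) - \<bar>s - p\<bar> powr (2*H))) / 2"
 proof -
  have c: "cov (B (s + \<epsilon>)) (B p) = 1/2 * ((s + \<epsilon>) powr (2*H) + p powr (2*H) - \<bar>s + \<epsilon> - p\<bar> powr (2*H))"
   "cov (B s) (B p) = 1/2 * (s powr (2*H) + p powr (2*H) - \<bar>s - p\<bar> powr (2*H))"
   using assms by (simp_all add: covariance)
  show ?thesis unfolding cov_comb[OF D_def B] c by (simp add: diff_divide_distrib add_divide_distrib)
 qed
 moreover have "\<bar>(s + \<epsilon>) powr (2*H) - s powr (2*H)\<bar> \<le> \<epsilon> powr (2*H)"
  using abs_powr_diff_le[of "2*H" "s + \<epsilon>" s] H assms by simp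
 moreover have "\<bar>\<bar>s + \<epsilon> - p\<bar> powr (2*H) - \<bar>s - p\<bar> powr (2*H)\<bar> \<le> \<epsilon> powr (2*H)"
 proof -
  have "\<bar>\<bar>s + \<epsilon> - p\<bar> powr (2*H) - \<bar>s - p\<bar> powr (2*H)\<bar> \<le> \<bar>\<bar>s + \<epsilon> - p\<bar> - \<bar>s - p\<bar>\<bar> powr (2*H)"
   using H by (intro abs_powr_diff_le) auto
  also have "... \<le> \<epsilon> powr (2*H)" using H assms by (intro powr_mono2) auto
  finally show ?thesis .
 qed
 moreover have "\<bar>(x - y) / 2\<bar> \<le> z" if "\<bar>x\<bar> \<le> z" "\<bar>y\<bar> \<le> z" for x y z :: real using that by (simp add: abs_le_iff)
 ultimately show ?thesis by presburger
qed

lemma cov_D_D: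
 assumes "0 \<le> s" "0 < \<epsilon>" "s < r"
 shows "\<bar>cov (D \<epsilon> s) (D \<epsilon> r)\<bar> \<le> \<epsilon> powr (4*H) * (r - s) powr (-2*H)"
proof -
 have B: "B (s + \<epsilon>) \<in> \<G>" "B s \<in> \<G>" "B (r + \<epsilon>) \<in> \<G>" "B r \<in> \<G>" using assms by (auto intro: B_in_\<G>)
 have Dr: "D \<epsilon> r \<in> \<G>" using assms by (intro D_in_\<G>) auto
 have e: "\<bar>s - r\<bar> = r - s" "\<bar>s - (r + \<epsilon>)\<bar> = (r - s) + \<epsilon>" "\<bar>s + \<epsilon> - r\<bar> = \<bar>(r - s) - \<epsilon>\<bar>" "\<bar>s + \<epsilon> - (r + \<epsilon>)\<bar> = r - s"
  using assms by auto
 have "cov (D \<epsilon> s) (D \<epsilon> r) = (((r - s) + \<epsilon>) powr (2*H) + \<bar>(r - s) - \<epsilon>\<bar> powr (2*H) - 2 * (r - s) powr (2*H)) / 2"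
  unfolding cov_comb(1)[OF D_def B(1,2) Dr] cov_comb(2)[OF D_def B(3,4,1)] cov_comb(2)[OF D_def B(3,4,2)]
  using assms by (simp add: covariance e diff_divide_distrib add_divide_distrib)
 then show ?thesis using second_difference_powr[of "2*H" "r - s" \<epsilon>] H assms by (simp add: mult.assoc[symmetric])
qed

definition \<Phi> :: "(real \<Rightarrow> real) \<Rightarrow> real \<Rightarrow> real" where
 "\<Phi> h p = expectation (\<lambda>w. (h (B p w))^2)"

definition \<Psi> :: "(real \<Rightarrow> real) \<Rightarrow> real \<Rightarrow> real" where
 "\<Psi> h p = weighted_square h (B p)"

text \<open>This is \<open>kernel_bound\<close> with the determinant estimate inserted:
  \<open>33 = 12 * 8 / 3 + 1\<close>, the last 1 from \<open>cov_D_D\<close>. The common shift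
  \<open>\<delta>\<close> keeps \<open>r + \<delta> \<le> 2 * (s + \<delta>)\<close>.\<close>

theorem increment_kernel_bound:
 assumes h: "admissible h (B (s + \<delta>))" "admissible h (B (r + \<delta>))"
  and s: "0 < s" "s < r" "r \<le> 2 * s" and e: "0 < \<epsilon>" "0 \<le> \<delta>" and l: "0 < l"
 shows "\<bar>expectation (\<lambda>w. h (B (s + \<delta>) w) * h (B (r + \<delta>) w) * (D \<epsilon> s w * D \<epsilon> r w))\<bar>
  \<le> \<epsilon> powr (4*H) * (l / 2 * (2 * (s + \<delta>) powr (-2*H) * \<Psi> h (s + \<delta>) + 33 * (r - s) powr (-2*H) * \<Phi> h (s + \<delta>))
   + 1 / (2 * l) * (2 * (r + \<delta>) powr (-2*H) * \<Psi> h (r + \<delta>) + 33 * (r - s) powr (-2*H) * \<Phi> h (r + \<delta>)))"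
proof -
 let ?p = "s + \<delta>" and ?q = "r + \<delta>" and ?X = "B (s + \<delta>)" and ?Y = "B (r + \<delta>)"
 have pq: "0 < ?p" "?p < ?q" "?q \<le> 2 * ?p" using s e by auto
 have vX: "cov ?X ?X = ?p powr (2*H)" and vY: "cov ?Y ?Y = ?q powr (2*H)" using s e by (simp_all add: variance_B)
 have c: "cov ?X ?Y = (?p powr (2*H) + ?q powr (2*H) - (?q - ?p) powr (2*H)) / 2" using s e by (simp add: covariance)
 note det = fbm_determinant[OF _ _ pq, of "2*H", folded c vX vY]
 have H2: "0 < 2 * H" "2 * H < 1" using H by auto
 define m where "m = \<epsilon> powr (2*H)"
 define E where "E = \<epsilon> powr (4*H) * (r - s) powr (-2*H)"
 have m2: "m^2 = \<epsilon> powr (4*H)" unfolding m_def using e by (simp add: power2_eq_square powr_add[symmetric])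
 have K: "\<bar>expectation (\<lambda>w. h (?X w) * h (?Y w) * (D \<epsilon> s w * D \<epsilon> r w))\<bar>
  \<le> l / 2 * (2 * m^2 / cov ?X ?X * weighted_square h ?X
    + (12 * m^2 * cov ?X ?X / (cov ?X ?X * cov ?Y ?Y - (cov ?X ?Y)^2) + E) * expectation (\<lambda>w. (h (?X w))^2))
   + 1 / (2 * l) * (2 * m^2 / cov ?Y ?Y * weighted_square h ?Y
    + (12 * m^2 * cov ?Y ?Y / (cov ?X ?X * cov ?Y ?Y - (cov ?X ?Y)^2) + E) * expectation (\<lambda>w. (h (?Y w))^2))"
  using s e l det[OF H2] unfolding m_def E_def by (intro kernel_bound h D_in_\<G> cov_D_B cov_D_D) auto
 have fin: "2 * m^2 / v * y + (12 * m^2 * v / R + E) * x \<le> \<epsilon> powr (4*H) * (2 * pw * y + 33 * (r - s) powr (-2*H) * x)"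
  if "v / R \<le> 8 / 3 * (?q - ?p) powr (- (2*H))" "pw = 1 / v" "0 \<le> x" for v R y x pw
 proof -
  have "12 * m^2 * v / R + E \<le> \<epsilon> powr (4*H) * (33 * (r - s) powr (-2*H))"
   using mult_left_mono[OF that(1), of "12 * \<epsilon> powr (4*H)"] by (simp add: m2 E_def)
  then have "(12 * m^2 * v / R + E) * x \<le> \<epsilon> powr (4*H) * (33 * (r - s) powr (-2*H)) * x"
   using that(3) by (rule mult_right_mono)
  then show ?thesis using that(2) m2 by (simp add: algebra_simps)
 qed
 have pw: "?p powr (-2*H) = 1 / cov ?X ?X" "?q powr (-2*H) = 1 / cov ?Y ?Y"
  unfolding vX vY using pq by (simp_all add: powr_minus_divide)
 have nn: "0 \<le> expectation (\<lambda>w. (h (?X w))^2)" "0 \<le> expectation (\<lambda>w. (h (?Y w))^2)"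
  by (auto intro!: integral_nonneg_AE)
 have "l / 2 * (2 * m^2 / cov ?X ?X * weighted_square h ?X
    + (12 * m^2 * cov ?X ?X / (cov ?X ?X * cov ?Y ?Y - (cov ?X ?Y)^2) + E) * expectation (\<lambda>w. (h (?X w))^2))
   + 1 / (2 * l) * (2 * m^2 / cov ?Y ?Y * weighted_square h ?Y
    + (12 * m^2 * cov ?Y ?Y / (cov ?X ?X * cov ?Y ?Y - (cov ?X ?Y)^2) + E) * expectation (\<lambda>w. (h (?Y w))^2))
  \<le> l / 2 * (\<epsilon> powr (4*H) * (2 * ?p powr (-2*H) * \<Psi> h ?p + 33 * (r - s) powr (-2*H) * \<Phi> h ?p))
   + 1 / (2 * l) * (\<epsilon> powr (4*H) * (2 * ?q powr (-2*H) * \<Psi> h ?q + 33 * (r - s) powr (-2*H) * \<Phi> h ?q))"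
  unfolding \<Psi>_def \<Phi>_def using l
  by (intro add_mono[OF mult_left_mono[OF fin] mult_left_mono[OF fin]] det(5,6)[OF H2] pw nn) auto
 also have "... = \<epsilon> powr (4*H) * (l / 2 * (2 * ?p powr (-2*H) * \<Psi> h ?p + 33 * (r - s) powr (-2*H) * \<Phi> h ?p)
   + 1 / (2 * l) * (2 * ?q powr (-2*H) * \<Psi> h ?q + 33 * (r - s) powr (-2*H) * \<Phi> h ?q))"
  unfolding distrib_left[of "\<epsilon> powr (4*H)"] mult.left_commute[of "\<epsilon> powr (4*H)" "l / 2"]
   mult.left_commute[of "\<epsilon> powr (4*H)" "1 / (2 * l)"] ..
 finally show ?thesis using K by (rule order_trans[rotated])
qed

text \<open>Rounding time down to dyadic points gives jointly measurable functions, which converge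
  by path continuity.\<close>

lemma B_jointly_measurable: "(\<lambda>(s, w). B s w) \<in> borel_measurable (lborel \<Otimes>\<^sub>M M)"
proof -
 define f where "f n z = B (of_int \<lfloor>2 ^ n * fst z\<rfloor> / 2 ^ n) (snd z)" for n :: nat and z :: "real \<times> 'a"
 have fm: "f n \<in> borel_measurable (lborel \<Otimes>\<^sub>M M)" for n
 proof -
  have "(\<lambda>z. (\<lambda>i z. B (of_int i / 2 ^ n) (snd z)) \<lfloor>(2::real) ^ n * fst z\<rfloor> z) \<in> borel_measurable (lborel \<Otimes>\<^sub>M M)"
   by (rule measurable_compose_countable) measurable
  then show ?thesis unfolding f_def[abs_def] .
 qed
 show ?thesis
 proof (rule borel_measurable_LIMSEQ_real[OF _ fm])
  fix z :: "real \<times> 'a"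
  have "(\<lambda>n. of_int \<lfloor>2 ^ n * fst z\<rfloor> / 2 ^ n - fst z) \<longlonglongrightarrow> 0"
  proof (rule Lim_null_comparison)
   show "eventually (\<lambda>n. norm (of_int \<lfloor>2 ^ n * fst z\<rfloor> / 2 ^ n - fst z) \<le> (1/2::real) ^ n) sequentially"
   proof (rule always_eventually, rule allI)
    fix n :: nat
    have "of_int \<lfloor>2 ^ n * fst z\<rfloor> / 2 ^ n - fst z = (of_int \<lfloor>2 ^ n * fst z\<rfloor> - 2 ^ n * fst z) / 2 ^ n"
     by (simp add: diff_divide_distrib)
    moreover have "\<bar>of_int \<lfloor>2 ^ n * fst z\<rfloor> - 2 ^ n * fst z\<bar> \<le> 1" by linarith
    ultimately show "norm (of_int \<lfloor>2 ^ n * fst z\<rfloor> / 2 ^ n - fst z) \<le> (1/2::real) ^ n"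
     by (simp add: power_one_over divide_right_mono)
   qed
   show "(\<lambda>n. (1/2::real) ^ n) \<longlonglongrightarrow> 0" by (rule LIMSEQ_power_zero) simp
  qed
  then have "(\<lambda>n. of_int \<lfloor>2 ^ n * fst z\<rfloor> / 2 ^ n) \<longlonglongrightarrow> fst z" by (rule LIM_zero_cancel)
  then have "(\<lambda>n. B (of_int \<lfloor>2 ^ n * fst z\<rfloor> / 2 ^ n) (snd z)) \<longlonglongrightarrow> B (fst z) (snd z)"
   by (rule continuous_on_tendsto_compose[OF paths]) auto
  then show "(\<lambda>n. f n z) \<longlonglongrightarrow> (case z of (s, w) \<Rightarrow> B s w)" by (simp add: f_def split_beta)
 qed
qed

end

section \<open>Approximations of the covariation\<close>

context fbm
begin

lemma mult_exp_neg_le: "z * exp (- z / 2) \<le> 2" for z :: real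
proof -
 have "z / 2 \<le> exp (z / 2)" using exp_ge_add_one_self[of "z / 2"] by linarith
 then have "z / 2 * exp (- z / 2) \<le> exp (z / 2) * exp (- z / 2)" by (rule mult_right_mono) simp
 then show ?thesis by (simp add: exp_add[symmetric])
qed

lemma distributed_B:
 assumes "0 < p"
 shows "distributed M lborel (B p) (\<lambda>x. ennreal (normal_density 0 (p powr H) x))"
proof -
 have v: "cov (B p) (B p) = p powr (2*H)" using assms by (simp add: variance_B)
 have "sqrt (p powr (2*H)) = p powr H" using powr_half_sqrt[of "p powr (2*H)"] by (simp add: powr_powr)
 then show ?thesis using assms by (cases rule: gaussian_cases[OF B_in_\<G>[of p]]) (simp_all add: v)
qed

text \<open>Of the Gaussian exponent \<open>y / 2\<close>, with \<open>y = x^2 / v\<close>, a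
  portion \<open>\<kappa> * y / 2\<close> absorbs the factor \<open>1 + y\<close> at cost
  \<open>3 / \<kappa>\<close>; the rest is compared with the weight \<open>\<rho>\<close>. It is
  used with \<open>\<rho> = 1\<close>, \<open>\<kappa> = 1\<close> for Lebesgue square integrals,
  and with the Gaussian weight of a later time in \<open>weighted_square_gap\<close>.\<close>

lemma weighted_square_le:
 assumes p: "0 < p" and \<kappa>: "0 < \<kappa>" "\<kappa> \<le> 1" and [measurable]: "h \<in> borel_measurable borel" "\<rho> \<in> borel_measurable borel"
  and \<rho>: "\<And>x. 0 \<le> \<rho> x"
   "\<And>x. exp (- (x^2 / (2 * p powr (2*H)))) \<le> \<rho> x * exp (- (\<kappa> * x^2 / (2 * p powr (2*H))))"
  and N: "(\<integral>\<^sup>+x. ennreal ((h x)^2 * \<rho> x) \<partial>lborel) \<le> ennreal N" "0 \<le> N"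
 shows "admissible h (B p)" and "\<Psi> h p \<le> 3 / \<kappa> * p powr (-H) * N"
proof -
 define v where "v = p powr (2*H)"
 have v: "0 < v" using p by (simp add: v_def)
 have sv: "sqrt v = p powr H" unfolding v_def using powr_half_sqrt[of "p powr (2*H)"] by (simp add: powr_powr)
 have pt: "normal_density 0 (p powr H) x * ((h x)^2 * (1 + x^2 / v)) \<le> 3 / \<kappa> * p powr (-H) * ((h x)^2 * \<rho> x)" for x
 proof -
  define y where "y = x^2 / v"
  have y: "0 \<le> y" using v by (simp add: y_def)
  have "normal_density 0 (p powr H) x = 1 / sqrt (2 * pi * v) * exp (- (x^2 / (2 * v)))"
   unfolding normal_density_def by (simp add: sv[symmetric] v less_imp_le)
  also have "... \<le> 1 / sqrt v * exp (- (x^2 / (2 * v)))"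
  proof (intro mult_right_mono divide_left_mono)
   have "1 * v \<le> 2 * pi * v" using v pi_gt3 by (intro mult_right_mono) auto
   then show "sqrt v \<le> sqrt (2 * pi * v)" by simp
  qed (use v in \<open>auto intro!: mult_pos_pos\<close>)
  also have "1 / sqrt v = p powr (-H)" by (simp add: sv powr_minus_divide)
  also have "p powr (-H) * exp (- (x^2 / (2 * v))) \<le> p powr (-H) * (\<rho> x * exp (- (\<kappa> * y) / 2))"
   using \<rho>(2)[of x] by (intro mult_left_mono) (simp_all add: v_def y_def mult.commute)
  finally have nd: "normal_density 0 (p powr H) x \<le> p powr (-H) * (\<rho> x * exp (- (\<kappa> * y) / 2))" .
  have "\<kappa> * (exp (- (\<kappa> * y) / 2) * (1 + y)) = \<kappa> * exp (- (\<kappa> * y) / 2) + (\<kappa> * y) * exp (- (\<kappa> * y) / 2)"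
   by (simp add: algebra_simps)
  also have "... \<le> 1 * 1 + 2" using \<kappa> y by (intro add_mono mult_mono mult_exp_neg_le) auto
  finally have "exp (- (\<kappa> * y) / 2) * (1 + y) \<le> 3 / \<kappa>" using \<kappa> by (simp add: field_simps)
  then have "p powr (-H) * \<rho> x * (h x)^2 * (exp (- (\<kappa> * y) / 2) * (1 + y)) \<le> p powr (-H) * \<rho> x * (h x)^2 * (3 / \<kappa>)"
   using \<rho>(1)[of x] by (intro mult_left_mono) auto
  moreover have "normal_density 0 (p powr H) x * ((h x)^2 * (1 + y)) \<le> p powr (-H) * (\<rho> x * exp (- (\<kappa> * y) / 2)) * ((h x)^2 * (1 + y))"
   using nd y by (intro mult_right_mono) auto
  ultimately show ?thesis by (simp add: y_def[symmetric] ac_simps)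
 qed
 define c where "c = 3 / \<kappa> * p powr (-H)"
 have c: "0 \<le> c" using \<kappa> by (simp add: c_def)
 define u where "u x = (h x)^2 * (1 + x^2 / v)" for x
 have w0: "0 \<le> u x" for x using v by (simp add: u_def)
 have [measurable]: "u \<in> borel_measurable borel" unfolding u_def by measurable
 have "(\<integral>\<^sup>+w. ennreal (u (B p w)) \<partial>M) = (\<integral>\<^sup>+x. ennreal (normal_density 0 (p powr H) x) * ennreal (u x) \<partial>lborel)"
  by (rule distributed_nn_integral[OF distributed_B[OF p], symmetric]) measurable
 also have "... \<le> (\<integral>\<^sup>+x. ennreal c * ennreal ((h x)^2 * \<rho> x) \<partial>lborel)"
  using pt c \<rho>(1) w0 by (intro nn_integral_mono) (simp add: ennreal_mult[symmetric] c_def u_def ennreal_leI)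
 also have "... = ennreal c * (\<integral>\<^sup>+x. ennreal ((h x)^2 * \<rho> x) \<partial>lborel)" by (rule nn_integral_cmult) measurable
 also have "... \<le> ennreal c * ennreal N" by (intro mult_left_mono N) simp
 also have "... = ennreal (c * N)" using c by (simp add: ennreal_mult')
 finally have bnd: "(\<integral>\<^sup>+w. ennreal (u (B p w)) \<partial>M) \<le> ennreal (c * N)" .
 then have iw: "integrable M (\<lambda>w. u (B p w))" using w0 by (intro integrableI_bounded) (auto intro: le_less_trans)
 have "integrable M (\<lambda>w. (h (B p w))^2 * (1 + (B p w)^2))"
 proof (rule Bochner_Integration.integrable_bound[OF integrable_mult_right[of "1 + v", OF iw]])
  show "AE w in M. norm ((h (B p w))^2 * (1 + (B p w)^2)) \<le> norm ((1 + v) * u (B p w))"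
  proof (rule AE_I2)
   fix w
   have "1 + b^2 \<le> (1 + v) * (1 + b^2 / v)" for b :: real
   proof -
    have "(1 + v) * (1 + b^2 / v) = 1 + v + b^2 / v + b^2" using v by (simp add: field_simps)
    moreover have "0 \<le> b^2 / v" using v by simp
    ultimately show ?thesis using v by simp
   qed
   then have "(h (B p w))^2 * (1 + (B p w)^2) \<le> (h (B p w))^2 * ((1 + v) * (1 + (B p w)^2 / v))"
    by (rule mult_left_mono) simp
   then show "norm ((h (B p w))^2 * (1 + (B p w)^2)) \<le> norm ((1 + v) * u (B p w))"
    using v w0 by (simp add: u_def abs_mult ac_simps)
  qed
 qed measurable
 then show "admissible h (B p)" unfolding admissible_def using p by (simp add: B_in_\<G> variance_B)
 have "ennreal (\<Psi> h p) = (\<integral>\<^sup>+w. ennreal (u (B p w)) \<partial>M)" unfolding \<Psi>_def weighted_square_def using p iw w0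
  by (subst nn_integral_eq_integral) (auto simp: u_def v_def variance_B)
 with bnd have "ennreal (\<Psi> h p) \<le> ennreal (c * N)" by simp
 then have "\<Psi> h p \<le> c * N" using ennreal_le_iff[of "c * N" "\<Psi> h p"] c N(2) by simp
 then show "\<Psi> h p \<le> 3 / \<kappa> * p powr (-H) * N" by (simp only: c_def)
qed

lemma \<Phi>_le_\<Psi>:
 assumes "admissible h (B p)"
 shows "0 \<le> \<Phi> h p" "\<Phi> h p \<le> \<Psi> h p" "0 \<le> \<Psi> h p"
proof -
 show *: "0 \<le> \<Phi> h p" unfolding \<Phi>_def by (auto intro!: integral_nonneg_AE)
 have "0 < cov (B p) (B p)" using assms by (simp add: admissible_def)
 then show "\<Phi> h p \<le> \<Psi> h p"
  unfolding \<Psi>_def \<Phi>_def weighted_square_eq[OF assms] by (auto intro!: divide_nonneg_pos integral_nonneg_AE)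
 with * show "0 \<le> \<Psi> h p" by linarith
qed

text \<open>Up to the factor \<open>2 * H\<close>, the integrand of \<open>qc_approx\<close> is the
  difference of the cases \<open>\<delta> = \<epsilon>\<close> and \<open>\<delta> = 0\<close>; both
  are estimated separately.\<close>

definition incr :: "(real \<Rightarrow> real) \<Rightarrow> real \<Rightarrow> real \<Rightarrow> real \<Rightarrow> 'a \<Rightarrow> real" where
 "incr h \<epsilon> \<delta> s w = s powr (2*H - 1) / \<epsilon> powr (2*H) * (h (B (s + \<delta>) w) * D \<epsilon> s w)"

lemma qc_approx_incr:
 "qc_approx H B h \<epsilon> t w = 2 * H * (LINT s:{0..t}|lborel. incr h \<epsilon> \<epsilon> s w - incr h \<epsilon> 0 s w)"
proof -
 have "(LINT s:{0..t}|lborel. incr h \<epsilon> \<epsilon> s w - incr h \<epsilon> 0 s w)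
  = (LINT s:{0..t}|lborel. 1 / \<epsilon> powr (2*H) * ((h (B (s + \<epsilon>) w) - h (B s w)) * (B (s + \<epsilon>) w - B s w) * s powr (2*H - 1)))"
  by (intro set_lebesgue_integral_cong) (auto simp: incr_def D_eq algebra_simps diff_divide_distrib)
 then show ?thesis unfolding qc_approx_def by simp
qed

lemma B_shift_measurable: "(\<lambda>(s, w). B (s + \<delta>) w) \<in> borel_measurable (lborel \<Otimes>\<^sub>M M)"
 using measurable_compose[OF _ B_jointly_measurable, of "\<lambda>z. (fst z + \<delta>, snd z)" "lborel \<Otimes>\<^sub>M M"]
 by (simp add: split_beta)

lemma incr_measurable:
 assumes [measurable]: "h \<in> borel_measurable borel"
 shows "(\<lambda>(s, w). incr h \<epsilon> \<delta> s w) \<in> borel_measurable (lborel \<Otimes>\<^sub>M M)"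
proof -
 have [measurable]: "(\<lambda>z. B (fst z + \<delta>) (snd z)) \<in> borel_measurable (lborel \<Otimes>\<^sub>M M)" for \<delta>
  using B_shift_measurable[of \<delta>] by (simp add: split_beta)
 have [measurable]: "(\<lambda>z. B (fst z) (snd z)) \<in> borel_measurable (lborel \<Otimes>\<^sub>M M)"
  using B_shift_measurable[of 0] by (simp add: split_beta)
 show ?thesis unfolding incr_def D_eq split_beta by measurable
qed

lemma expectation_incr:
 "expectation (\<lambda>w. incr h \<epsilon> \<delta> s w * incr h \<epsilon> \<delta> r w)
  = s powr (2*H - 1) * r powr (2*H - 1) / (\<epsilon> powr (2*H))^2
   * expectation (\<lambda>w. h (B (s + \<delta>) w) * h (B (r + \<delta>) w) * (D \<epsilon> s w * D \<epsilon> r w))"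
 by (subst integral_mult_right_zero[symmetric]) (simp add: incr_def power2_eq_square ac_simps)

text \<open>A crude bound that deteriorates as \<open>\<epsilon>\<close> tends to 0. It supplies the
  function \<open>\<psi>\<close> that legitimates Fubini at a fixed
  \<open>\<epsilon>\<close>.\<close>

lemma incr_second_moment:
 assumes a: "admissible h (B (s + \<delta>))" and s: "0 < s" and e: "0 < \<epsilon>" "0 \<le> \<delta>" and \<Gamma>: "\<Psi> h (s + \<delta>) \<le> \<Gamma>" "0 \<le> \<Gamma>"
 shows "(\<integral>\<^sup>+w. ennreal ((incr h \<epsilon> \<delta> s w)^2) \<partial>M) \<le> ennreal ((s powr (2*H - 1) / \<epsilon> powr H * sqrt \<Gamma>)^2)"
proof -
 have Dg: "D \<epsilon> s \<in> \<G>" using s e by (intro D_in_\<G>) auto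
 note sb = square_bound[OF a Dg]
 define k where "k = s powr (2*H - 1) / \<epsilon> powr (2*H)"
 have i: "integrable M (\<lambda>w. k^2 * ((h (B (s + \<delta>) w))^2 * (D \<epsilon> s w)^2))" using sb(1) by simp
 have "(\<integral>\<^sup>+w. ennreal ((incr h \<epsilon> \<delta> s w)^2) \<partial>M) = (\<integral>\<^sup>+w. ennreal (k^2 * ((h (B (s + \<delta>) w))^2 * (D \<epsilon> s w)^2)) \<partial>M)"
  by (simp add: incr_def k_def power_mult_distrib power_divide)
 also have "... = ennreal (k^2 * expectation (\<lambda>w. (h (B (s + \<delta>) w))^2 * (D \<epsilon> s w)^2))"
  by (subst nn_integral_eq_integral[OF i]) auto
 also have "... \<le> ennreal (k^2 * (\<epsilon> powr (2*H) * \<Gamma>))"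
 proof (intro ennreal_leI mult_left_mono)
  have "expectation (\<lambda>w. (h (B (s + \<delta>) w))^2 * (D \<epsilon> s w)^2) \<le> \<epsilon> powr (2*H) * \<Psi> h (s + \<delta>)"
   using sb(2) s e by (simp add: variance_D \<Psi>_def)
  also have "... \<le> \<epsilon> powr (2*H) * \<Gamma>" using \<Gamma> by (intro mult_left_mono) auto
  finally show "expectation (\<lambda>w. (h (B (s + \<delta>) w))^2 * (D \<epsilon> s w)^2) \<le> \<epsilon> powr (2*H) * \<Gamma>" .
 qed simp
 also have "k^2 * (\<epsilon> powr (2*H) * \<Gamma>) = (s powr (2*H - 1) / \<epsilon> powr H * sqrt \<Gamma>)^2"
 proof -
  have "\<epsilon> powr (2*H) = \<epsilon> powr H * \<epsilon> powr H" by (simp add: powr_add[symmetric])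
  then show ?thesis unfolding k_def using \<Gamma>(2) e by (simp add: power_mult_distrib power_divide power2_eq_square)
 qed
 finally show ?thesis .
qed

text \<open>In \<open>increment_kernel_bound\<close> with \<open>l = 1\<close> both
  \<open>\<Phi>\<close> and \<open>\<Psi>\<close> are at most \<open>\<Gamma> * s powr (-H)\<close>
  and the power of \<open>\<epsilon>\<close> cancels, giving \<open>35 = 2 + 33\<close>. The
  exponent \<open>3*H - 2\<close> is \<open>2 * (2*H - 1) - H\<close>. The resulting bound does not
  depend on \<open>\<epsilon>\<close>.\<close>

lemma incr_maximal:
 assumes T: "0 < T" and e: "0 < \<epsilon>" "0 \<le> \<delta>" and \<Gamma>: "0 \<le> \<Gamma>" and h [measurable]: "h \<in> borel_measurable borel"
  and a: "\<And>p. 0 < p \<Longrightarrow> p \<le> T + \<delta> \<Longrightarrow> admissible h (B p)"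
  and b: "\<And>p. 0 < p \<Longrightarrow> p \<le> T + \<delta> \<Longrightarrow> \<Psi> h p \<le> \<Gamma> * p powr (-H)"
 shows "\<exists>S\<in>borel_measurable M. (\<integral>\<^sup>+w. S w \<partial>M) \<le> ennreal (max_const H T * (35 * \<Gamma>)) \<and>
  (AE w in M. set_integrable lborel {0..T} (\<lambda>s. incr h \<epsilon> \<delta> s w) \<and>
   (\<forall>t\<in>{0..T}. ennreal ((LINT s:{0..t}|lborel. incr h \<epsilon> \<delta> s w)^2) \<le> S w))"
proof (rule maximal_inequality[OF H T _ incr_measurable[OF h], where \<psi>="\<lambda>s. sqrt \<Gamma> / \<epsilon> powr H * s powr (3*H/2 - 1)"])
 show "0 \<le> 35 * \<Gamma>" using \<Gamma> by simp
 show "0 \<le> sqrt \<Gamma> / \<epsilon> powr H * s powr (3*H/2 - 1)" for s using \<Gamma> by simp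
 have "set_integrable lborel {0..T} (\<lambda>s. s powr (3*H/2 - 1))" unfolding set_integrable_def
 proof (rule integrableI_bounded)
  have "(\<integral>\<^sup>+s. ennreal (norm (indicator {0..T} s *\<^sub>R s powr (3*H/2 - 1))) \<partial>lborel) = (\<integral>\<^sup>+s\<in>{0..T}. ennreal (s powr (3*H/2 - 1)) \<partial>lborel)"
   by (intro nn_integral_cong) (auto split: split_indicator)
  also have "... < \<infinity>" using H T by (subst nn_integral_powr_from_0) auto
  finally show "(\<integral>\<^sup>+s. ennreal (norm (indicator {0..T} s *\<^sub>R s powr (3*H/2 - 1))) \<partial>lborel) < \<infinity>" .
 qed measurable
 then show "set_integrable lborel {0..T} (\<lambda>s. sqrt \<Gamma> / \<epsilon> powr H * s powr (3*H/2 - 1))"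
  by (rule set_integrable_mult_right)
 show "(\<integral>\<^sup>+w. ennreal ((incr h \<epsilon> \<delta> s w)^2) \<partial>M) \<le> ennreal ((sqrt \<Gamma> / \<epsilon> powr H * s powr (3*H/2 - 1))^2)"
  if s: "s \<in> {0..T}" for s
 proof (cases "s = 0")
  case True then show ?thesis by (simp add: incr_def)
 next
  case False
  then have s0: "0 < s" using s by simp
  have "\<Psi> h (s + \<delta>) \<le> \<Gamma> * (s + \<delta>) powr (-H)" using s s0 e by (intro b) auto
  also have "... \<le> \<Gamma> * s powr (-H)" using s0 e H \<Gamma> by (intro mult_left_mono powr_mono2') auto
  finally have "(\<integral>\<^sup>+w. ennreal ((incr h \<epsilon> \<delta> s w)^2) \<partial>M) \<le> ennreal ((s powr (2*H - 1) / \<epsilon> powr H * sqrt (\<Gamma> * s powr (-H)))^2)"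
   using s s0 e \<Gamma> by (intro incr_second_moment a) auto
  also have "sqrt (\<Gamma> * s powr (-H)) = sqrt \<Gamma> * s powr (-H/2)"
   by (simp add: real_sqrt_mult powr_half_sqrt[symmetric] powr_powr)
  also have "s powr (2*H - 1) / \<epsilon> powr H * (sqrt \<Gamma> * s powr (-H/2)) = sqrt \<Gamma> / \<epsilon> powr H * (s powr (2*H - 1) * s powr (-H/2))"
   by simp
  also have "s powr (2*H - 1) * s powr (-H/2) = s powr (3*H/2 - 1)" by (simp add: powr_add[symmetric] field_simps)
  finally show ?thesis .
 qed
 show "\<bar>expectation (\<lambda>w. incr h \<epsilon> \<delta> s w * incr h \<epsilon> \<delta> r w)\<bar> \<le> 35 * \<Gamma> * s powr (3*H - 2) * (r - s) powr (-2*H)"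
  if s: "0 < s" "s < r" "r \<le> 2 * s" "r \<le> T" for s r
 proof -
  define d where "d = (r - s) powr (-2*H)"
  define g where "g = \<Gamma> * s powr (-H)"
  have pos: "0 < \<epsilon> powr (4*H)" using e by simp
  have half: "2 * q powr (-2*H) * \<Psi> h q + 33 * d * \<Phi> h q \<le> 35 * d * g" if q: "s \<le> q" "q \<le> T + \<delta>" for q
  proof -
   have aq: "admissible h (B q)" using q s by (intro a) auto
   have "\<Psi> h q \<le> \<Gamma> * q powr (-H)" using q s by (intro b) auto
   also have "... \<le> g" unfolding g_def using q s H \<Gamma> by (intro mult_left_mono powr_mono2') auto
   finally have 1: "\<Psi> h q \<le> g" .
   have "q powr (-2*H) \<le> d" unfolding d_def using q s H by (intro powr_mono2') auto
   then have "q powr (-2*H) * \<Psi> h q \<le> d * g" using 1 \<Phi>_le_\<Psi>[OF aq] by (intro mult_mono) (auto simp: d_def)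
   moreover have "d * \<Phi> h q \<le> d * g" using 1 \<Phi>_le_\<Psi>[OF aq] by (intro mult_left_mono) (auto simp: d_def)
   ultimately show ?thesis by simp
  qed
  have "\<bar>expectation (\<lambda>w. h (B (s + \<delta>) w) * h (B (r + \<delta>) w) * (D \<epsilon> s w * D \<epsilon> r w))\<bar>
   \<le> \<epsilon> powr (4*H) * (1 / 2 * (2 * (s + \<delta>) powr (-2*H) * \<Psi> h (s + \<delta>) + 33 * (r - s) powr (-2*H) * \<Phi> h (s + \<delta>))
   + 1 / (2 * 1) * (2 * (r + \<delta>) powr (-2*H) * \<Psi> h (r + \<delta>) + 33 * (r - s) powr (-2*H) * \<Phi> h (r + \<delta>)))"
   using s e by (intro increment_kernel_bound a) auto
  also have "... \<le> \<epsilon> powr (4*H) * (1 / 2 * (35 * d * g) + 1 / (2 * 1) * (35 * d * g))"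
   using half[of "s + \<delta>"] half[of "r + \<delta>"] s e unfolding d_def[symmetric] by (intro mult_left_mono add_mono) auto
  finally have K: "\<bar>expectation (\<lambda>w. h (B (s + \<delta>) w) * h (B (r + \<delta>) w) * (D \<epsilon> s w * D \<epsilon> r w))\<bar> \<le> \<epsilon> powr (4*H) * (35 * d * g)"
   by simp
  have e2: "(\<epsilon> powr (2*H))^2 = \<epsilon> powr (4*H)" by (simp add: power2_eq_square powr_add[symmetric])
  have "\<bar>expectation (\<lambda>w. incr h \<epsilon> \<delta> s w * incr h \<epsilon> \<delta> r w)\<bar>
    \<le> s powr (2*H - 1) * r powr (2*H - 1) / \<epsilon> powr (4*H) * (\<epsilon> powr (4*H) * (35 * d * g))"
   unfolding expectation_incr e2 abs_mult using K by (intro mult_mono) auto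
  also have "... = s powr (2*H - 1) * r powr (2*H - 1) * (35 * d * g)" using pos by simp
  also have "... \<le> s powr (2*H - 1) * s powr (2*H - 1) * (35 * d * g)"
   using s H \<Gamma> by (intro mult_right_mono mult_left_mono powr_mono2') (auto simp: d_def g_def)
  also have "... = 35 * \<Gamma> * (s powr (2*H - 1) * s powr (2*H - 1) * s powr (-H)) * d" by (simp add: g_def)
  also have "s powr (2*H - 1) * s powr (2*H - 1) * s powr (-H) = s powr (3*H - 2)"
   by (simp add: powr_add[symmetric] algebra_simps)
  finally show ?thesis by (simp add: d_def)
 qed
qed

text \<open>The constant is \<open>140 = 4 * 35\<close>: two halves, each doubled by
  \<open>(x - y)^2 \<le> 2 * x^2 + 2 * y^2\<close>, while \<open>(2 * H)^2 \<le> 1\<close>.\<close>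

theorem qc_maximal:
 assumes T: "0 < T" and e: "0 < \<epsilon>" and \<Gamma>: "0 \<le> \<Gamma>" and h [measurable]: "h \<in> borel_measurable borel"
  and a: "\<And>p. 0 < p \<Longrightarrow> p \<le> T + \<epsilon> \<Longrightarrow> admissible h (B p)"
  and b: "\<And>p. 0 < p \<Longrightarrow> p \<le> T + \<epsilon> \<Longrightarrow> \<Psi> h p \<le> \<Gamma> * p powr (-H)"
 shows "\<exists>S\<in>borel_measurable M. (\<integral>\<^sup>+w. S w \<partial>M) \<le> ennreal (140 * max_const H T * \<Gamma>) \<and>
  (AE w in M. set_integrable lborel {0..T} (\<lambda>s. incr h \<epsilon> \<epsilon> s w) \<and> set_integrable lborel {0..T} (\<lambda>s. incr h \<epsilon> 0 s w) \<and>
   (\<forall>t\<in>{0..T}. ennreal ((qc_approx H B h \<epsilon> t w)^2) \<le> S w))"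
proof -
 obtain S1 where [measurable]: "S1 \<in> borel_measurable M" and ES1: "(\<integral>\<^sup>+w. S1 w \<partial>M) \<le> ennreal (max_const H T * (35 * \<Gamma>))"
  and S1: "AE w in M. set_integrable lborel {0..T} (\<lambda>s. incr h \<epsilon> \<epsilon> s w) \<and>
   (\<forall>t\<in>{0..T}. ennreal ((LINT s:{0..t}|lborel. incr h \<epsilon> \<epsilon> s w)^2) \<le> S1 w)"
  using incr_maximal[OF T e less_imp_le[OF e] \<Gamma> h a b] by blast
 obtain S0 where [measurable]: "S0 \<in> borel_measurable M" and ES0: "(\<integral>\<^sup>+w. S0 w \<partial>M) \<le> ennreal (max_const H T * (35 * \<Gamma>))"
  and S0: "AE w in M. set_integrable lborel {0..T} (\<lambda>s. incr h \<epsilon> 0 s w) \<and>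
   (\<forall>t\<in>{0..T}. ennreal ((LINT s:{0..t}|lborel. incr h \<epsilon> 0 s w)^2) \<le> S0 w)"
  using incr_maximal[OF T e order_refl \<Gamma> h a b] e by auto
 define m where "m = max_const H T * (35 * \<Gamma>)"
 show ?thesis
 proof (intro bexI[of _ "\<lambda>w. 2 * S1 w + 2 * S0 w"] conjI)
  have "(\<integral>\<^sup>+w. 2 * S1 w + 2 * S0 w \<partial>M) = 2 * (\<integral>\<^sup>+w. S1 w \<partial>M) + 2 * (\<integral>\<^sup>+w. S0 w \<partial>M)"
   by (simp add: nn_integral_add nn_integral_cmult)
  also have "... \<le> 2 * ennreal m + 2 * ennreal m" unfolding m_def by (intro add_mono mult_left_mono ES1 ES0) auto
  also have "... = ennreal 4 * ennreal m" by (simp add: distrib_right[symmetric])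
  also have "... = ennreal (4 * m)" by (rule ennreal_mult'[symmetric]) simp
  also have "4 * m = 140 * max_const H T * \<Gamma>" by (simp add: m_def)
  finally show "(\<integral>\<^sup>+w. 2 * S1 w + 2 * S0 w \<partial>M) \<le> ennreal (140 * max_const H T * \<Gamma>)" .
  show "AE w in M. set_integrable lborel {0..T} (\<lambda>s. incr h \<epsilon> \<epsilon> s w) \<and> set_integrable lborel {0..T} (\<lambda>s. incr h \<epsilon> 0 s w) \<and>
   (\<forall>t\<in>{0..T}. ennreal ((qc_approx H B h \<epsilon> t w)^2) \<le> 2 * S1 w + 2 * S0 w)" using S1 S0
  proof eventually_elim
   case (elim w)
   have "ennreal ((qc_approx H B h \<epsilon> t w)^2) \<le> 2 * S1 w + 2 * S0 w" if t: "t \<in> {0..T}" for t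
   proof -
    define x where "x = (LINT s:{0..t}|lborel. incr h \<epsilon> \<epsilon> s w)"
    define y where "y = (LINT s:{0..t}|lborel. incr h \<epsilon> 0 s w)"
    have "set_integrable lborel {0..t} (\<lambda>s. incr h \<epsilon> \<epsilon> s w)" "set_integrable lborel {0..t} (\<lambda>s. incr h \<epsilon> 0 s w)"
     using elim t by (auto elim!: set_integrable_subset)
    then have q: "qc_approx H B h \<epsilon> t w = 2 * H * (x - y)" unfolding qc_approx_incr x_def y_def by simp
    have "(2 * H)^2 * (x - y)^2 \<le> 1 * (2 * x^2 + 2 * y^2)"
    proof (rule mult_mono)
     show "(2 * H)^2 \<le> 1" using H by (intro power_le_one) auto
     have "0 \<le> (x + y)^2" by simp
     then show "(x - y)^2 \<le> 2 * x^2 + 2 * y^2" by (simp add: power2_eq_square algebra_simps)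
    qed auto
    then have "ennreal ((qc_approx H B h \<epsilon> t w)^2) \<le> ennreal (2 * x^2 + 2 * y^2)"
     unfolding q power_mult_distrib[of "2 * H"] by (intro ennreal_leI) simp
    also have "... = 2 * ennreal (x^2) + 2 * ennreal (y^2)" by (simp add: ennreal_mult)
    also have "... \<le> 2 * S1 w + 2 * S0 w" unfolding x_def y_def using elim t by (intro add_mono mult_left_mono) auto
    finally show ?thesis .
   qed
   then show ?case using elim by blast
  qed
 qed measurable
qed

end

section \<open>Uniform convergence in probability\<close>

context prob_space
begin

text \<open>The Ky Fan form of uniform convergence in probability.\<close>

definition near :: "real \<Rightarrow> (real \<Rightarrow> 'a \<Rightarrow> real) \<Rightarrow> (real \<Rightarrow> 'a \<Rightarrow> real) \<Rightarrow> real \<Rightarrow> bool" where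
 "near T X Y \<eta> \<longleftrightarrow>
   (\<exists>A\<in>events. prob A \<le> \<eta> \<and> (\<forall>w\<in>space M - A. \<forall>t\<in>{0..T}. \<bar>X t w - Y t w\<bar> \<le> \<eta>))"

lemma near_sym: "near T X Y \<eta> \<Longrightarrow> near T Y X \<eta>"
 unfolding near_def by (simp add: abs_minus_commute)

lemma near_mono: "near T X Y \<eta> \<Longrightarrow> \<eta> \<le> \<eta>' \<Longrightarrow> near T X Y \<eta>'"
 unfolding near_def by (meson order_trans)

lemma near_triangle:
 assumes "near T X Y a" "near T Y Z b"
 shows "near T X Z (a + b)"
proof -
 obtain A where A: "A \<in> events" "prob A \<le> a" "\<And>w t. w \<in> space M - A \<Longrightarrow> t \<in> {0..T} \<Longrightarrow> \<bar>X t w - Y t w\<bar> \<le> a"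
  using assms(1) unfolding near_def by blast
 obtain C where C: "C \<in> events" "prob C \<le> b" "\<And>w t. w \<in> space M - C \<Longrightarrow> t \<in> {0..T} \<Longrightarrow> \<bar>Y t w - Z t w\<bar> \<le> b"
  using assms(2) unfolding near_def by blast
 have "prob (A \<union> C) \<le> a + b" using measure_Un_le[OF A(1) C(1)] A(2) C(2) by linarith
 moreover have "\<bar>X t w - Z t w\<bar> \<le> a + b" if "w \<in> space M - (A \<union> C)" "t \<in> {0..T}" for w t
  using A(3)[of w t] C(3)[of w t] that by fastforce
 ultimately show ?thesis unfolding near_def using A(1) C(1) by blast
qed

lemma near_AE_cong:
 assumes "near T X Y \<eta>" and "AE w in M. \<forall>t\<in>{0..T}. X' t w = X t w \<and> Y' t w = Y t w"
 shows "near T X' Y' \<eta>"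
proof -
 obtain A where A: "A \<in> events" "prob A \<le> \<eta>" "\<And>w t. w \<in> space M - A \<Longrightarrow> t \<in> {0..T} \<Longrightarrow> \<bar>X t w - Y t w\<bar> \<le> \<eta>"
  using assms(1) unfolding near_def by blast
 obtain N where N: "N \<in> null_sets M" "{w\<in>space M. \<not> (\<forall>t\<in>{0..T}. X' t w = X t w \<and> Y' t w = Y t w)} \<subseteq> N"
  using assms(2) by (auto simp: eventually_ae_filter)
 have P: "prob (A \<union> N) = prob A" using A N by (intro measure_Un_null_set) auto
 have "\<bar>X' t w - Y' t w\<bar> \<le> \<eta>" if "w \<in> space M - (A \<union> N)" "t \<in> {0..T}" for w t
 proof -
  have "X' t w = X t w \<and> Y' t w = Y t w" using N(2) that by blast
  then show ?thesis using A(3)[of w t] that by simp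
 qed
 then show ?thesis unfolding near_def using A(1,2) N(1) P by (intro bexI[of _ "A \<union> N"]) auto
qed

text \<open>Markov's inequality at level \<open>\<eta>^2\<close>: the event that \<open>S\<close>
  reaches this level has probability at most \<open>\<eta>^3 / \<eta>^2\<close>. A null set is added
  for the paths on which the bound by \<open>S\<close> fails.\<close>

lemma near_of_second_moment:
 assumes [measurable]: "S \<in> borel_measurable M" and S: "(\<integral>\<^sup>+w. S w \<partial>M) \<le> ennreal (\<eta> ^ 3)" and \<eta>: "0 < \<eta>"
  and bound: "AE w in M. \<forall>t\<in>{0..T}. ennreal ((X t w - Y t w)^2) \<le> S w"
 shows "near T X Y \<eta>"
proof -
 obtain N where N: "N \<in> null_sets M" "{w\<in>space M. \<not> (\<forall>t\<in>{0..T}. ennreal ((X t w - Y t w)^2) \<le> S w)} \<subseteq> N"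
  using bound by (auto simp: eventually_ae_filter)
 let ?A = "{w\<in>space M. ennreal (\<eta>^2) \<le> S w}"
 have iff: "ennreal (\<eta>^2) \<le> s \<longleftrightarrow> 1 \<le> ennreal (1 / \<eta>^2) * s" for s
 proof (cases s)
  case (real r)
  then show ?thesis using \<eta> by (simp add: ennreal_mult'[symmetric] ennreal_1[symmetric] field_simps del: ennreal_1)
 next
  case top
  then show ?thesis using \<eta> by (simp add: ennreal_mult_top)
 qed
 have "emeasure M ?A \<le> ennreal (1 / \<eta>^2) * (\<integral>\<^sup>+w\<in>space M. S w \<partial>M)"
  unfolding iff by (rule nn_integral_Markov_inequality) auto
 also have "(\<integral>\<^sup>+w\<in>space M. S w \<partial>M) = (\<integral>\<^sup>+w. S w \<partial>M)" by (intro nn_integral_cong) simp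
 also have "ennreal (1 / \<eta>^2) * ... \<le> ennreal (1 / \<eta>^2) * ennreal (\<eta> ^ 3)" by (intro mult_left_mono S) simp
 also have "... = ennreal \<eta>" using \<eta> by (simp add: ennreal_mult'[symmetric] power2_eq_square power3_eq_cube)
 finally have P: "prob ?A \<le> \<eta>" using \<eta> by (simp add: emeasure_eq_measure)
 have "prob (?A \<union> N) = prob ?A" using N by (intro measure_Un_null_set) auto
 moreover have "\<bar>X t w - Y t w\<bar> \<le> \<eta>" if "w \<in> space M - (?A \<union> N)" "t \<in> {0..T}" for w t
 proof -
  have "ennreal ((X t w - Y t w)^2) \<le> S w" using that N(2) by blast
  moreover have "S w < ennreal (\<eta>^2)" using that by (auto simp: not_le)
  ultimately have "ennreal ((X t w - Y t w)^2) < ennreal (\<eta>^2)" by (rule le_less_trans)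
  then have "(X t w - Y t w)^2 \<le> \<eta>^2" by (simp add: ennreal_less_iff)
  then show ?thesis using \<eta> abs_le_square_iff[of "X t w - Y t w" \<eta>] by simp
 qed
 ultimately show ?thesis unfolding near_def using P N(1) by (intro bexI[of _ "?A \<union> N"]) auto
qed

text \<open>A small outer measure yields a measurable cover of small probability. Conversely, the
  separate thresholds for size and probability are met together at level
  \<open>min \<eta> e'\<close>.\<close>

lemma ucp_limit_iff_near:
 "ucp_limit M T X Q \<longleftrightarrow> (\<forall>\<eta>>0. eventually (\<lambda>\<epsilon>. near T (X \<epsilon>) Q \<eta>) (at_right 0))"
proof (intro iffI allI impI)
 fix \<eta> :: real assume u: "ucp_limit M T X Q" and \<eta>: "0 < \<eta>"
 from u \<eta> have "((\<lambda>\<epsilon>. outer_measure_of M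
     {w\<in>space M. (SUP t\<in>{0..T}. ennreal \<bar>X \<epsilon> t w - Q t w\<bar>) > ennreal \<eta>}) \<longlongrightarrow> 0) (at_right 0)"
  unfolding ucp_limit_def by blast
 then have "eventually (\<lambda>\<epsilon>. outer_measure_of M
     {w\<in>space M. (SUP t\<in>{0..T}. ennreal \<bar>X \<epsilon> t w - Q t w\<bar>) > ennreal \<eta>} < ennreal \<eta>) (at_right 0)"
  using \<eta> by (intro order_tendstoD) auto
 then show "eventually (\<lambda>\<epsilon>. near T (X \<epsilon>) Q \<eta>) (at_right 0)"
 proof eventually_elim
  case (elim \<epsilon>)
  then obtain A where A: "A \<in> events" "{w\<in>space M. (SUP t\<in>{0..T}. ennreal \<bar>X \<epsilon> t w - Q t w\<bar>) > ennreal \<eta>} \<subseteq> A"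
   "emeasure M A < ennreal \<eta>"
   unfolding outer_measure_of_def INF_less_iff by auto
  have "\<bar>X \<epsilon> t w - Q t w\<bar> \<le> \<eta>" if "w \<in> space M - A" "t \<in> {0..T}" for w t
  proof -
   have "(SUP t\<in>{0..T}. ennreal \<bar>X \<epsilon> t w - Q t w\<bar>) \<le> ennreal \<eta>" using that A(2) by (auto simp: not_less[symmetric])
   then have "ennreal \<bar>X \<epsilon> t w - Q t w\<bar> \<le> ennreal \<eta>" using that(2) by (meson SUP_le_iff)
   then show ?thesis using \<eta> by simp
  qed
  then show ?case unfolding near_def using A \<eta>
   by (intro bexI[of _ A]) (auto simp: emeasure_eq_measure ennreal_less_iff)
 qed
next
 assume n: "\<forall>\<eta>>0. eventually (\<lambda>\<epsilon>. near T (X \<epsilon>) Q \<eta>) (at_right 0)"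
 show "ucp_limit M T X Q" unfolding ucp_limit_def
 proof (intro allI impI order_tendstoI)
  fix \<eta> :: real and e :: ennreal assume \<eta>: "0 < \<eta>" and e: "0 < e"
  obtain e' where e': "0 < e'" "ennreal e' < e"
  proof (cases e)
   case (real r)
   then show ?thesis using e by (intro that[of "r / 2"]) (auto simp: ennreal_less_iff)
  qed (auto intro: that[of 1])
  have "eventually (\<lambda>\<epsilon>. near T (X \<epsilon>) Q (min \<eta> e')) (at_right 0)" using n \<eta> e' by simp
  then show "eventually (\<lambda>\<epsilon>. outer_measure_of M
     {w\<in>space M. (SUP t\<in>{0..T}. ennreal \<bar>X \<epsilon> t w - Q t w\<bar>) > ennreal \<eta>} < e) (at_right 0)"
  proof eventually_elim
   case (elim \<epsilon>)
   then obtain A where A: "A \<in> events" "prob A \<le> min \<eta> e'"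
    "\<And>w t. w \<in> space M - A \<Longrightarrow> t \<in> {0..T} \<Longrightarrow> \<bar>X \<epsilon> t w - Q t w\<bar> \<le> min \<eta> e'"
    unfolding near_def by blast
   have "{w\<in>space M. (SUP t\<in>{0..T}. ennreal \<bar>X \<epsilon> t w - Q t w\<bar>) > ennreal \<eta>} \<subseteq> A"
   proof (rule subsetI, rule ccontr)
    fix w assume w: "w \<in> {w\<in>space M. (SUP t\<in>{0..T}. ennreal \<bar>X \<epsilon> t w - Q t w\<bar>) > ennreal \<eta>}" "w \<notin> A"
    then have "(SUP t\<in>{0..T}. ennreal \<bar>X \<epsilon> t w - Q t w\<bar>) \<le> ennreal \<eta>"
     using A(3)[of w] by (intro SUP_least ennreal_leI) auto
    then show False using w(1) by (simp add: not_le[symmetric])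
   qed
   then have "outer_measure_of M {w\<in>space M. (SUP t\<in>{0..T}. ennreal \<bar>X \<epsilon> t w - Q t w\<bar>) > ennreal \<eta>} \<le> emeasure M A"
    unfolding outer_measure_of_def using A(1) by (intro INF_lower) auto
   also have "... \<le> ennreal e'" using A(2) by (simp add: emeasure_eq_measure ennreal_leI)
   finally show ?case using e'(2) by (rule le_less_trans)
  qed
 qed simp
qed

lemma summable_half_powers: "summable (\<lambda>m. 1 / (2::real) ^ (m + n))"
proof -
 have "summable (\<lambda>m. 1 / 2 ^ n * (1/2::real) ^ m)" by (intro summable_mult summable_geometric) simp
 then show ?thesis by (simp add: power_add power_one_over mult.commute)
qed

lemma suminf_half_powers: "(\<Sum>m. 1 / (2::real) ^ (m + n)) = 2 / 2 ^ n"
proof -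
 have "(\<Sum>m. 1 / 2 ^ n * (1/2::real) ^ m) = 1 / 2 ^ n * 2"
  by (subst suminf_mult) (auto intro: summable_geometric simp: suminf_geometric)
 then show ?thesis by (simp add: power_add power_one_over mult.commute)
qed

lemma near_limsup_null:
 assumes "\<And>n::nat. near T (X n) (Y n) (1 / 2 ^ n)"
 shows "AE w in M. \<exists>k. \<forall>m\<ge>k. \<forall>t\<in>{0..T}. \<bar>X m t w - Y m t w\<bar> \<le> 1 / 2 ^ m"
proof -
 obtain A where A: "\<And>n. A n \<in> events" "\<And>n. prob (A n) \<le> 1 / 2 ^ n"
  "\<And>n w t. w \<in> space M - A n \<Longrightarrow> t \<in> {0..T} \<Longrightarrow> \<bar>X n t w - Y n t w\<bar> \<le> 1 / 2 ^ n"
  using assms unfolding near_def by metis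
 have s: "summable (\<lambda>n. prob (A n))"
  by (rule summable_comparison_test'[OF summable_half_powers[of 0]]) (use A(2) in simp)
 have "AE w in M. eventually (\<lambda>n. w \<in> space M - A n) sequentially"
  by (rule borel_cantelli_AE1[OF A(1) _ s]) (simp add: emeasure_eq_measure)
 then show ?thesis by eventually_elim (auto simp: eventually_sequentially intro: A(3))
qed

lemma near_tail:
 assumes "\<And>n::nat. near T (Q n) (Q (Suc n)) (1 / 2 ^ n)"
 shows "\<exists>A\<in>events. prob A \<le> 2 / 2 ^ n \<and> (\<forall>w\<in>space M - A. \<forall>t\<in>{0..T}. \<forall>m\<ge>n. \<bar>Q m t w - Q (Suc m) t w\<bar> \<le> 1 / 2 ^ m)"
proof -
 obtain A where A: "\<And>n. A n \<in> events" "\<And>n. prob (A n) \<le> 1 / 2 ^ n"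
  "\<And>n w t. w \<in> space M - A n \<Longrightarrow> t \<in> {0..T} \<Longrightarrow> \<bar>Q n t w - Q (Suc n) t w\<bar> \<le> 1 / 2 ^ n"
  using assms unfolding near_def by metis
 let ?U = "\<Union>m. A (m + n)"
 have s: "summable (\<lambda>m. prob (A (m + n)))"
  by (rule summable_comparison_test'[OF summable_half_powers[of n]]) (use A(2) in simp)
 have "prob ?U \<le> (\<Sum>m. prob (A (m + n)))" using A(1) s by (intro finite_measure_subadditive_countably) auto
 also have "... \<le> (\<Sum>m. 1 / 2 ^ (m + n))" by (intro suminf_le s summable_half_powers A(2))
 finally have P: "prob ?U \<le> 2 / 2 ^ n" unfolding suminf_half_powers .
 have "\<bar>Q m t w - Q (Suc m) t w\<bar> \<le> 1 / 2 ^ m" if "w \<in> space M - ?U" "t \<in> {0..T}" "n \<le> m" for w t m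
 proof (rule A(3)[OF _ that(2)])
  have "w \<notin> A ((m - n) + n)" using that(1) by blast
  then show "w \<in> space M - A m" using that by simp
 qed
 then show ?thesis using A(1) P by (intro bexI[of _ ?U]) auto
qed

text \<open>The union of the exceptional events from index \<open>n\<close> on has probability at
  most \<open>2 / 2 ^ n\<close>, and outside it the sequence is uniformly Cauchy. Where it diverges,
  \<open>lim\<close> has an unspecified value, which the exceptional events absorb; measurability
  for fixed \<open>t\<close> holds all the same.\<close>

lemma near_complete:
 assumes m: "\<And>n t. t \<in> {0..T} \<Longrightarrow> Q n t \<in> borel_measurable M"
  and n: "\<And>n::nat. near T (Q n) (Q (Suc n)) (1 / 2 ^ n)"
 shows "\<exists>Q'. (\<forall>t\<in>{0..T}. Q' t \<in> borel_measurable M) \<and> (\<forall>n. near T (Q n) Q' (2 / 2 ^ n))"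
proof (intro exI[of _ "\<lambda>t w. lim (\<lambda>n. Q n t w)"] conjI ballI allI)
 fix t assume t: "t \<in> {0..T}"
 show "(\<lambda>w. lim (\<lambda>n. Q n t w)) \<in> borel_measurable M" by (rule borel_measurable_lim_metric) (rule m[OF t])
next
 fix n
 obtain A where A: "A \<in> events" "prob A \<le> 2 / 2 ^ n"
  "\<And>w t m. w \<in> space M - A \<Longrightarrow> t \<in> {0..T} \<Longrightarrow> n \<le> m \<Longrightarrow> \<bar>Q m t w - Q (Suc m) t w\<bar> \<le> 1 / 2 ^ m"
  using near_tail[where n=n, OF n] by blast
 have "\<bar>Q n t w - lim (\<lambda>n. Q n t w)\<bar> \<le> 2 / 2 ^ n" if w: "w \<in> space M - A" and t: "t \<in> {0..T}" for w t
 proof -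
  have fin: "\<bar>Q n t w - Q (n + k) t w\<bar> \<le> 2 / 2 ^ n - 2 / 2 ^ (n + k)" for k
  proof (induction k)
   case (Suc k)
   have "2 / 2 ^ (n + k) - 1 / 2 ^ (n + k) = 2 / (2::real) ^ (n + Suc k)" by (simp add: field_simps)
   then show ?case using Suc A(3)[OF w t, of "n + k"] by simp
  qed simp
  have "summable (\<lambda>k. Q (Suc k + n) t w - Q (k + n) t w)"
  proof (rule summable_comparison_test'[OF summable_half_powers[of n]])
   fix k show "norm (Q (Suc k + n) t w - Q (k + n) t w) \<le> 1 / 2 ^ (k + n)"
    using A(3)[OF w t, of "k + n"] by (simp add: abs_minus_commute)
  qed
  then have "convergent (\<lambda>N. \<Sum>k<N. Q (Suc k + n) t w - Q (k + n) t w)" by (simp only: summable_iff_convergent)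
  then have "convergent (\<lambda>N. Q (N + n) t w - Q (0 + n) t w)"
   unfolding sum_lessThan_telescope[of "\<lambda>k. Q (k + n) t w"] .
  then have "convergent (\<lambda>k. Q (k + n) t w)" by (simp only: convergent_diff_const_right_iff)
  then have "convergent (\<lambda>k. Q k t w)" by (rule convergent_ignore_initial_segment[THEN iffD1])
  then have "(\<lambda>k. Q k t w) \<longlonglongrightarrow> lim (\<lambda>n. Q n t w)" by (simp add: convergent_LIMSEQ_iff)
  then have "(\<lambda>k. \<bar>Q n t w - Q (k + n) t w\<bar>) \<longlonglongrightarrow> \<bar>Q n t w - lim (\<lambda>n. Q n t w)\<bar>"
   by (intro tendsto_intros LIMSEQ_ignore_initial_segment)
  then show ?thesis
  proof (rule LIMSEQ_le_const2, intro exI allI impI)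
   fix k
   have "0 \<le> 2 / (2::real) ^ (n + k)" by simp
   then have "\<bar>Q n t w - Q (n + k) t w\<bar> \<le> 2 / 2 ^ n" using fin[of k] by linarith
   then show "\<bar>Q n t w - Q (k + n) t w\<bar> \<le> 2 / 2 ^ n" by (simp only: add.commute)
  qed
 qed
 then show "near T (Q n) (\<lambda>t w. lim (\<lambda>n. Q n t w)) (2 / 2 ^ n)" unfolding near_def using A(1,2) by blast
qed

lemma near_of_AE_tendsto:
 assumes m: "\<And>n::nat. f n \<in> borel_measurable M" "g \<in> borel_measurable M"
  and lim: "AE w in M. (\<lambda>n. f n w) \<longlonglongrightarrow> (g w :: real)" and \<eta>: "0 < \<eta>"
 shows "eventually (\<lambda>n. near T (\<lambda>_. f n) (\<lambda>_. g) \<eta>) sequentially"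
proof -
 note [measurable] = m
 let ?A = "\<lambda>n. {w\<in>space M. \<eta> < \<bar>f n w - g w\<bar>}"
 have "(\<lambda>n. expectation (indicator (?A n))) \<longlonglongrightarrow> expectation (\<lambda>_. 0 :: real)"
 proof (rule integral_dominated_convergence[where w="\<lambda>_. 1"])
  show "AE w in M. (\<lambda>n. indicator (?A n) w) \<longlonglongrightarrow> (0::real)" using lim
  proof eventually_elim
   case (elim w)
   have "eventually (\<lambda>n. \<bar>f n w - g w\<bar> < \<eta>) sequentially" using elim \<eta> unfolding tendsto_iff dist_real_def by simp
   then have "eventually (\<lambda>n. indicator (?A n) w = (0::real)) sequentially"
    by eventually_elim (auto split: split_indicator)
   then show ?case by (rule tendsto_eventually)
  qed
 qed (auto split: split_indicator)
 then have "(\<lambda>n. prob (?A n)) \<longlonglongrightarrow> 0" by simp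
 then have "eventually (\<lambda>n. prob (?A n) < \<eta>) sequentially" using \<eta> by (rule order_tendstoD)
 then show ?thesis
 proof eventually_elim
  case (elim n)
  then show ?case unfolding near_def by (intro bexI[of _ "?A n"]) auto
 qed
qed

end

section \<open>Locally square integrable functions\<close>

definition L2loc :: "(real \<Rightarrow> real) \<Rightarrow> bool" where
 "L2loc f \<longleftrightarrow> f \<in> borel_measurable borel \<and> (\<forall>N. (\<integral>\<^sup>+x\<in>{-N..N}. ennreal ((f x)^2) \<partial>lborel) < \<infinity>)"

definition cutoff :: "real \<Rightarrow> (real \<Rightarrow> real) \<Rightarrow> real \<Rightarrow> real" where
 "cutoff N f x = indicator {-N..N} x * f x"

lemma cutoff_measurable [measurable]: "f \<in> borel_measurable borel \<Longrightarrow> cutoff N f \<in> borel_measurable borel"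
 unfolding cutoff_def[abs_def] by measurable

lemma cutoff_square: "(\<integral>\<^sup>+x. ennreal ((cutoff N f x)^2) \<partial>lborel) = (\<integral>\<^sup>+x\<in>{-N..N}. ennreal ((f x)^2) \<partial>lborel)"
 by (intro nn_integral_cong) (auto simp: cutoff_def split: split_indicator)

lemma L2loc_measurable [measurable_dest]: "L2loc f \<Longrightarrow> f \<in> borel_measurable borel"
 by (simp add: L2loc_def)

lemma nn_integral_square_lincomb:
 fixes f g :: "'b \<Rightarrow> real"
 assumes [measurable]: "f \<in> borel_measurable N" "g \<in> borel_measurable N"
 shows "(\<integral>\<^sup>+x. ennreal ((c * f x + d * g x)^2) \<partial>N)
  \<le> ennreal (2 * c^2) * (\<integral>\<^sup>+x. ennreal ((f x)^2) \<partial>N) + ennreal (2 * d^2) * (\<integral>\<^sup>+x. ennreal ((g x)^2) \<partial>N)"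
proof -
 have "(\<integral>\<^sup>+x. ennreal ((c * f x + d * g x)^2) \<partial>N) \<le> (\<integral>\<^sup>+x. ennreal (2 * c^2) * ennreal ((f x)^2) + ennreal (2 * d^2) * ennreal ((g x)^2) \<partial>N)"
 proof (rule nn_integral_mono)
  fix x
  have "(c * f x + d * g x)^2 \<le> 2 * c^2 * (f x)^2 + 2 * d^2 * (g x)^2"
   using zero_le_power2[of "c * f x - d * g x"] by (simp add: power2_eq_square algebra_simps)
  from ennreal_leI[OF this] show "ennreal ((c * f x + d * g x)^2) \<le> ennreal (2 * c^2) * ennreal ((f x)^2) + ennreal (2 * d^2) * ennreal ((g x)^2)"
   by (simp add: ennreal_mult')
 qed
 also have "... = ennreal (2 * c^2) * (\<integral>\<^sup>+x. ennreal ((f x)^2) \<partial>N) + ennreal (2 * d^2) * (\<integral>\<^sup>+x. ennreal ((g x)^2) \<partial>N)"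
  by (simp add: nn_integral_add nn_integral_cmult)
 finally show ?thesis .
qed

lemma L2loc_lincomb:
 assumes "L2loc f" "L2loc g"
 shows "L2loc (\<lambda>x. c * f x + d * g x)"
 unfolding L2loc_def
proof (intro conjI allI)
 have [measurable]: "f \<in> borel_measurable borel" "g \<in> borel_measurable borel" using assms by (auto simp: L2loc_def)
 show "(\<lambda>x. c * f x + d * g x) \<in> borel_measurable borel" by measurable
 fix N
 have "cutoff N (\<lambda>x. c * f x + d * g x) = (\<lambda>x. c * cutoff N f x + d * cutoff N g x)"
  by (auto simp: cutoff_def algebra_simps)
 then have "(\<integral>\<^sup>+x\<in>{-N..N}. ennreal ((c * f x + d * g x)^2) \<partial>lborel)
  \<le> ennreal (2 * c^2) * (\<integral>\<^sup>+x\<in>{-N..N}. ennreal ((f x)^2) \<partial>lborel) + ennreal (2 * d^2) * (\<integral>\<^sup>+x\<in>{-N..N}. ennreal ((g x)^2) \<partial>lborel)"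
  unfolding cutoff_square[symmetric] by (simp only:) (rule nn_integral_square_lincomb; measurable)
 also have "... < \<infinity>" using assms by (auto simp: L2loc_def ennreal_mult_less_top)
 finally show "(\<integral>\<^sup>+x\<in>{-N..N}. ennreal ((c * f x + d * g x)^2) \<partial>lborel) < \<infinity>" .
qed

lemma L2loc_bounded:
 assumes [measurable]: "f \<in> borel_measurable borel" and b: "\<And>x. \<bar>f x\<bar> \<le> c"
 shows "L2loc f"
 unfolding L2loc_def
proof (intro conjI allI)
 fix N
 have "(\<integral>\<^sup>+x\<in>{-N..N}. ennreal ((f x)^2) \<partial>lborel) \<le> (\<integral>\<^sup>+x\<in>{-N..N}. ennreal (c^2) \<partial>lborel)"
 proof (intro nn_integral_mono mult_right_mono ennreal_leI)
  fix x show "(f x)^2 \<le> c^2" using power_mono[OF b[of x], of 2] by simp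
 qed simp
 also have "... = ennreal (c^2) * emeasure lborel {-N..N}" by (rule nn_integral_cmult_indicator) simp
 also have "... < \<infinity>" by (simp add: ennreal_mult_less_top emeasure_lborel_Icc_eq)
 finally show "(\<integral>\<^sup>+x\<in>{-N..N}. ennreal ((f x)^2) \<partial>lborel) < \<infinity>" .
qed simp

section \<open>Localisation to bounded paths\<close>

context fbm
begin

text \<open>Rational times keep the event measurable; continuity extends the bound to all times in
  \<open>not_big\<close>. The horizon \<open>T + 1\<close> of later uses covers
  \<open>s + \<epsilon>\<close> for \<open>\<epsilon> \<le> 1\<close>.\<close>

definition big :: "real \<Rightarrow> nat \<Rightarrow> 'a set" where
 "big K N = {w\<in>space M. \<exists>s\<in>\<rat> \<inter> {0..K}. real N < \<bar>B s w\<bar>}"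

lemma big_measurable [measurable]: "big K N \<in> events"
proof -
 have "countable (\<rat> \<inter> {0..K})" using countable_rat by (rule countable_subset[rotated]) auto
 moreover have "big K N = (\<Union>s\<in>\<rat> \<inter> {0..K}. {w\<in>space M. real N < \<bar>B s w\<bar>})" by (auto simp: big_def)
 ultimately show ?thesis by (simp only:) (intro sets.countable_UN', auto)
qed

lemma not_big:
 assumes "w \<in> space M - big K N" "0 < K" "s \<in> {0..K}"
 shows "\<bar>B s w\<bar> \<le> real N"
proof -
 have inner: "\<bar>B t w\<bar> \<le> real N" if t: "t \<in> {0<..<K}" for t
 proof (rule ccontr)
  assume "\<not> \<bar>B t w\<bar> \<le> real N"
  moreover have "open {t. real N < \<bar>B t w\<bar>}" using paths[of w] by (intro open_Collect_less continuous_intros)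
  ultimately have "open ({t. real N < \<bar>B t w\<bar>} \<inter> {0<..<K})" "t \<in> {t. real N < \<bar>B t w\<bar>} \<inter> {0<..<K}" using t by auto
  then obtain e where e: "0 < e" "ball t e \<subseteq> {t. real N < \<bar>B t w\<bar>} \<inter> {0<..<K}" by (rule openE) blast
  obtain q where q: "q \<in> \<rat>" "t < q" "q < t + e" using Rats_dense_in_real[of t "t + e"] e by auto
  then have "q \<in> ball t e" by (simp add: dist_real_def)
  then have "q \<in> {t. real N < \<bar>B t w\<bar>} \<inter> {0<..<K}" using e(2) by blast
  then have "q \<in> \<rat> \<inter> {0..K}" "real N < \<bar>B q w\<bar>" using q by auto
  then show False using assms(1) by (auto simp: big_def)
 qed
 have "closed {t. \<bar>B t w\<bar> \<le> real N}" using paths[of w] by (intro closed_Collect_le continuous_intros)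
 then have "closure {0<..<K} \<subseteq> {t. \<bar>B t w\<bar> \<le> real N}" using inner by (intro closure_minimal) auto
 then show ?thesis using assms(2,3) by auto
qed

lemma prob_big: "0 < \<eta> \<Longrightarrow> \<exists>N. prob (big K N) \<le> \<eta>"
proof -
 assume \<eta>: "0 < \<eta>"
 have "(\<lambda>N. prob (big K N)) \<longlonglongrightarrow> prob (\<Inter>N. big K N)"
 proof (rule finite_Lim_measure_decseq)
  show "range (big K) \<subseteq> events" using big_measurable by auto
  show "decseq (big K)"
  proof (rule decseq_SucI)
   fix n
   have "real n < x" if "real (Suc n) < x" for x using that by simp
   then show "big K (Suc n) \<subseteq> big K n" unfolding big_def by blast
  qed
 qed
 also have "(\<Inter>N. big K N) = {}"
 proof -
  have False if "w \<in> (\<Inter>N. big K N)" for w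
  proof -
   have "compact ((\<lambda>t. B t w) ` {0..K})" by (intro compact_continuous_image continuous_on_subset[OF paths]) auto
   then obtain b where b: "\<And>t. t \<in> {0..K} \<Longrightarrow> \<bar>B t w\<bar> \<le> b"
    using compact_imp_bounded bounded_iff by (metis (no_types, lifting) image_eqI real_norm_def)
   obtain N where "b \<le> real N" using real_arch_simple by blast
   moreover have "w \<in> big K N" using that by blast
   ultimately show False unfolding big_def using b by fastforce
  qed
  then show ?thesis by blast
 qed
 finally have "(\<lambda>N. prob (big K N)) \<longlonglongrightarrow> 0" by simp
 then have "eventually (\<lambda>N. prob (big K N) < \<eta>) sequentially" using \<eta> by (rule order_tendstoD)
 then show ?thesis by (auto simp: eventually_sequentially intro: less_imp_le)
qed

lemma qc_maximal_L2:
 assumes T: "0 < T" and e: "0 < \<epsilon>" and h [measurable]: "h \<in> borel_measurable borel"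
  and I: "(\<integral>\<^sup>+x. ennreal ((h x)^2) \<partial>lborel) \<le> ennreal I" "0 \<le> I"
 shows "\<exists>S\<in>borel_measurable M. (\<integral>\<^sup>+w. S w \<partial>M) \<le> ennreal (140 * max_const H T * (3 * I)) \<and>
  (AE w in M. set_integrable lborel {0..T} (\<lambda>s. incr h \<epsilon> \<epsilon> s w) \<and> set_integrable lborel {0..T} (\<lambda>s. incr h \<epsilon> 0 s w) \<and>
   (\<forall>t\<in>{0..T}. ennreal ((qc_approx H B h \<epsilon> t w)^2) \<le> S w))"
proof (rule qc_maximal[OF T e _ h])
 show "0 \<le> 3 * I" using I by simp
 fix p :: real assume p: "0 < p" "p \<le> T + \<epsilon>"
 have "admissible h (B p) \<and> \<Psi> h p \<le> 3 / 1 * p powr (-H) * I"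
  using I by (intro conjI weighted_square_le[OF p(1) _ _ h, where \<rho>="\<lambda>_. 1"]) auto
 then show "admissible h (B p)" "\<Psi> h p \<le> 3 * I * p powr (-H)" by (auto simp: ac_simps)
qed

lemma incr_cutoff:
 assumes w: "w \<in> space M - big (T + 1) N" and s: "s \<in> {0..T}" and d: "0 \<le> \<delta>" "\<delta> \<le> 1" and T: "0 < T"
 shows "incr (cutoff (real N) f) \<epsilon> \<delta> s w = incr f \<epsilon> \<delta> s w"
 using not_big[OF w, of "s + \<delta>"] s d T by (auto simp: incr_def cutoff_def abs_le_iff)

text \<open>Almost every path lies outside some \<open>big (T + 1) N\<close>, and there
  \<open>f\<close> may be replaced by its square integrable cutoff.\<close>

lemma incr_L2loc_integrable:
 assumes f: "L2loc f" and T: "0 < T" and e: "0 < \<epsilon>" "\<epsilon> \<le> 1"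
 shows "AE w in M. set_integrable lborel {0..T} (\<lambda>s. incr f \<epsilon> \<epsilon> s w) \<and> set_integrable lborel {0..T} (\<lambda>s. incr f \<epsilon> 0 s w)"
proof -
 note [measurable] = f
 have "AE w in M. \<forall>N::nat. set_integrable lborel {0..T} (\<lambda>s. incr (cutoff N f) \<epsilon> \<epsilon> s w)
   \<and> set_integrable lborel {0..T} (\<lambda>s. incr (cutoff N f) \<epsilon> 0 s w)" unfolding AE_all_countable
 proof
  fix N :: nat
  obtain I where I: "(\<integral>\<^sup>+x. ennreal ((cutoff N f x)^2) \<partial>lborel) = ennreal I" "0 \<le> I"
  proof -
   have "(\<integral>\<^sup>+x\<in>{-real N..real N}. ennreal ((f x)^2) \<partial>lborel) < \<infinity>" using f unfolding L2loc_def by blast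
   then show ?thesis using that unfolding cutoff_square
    by (cases "\<integral>\<^sup>+x\<in>{-real N..real N}. ennreal ((f x)^2) \<partial>lborel") auto
  qed
  show "AE w in M. set_integrable lborel {0..T} (\<lambda>s. incr (cutoff N f) \<epsilon> \<epsilon> s w)
   \<and> set_integrable lborel {0..T} (\<lambda>s. incr (cutoff N f) \<epsilon> 0 s w)"
   using qc_maximal_L2[OF T e(1) cutoff_measurable eq_refl[OF I(1)] I(2)] by auto
 qed
 moreover have "AE w in M. \<exists>N. w \<notin> big (T + 1) N"
 proof -
  have "(\<Inter>N. big (T + 1) N) \<in> null_sets M"
  proof (rule null_setsI)
   have "prob (\<Inter>N. big (T + 1) N) \<le> \<eta>" if \<eta>: "0 < \<eta>" for \<eta>
   proof -
    obtain N where "prob (big (T + 1) N) \<le> \<eta>" using prob_big[OF \<eta>] by blast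
    moreover have "prob (\<Inter>N. big (T + 1) N) \<le> prob (big (T + 1) N)"
     by (rule finite_measure_mono[OF _ big_measurable], rule INT_lower, rule UNIV_I)
    ultimately show ?thesis by linarith
   qed
   then have "prob (\<Inter>N. big (T + 1) N) \<le> 0" by (rule field_le_epsilon[where y=0, simplified])
   then show "emeasure M (\<Inter>N. big (T + 1) N) = 0" by (simp add: emeasure_eq_measure measure_le_0_iff)
  qed measurable
  then show ?thesis by (intro AE_I'[where N="\<Inter>N. big (T + 1) N"]) auto
 qed
 ultimately show ?thesis using AE_space
 proof eventually_elim
  case (elim w)
  then obtain N where N: "w \<in> space M - big (T + 1) N" by blast
  have "set_integrable lborel {0..T} (\<lambda>s. incr f \<epsilon> \<delta> s w) \<longleftrightarrow> set_integrable lborel {0..T} (\<lambda>s. incr (cutoff N f) \<epsilon> \<delta> s w)"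
   if "0 \<le> \<delta>" "\<delta> \<le> 1" for \<delta> by (rule set_integrable_cong) (use incr_cutoff[OF N _ that T] in auto)
  then show ?case using elim e by auto
 qed
qed

lemma qc_approx_lincomb:
 assumes f: "L2loc f" and g: "L2loc g" and T: "0 < T" and e: "0 < \<epsilon>" "\<epsilon> \<le> 1"
 shows "AE w in M. \<forall>t\<in>{0..T}. qc_approx H B (\<lambda>x. c * f x + d * g x) \<epsilon> t w = c * qc_approx H B f \<epsilon> t w + d * qc_approx H B g \<epsilon> t w"
 using incr_L2loc_integrable[OF f T e] incr_L2loc_integrable[OF g T e]
proof eventually_elim
 case (elim w)
 show ?case
 proof
  fix t assume t: "t \<in> {0..T}"
  have i: "set_integrable lborel {0..t} (\<lambda>s. incr f \<epsilon> \<epsilon> s w - incr f \<epsilon> 0 s w)"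
   "set_integrable lborel {0..t} (\<lambda>s. incr g \<epsilon> \<epsilon> s w - incr g \<epsilon> 0 s w)"
   using elim t by (auto elim!: set_integrable_subset intro!: set_integral_diff)
  have "(LINT s:{0..t}|lborel. incr (\<lambda>x. c * f x + d * g x) \<epsilon> \<epsilon> s w - incr (\<lambda>x. c * f x + d * g x) \<epsilon> 0 s w)
   = (LINT s:{0..t}|lborel. c * (incr f \<epsilon> \<epsilon> s w - incr f \<epsilon> 0 s w) + d * (incr g \<epsilon> \<epsilon> s w - incr g \<epsilon> 0 s w))"
   by (intro set_lebesgue_integral_cong) (auto simp: incr_def algebra_simps)
  also have "... = c * (LINT s:{0..t}|lborel. incr f \<epsilon> \<epsilon> s w - incr f \<epsilon> 0 s w)
    + d * (LINT s:{0..t}|lborel. incr g \<epsilon> \<epsilon> s w - incr g \<epsilon> 0 s w)" using i by (subst set_integral_add) auto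
  finally show "qc_approx H B (\<lambda>x. c * f x + d * g x) \<epsilon> t w = c * qc_approx H B f \<epsilon> t w + d * qc_approx H B g \<epsilon> t w"
   unfolding qc_approx_incr by (simp add: algebra_simps)
 qed
qed

lemma qc_approx_continuous:
 assumes f: "L2loc f" and T: "0 < T" and e: "0 < \<epsilon>" "\<epsilon> \<le> 1"
 shows "AE w in M. continuous_on {0..T} (\<lambda>t. qc_approx H B f \<epsilon> t w)"
 using incr_L2loc_integrable[OF f T e]
proof eventually_elim
 case (elim w)
 then have "set_integrable lborel {0..T} (\<lambda>s. incr f \<epsilon> \<epsilon> s w - incr f \<epsilon> 0 s w)" by (auto intro: set_integral_diff)
 from set_lebesgue_integral_continuous(1)[OF this] show ?case unfolding qc_approx_incr by (intro continuous_intros)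
qed

text \<open>On paths bounded by \<open>N\<close> only the cutoff of \<open>f - g\<close> matters,
  and \<open>qc_maximal_L2\<close> bounds its approximation uniformly in \<open>\<epsilon>\<close>
  and \<open>t\<close>. That \<open>N\<close> and \<open>d\<close> do not depend on
  \<open>f\<close>, \<open>g\<close> and \<open>\<epsilon>\<close> is what later permits exchanging
  the limits in \<open>\<epsilon>\<close> and in the function.\<close>

theorem qc_approx_near:
 assumes T: "0 < T" and \<eta>: "0 < \<eta>"
 shows "\<exists>N::nat. \<exists>d>0. \<forall>f g. L2loc f \<longrightarrow> L2loc g \<longrightarrow> (\<integral>\<^sup>+x\<in>{-real N..real N}. ennreal ((f x - g x)^2) \<partial>lborel) \<le> ennreal d \<longrightarrow>
  (\<forall>\<epsilon>\<in>{0<..1}. near T (qc_approx H B f \<epsilon>) (qc_approx H B g \<epsilon>) \<eta>)"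
proof -
 \<comment> \<open>The number \<open>420 = 140 * 3\<close> comes from \<open>qc_maximal_L2\<close>;
   the absolute value and the 1 make \<open>c\<close> positive.\<close>
 define c where "c = 420 * \<bar>max_const H T\<bar> + 1"
 have c: "0 < c" by (simp add: c_def add_nonneg_pos)
 obtain N where N: "prob (big (T + 1) N) \<le> \<eta> / 2" using prob_big[of "\<eta> / 2"] \<eta> by auto
 define d where "d = (\<eta> / 2) ^ 3 / c"
 have d: "0 < d" using \<eta> c by (simp add: d_def)
 have "near T (qc_approx H B f \<epsilon>) (qc_approx H B g \<epsilon>) \<eta>"
  if f: "L2loc f" and g: "L2loc g" and I: "(\<integral>\<^sup>+x\<in>{-real N..real N}. ennreal ((f x - g x)^2) \<partial>lborel) \<le> ennreal d"
   and e: "0 < \<epsilon>" "\<epsilon> \<le> 1" for f g \<epsilon>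
 proof -
  note [measurable] = f g
  define h where "h = cutoff N (\<lambda>x. f x - g x)"
  have [measurable]: "h \<in> borel_measurable borel" unfolding h_def by measurable
  have "(\<integral>\<^sup>+x. ennreal ((h x)^2) \<partial>lborel) \<le> ennreal d" using I by (simp add: h_def cutoff_square)
  from qc_maximal_L2[OF T e(1) _ this less_imp_le[OF d]]
  obtain S where [measurable]: "S \<in> borel_measurable M" and ES: "(\<integral>\<^sup>+w. S w \<partial>M) \<le> ennreal (140 * max_const H T * (3 * d))"
   and S: "AE w in M. \<forall>t\<in>{0..T}. ennreal ((qc_approx H B h \<epsilon> t w)^2) \<le> S w" by auto
  have "140 * max_const H T * (3 * d) \<le> c * d" using d by (simp add: c_def)
  also have "c * d = (\<eta> / 2) ^ 3" using c by (simp add: d_def)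
  finally have "(\<integral>\<^sup>+w. S w \<partial>M) \<le> ennreal ((\<eta> / 2) ^ 3)" using ES by (meson ennreal_leI order_trans)
  then have "near T (qc_approx H B h \<epsilon>) (\<lambda>_ _. 0) (\<eta> / 2)" using S \<eta> by (intro near_of_second_moment[of S]) auto
  moreover have "near T (\<lambda>t w. qc_approx H B (\<lambda>x. 1 * f x + (-1) * g x) \<epsilon> t w) (qc_approx H B h \<epsilon>) (\<eta> / 2)"
   unfolding near_def
  proof (intro bexI[of _ "big (T + 1) N"] conjI ballI)
   show "prob (big (T + 1) N) \<le> \<eta> / 2" by (rule N)
   fix w t assume w: "w \<in> space M - big (T + 1) N" and t: "t \<in> {0..T}"
   have "incr h \<epsilon> \<delta> s w = incr (\<lambda>x. 1 * f x + (-1) * g x) \<epsilon> \<delta> s w" if "s \<in> {0..t}" "0 \<le> \<delta>" "\<delta> \<le> 1" for s \<delta>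
    unfolding h_def using incr_cutoff[OF w _ that(2,3) T] that(1) t by auto
   then have "qc_approx H B (\<lambda>x. 1 * f x + (-1) * g x) \<epsilon> t w = qc_approx H B h \<epsilon> t w"
    unfolding qc_approx_incr using e by (intro arg_cong2[where f="(*)"] set_lebesgue_integral_cong) auto
   then show "\<bar>qc_approx H B (\<lambda>x. 1 * f x + (-1) * g x) \<epsilon> t w - qc_approx H B h \<epsilon> t w\<bar> \<le> \<eta> / 2" using \<eta> by simp
  qed measurable
  ultimately have "near T (\<lambda>t w. qc_approx H B (\<lambda>x. 1 * f x + (-1) * g x) \<epsilon> t w) (\<lambda>_ _. 0) \<eta>"
   using near_triangle by fastforce
  then have "near T (\<lambda>t w. qc_approx H B f \<epsilon> t w - qc_approx H B g \<epsilon> t w) (\<lambda>_ _. 0) \<eta>"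
   by (rule near_AE_cong) (use qc_approx_lincomb[OF f g T e, of 1 "-1"] in eventually_elim, simp)
  then show ?thesis unfolding near_def by simp
 qed
 then show ?thesis using d by (intro exI[of _ N] exI[of _ d]) auto
qed

end

section \<open>Smooth functions\<close>

lemma set_integrable_bounded_mult:
 fixes f g :: "real \<Rightarrow> real"
 assumes g: "set_integrable lborel {a..b} g" and f: "continuous_on {a..b} f" and C: "\<And>x. x \<in> {a..b} \<Longrightarrow> \<bar>f x\<bar> \<le> C"
 shows "set_integrable lborel {a..b} (\<lambda>x. f x * g x)"
 unfolding set_integrable_def
proof (rule Bochner_Integration.integrable_bound)
 show "integrable lborel (\<lambda>x. C * (indicator {a..b} x *\<^sub>R g x))"
  using g unfolding set_integrable_def by (rule integrable_mult_right)
 have "(\<lambda>x. indicator {a..b} x *\<^sub>R f x) \<in> borel_measurable borel"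
  using f by (intro borel_measurable_continuous_on_indicator) auto
 moreover have "(\<lambda>x. indicator {a..b} x *\<^sub>R g x) \<in> borel_measurable lborel"
  using g unfolding set_integrable_def by auto
 ultimately have "(\<lambda>x. (indicator {a..b} x *\<^sub>R f x) * (indicator {a..b} x *\<^sub>R g x)) \<in> borel_measurable lborel"
  by (intro borel_measurable_times) auto
 then show "(\<lambda>x. indicator {a..b} x *\<^sub>R (f x * g x)) \<in> borel_measurable lborel"
  by (rule measurable_cong[THEN iffD1, rotated]) (auto split: split_indicator)
 show "AE x in lborel. norm (indicator {a..b} x *\<^sub>R (f x * g x)) \<le> norm (C * (indicator {a..b} x *\<^sub>R g x))"
  using C by (intro AE_I2) (force simp: abs_mult intro!: mult_right_mono split: split_indicator)
qed

lemma integral_against_close_weights: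
 fixes \<phi> m w :: "real \<Rightarrow> real"
 assumes T: "0 < T" and n: "0 < n" and \<phi>: "continuous_on {0..T} \<phi>" "\<And>s. s \<in> {0..T} \<Longrightarrow> \<bar>\<phi> s\<bar> \<le> C"
  and osc: "\<And>s r. s \<in> {0..T} \<Longrightarrow> r \<in> {0..T} \<Longrightarrow> \<bar>s - r\<bar> \<le> T / real n \<Longrightarrow> \<bar>\<phi> s - \<phi> r\<bar> \<le> \<theta>"
  and m: "set_integrable lborel {0..T} m" "\<And>s. 0 \<le> m s" and w: "set_integrable lborel {0..T} w" "\<And>s. 0 \<le> w s"
  and close: "\<And>t. t \<in> {0..T} \<Longrightarrow> \<bar>LINT s:{0..t}|lborel. m s - w s\<bar> \<le> \<sigma>"
  and t: "t \<in> {0..T}"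
 shows "\<bar>LINT s:{0..t}|lborel. \<phi> s * (m s - w s)\<bar> \<le> \<theta> * (2 * (LINT s:{0..T}|lborel. w s) + \<sigma>) + 2 * real n * C * \<sigma>"
proof -
 have C: "0 \<le> C" using \<phi>(2)[of 0] T by auto
 have \<sigma>: "0 \<le> \<sigma>" using close[of 0] T by auto
 have \<theta>: "0 \<le> \<theta>" using osc[of 0 0] T by auto
 have d: "set_integrable lborel {0..T} (\<lambda>s. m s - w s)" using m w by (auto intro: set_integral_diff)
 have p: "set_integrable lborel {0..T} (\<lambda>s. m s + w s)" using m w by (auto intro: set_integral_add)
 have \<phi>d: "set_integrable lborel {0..T} (\<lambda>s. \<phi> s * (m s - w s))" by (rule set_integrable_bounded_mult[OF d \<phi>])
 note cd = set_lebesgue_integral_continuous(2)[OF d]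
 note cp = set_lebesgue_integral_continuous(2)[OF p]
 note c\<phi> = set_lebesgue_integral_continuous(2)[OF \<phi>d]
 have ind: "\<forall>t. 0 \<le> t \<and> t \<le> real k * (T / n) \<longrightarrow>
  \<bar>LINT s:{0..t}|lborel. \<phi> s * (m s - w s)\<bar> \<le> \<theta> * (LINT s:{0..t}|lborel. m s + w s) + 2 * real k * C * \<sigma>"
  if "k \<le> n" for k using that
 proof (induction k)
  case 0
  have "(LINT s:{0..0}|lborel. f s) = 0" if "set_integrable lborel {0..T} f" for f :: "real \<Rightarrow> real"
   using set_borel_integral_eq_integral(2)[OF set_integrable_subset[OF that, of "{0..0}"]] T by simp
  from this[OF \<phi>d] this[OF p] show ?case by (auto dest: order_antisym)
 next
  case (Suc k)
  define u where "u = real k * (T / n)"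
  have u: "0 \<le> u" "u \<le> T" "u + T / n \<le> T"
  proof -
   show "0 \<le> u" using T by (simp add: u_def)
   have "real (Suc k) * (T / n) \<le> real n * (T / n)" using Suc.prems T by (intro mult_right_mono) auto
   then show *: "u + T / n \<le> T" using n by (simp add: u_def algebra_simps add_divide_distrib)
   have "0 \<le> T / n" using T by simp
   then show "u \<le> T" using * by linarith
  qed
  show ?case
  proof (intro allI impI)
   fix t assume t: "0 \<le> t \<and> t \<le> real (Suc k) * (T / n)"
   then have t': "t \<le> u + T / n" by (simp add: u_def algebra_simps add_divide_distrib)
   have mono: "2 * real k * C * \<sigma> \<le> 2 * real (Suc k) * C * \<sigma>" using C \<sigma> by (intro mult_right_mono) auto
   show "\<bar>LINT s:{0..t}|lborel. \<phi> s * (m s - w s)\<bar> \<le> \<theta> * (LINT s:{0..t}|lborel. m s + w s) + 2 * real (Suc k) * C * \<sigma>"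
   proof (cases "t \<le> u")
    case True
    then show ?thesis using Suc t mono by (force simp: u_def)
   next
    case False
    then have ut: "0 \<le> u" "u \<le> t" "t \<le> T" using u t' by auto
    have sub: "set_integrable lborel {u..t} f" if "set_integrable lborel {0..T} f" for f :: "real \<Rightarrow> real"
     by (rule set_integrable_subset[OF that]) (use ut in auto)
    have I: "\<bar>LINT s:{0..u}|lborel. \<phi> s * (m s - w s)\<bar> \<le> \<theta> * (LINT s:{0..u}|lborel. m s + w s) + 2 * real k * C * \<sigma>"
     using Suc u(1) by (auto simp: u_def)
    have i1: "set_integrable lborel {u..t} (\<lambda>s. \<phi> u * (m s - w s))"
     by (rule set_integrable_mult_right) (rule sub[OF d])
    note i2 = set_integral_diff(1)[OF sub[OF \<phi>d] i1]
    have i3: "set_integrable lborel {u..t} (\<lambda>s. \<theta> * (m s + w s))"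
     by (rule set_integrable_mult_right) (rule sub[OF p])
    have "(LINT s:{u..t}|lborel. \<phi> s * (m s - w s))
     = (LINT s:{u..t}|lborel. \<phi> u * (m s - w s) + (\<phi> s * (m s - w s) - \<phi> u * (m s - w s)))" by simp
    also have "... = (LINT s:{u..t}|lborel. \<phi> u * (m s - w s)) + (LINT s:{u..t}|lborel. \<phi> s * (m s - w s) - \<phi> u * (m s - w s))"
     by (rule set_integral_add(2)[OF i1 i2])
    finally have split: "(LINT s:{u..t}|lborel. \<phi> s * (m s - w s))
     = \<phi> u * (LINT s:{u..t}|lborel. m s - w s) + (LINT s:{u..t}|lborel. \<phi> s * (m s - w s) - \<phi> u * (m s - w s))" by simp
    have "\<bar>\<phi> u * (LINT s:{u..t}|lborel. m s - w s)\<bar> \<le> C * (2 * \<sigma>)" unfolding abs_mult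
    proof (rule mult_mono)
     show "\<bar>\<phi> u\<bar> \<le> C" using \<phi>(2) u by auto
     show "\<bar>LINT s:{u..t}|lborel. m s - w s\<bar> \<le> 2 * \<sigma>" using cd[OF ut] close[of u] close[of t] ut by auto
    qed (use C in auto)
    moreover have "\<bar>LINT s:{u..t}|lborel. \<phi> s * (m s - w s) - \<phi> u * (m s - w s)\<bar> \<le> \<theta> * (LINT s:{u..t}|lborel. m s + w s)"
    proof -
     have "norm (LINT s:{u..t}|lborel. \<phi> s * (m s - w s) - \<phi> u * (m s - w s)) \<le> (LINT s:{u..t}|lborel. \<theta> * (m s + w s))"
      unfolding set_lebesgue_integral_def
     proof (rule order_trans[OF integral_norm_bound integral_mono])
      show "integrable lborel (\<lambda>s. norm (indicator {u..t} s *\<^sub>R (\<phi> s * (m s - w s) - \<phi> u * (m s - w s))))"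
       using i2 unfolding set_integrable_def by (rule integrable_norm)
      show "integrable lborel (\<lambda>s. indicator {u..t} s *\<^sub>R (\<theta> * (m s + w s)))"
       using i3 unfolding set_integrable_def .
      fix s
      have "\<bar>\<phi> s * (m s - w s) - \<phi> u * (m s - w s)\<bar> \<le> \<theta> * (m s + w s)" if s: "s \<in> {u..t}"
      proof -
       have "\<bar>\<phi> s * (m s - w s) - \<phi> u * (m s - w s)\<bar> = \<bar>\<phi> s - \<phi> u\<bar> * \<bar>m s - w s\<bar>"
        by (simp add: left_diff_distrib[symmetric] abs_mult)
       also have "... \<le> \<theta> * (m s + w s)" using s ut t' m(2)[of s] w(2)[of s] \<theta> by (intro mult_mono osc) auto
       finally show ?thesis .
      qed
      then show "norm (indicator {u..t} s *\<^sub>R (\<phi> s * (m s - w s) - \<phi> u * (m s - w s))) \<le> indicator {u..t} s *\<^sub>R (\<theta> * (m s + w s))"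
       by (simp split: split_indicator)
     qed
     then show ?thesis by simp
    qed
    ultimately have J: "\<bar>LINT s:{u..t}|lborel. \<phi> s * (m s - w s)\<bar> \<le> C * (2 * \<sigma>) + \<theta> * (LINT s:{u..t}|lborel. m s + w s)"
     unfolding split by linarith
    have "2 * real (Suc k) * C * \<sigma> = 2 * real k * C * \<sigma> + C * (2 * \<sigma>)" by (simp add: algebra_simps)
    moreover have "\<theta> * (LINT s:{0..t}|lborel. m s + w s) = \<theta> * (LINT s:{0..u}|lborel. m s + w s) + \<theta> * (LINT s:{u..t}|lborel. m s + w s)"
     unfolding cp[OF ut, symmetric] by (simp add: algebra_simps)
    ultimately show ?thesis using I J c\<phi>[OF ut] by linarith
   qed
  qed
 qed
 have "\<bar>LINT s:{0..t}|lborel. \<phi> s * (m s - w s)\<bar> \<le> \<theta> * (LINT s:{0..t}|lborel. m s + w s) + 2 * real n * C * \<sigma>"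
  using ind[OF order_refl] t n by auto
 also have "(LINT s:{0..t}|lborel. m s + w s) \<le> 2 * (LINT s:{0..T}|lborel. w s) + \<sigma>"
 proof -
  have "(LINT s:{0..t}|lborel. m s + w s) \<le> (LINT s:{0..T}|lborel. m s + w s)" unfolding set_lebesgue_integral_def
   using p set_integrable_subset[OF p, of "{0..t}"] t m(2) w(2)
   by (intro integral_mono) (auto simp: set_integrable_def split: split_indicator)
  also have "... = (LINT s:{0..T}|lborel. m s) + (LINT s:{0..T}|lborel. w s)" using m w by simp
  also have "(LINT s:{0..T}|lborel. m s) = (LINT s:{0..T}|lborel. m s - w s) + (LINT s:{0..T}|lborel. w s)" using m w by simp
  finally show ?thesis using close[of T] T by auto
 qed
 finally show ?thesis using \<theta> by (simp add: mult_left_mono)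
qed

lemma set_integrable_powr: "-1 < p \<Longrightarrow> 0 \<le> T \<Longrightarrow> set_integrable lborel {0..T} (\<lambda>s::real. s powr p)"
 unfolding set_integrable_def
proof (rule integrableI_bounded)
 assume p: "-1 < p" "0 \<le> T"
 have "(\<integral>\<^sup>+s. ennreal (norm (indicator {0..T} s *\<^sub>R s powr p)) \<partial>lborel) = (\<integral>\<^sup>+s\<in>{0..T}. ennreal (s powr p) \<partial>lborel)"
  by (intro nn_integral_cong) (auto split: split_indicator)
 also have "... < \<infinity>" using p by (subst nn_integral_powr_from_0) auto
 finally show "(\<integral>\<^sup>+s. ennreal (norm (indicator {0..T} s *\<^sub>R s powr p)) \<partial>lborel) < \<infinity>" .
qed measurable

section \<open>Law of large numbers for squared increments\<close>

context gaussian_space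
begin

lemma abs_cov_le:
 assumes X: "X \<in> G" and Y: "Y \<in> G"
 shows "\<bar>cov X Y\<bar> \<le> (cov X X + cov Y Y) / 2"
proof -
 let ?S = "\<lambda>w. 1 * X w + 1 * Y w" and ?D = "\<lambda>w. 1 * X w + (-1) * Y w"
 have S: "?S \<in> G" and D: "?D \<in> G" by (rule lin[OF X Y])+
 have SS: "cov ?S ?S = cov X X + 2 * cov X Y + cov Y Y"
  using cov_lin(1)[OF X Y S, of 1 1] cov_lin(2)[OF X Y X, of 1 1] cov_lin(2)[OF X Y Y, of 1 1] cov_commute[of Y X] by linarith
 have DD: "cov ?D ?D = cov X X - 2 * cov X Y + cov Y Y"
  using cov_lin(1)[OF X Y D, of 1 "-1"] cov_lin(2)[OF X Y X, of 1 "-1"] cov_lin(2)[OF X Y Y, of 1 "-1"] cov_commute[of Y X] by linarith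
 show ?thesis using cov_nonneg[of ?S] cov_nonneg[of ?D] unfolding SS DD by (simp add: abs_le_iff)
qed

end

context fbm
begin

text \<open>Normalised so that its mean is \<open>s powr (2*H - 1)\<close>, the weight in the
  limit.\<close>

definition quad :: "real \<Rightarrow> real \<Rightarrow> 'a \<Rightarrow> real" where
 "quad \<epsilon> s w = s powr (2*H - 1) / \<epsilon> powr (2*H) * (D \<epsilon> s w)^2"

lemma quad_moments:
 assumes s: "0 \<le> s" "0 \<le> r" and e: "0 < \<epsilon>"
 defines "F \<equiv> \<lambda>s w. quad \<epsilon> s w - s powr (2*H - 1)"
 shows "integrable M (\<lambda>w. F s w * F r w)"
  and "expectation (\<lambda>w. F s w * F r w)
   = s powr (2*H - 1) * r powr (2*H - 1) * (2 * (cov (D \<epsilon> s) (D \<epsilon> r) / \<epsilon> powr (2*H))^2)"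
proof -
 have D: "D \<epsilon> s \<in> \<G>" "D \<epsilon> r \<in> \<G>" using s e by (auto intro: D_in_\<G>)
 define q where "q = \<epsilon> powr (2*H)"
 have q: "0 < q" using e by (simp add: q_def)
 define k where "k = s powr (2*H - 1) * r powr (2*H - 1)"
 have eq: "F s w * F r w = k * ((D \<epsilon> s w)^2 * (D \<epsilon> r w)^2 / q^2 - (D \<epsilon> s w)^2 / q - (D \<epsilon> r w)^2 / q + 1)" for w
  unfolding F_def quad_def k_def q_def[symmetric] using q by (simp add: field_simps power2_eq_square)
 have v: "expectation (\<lambda>w. (D \<epsilon> s w)^2) = q" "expectation (\<lambda>w. (D \<epsilon> r w)^2) = q"
  using variance_D[OF s(1) e] variance_D[OF s(2) e] by (simp_all add: power2_eq_square q_def)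
 note f = fourth_moment_pair[OF D, unfolded variance_D[OF s(1) e] variance_D[OF s(2) e], folded q_def]
 have i: "integrable M (\<lambda>w. (D \<epsilon> s w)^2)" "integrable M (\<lambda>w. (D \<epsilon> r w)^2)" using D by (auto intro: integrable_power)
 show "integrable M (\<lambda>w. F s w * F r w)" unfolding eq using f(1) i by auto
 have "expectation (\<lambda>w. F s w * F r w)
  = k * ((q * q + 2 * (cov (D \<epsilon> s) (D \<epsilon> r))^2) / q^2 - q / q - q / q + 1)"
  unfolding eq using f i v by (simp add: prob_space)
 also have "... = k * (2 * (cov (D \<epsilon> s) (D \<epsilon> r) / q)^2)" using q by (simp add: field_simps power2_eq_square)
 finally show "expectation (\<lambda>w. F s w * F r w)
   = s powr (2*H - 1) * r powr (2*H - 1) * (2 * (cov (D \<epsilon> s) (D \<epsilon> r) / \<epsilon> powr (2*H))^2)" by (simp only: k_def q_def)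
qed

lemma quad_lln:
 assumes T: "0 < T" and \<eta>: "0 < \<eta>"
 shows "eventually (\<lambda>\<epsilon>. \<exists>A\<in>events. prob A \<le> \<eta> \<and> (\<forall>w\<in>space M - A. set_integrable lborel {0..T} (\<lambda>s. quad \<epsilon> s w) \<and>
   (\<forall>t\<in>{0..T}. \<bar>LINT s:{0..t}|lborel. quad \<epsilon> s w - s powr (2*H - 1)\<bar> \<le> \<eta>))) (at_right 0)"
proof -
 have "((\<lambda>\<epsilon>. max_const H T * (2 * T powr H * \<epsilon> powr (2*H))) \<longlongrightarrow> max_const H T * (2 * T powr H * 0 powr (2*H))) (at_right 0)"
  using H by (intro tendsto_intros) (auto simp: eventually_at_right_less less_imp_le eventually_at_filter)
 then have "eventually (\<lambda>\<epsilon>. max_const H T * (2 * T powr H * \<epsilon> powr (2*H)) < \<eta> ^ 3) (at_right 0)"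
  using \<eta> by (intro order_tendstoD) auto
 moreover have "eventually (\<lambda>\<epsilon>::real. 0 < \<epsilon>) (at_right 0)" by (rule eventually_at_right_less)
 ultimately show ?thesis
 proof eventually_elim
  case (elim \<epsilon>)
  then have e: "0 < \<epsilon>" by simp
  define F where "F s w = quad \<epsilon> s w - s powr (2*H - 1)" for s w
  note mom = quad_moments[OF _ _ e, folded F_def]
  have [measurable]: "(\<lambda>z. B (fst z + \<delta>) (snd z)) \<in> borel_measurable (lborel \<Otimes>\<^sub>M M)" for \<delta>
   using B_shift_measurable[of \<delta>] by (simp add: split_beta)
  have [measurable]: "(\<lambda>z. B (fst z) (snd z)) \<in> borel_measurable (lborel \<Otimes>\<^sub>M M)"
   using B_shift_measurable[of 0] by (simp add: split_beta)
  have Fm: "(\<lambda>(s, w). F s w) \<in> borel_measurable (lborel \<Otimes>\<^sub>M M)" unfolding F_def quad_def D_eq split_beta by measurable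
  have q: "0 < \<epsilon> powr (2*H)" using e by simp
  have "\<exists>S\<in>borel_measurable M. (\<integral>\<^sup>+w. S w \<partial>M) \<le> ennreal (max_const H T * (2 * T powr H * \<epsilon> powr (2*H))) \<and>
   (AE w in M. set_integrable lborel {0..T} (\<lambda>s. F s w) \<and>
    (\<forall>t\<in>{0..T}. ennreal ((LINT s:{0..t}|lborel. F s w)^2) \<le> S w))"
  proof (rule maximal_inequality[OF H T _ Fm, where \<psi>="\<lambda>s. sqrt 2 * s powr (2*H - 1)"])
   show "set_integrable lborel {0..T} (\<lambda>s. sqrt 2 * s powr (2*H - 1))"
    using H T by (intro set_integrable_mult_right set_integrable_powr) auto
   show "(\<integral>\<^sup>+w. ennreal ((F s w)^2) \<partial>M) \<le> ennreal ((sqrt 2 * s powr (2*H - 1))^2)" if "s \<in> {0..T}" for s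
   proof -
    have s: "0 \<le> s" using that by simp
    have "(\<integral>\<^sup>+w. ennreal ((F s w)^2) \<partial>M) = ennreal (expectation (\<lambda>w. F s w * F s w))"
     unfolding power2_eq_square by (rule nn_integral_eq_integral[OF mom(1)[OF s s]]) simp
    also have "expectation (\<lambda>w. F s w * F s w) = (sqrt 2 * s powr (2*H - 1))^2"
     unfolding mom(2)[OF s s] variance_D[OF s e] using q by (simp add: power_mult_distrib power2_eq_square)
    finally show ?thesis by simp
   qed
   show "\<bar>expectation (\<lambda>w. F s w * F r w)\<bar> \<le> 2 * T powr H * \<epsilon> powr (2*H) * s powr (3*H - 2) * (r - s) powr (-2*H)"
    if s: "0 < s" "s < r" "r \<le> 2 * s" "r \<le> T" for s r
   proof -
    define c where "c = cov (D \<epsilon> s) (D \<epsilon> r)"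
    define d where "d = (r - s) powr (-2*H)"
    have DG: "D \<epsilon> s \<in> \<G>" "D \<epsilon> r \<in> \<G>" using s e by (auto intro!: D_in_\<G>)
    have c1: "\<bar>c\<bar> \<le> \<epsilon> powr (2*H)" using abs_cov_le[OF DG] s e by (simp add: c_def variance_D)
    have c2: "\<bar>c\<bar> \<le> \<epsilon> powr (4*H) * d" using cov_D_D[of s \<epsilon> r] s e by (simp add: c_def d_def)
    have "c^2 \<le> \<epsilon> powr (2*H) * (\<epsilon> powr (4*H) * d)"
     using mult_mono[OF c1 c2] by (simp add: power2_eq_square abs_mult_self_eq)
    also have "... = (\<epsilon> powr (2*H))^2 * (\<epsilon> powr (2*H) * d)" by (simp add: power2_eq_square powr_add[symmetric])
    finally have c3: "(c / \<epsilon> powr (2*H))^2 \<le> \<epsilon> powr (2*H) * d"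
     using q by (simp add: power_divide divide_le_eq mult.commute)
    have "s powr (2*H - 1) * r powr (2*H - 1) \<le> s powr (2*H - 1) * s powr (2*H - 1)"
     using s H by (intro mult_left_mono powr_mono2') auto
    also have "... = s powr H * s powr (3*H - 2)" by (simp add: powr_add[symmetric])
    also have "... \<le> T powr H * s powr (3*H - 2)" using s H by (intro mult_right_mono powr_mono2) auto
    finally have "s powr (2*H - 1) * r powr (2*H - 1) * (2 * (c / \<epsilon> powr (2*H))^2)
     \<le> T powr H * s powr (3*H - 2) * (2 * (\<epsilon> powr (2*H) * d))" by (rule mult_mono) (use c3 in simp_all)
    then show ?thesis using s unfolding c_def d_def by (subst mom(2)) (auto simp: abs_mult ac_simps)
   qed
  qed auto
  then obtain S where [measurable]: "S \<in> borel_measurable M"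
   and ES: "(\<integral>\<^sup>+w. S w \<partial>M) \<le> ennreal (max_const H T * (2 * T powr H * \<epsilon> powr (2*H)))"
   and S: "AE w in M. set_integrable lborel {0..T} (\<lambda>s. F s w) \<and>
    (\<forall>t\<in>{0..T}. ennreal ((LINT s:{0..t}|lborel. F s w)^2) \<le> S w)" by blast
  have "(\<integral>\<^sup>+w. S w \<partial>M) \<le> ennreal (\<eta> ^ 3)" using ES elim(1) by (meson ennreal_leI less_imp_le order_trans)
  then have "near T (\<lambda>t w. LINT s:{0..t}|lborel. F s w) (\<lambda>_ _. 0) \<eta>"
   using S \<eta> by (intro near_of_second_moment[of S]) auto
  then obtain A where A: "A \<in> events" "prob A \<le> \<eta>"
   "\<And>w t. w \<in> space M - A \<Longrightarrow> t \<in> {0..T} \<Longrightarrow> \<bar>LINT s:{0..t}|lborel. F s w\<bar> \<le> \<eta>"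
   unfolding near_def by auto
  obtain N where N: "N \<in> null_sets M" "{w\<in>space M. \<not> set_integrable lborel {0..T} (\<lambda>s. F s w)} \<subseteq> N"
  proof -
   have "AE w in M. set_integrable lborel {0..T} (\<lambda>s. F s w)" using S by auto
   then show ?thesis using that by (auto simp: eventually_ae_filter)
  qed
  have "prob (A \<union> N) \<le> \<eta>" using A N measure_Un_null_set[OF A(1) N(1)] by simp
  moreover have "set_integrable lborel {0..T} (\<lambda>s. quad \<epsilon> s w)" if "w \<in> space M - (A \<union> N)" for w
  proof -
   have "set_integrable lborel {0..T} (\<lambda>s. F s w)" using N(2) that by blast
   moreover have "set_integrable lborel {0..T} (\<lambda>s::real. s powr (2*H - 1))" using H T by (intro set_integrable_powr) auto
   ultimately have "set_integrable lborel {0..T} (\<lambda>s. F s w + s powr (2*H - 1))" by (rule set_integral_add(1))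
   then show ?thesis by (simp add: F_def)
  qed
  ultimately show ?case using A N unfolding F_def by (intro bexI[of _ "A \<union> N"]) auto
 qed
qed

text \<open>By uniform continuity of paths on \<open>{0..K}\<close> the events of an oscillation
  above \<open>\<theta>\<close> at scale \<open>1 / Suc n\<close> decrease to the empty set.
  Clamping times by \<open>c\<close> makes the oscillation continuous on the whole plane, so a
  countable dense set of pairs witnesses each event and gives measurability.\<close>

lemma modulus_of_continuity:
 assumes K: "0 < K" and \<theta>: "0 < \<theta>" and \<eta>: "0 < \<eta>"
 shows "\<exists>\<delta>>0. \<exists>A\<in>events. prob A \<le> \<eta> \<and> (\<forall>w\<in>space M - A. \<forall>s\<in>{0..K}. \<forall>r\<in>{0..K}. \<bar>s - r\<bar> \<le> \<delta> \<longrightarrow> \<bar>B s w - B r w\<bar> \<le> \<theta>)"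
proof -
 define c where "c s = max 0 (min K s)" for s
 define g where "g z w = \<bar>B (c (fst z)) w - B (c (snd z)) w\<bar>" for z w
 define U where "U n = {z. \<bar>fst z - snd z\<bar> < 1 / real (Suc n)}" for n
 define E where "E n = {w\<in>space M. \<exists>z\<in>U n. \<theta> < g z w}" for n
 obtain Q :: "(real \<times> real) set" where Q: "countable Q" "\<And>X. open X \<Longrightarrow> X \<noteq> {} \<Longrightarrow> \<exists>z\<in>Q. z \<in> X"
  using countable_dense_exists by blast
 have Em: "E n \<in> events" for n
 proof -
  have "\<exists>z\<in>Q \<inter> U n. \<theta> < g z w" if "z \<in> U n" "\<theta> < g z w" for z w
  proof -
   have "open {z. z \<in> U n \<and> \<theta> < g z w}" unfolding g_def c_def U_def mem_Collect_eq
    by (intro open_Collect_conj open_Collect_less continuous_intros continuous_on_compose2[OF paths]) auto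
   from Q(2)[OF this] show ?thesis using that by blast
  qed
  then have "E n = (\<Union>z\<in>Q \<inter> U n. {w\<in>space M. \<theta> < g z w})" unfolding E_def by blast
  moreover have "{w\<in>space M. \<theta> < g z w} \<in> events" for z unfolding g_def by measurable
  ultimately show ?thesis using Q(1) by (simp only:) (intro sets.countable_UN' countable_Int1, auto)
 qed
 have "(\<lambda>n. prob (E n)) \<longlonglongrightarrow> prob (\<Inter>n. E n)"
 proof (rule finite_Lim_measure_decseq)
  show "range E \<subseteq> events" using Em by auto
  have "U (Suc n) \<subseteq> U n" for n using frac_le[of 1 1 "real (Suc n)" "real (Suc (Suc n))"] by (auto simp: U_def)
  then show "decseq E" by (intro decseq_SucI) (auto simp: E_def)
 qed
 also have "(\<Inter>n. E n) = {}"
 proof -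
  have False if w: "\<And>n. w \<in> E n" for w
  proof -
   have "uniformly_continuous_on {0..K} (\<lambda>t. B t w)"
    by (intro compact_uniformly_continuous continuous_on_subset[OF paths]) auto
   then obtain d where d: "0 < d" "\<And>s r. s \<in> {0..K} \<Longrightarrow> r \<in> {0..K} \<Longrightarrow> \<bar>s - r\<bar> < d \<Longrightarrow> \<bar>B s w - B r w\<bar> < \<theta>"
    unfolding uniformly_continuous_on_def dist_real_def using \<theta> by metis
   obtain n where n: "1 / real (Suc n) < d" using d(1) nat_approx_posE by blast
   obtain z where z: "z \<in> U n" "\<theta> < g z w" using w[of n] by (auto simp: E_def)
   then have "\<bar>c (fst z) - c (snd z)\<bar> < d" using n by (auto simp: U_def c_def)
   moreover have "c (fst z) \<in> {0..K}" "c (snd z) \<in> {0..K}" using K by (auto simp: c_def)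
   ultimately show False using d(2) z(2) by (fastforce simp: g_def)
  qed
  then show ?thesis by blast
 qed
 finally have "(\<lambda>n. prob (E n)) \<longlonglongrightarrow> 0" by simp
 then have "eventually (\<lambda>n. prob (E n) < \<eta>) sequentially" using \<eta> by (rule order_tendstoD)
 then obtain n where n: "prob (E n) < \<eta>" by (auto simp: eventually_sequentially)
 have "\<bar>B s w - B r w\<bar> \<le> \<theta>"
  if "w \<in> space M - E n" "s \<in> {0..K}" "r \<in> {0..K}" "\<bar>s - r\<bar> \<le> 1 / real (Suc (Suc n))" for w s r
 proof -
  have "1 / real (Suc (Suc n)) < 1 / real (Suc n)" by (intro divide_strict_left_mono) auto
  then have "(s, r) \<in> U n" using that(4) by (simp add: U_def)
  then have "\<not> \<theta> < g (s, r) w" using that(1) by (auto simp: E_def)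
  then show ?thesis using that(2,3) by (simp add: g_def c_def)
 qed
 then show ?thesis using Em n by (intro exI[of _ "1 / real (Suc (Suc n))"] conjI bexI[of _ "E n"]) auto
qed

text \<open>A first-order Taylor expansion at \<open>B s w\<close> replaces the increment of
  \<open>g\<close> by \<open>g' (B s w)\<close> times the increment of \<open>B\<close>, with an
  error of \<open>K * \<theta>\<close> times \<open>quad\<close>; then \<open>quad\<close> is
  replaced by its mean via \<open>quad_lln\<close> and
  \<open>integral_against_close_weights\<close>.\<close>

theorem qc_smooth_limit:
 assumes T: "0 < T" and \<eta>: "0 < \<eta>" and g: "\<And>x. (g has_real_derivative g' x) (at x)"
  and lip: "\<And>x y. \<bar>g' x - g' y\<bar> \<le> K * \<bar>x - y\<bar>" and C: "\<And>x. \<bar>g' x\<bar> \<le> C"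
 shows "eventually (\<lambda>\<epsilon>. near T (qc_approx H B g \<epsilon>) (\<lambda>t w. 2 * H * (LINT s:{0..t}|lborel. g' (B s w) * s powr (2*H - 1))) \<eta>) (at_right 0)"
proof -
 have K: "0 \<le> K" using lip[of 0 1] by (auto intro: order_trans[OF abs_ge_zero])
 have C0: "0 \<le> C" using C[of 0] by linarith
 define \<mu> where "\<mu> = (LINT s:{0..T}|lborel. s powr (2*H - 1))"
 have wi: "set_integrable lborel {0..T} (\<lambda>s::real. s powr (2*H - 1))" using H T by (intro set_integrable_powr) auto
 have \<mu>: "0 \<le> \<mu>" unfolding \<mu>_def set_lebesgue_integral_def by (intro integral_nonneg_AE) auto
 \<comment> \<open>Order of choices: \<open>\<theta>\<close> from the mass \<open>\<mu>\<close>,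
   then \<open>\<delta>\<close> and \<open>n\<close> from the modulus of continuity, then
   \<open>\<sigma>\<close> from \<open>n\<close>. One error term is
   \<open>K * \<theta> * (3 * \<mu> + 2 * \<sigma>)\<close>, with \<open>\<mu> + \<sigma>\<close>
   from Taylor and \<open>2 * \<mu> + \<sigma>\<close> from the weights, the other
   \<open>2 * n * C * \<sigma>\<close>; each is kept below \<open>\<eta> / 2\<close>.\<close>
 define \<theta> where "\<theta> = \<eta> / 2 / ((K + 1) * (3 * \<mu> + 2))"
 have kp: "0 < (K + 1) * (3 * \<mu> + 2)" using K \<mu> by (intro mult_pos_pos) auto
 have \<theta>: "0 < \<theta>" using \<eta> kp by (simp add: \<theta>_def)
 obtain \<delta> A where \<delta>: "0 < \<delta>" and A: "A \<in> events" "prob A \<le> \<eta> / 2"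
  and mod: "\<And>w s r. w \<in> space M - A \<Longrightarrow> s \<in> {0..T + 1} \<Longrightarrow> r \<in> {0..T + 1} \<Longrightarrow> \<bar>s - r\<bar> \<le> \<delta> \<Longrightarrow> \<bar>B s w - B r w\<bar> \<le> \<theta>"
  using modulus_of_continuity[of "T + 1" \<theta> "\<eta> / 2"] T \<theta> \<eta> by (metis add_pos_pos half_gt_zero zero_less_one)
 obtain n0 where "T / \<delta> \<le> real n0" using real_arch_simple by blast
 define n where "n = Suc n0"
 have n: "0 < n" "T / real n \<le> \<delta>"
 proof -
  have "T / \<delta> \<le> real n" using \<open>T / \<delta> \<le> real n0\<close> by (simp add: n_def)
  then show "0 < n" "T / real n \<le> \<delta>" using \<delta> by (auto simp: n_def field_simps)
 qed
 define \<sigma> where "\<sigma> = min (min 1 (\<eta> / 2)) (\<eta> / 2 / (2 * real n * C + 1))"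
 have nC: "0 < 2 * real n * C + 1" using C0 by (simp add: add_nonneg_pos)
 have \<sigma>: "0 < \<sigma>" "\<sigma> \<le> 1" "\<sigma> \<le> \<eta> / 2" "2 * real n * C * \<sigma> \<le> \<eta> / 2"
 proof -
  show "0 < \<sigma>" using \<eta> nC by (simp add: \<sigma>_def)
  have "\<sigma> \<le> min 1 (\<eta> / 2)" unfolding \<sigma>_def by (rule min.cobounded1)
  then show "\<sigma> \<le> 1" "\<sigma> \<le> \<eta> / 2" by linarith+
  have "\<sigma> \<le> \<eta> / 2 / (2 * real n * C + 1)" by (simp add: \<sigma>_def)
  then have "(2 * real n * C + 1) * \<sigma> \<le> \<eta> / 2" using nC by (simp add: field_simps)
  then show "2 * real n * C * \<sigma> \<le> \<eta> / 2" using \<open>0 < \<sigma>\<close> by (simp add: distrib_right)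
 qed
 have small: "K * \<theta> * (3 * \<mu> + 2 * \<sigma>) \<le> \<eta> / 2"
 proof -
  have "K * \<theta> * (3 * \<mu> + 2 * \<sigma>) \<le> (K + 1) * \<theta> * (3 * \<mu> + 2)" using K \<theta> \<mu> \<sigma> by (intro mult_mono) auto
  also have "... = \<theta> * ((K + 1) * (3 * \<mu> + 2))" by simp
  also have "... = \<eta> / 2" unfolding \<theta>_def using kp by (subst nonzero_eq_divide_eq[symmetric]) auto
  finally show ?thesis .
 qed
 have g'c: "continuous_on UNIV g'"
 proof (rule continuous_onI)
  fix x and e :: real assume e: "0 < e"
  show "\<exists>d>0. \<forall>x'\<in>UNIV. dist x' x < d \<longrightarrow> dist (g' x') (g' x) \<le> e"
  proof (intro exI[of _ "e / (K + 1)"] conjI ballI impI)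
   show "0 < e / (K + 1)" using e K by simp
   fix y assume "dist y x < e / (K + 1)"
   then have "(K + 1) * \<bar>y - x\<bar> \<le> e" using K by (simp add: dist_real_def field_simps)
   moreover have "K * \<bar>y - x\<bar> \<le> (K + 1) * \<bar>y - x\<bar>" by (intro mult_right_mono) auto
   ultimately show "dist (g' y) (g' x) \<le> e" using lip[of y x] by (simp add: dist_real_def)
  qed
 qed
 have gc: "continuous_on UNIV g" using g by (auto intro!: DERIV_continuous_on)
 have taylor: "\<bar>g y - g x - g' x * (y - x)\<bar> \<le> K * \<bar>y - x\<bar> * \<bar>y - x\<bar>" for x y
 proof (cases "x = y")
  case False
  have "\<exists>z. \<bar>z - x\<bar> \<le> \<bar>y - x\<bar> \<and> g y - g x = (y - x) * g' z"
  proof (cases "x < y")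
   case True
   then obtain z where "x < z" "z < y" "g y - g x = (y - x) * g' z" using MVT2[OF True, of g g'] g by blast
   then show ?thesis by (intro exI[of _ z]) auto
  next
   case False
   then have yx: "y < x" using \<open>x \<noteq> y\<close> by simp
   then obtain z where "y < z" "z < x" "g x - g y = (x - y) * g' z" using MVT2[OF yx, of g g'] g by blast
   then show ?thesis by (intro exI[of _ z]) (auto simp: algebra_simps)
  qed
  then obtain z where z: "\<bar>z - x\<bar> \<le> \<bar>y - x\<bar>" "g y - g x = (y - x) * g' z" by blast
  have "\<bar>g y - g x - g' x * (y - x)\<bar> = \<bar>g' z - g' x\<bar> * \<bar>y - x\<bar>"
   unfolding z(2) abs_mult[symmetric] by (simp add: algebra_simps)
  also have "... \<le> K * \<bar>y - x\<bar> * \<bar>y - x\<bar>"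
   using lip[of z x] z(1) K by (intro mult_right_mono order_trans[OF lip] mult_left_mono) auto
  finally show ?thesis .
 qed simp
 have ev: "eventually (\<lambda>\<epsilon>. \<epsilon> < min \<delta> 1) (at_right 0)" "eventually (\<lambda>\<epsilon>::real. 0 < \<epsilon>) (at_right 0)"
  using \<delta> unfolding eventually_at_right_field by (auto intro: exI[of _ "min \<delta> 1"] exI[of _ 1])
 show ?thesis using quad_lln[OF T \<sigma>(1)] ev
 proof eventually_elim
  case (elim \<epsilon>)
  then have e: "0 < \<epsilon>" "\<epsilon> \<le> \<delta>" "\<epsilon> \<le> 1" by auto
  obtain A' where A': "A' \<in> events" "prob A' \<le> \<sigma>"
   and qi: "\<And>w. w \<in> space M - A' \<Longrightarrow> set_integrable lborel {0..T} (\<lambda>s. quad \<epsilon> s w)"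
   and ql: "\<And>w t. w \<in> space M - A' \<Longrightarrow> t \<in> {0..T} \<Longrightarrow> \<bar>LINT s:{0..t}|lborel. quad \<epsilon> s w - s powr (2*H - 1)\<bar> \<le> \<sigma>"
   using elim(1) by blast
  show ?case unfolding near_def
  proof (intro bexI[of _ "A \<union> A'"] conjI ballI)
   show "prob (A \<union> A') \<le> \<eta>" using measure_Un_le[OF A(1) A'(1)] A(2) A'(2) \<sigma>(3) by linarith
   show "A \<union> A' \<in> events" using A A' by auto
   fix w t assume w: "w \<in> space M - (A \<union> A')" and t: "t \<in> {0..T}"
   define \<phi> where "\<phi> s = g' (B s w)" for s
   define m where "m s = quad \<epsilon> s w" for s
   define v where "v s = s powr (2*H - 1)" for s :: real
   have m: "set_integrable lborel {0..T} m" "0 \<le> m s" for s using qi[of w] w by (auto simp: m_def[abs_def] quad_def)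
   have v: "set_integrable lborel {0..T} v" "0 \<le> v s" for s using wi by (auto simp: v_def[abs_def])
   have close: "\<bar>LINT s:{0..t}|lborel. m s - v s\<bar> \<le> \<sigma>" if "t \<in> {0..T}" for t
    using ql[OF _ that, of w] w by (simp add: m_def v_def)
   have Bc: "continuous_on S (\<lambda>s. B s w)" for S by (rule continuous_on_subset[OF paths]) simp
   have Bc': "continuous_on S (\<lambda>s. B (s + \<epsilon>) w)" for S
    by (rule continuous_on_compose2[OF paths]) (auto intro!: continuous_intros)
   have \<phi>: "continuous_on {0..T} \<phi>" "\<bar>\<phi> s\<bar> \<le> C" for s
    unfolding \<phi>_def by (auto intro!: continuous_on_compose2[OF g'c Bc] C)
   have osc: "\<bar>\<phi> s - \<phi> r\<bar> \<le> K * \<theta>" if "s \<in> {0..T}" "r \<in> {0..T}" "\<bar>s - r\<bar> \<le> T / real n" for s r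
   proof -
    have "\<bar>\<phi> s - \<phi> r\<bar> \<le> K * \<bar>B s w - B r w\<bar>" unfolding \<phi>_def by (rule lip)
    also have "... \<le> K * \<theta>" using that n(2) w K by (intro mult_left_mono mod) auto
    finally show ?thesis .
   qed
   have I1: "\<bar>LINT s:{0..t}|lborel. \<phi> s * (m s - v s)\<bar> \<le> K * \<theta> * (2 * \<mu> + \<sigma>) + 2 * real n * C * \<sigma>"
    unfolding \<mu>_def v_def[symmetric] by (rule integral_against_close_weights[OF T n(1) \<phi> osc m v close t])
   have sub: "set_integrable lborel {0..t} f" if "set_integrable lborel {0..T} f" for f :: "real \<Rightarrow> real"
    by (rule set_integrable_subset[OF that]) (use t in auto)
   define x where "x s = s powr (2*H - 1) / \<epsilon> powr (2*H) * ((g (B (s + \<epsilon>) w) - g (B s w)) * D \<epsilon> s w)" for s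
   have xq: "qc_approx H B g \<epsilon> t w = 2 * H * (LINT s:{0..t}|lborel. x s)"
    unfolding qc_approx_incr by (intro arg_cong2[where f="(*)"] set_lebesgue_integral_cong) (auto simp: x_def incr_def algebra_simps)
   have xm: "\<bar>x s - \<phi> s * m s\<bar> \<le> K * \<theta> * m s" if s: "s \<in> {0..T}" for s
   proof -
    have "x s - \<phi> s * m s = s powr (2*H - 1) / \<epsilon> powr (2*H) * ((g (B (s + \<epsilon>) w) - g (B s w) - g' (B s w) * D \<epsilon> s w) * D \<epsilon> s w)"
     by (simp add: x_def \<phi>_def m_def quad_def power2_eq_square algebra_simps)
    then have "\<bar>x s - \<phi> s * m s\<bar> = s powr (2*H - 1) / \<epsilon> powr (2*H) * (\<bar>g (B (s + \<epsilon>) w) - g (B s w) - g' (B s w) * D \<epsilon> s w\<bar> * \<bar>D \<epsilon> s w\<bar>)"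
     by (simp add: abs_mult)
    also have "... \<le> s powr (2*H - 1) / \<epsilon> powr (2*H) * (K * \<theta> * \<bar>D \<epsilon> s w\<bar> * \<bar>D \<epsilon> s w\<bar>)"
    proof (intro mult_left_mono mult_right_mono)
     have "\<bar>g (B (s + \<epsilon>) w) - g (B s w) - g' (B s w) * D \<epsilon> s w\<bar> \<le> K * \<bar>D \<epsilon> s w\<bar> * \<bar>D \<epsilon> s w\<bar>"
      unfolding D_eq by (rule taylor)
     also have "... \<le> K * \<theta> * \<bar>D \<epsilon> s w\<bar>"
      using mod[of w "s + \<epsilon>" s] w s e K by (intro mult_right_mono mult_left_mono) (auto simp: D_eq)
     finally show "\<bar>g (B (s + \<epsilon>) w) - g (B s w) - g' (B s w) * D \<epsilon> s w\<bar> \<le> K * \<theta> * \<bar>D \<epsilon> s w\<bar>" .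
    qed auto
    also have "... = K * \<theta> * m s" by (simp add: m_def quad_def power2_eq_square abs_mult_self_eq mult.assoc)
    finally show ?thesis .
   qed
   have \<phi>m: "set_integrable lborel {0..T} (\<lambda>s. \<phi> s * m s)" by (rule set_integrable_bounded_mult[OF m(1) \<phi>])
   have \<phi>v: "set_integrable lborel {0..T} (\<lambda>s. \<phi> s * v s)" by (rule set_integrable_bounded_mult[OF v(1) \<phi>])
   have Km: "set_integrable lborel {0..T} (\<lambda>s. K * \<theta> * m s)" by (rule set_integrable_mult_right) (rule m(1))
   have dx: "set_integrable lborel {0..T} (\<lambda>s. x s - \<phi> s * m s)" unfolding set_integrable_def
   proof (rule Bochner_Integration.integrable_bound)
    show "integrable lborel (\<lambda>s. indicator {0..T} s *\<^sub>R (K * \<theta> * m s))" using Km unfolding set_integrable_def .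
    have "continuous_on UNIV (\<lambda>s. (g (B (s + \<epsilon>) w) - g (B s w)) * D \<epsilon> s w)"
     unfolding D_eq by (intro continuous_intros continuous_on_compose2[OF gc] Bc Bc') auto
    then have [measurable]: "(\<lambda>s. (g (B (s + \<epsilon>) w) - g (B s w)) * D \<epsilon> s w) \<in> borel_measurable borel"
     by (rule borel_measurable_continuous_onI)
    have "(\<lambda>s. indicator {0..T} s *\<^sub>R x s) \<in> borel_measurable lborel" unfolding x_def by measurable
    moreover have "(\<lambda>s. indicator {0..T} s *\<^sub>R (\<phi> s * m s)) \<in> borel_measurable lborel"
     using \<phi>m unfolding set_integrable_def by auto
    ultimately show "(\<lambda>s. indicator {0..T} s *\<^sub>R (x s - \<phi> s * m s)) \<in> borel_measurable lborel"
     unfolding scaleR_diff_right by (rule borel_measurable_diff)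
    show "AE s in lborel. norm (indicator {0..T} s *\<^sub>R (x s - \<phi> s * m s)) \<le> norm (indicator {0..T} s *\<^sub>R (K * \<theta> * m s))"
     using xm K \<theta> m(2) by (intro AE_I2) (force simp: abs_mult split: split_indicator)
   qed
   have "(LINT s:{0..t}|lborel. x s) - (LINT s:{0..t}|lborel. \<phi> s * v s)
    = (LINT s:{0..t}|lborel. x s - \<phi> s * m s) + (LINT s:{0..t}|lborel. \<phi> s * (m s - v s))"
   proof -
    have "(LINT s:{0..t}|lborel. x s) = (LINT s:{0..t}|lborel. (x s - \<phi> s * m s) + \<phi> s * m s)" by simp
    also have "... = (LINT s:{0..t}|lborel. x s - \<phi> s * m s) + (LINT s:{0..t}|lborel. \<phi> s * m s)"
     by (rule set_integral_add(2)[OF sub[OF dx] sub[OF \<phi>m]])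
    moreover have "(LINT s:{0..t}|lborel. \<phi> s * (m s - v s)) = (LINT s:{0..t}|lborel. \<phi> s * m s) - (LINT s:{0..t}|lborel. \<phi> s * v s)"
     unfolding right_diff_distrib by (rule set_integral_diff(2)[OF sub[OF \<phi>m] sub[OF \<phi>v]])
    ultimately show ?thesis by simp
   qed
   moreover have "\<bar>LINT s:{0..t}|lborel. x s - \<phi> s * m s\<bar> \<le> K * \<theta> * (\<mu> + \<sigma>)"
   proof -
    have "norm (LINT s:{0..t}|lborel. x s - \<phi> s * m s) \<le> (LINT s:{0..T}|lborel. K * \<theta> * m s)"
     unfolding set_lebesgue_integral_def
    proof (rule order_trans[OF integral_norm_bound integral_mono])
     show "integrable lborel (\<lambda>s. norm (indicator {0..t} s *\<^sub>R (x s - \<phi> s * m s)))"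
      using sub[OF dx] unfolding set_integrable_def by (rule integrable_norm)
     show "integrable lborel (\<lambda>s. indicator {0..T} s *\<^sub>R (K * \<theta> * m s))" using Km unfolding set_integrable_def .
     fix s show "norm (indicator {0..t} s *\<^sub>R (x s - \<phi> s * m s)) \<le> indicator {0..T} s *\<^sub>R (K * \<theta> * m s)"
      using xm[of s] K \<theta> m(2)[of s] t by (auto split: split_indicator)
    qed
    also have "... = K * \<theta> * (LINT s:{0..T}|lborel. m s)" by simp
    also have "(LINT s:{0..T}|lborel. m s) \<le> \<mu> + \<sigma>"
    proof -
     have "(LINT s:{0..T}|lborel. m s - v s) = (LINT s:{0..T}|lborel. m s) - (LINT s:{0..T}|lborel. v s)"
      by (rule set_integral_diff(2)[OF m(1) v(1)])
     then show ?thesis using close[of T] T unfolding \<mu>_def v_def by auto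
    qed
    finally show ?thesis using K \<theta> by (simp add: mult_left_mono)
   qed
   ultimately have "\<bar>(LINT s:{0..t}|lborel. x s) - (LINT s:{0..t}|lborel. \<phi> s * v s)\<bar>
    \<le> K * \<theta> * (\<mu> + \<sigma>) + (K * \<theta> * (2 * \<mu> + \<sigma>) + 2 * real n * C * \<sigma>)" using I1 by linarith
   also have "... = K * \<theta> * (3 * \<mu> + 2 * \<sigma>) + 2 * real n * C * \<sigma>" by (simp add: algebra_simps)
   also have "... \<le> \<eta>" using small \<sigma>(4) by linarith
   finally have d: "\<bar>(LINT s:{0..t}|lborel. x s) - (LINT s:{0..t}|lborel. \<phi> s * v s)\<bar> \<le> \<eta>" .
   have "\<bar>qc_approx H B g \<epsilon> t w - 2 * H * (LINT s:{0..t}|lborel. g' (B s w) * s powr (2*H - 1))\<bar>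
    = 2 * H * \<bar>(LINT s:{0..t}|lborel. x s) - (LINT s:{0..t}|lborel. \<phi> s * v s)\<bar>"
    unfolding xq \<phi>_def v_def right_diff_distrib[symmetric] abs_mult using H by simp
   also have "... \<le> 1 * \<eta>" using H d \<eta> by (intro mult_mono) auto
   finally show "\<bar>qc_approx H B g \<epsilon> t w - 2 * H * (LINT s:{0..t}|lborel. g' (B s w) * s powr (2*H - 1))\<bar> \<le> \<eta>" by simp
  qed
 qed
qed

end

section \<open>Density of elementary functions\<close>

text \<open>\<open>step_wrt P f\<close>: the value \<open>f x\<close> depends only on which points of the finite set \<open>P\<close> lie strictly
 below \<open>x\<close>, and vanishes outside the range of \<open>P\<close>.\<close>

definition below :: "real set \<Rightarrow> real \<Rightarrow> real set" where
 "below P x = {p\<in>P. p < x}"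

definition step_wrt :: "real set \<Rightarrow> (real \<Rightarrow> real) \<Rightarrow> bool" where
 "step_wrt P f \<longleftrightarrow> finite P \<and> (\<forall>x y. below P x = below P y \<longrightarrow> f x = f y)
   \<and> (\<forall>x. below P x = {} \<or> below P x = P \<longrightarrow> f x = 0)"

lemma step_wrt_const: "step_wrt P f \<Longrightarrow> below P x = below P y \<Longrightarrow> f x = f y"
 unfolding step_wrt_def by (drule conjunct2, drule conjunct1, drule spec, drule spec, erule mp)

lemma step_wrt_zero: "step_wrt P f \<Longrightarrow> below P x = {} \<or> below P x = P \<Longrightarrow> f x = 0"
 unfolding step_wrt_def by (drule conjunct2, drule conjunct2, drule spec, erule mp)

lemma step_wrt_lincomb:
 assumes "step_wrt P f" "step_wrt Q g"
 shows "step_wrt (P \<union> Q) (\<lambda>x. c * f x + d * g x)"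
 unfolding step_wrt_def
proof (intro conjI allI impI)
 show "finite (P \<union> Q)" using assms by (simp add: step_wrt_def)
 have P: "below P x = below (P \<union> Q) x \<inter> P" and Q: "below Q x = below (P \<union> Q) x \<inter> Q" for x by (auto simp: below_def)
 show "c * f x + d * g x = c * f y + d * g y" if "below (P \<union> Q) x = below (P \<union> Q) y" for x y
 proof -
  have "f x = f y" by (rule step_wrt_const[OF assms(1)]) (simp only: P[of x] P[of y] that)
  moreover have "g x = g y" by (rule step_wrt_const[OF assms(2)]) (simp only: Q[of x] Q[of y] that)
  ultimately show ?thesis by simp
 qed
 show "c * f x + d * g x = 0" if "below (P \<union> Q) x = {} \<or> below (P \<union> Q) x = P \<union> Q" for x
 proof -
  have "below P x = {} \<or> below P x = P" unfolding P[of x] using that by auto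
  moreover have "below Q x = {} \<or> below Q x = Q" unfolding Q[of x] using that by auto
  ultimately show ?thesis using step_wrt_zero[OF assms(1)] step_wrt_zero[OF assms(2)] by simp
 qed
qed

lemma step_wrt_Ioc: "step_wrt {a, b} (indicator {a<..b})"
 unfolding step_wrt_def
proof (intro conjI allI impI)
 have b: "a \<in> below {a, b} x \<longleftrightarrow> a < x" "b \<in> below {a, b} x \<longleftrightarrow> b < x" for x by (simp_all add: below_def)
 show "indicator {a<..b} x = (indicator {a<..b} y :: real)" if "below {a, b} x = below {a, b} y" for x y
 proof -
  have "(a < x) = (a < y)" "(b < x) = (b < y)" unfolding b[symmetric] that by (rule refl)+
  then show ?thesis by (auto split: split_indicator)
 qed
 show "indicator {a<..b} x = (0::real)" if "below {a, b} x = {} \<or> below {a, b} x = {a, b}" for x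
 proof -
  have "\<not> a < x \<or> b < x" using that b[of x] by blast
  then show ?thesis by (auto split: split_indicator)
 qed
qed simp

lemma elem_fun_eq: "elem_fun (l, a, c) x = (\<Sum>j=1..l. c j * indicator {a (j - 1)<..a j} x)"
 unfolding elem_fun_def by (simp only: prod.case)

text \<open>With the points of \<open>P\<close> sorted as \<open>a\<close>, every \<open>x\<close>
  in the cell from \<open>a (k - 1)\<close> to \<open>a k\<close> has the same points of
  \<open>P\<close> below it as \<open>a k\<close>, so the coefficient of a cell is the value of
  \<open>f\<close> at its right end. Outside the cells both functions vanish.\<close>

lemma step_wrt_elementary:
 assumes "step_wrt P f"
 shows "\<exists>g. is_elementary g \<and> elem_fun g = f"
proof (cases "P = {}")
 case True
 have "f = (\<lambda>x. 0)" by (rule ext, rule step_wrt_zero[OF assms]) (simp add: True below_def)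
 then show ?thesis by (intro exI[of _ "(0, \<lambda>_. 0, \<lambda>_. 0)"]) (auto simp: is_elementary_def elem_fun_def strict_mono_on_def)
next
 case False
 have fin: "finite P" using assms by (simp add: step_wrt_def)
 define xs where "xs = sorted_list_of_set P"
 define l where "l = card P - 1"
 define a where "a j = xs ! j" for j
 have len: "length xs = Suc l" using fin False by (simp add: xs_def l_def card_gt_0_iff)
 have set: "set xs = P" using fin by (simp add: xs_def)
 have sw: "sorted_wrt (<) xs" unfolding xs_def by (rule strict_sorted_list_of_set)
 have mono: "a i < a j" if "i < j" "j \<le> l" for i j
  using sorted_wrt_nth_less[OF sw that(1)] that len by (simp add: a_def)
 have P: "P = a ` {..l}" unfolding set[symmetric] a_def set_conv_nth len by (auto simp: less_Suc_eq_le)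
 have mono': "a i \<le> a j" if "i \<le> j" "j \<le> l" for i j using mono[of i j] that by (cases "i = j") auto
 have el: "is_elementary (l, a, \<lambda>j. f (a j))" using mono by (auto simp: is_elementary_def strict_mono_on_def)
 have "elem_fun (l, a, \<lambda>j. f (a j)) x = f x" for x
 proof (cases "below P x = {} \<or> below P x = P")
  case True
  have "indicator {a (j - 1)<..a j} x = (0::real)" if j: "j \<in> {1..l}" for j
  proof -
   have "a (j - 1) \<in> P" "a j \<in> P" using j by (auto simp: P)
   then have "\<not> a (j - 1) < x \<or> a j < x" using True by (auto simp: below_def)
   then show ?thesis by (auto split: split_indicator)
  qed
  then have "elem_fun (l, a, \<lambda>j. f (a j)) x = 0" unfolding elem_fun_eq by (intro sum.neutral) auto
  moreover have "f x = 0" by (rule step_wrt_zero[OF assms True])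
  ultimately show ?thesis by simp
 next
  case False
  define k where "k = (LEAST j. j \<le> l \<and> x \<le> a j)"
  have ex: "\<exists>j. j \<le> l \<and> x \<le> a j" using False by (force simp: P below_def not_less)
  have k: "k \<le> l" "x \<le> a k" using LeastI_ex[OF ex] by (auto simp: k_def)
  have below: "a j < x" if "j < k" for j using not_less_Least[OF that[unfolded k_def]] that k(1) by auto
  have "k \<noteq> 0"
  proof
   assume "k = 0"
   then have "x \<le> a j" if "j \<le> l" for j using k mono'[of 0 j] that by auto
   then show False using False by (force simp: P below_def)
  qed
  then have k1: "1 \<le> k" by simp
  have cut: "below P x = below P (a k)"
  proof -
   have "a j < x \<longleftrightarrow> a j < a k" if "j \<le> l" for j
    using below[of j] mono'[of k j] k mono[of j k] that by (cases "j < k") auto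
   then show ?thesis unfolding P below_def by auto
  qed
  have "elem_fun (l, a, \<lambda>j. f (a j)) x = (\<Sum>j=1..l. if j = k then f (a k) else 0)" unfolding elem_fun_eq
  proof (rule sum.cong[OF refl])
   fix j assume j: "j \<in> {1..l}"
   have "x \<in> {a (j - 1)<..a j} \<longleftrightarrow> j = k"
   proof
    assume x: "x \<in> {a (j - 1)<..a j}"
    show "j = k"
    proof (rule ccontr)
     assume "j \<noteq> k"
     then consider "j < k" | "k \<le> j - 1" by linarith
     then show False
     proof cases
      case 1 then show ?thesis using below[of j] x by auto
     next
      case 2
      moreover have "j - 1 \<le> l" using j by auto
      ultimately have "a k \<le> a (j - 1)" by (rule mono')
      then show ?thesis using k x by auto
     qed
    qed
   next
    assume "j = k" then show "x \<in> {a (j - 1)<..a j}" using below[of "k - 1"] k k1 by auto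
   qed
   then show "f (a j) * indicator {a (j - 1)<..a j} x = (if j = k then f (a k) else 0)"
    by (auto split: split_indicator)
  qed
  also have "... = f (a k)" using k1 k(1) by simp
  also have "... = f x" by (rule step_wrt_const[OF assms cut[symmetric]])
  finally show ?thesis .
 qed
 then show ?thesis using el by blast
qed

text \<open>Used for Lebesgue measure on a bounded interval (existence of the covariation) and for
  the measure with density \<open>norm_weight\<close> (density of elementary functions in the
  norm).\<close>

locale finite_borel = finite_measure \<nu> for \<nu> :: "real measure" +
 assumes sets_nu [measurable_cong]: "sets \<nu> = sets borel"
begin

definition steps_dense :: "(real \<Rightarrow> real) \<Rightarrow> bool" where
 "steps_dense f \<longleftrightarrow> f \<in> borel_measurable borel \<and>
   (\<forall>e>0. \<exists>P g. step_wrt P g \<and> g \<in> borel_measurable borel \<and> (\<integral>\<^sup>+x. ennreal ((f x - g x)^2) \<partial>\<nu>) \<le> ennreal e)"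

lemma square_triangle:
 assumes [measurable]: "f \<in> borel_measurable borel" "g \<in> borel_measurable borel" "h \<in> borel_measurable borel"
  and "(\<integral>\<^sup>+x. ennreal ((f x - g x)^2) \<partial>\<nu>) \<le> ennreal e" "(\<integral>\<^sup>+x. ennreal ((g x - h x)^2) \<partial>\<nu>) \<le> ennreal e'" "0 \<le> e" "0 \<le> e'"
 shows "(\<integral>\<^sup>+x. ennreal ((f x - h x)^2) \<partial>\<nu>) \<le> ennreal (2 * e + 2 * e')"
proof -
 have "(\<integral>\<^sup>+x. ennreal ((f x - h x)^2) \<partial>\<nu>) = (\<integral>\<^sup>+x. ennreal ((1 * (f x - g x) + 1 * (g x - h x))^2) \<partial>\<nu>)" by simp
 also have "... \<le> ennreal (2 * 1^2) * (\<integral>\<^sup>+x. ennreal ((f x - g x)^2) \<partial>\<nu>) + ennreal (2 * 1^2) * (\<integral>\<^sup>+x. ennreal ((g x - h x)^2) \<partial>\<nu>)"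
  by (rule nn_integral_square_lincomb) measurable
 also have "... \<le> ennreal (2 * 1^2) * ennreal e + ennreal (2 * 1^2) * ennreal e'" by (intro add_mono mult_left_mono assms) auto
 also have "... = ennreal (2 * e + 2 * e')" using assms(6,7) by (simp add: ennreal_mult)
 finally show ?thesis .
qed

lemma steps_dense_closed:
 assumes f: "f \<in> borel_measurable borel"
  and h: "\<And>e. 0 < e \<Longrightarrow> \<exists>h. steps_dense h \<and> (\<integral>\<^sup>+x. ennreal ((f x - h x)^2) \<partial>\<nu>) \<le> ennreal e"
 shows "steps_dense f"
 unfolding steps_dense_def
proof (intro conjI allI impI f)
 fix e :: real assume e: "0 < e"
 obtain h where h1: "steps_dense h" "(\<integral>\<^sup>+x. ennreal ((f x - h x)^2) \<partial>\<nu>) \<le> ennreal (e / 4)" using h[of "e / 4"] e by auto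
 obtain P g where g: "step_wrt P g" "g \<in> borel_measurable borel" "(\<integral>\<^sup>+x. ennreal ((h x - g x)^2) \<partial>\<nu>) \<le> ennreal (e / 4)"
  using h1(1) e unfolding steps_dense_def by (metis zero_less_divide_iff zero_less_numeral)
 have "(\<integral>\<^sup>+x. ennreal ((f x - g x)^2) \<partial>\<nu>) \<le> ennreal (2 * (e / 4) + 2 * (e / 4))"
  using h1 g e f by (intro square_triangle[of f h g]) (auto simp: steps_dense_def)
 then show "\<exists>P g. step_wrt P g \<and> g \<in> borel_measurable borel \<and> (\<integral>\<^sup>+x. ennreal ((f x - g x)^2) \<partial>\<nu>) \<le> ennreal e"
  using g by auto
qed

lemma steps_dense_lincomb:
 assumes f: "steps_dense f" and g: "steps_dense g"
 shows "steps_dense (\<lambda>x. c * f x + d * g x)"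
 unfolding steps_dense_def
proof (intro conjI allI impI)
 have [measurable]: "f \<in> borel_measurable borel" "g \<in> borel_measurable borel" using f g by (auto simp: steps_dense_def)
 show "(\<lambda>x. c * f x + d * g x) \<in> borel_measurable borel" by measurable
 fix e :: real assume e: "0 < e"
 \<comment> \<open>The 1 keeps \<open>k\<close> positive when both coefficients vanish.\<close>
 define k where "k = 2 * c^2 + 2 * d^2 + 1"
 have k: "0 < k" "2 * c^2 + 2 * d^2 \<le> k" by (auto simp: k_def intro: add_nonneg_pos)
 have ek: "0 < e / k" using e k by simp
 obtain P f' where f': "step_wrt P f'" and [measurable]: "f' \<in> borel_measurable borel" and If: "(\<integral>\<^sup>+x. ennreal ((f x - f' x)^2) \<partial>\<nu>) \<le> ennreal (e / k)"
  using f ek unfolding steps_dense_def by metis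
 obtain Q g' where g': "step_wrt Q g'" and [measurable]: "g' \<in> borel_measurable borel" and Ig: "(\<integral>\<^sup>+x. ennreal ((g x - g' x)^2) \<partial>\<nu>) \<le> ennreal (e / k)"
  using g ek unfolding steps_dense_def by metis
 have "(\<integral>\<^sup>+x. ennreal ((c * f x + d * g x - (c * f' x + d * g' x))^2) \<partial>\<nu>)
  = (\<integral>\<^sup>+x. ennreal ((c * (f x - f' x) + d * (g x - g' x))^2) \<partial>\<nu>)" by (simp add: algebra_simps)
 also have "... \<le> ennreal (2 * c^2) * (\<integral>\<^sup>+x. ennreal ((f x - f' x)^2) \<partial>\<nu>) + ennreal (2 * d^2) * (\<integral>\<^sup>+x. ennreal ((g x - g' x)^2) \<partial>\<nu>)"
  by (rule nn_integral_square_lincomb) measurable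
 also have "... \<le> ennreal (2 * c^2) * ennreal (e / k) + ennreal (2 * d^2) * ennreal (e / k)"
  by (intro add_mono mult_left_mono If Ig) auto
 also have "... = ennreal ((2 * c^2 + 2 * d^2) * (e / k))"
 proof -
  have "ennreal (2 * c^2) * ennreal y + ennreal (2 * d^2) * ennreal y = ennreal ((2 * c^2 + 2 * d^2) * y)" if "0 \<le> y" for y
   using that by (simp add: distrib_right ennreal_mult)
  then show ?thesis using ek less_imp_le by blast
 qed
 also have "... \<le> ennreal (k * (e / k))" using k ek by (intro ennreal_leI mult_right_mono) auto
 also have "k * (e / k) = e" using k by simp
 finally show "\<exists>P h. step_wrt P h \<and> h \<in> borel_measurable borel \<and> (\<integral>\<^sup>+x. ennreal ((c * f x + d * g x - h x)^2) \<partial>\<nu>) \<le> ennreal e"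
  using step_wrt_lincomb[OF f' g', of c d] by (intro exI[of _ "P \<union> Q"] exI[of _ "\<lambda>x. c * f' x + d * g' x"]) simp
qed

lemma steps_dense_Ioc: "steps_dense (indicator {a<..b})"
 unfolding steps_dense_def using step_wrt_Ioc[of a b] by (auto intro!: exI[of _ "{a, b}"] exI[of _ "indicator {a<..b}"])

lemma steps_dense_seq:
 assumes f [measurable]: "f \<in> borel_measurable borel" and F: "\<And>n. steps_dense (F n)"
  and lim: "\<And>x. (\<lambda>n. F n x) \<longlonglongrightarrow> f x"
  and bound: "\<And>n x. \<bar>F n x\<bar> \<le> \<bar>f x\<bar>" and sq: "(\<integral>\<^sup>+x. ennreal ((f x)^2) \<partial>\<nu>) < \<infinity>"
 shows "steps_dense f"
proof (rule steps_dense_closed[OF f])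
 fix e :: real assume e: "0 < e"
 have [measurable]: "F n \<in> borel_measurable borel" for n using F by (simp add: steps_dense_def)
 have "(\<lambda>n. \<integral>\<^sup>+x. ennreal ((f x - F n x)^2) \<partial>\<nu>) \<longlonglongrightarrow> (\<integral>\<^sup>+x. 0 \<partial>\<nu>)"
 proof (rule nn_integral_dominated_convergence[where w="\<lambda>x. 4 * ennreal ((f x)^2)"])
  show "AE x in \<nu>. ennreal ((f x - F n x)^2) \<le> 4 * ennreal ((f x)^2)" for n
  proof (rule AE_I2)
   fix x
   have "\<bar>f x - F n x\<bar> \<le> 2 * \<bar>f x\<bar>" using bound[of n x] by linarith
   then have "(f x - F n x)^2 \<le> (2 * \<bar>f x\<bar>)^2" by (metis power2_abs power_mono abs_ge_zero)
   then have "ennreal ((f x - F n x)^2) \<le> ennreal (4 * (f x)^2)" by (intro ennreal_leI) (simp add: power_mult_distrib)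
   then show "ennreal ((f x - F n x)^2) \<le> 4 * ennreal ((f x)^2)" by (simp add: ennreal_mult)
  qed
  show "AE x in \<nu>. (\<lambda>n. ennreal ((f x - F n x)^2)) \<longlonglongrightarrow> 0"
  proof (rule AE_I2)
   fix x
   have "(\<lambda>n. ennreal ((f x - F n x)^2)) \<longlonglongrightarrow> ennreal ((f x - f x)^2)" by (intro tendsto_intros lim)
   then show "(\<lambda>n. ennreal ((f x - F n x)^2)) \<longlonglongrightarrow> 0" by simp
  qed
  show "(\<integral>\<^sup>+x. 4 * ennreal ((f x)^2) \<partial>\<nu>) < \<infinity>" using sq by (simp add: nn_integral_cmult ennreal_mult_less_top)
 qed auto
 then have "eventually (\<lambda>n. (\<integral>\<^sup>+x. ennreal ((f x - F n x)^2) \<partial>\<nu>) < ennreal e) sequentially"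
  using e by (intro order_tendstoD) auto
 then obtain n where "(\<integral>\<^sup>+x. ennreal ((f x - F n x)^2) \<partial>\<nu>) < ennreal e" by (auto simp: eventually_sequentially)
 then show "\<exists>h. steps_dense h \<and> (\<integral>\<^sup>+x. ennreal ((f x - h x)^2) \<partial>\<nu>) \<le> ennreal e" using F by (auto intro: less_imp_le)
qed

lemma steps_dense_UNIV: "steps_dense (\<lambda>x. 1)"
proof (rule steps_dense_seq)
 show "steps_dense (indicator {- real n<..real n})" for n by (rule steps_dense_Ioc)
 show "(\<lambda>n. indicator {- real n<..real n} x) \<longlonglongrightarrow> (1::real)" for x
 proof -
  obtain m where m: "\<bar>x\<bar> < real m" using reals_Archimedean2 by blast
  have "eventually (\<lambda>n. indicator {- real n<..real n} x = (1::real)) sequentially" unfolding eventually_sequentially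
  proof (intro exI[of _ m] allI impI)
   fix n assume "m \<le> n"
   then have "real m \<le> real n" by simp
   then have "x \<in> {- real n<..real n}" using m by auto
   then show "indicator {- real n<..real n} x = (1::real)" by simp
  qed
  then show ?thesis by (rule tendsto_eventually)
 qed
 show "(\<integral>\<^sup>+x. ennreal (1^2) \<partial>\<nu>) < \<infinity>" by (simp add: less_top[symmetric])
qed (auto split: split_indicator)

text \<open>Half-open intervals are an intersection-stable generator of the Borel sets; complements
  and countable disjoint unions preserve density because the measure is finite.\<close>

lemma steps_dense_indicator:
 assumes "A \<in> sets borel"
 shows "steps_dense (indicator A)"
proof -
 let ?G = "range (\<lambda>(a, b). {a<..b::real})"
 have A: "A \<in> sigma_sets UNIV ?G" using assms unfolding borel_sigma_sets_Ioc by (simp add: sets_measure_of)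
 have st: "Int_stable ?G"
 proof (rule Int_stableI_image)
  fix i j :: "real \<times> real"
  show "\<exists>k\<in>UNIV. (case i of (a, b) \<Rightarrow> {a<..b}) \<inter> (case j of (a, b) \<Rightarrow> {a<..b}) = (case k of (a, b) \<Rightarrow> {a<..b})"
   by (intro bexI[of _ "(max (fst i) (fst j), min (snd i) (snd j))"]) (auto simp: split_beta)
 qed
 have sub: "?G \<subseteq> Pow UNIV" by simp
 from st sub A show ?thesis
 proof (induction rule: sigma_sets_induct_disjoint)
  case (basic A)
  then show ?case using steps_dense_Ioc by auto
 next
  case empty
  then show ?case using steps_dense_lincomb[OF steps_dense_UNIV steps_dense_UNIV, of 0 0] by simp
 next
  case (compl A)
  have "(indicator (UNIV - A) :: real \<Rightarrow> real) = (\<lambda>x. 1 * 1 + (-1) * indicator A x)" by (auto split: split_indicator)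
  then show ?case using steps_dense_lincomb[OF steps_dense_UNIV compl(2), of 1 "-1"] by simp
 next
  case (union A)
  have Am: "A i \<in> sets borel" for i using union(2) unfolding borel_sigma_sets_Ioc by (auto simp: sets_measure_of)
  have part: "steps_dense (indicator (\<Union>i<n. A i))" for n
  proof (induction n)
   case 0
   then show ?case using steps_dense_lincomb[OF steps_dense_UNIV steps_dense_UNIV, of 0 0] by simp
  next
   case (Suc n)
   have "A n \<inter> A i = {}" if "i < n" for i using disjoint_family_onD[OF union(1), of n i] that by simp
   then have disj: "A n \<inter> (\<Union>i<n. A i) = {}" by (simp add: Int_UN_distrib)
   have "(indicator (\<Union>i<Suc n. A i) :: real \<Rightarrow> real) = (\<lambda>x. 1 * indicator (A n) x + 1 * indicator (\<Union>i<n. A i) x)"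
    by (rule ext) (use disj in \<open>auto simp: lessThan_Suc split: split_indicator\<close>)
   then show ?case using steps_dense_lincomb[OF union(3)[of n] Suc, of 1 1] by simp
  qed
  show ?case
  proof (rule steps_dense_seq[OF _ part])
   show "(\<lambda>n. indicator (\<Union>i<n. A i) x) \<longlonglongrightarrow> (indicator (\<Union>i. A i) x :: real)" for x
    using LIMSEQ_indicator_UN[of A x] by simp
   show "(\<integral>\<^sup>+x. ennreal ((indicator (\<Union>i. A i) x)^2) \<partial>\<nu>) < \<infinity>"
   proof -
    have "(\<integral>\<^sup>+x. ennreal ((indicator (\<Union>i. A i) x)^2) \<partial>\<nu>) \<le> (\<integral>\<^sup>+x. 1 \<partial>\<nu>)"
     by (intro nn_integral_mono) (auto split: split_indicator)
    also have "... < \<infinity>" by (simp add: less_top[symmetric])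
    finally show ?thesis .
   qed
  qed (use Am in \<open>auto split: split_indicator\<close>)
 qed
qed

lemma steps_dense_nonneg:
 assumes "f \<in> borel_measurable borel" "\<And>x. 0 \<le> f x" "(\<integral>\<^sup>+x. ennreal ((f x)^2) \<partial>\<nu>) < \<infinity>"
 shows "steps_dense f"
 using assms(1,2,3)
proof (induction rule: borel_measurable_induct_real)
 case (set A)
 then show ?case by (simp add: steps_dense_indicator)
next
 case (mult u c)
 show ?case
 proof (cases "c = 0")
  case True
  then show ?thesis using steps_dense_lincomb[OF steps_dense_UNIV steps_dense_UNIV, of 0 0] by simp
 next
  case False
  then have c: "0 < c" using mult by simp
  have [measurable]: "u \<in> borel_measurable borel" using mult by simp
  have "(\<integral>\<^sup>+x. ennreal ((c * u x)^2) \<partial>\<nu>) = ennreal (c^2) * (\<integral>\<^sup>+x. ennreal ((u x)^2) \<partial>\<nu>)"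
   by (simp add: power_mult_distrib ennreal_mult' nn_integral_cmult)
  then have "(\<integral>\<^sup>+x. ennreal ((u x)^2) \<partial>\<nu>) < \<infinity>" using mult(5) c by (auto simp: ennreal_mult_less_top)
  then show ?thesis using steps_dense_lincomb[OF mult.IH steps_dense_UNIV, of c 0] by simp
 qed
next
 case (add u v)
 have le: "(\<integral>\<^sup>+x. ennreal ((w x)^2) \<partial>\<nu>) < \<infinity>" if "\<And>x. 0 \<le> w x \<and> w x \<le> u x + v x" for w
 proof -
  have "(\<integral>\<^sup>+x. ennreal ((w x)^2) \<partial>\<nu>) \<le> (\<integral>\<^sup>+x. ennreal ((v x + u x)^2) \<partial>\<nu>)"
   using that by (intro nn_integral_mono ennreal_leI power_mono) (auto simp: add.commute)
  also have "... < \<infinity>" using add.prems by (simp add: add.commute)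
  finally show ?thesis .
 qed
 have "steps_dense u" "steps_dense v" using add le[of u] le[of v] by auto
 then show ?case using steps_dense_lincomb[of v u 1 1] by (simp add: add.commute)
next
 case (seq U)
 have inc: "U i x \<le> f x" for i x
  using seq by (intro LIMSEQ_le_const[of "\<lambda>i. U i x"]) (auto simp: incseq_def le_fun_def intro!: exI[of _ i])
 have "(\<integral>\<^sup>+x. ennreal ((U i x)^2) \<partial>\<nu>) < \<infinity>" for i
 proof -
  have "(\<integral>\<^sup>+x. ennreal ((U i x)^2) \<partial>\<nu>) \<le> (\<integral>\<^sup>+x. ennreal ((f x)^2) \<partial>\<nu>)"
   using inc seq by (intro nn_integral_mono ennreal_leI power_mono) auto
  then show ?thesis using seq.prems by (rule le_less_trans)
 qed
 then have "steps_dense (U i)" for i using seq by simp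
 moreover have "\<bar>U i x\<bar> \<le> \<bar>f x\<bar>" for i x using inc[of i x] seq(2)[of i x] by simp
 moreover have "f \<in> borel_measurable borel" using assms(1) .
 ultimately show ?case using seq by (intro steps_dense_seq[of f U]) auto
qed

theorem elementary_dense:
 assumes [measurable]: "f \<in> borel_measurable borel" and sq: "(\<integral>\<^sup>+x. ennreal ((f x)^2) \<partial>\<nu>) < \<infinity>" and e: "0 < e"
 shows "\<exists>g. is_elementary g \<and> (\<integral>\<^sup>+x. ennreal ((elem_fun g x - f x)^2) \<partial>\<nu>) \<le> ennreal e"
proof -
 have le: "(\<integral>\<^sup>+x. ennreal ((w x)^2) \<partial>\<nu>) < \<infinity>" if "\<And>x. \<bar>w x\<bar> \<le> \<bar>f x\<bar>" for w
 proof -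
  have "(\<integral>\<^sup>+x. ennreal ((w x)^2) \<partial>\<nu>) \<le> (\<integral>\<^sup>+x. ennreal ((f x)^2) \<partial>\<nu>)"
  proof (intro nn_integral_mono ennreal_leI)
   fix x show "(w x)^2 \<le> (f x)^2" using power_mono[OF that[of x], of 2] by simp
  qed
  then show ?thesis using sq by (rule le_less_trans)
 qed
 have "steps_dense (\<lambda>x. max 0 (f x))" "steps_dense (\<lambda>x. max 0 (- f x))" by (intro steps_dense_nonneg le; auto)+
 from steps_dense_lincomb[OF this, of 1 "-1"] have "steps_dense (\<lambda>x. 1 * max 0 (f x) + (-1) * max 0 (- f x))" .
 moreover have "(\<lambda>x. 1 * max 0 (f x) + (-1) * max 0 (- f x)) = f" by (auto simp: max_def)
 ultimately have "steps_dense f" by simp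
 then obtain P g where "step_wrt P g" "(\<integral>\<^sup>+x. ennreal ((f x - g x)^2) \<partial>\<nu>) \<le> ennreal e"
  using e unfolding steps_dense_def by metis
 moreover obtain g' where "is_elementary g'" "elem_fun g' = g" using step_wrt_elementary[OF \<open>step_wrt P g\<close>] by blast
 moreover have "(\<integral>\<^sup>+x. ennreal ((g x - f x)^2) \<partial>\<nu>) = (\<integral>\<^sup>+x. ennreal ((f x - g x)^2) \<partial>\<nu>)"
  by (intro nn_integral_cong) (simp add: power2_commute)
 ultimately show ?thesis by (intro exI[of _ g'] conjI) simp_all
qed

end

section \<open>Existence of the covariation\<close>

text \<open>The triangle with support \<open>{0..2}\<close>, height 1 and unit mass, written as a
  second difference of positive parts. Its primitive \<open>ramp1\<close> is a step from 0 to 1 with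
  Lipschitz derivative, as \<open>qc_smooth_limit\<close> requires.\<close>

definition hat :: "real \<Rightarrow> real" where
 "hat x = max 0 x - 2 * max 0 (x - 1) + max 0 (x - 2)"

definition ramp1 :: "real \<Rightarrow> real" where
 "ramp1 x = ((max 0 x)^2 - 2 * (max 0 (x - 1))^2 + (max 0 (x - 2))^2) / 2"

lemma DERIV_positive_part_square: "((\<lambda>x. (max 0 x)^2) has_real_derivative 2 * max 0 x) (at x)"
proof (cases x "0::real" rule: linorder_cases)
 case less
 have "((\<lambda>x. 0) has_real_derivative 0) (at x)" by simp
 then have "((\<lambda>x. (max 0 x)^2) has_real_derivative 0) (at x)"
  by (rule has_field_derivative_transform_within_open[where S="{..<0}"]) (use less in auto)
 then show ?thesis using less by simp
next
 case equal
 have "((\<lambda>h. (max 0 h)^2 / h) \<longlongrightarrow> 0) (at (0::real))"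
 proof (rule Lim_null_comparison)
  show "eventually (\<lambda>h. norm ((max 0 h)^2 / h) \<le> \<bar>h\<bar>) (at (0::real))"
   by (rule always_eventually) (auto simp: max_def power2_eq_square)
  show "((\<lambda>h. \<bar>h\<bar>) \<longlongrightarrow> 0) (at (0::real))" by (rule tendsto_eq_intros | simp)+
 qed
 then show ?thesis using equal by (simp add: DERIV_def)
next
 case greater
 have "((\<lambda>x. x^2) has_real_derivative 2 * x) (at x)" by (auto intro!: derivative_eq_intros)
 then have "((\<lambda>x. (max 0 x)^2) has_real_derivative 2 * x) (at x)"
  by (rule has_field_derivative_transform_within_open[where S="{0<..}"]) (use greater in auto)
 then show ?thesis using greater by simp
qed

lemma DERIV_ramp1: "(ramp1 has_real_derivative hat x) (at x)"
proof -
 have sh: "((\<lambda>x. (max 0 (x - c))^2) has_real_derivative 2 * max 0 (x - c)) (at x)" for c :: real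
  using DERIV_chain2[OF DERIV_positive_part_square, of "\<lambda>x. x - c" 1 x UNIV] by (simp add: DERIV_diff[OF DERIV_ident DERIV_const, simplified])
 have "((\<lambda>x. ((max 0 (x - 0))^2 - 2 * (max 0 (x - 1))^2 + (max 0 (x - 2))^2) / 2) has_real_derivative
   (2 * max 0 (x - 0) - 2 * (2 * max 0 (x - 1)) + 2 * max 0 (x - 2)) / 2) (at x)"
  by (intro DERIV_cdivide DERIV_add DERIV_diff DERIV_cmult sh)
 then show ?thesis by (simp add: ramp1_def[abs_def] hat_def algebra_simps add_divide_distrib diff_divide_distrib)
qed

lemma hat_bounds: "0 \<le> hat x" "hat x \<le> 1" "hat x \<noteq> 0 \<Longrightarrow> x \<in> {0..2}"
 by (auto simp: hat_def max_def split: if_splits)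

lemma hat_lipschitz: "\<bar>hat x - hat y\<bar> \<le> 4 * \<bar>x - y\<bar>"
 by (auto simp: hat_def max_def abs_if)

lemma ramp1_bounds: "0 \<le> ramp1 x" "ramp1 x \<le> 1" "x \<le> 0 \<Longrightarrow> ramp1 x = 0" "2 \<le> x \<Longrightarrow> ramp1 x = 1"
proof -
 consider "x \<le> 0" | "0 < x" "x \<le> 1" | "1 < x" "x \<le> 2" | "2 < x" by linarith
 then have "0 \<le> ramp1 x \<and> ramp1 x \<le> 1"
 proof cases
  case 2
  then have "x^2 \<le> 1" by (simp add: power_le_one)
  then show ?thesis using 2 by (simp add: ramp1_def)
 next
  case 3
  then have e: "ramp1 x = 1 - (2 - x)^2 / 2" by (simp add: ramp1_def power2_eq_square field_simps)
  have "(2 - x)^2 \<le> 1" using 3 by (intro power_le_one) auto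
  then show ?thesis unfolding e by simp
 qed (simp_all add: ramp1_def power2_eq_square algebra_simps)
 then show "0 \<le> ramp1 x" "ramp1 x \<le> 1" by auto
 show "x \<le> 0 \<Longrightarrow> ramp1 x = 0" by (simp add: ramp1_def)
 show "2 \<le> x \<Longrightarrow> ramp1 x = 1" by (simp add: ramp1_def power2_eq_square algebra_simps)
qed

definition ramp :: "real \<Rightarrow> real \<Rightarrow> real \<Rightarrow> real" where
 "ramp a d x = ramp1 ((x - a) / d)"

text \<open>An approximate Dirac mass at \<open>a\<close>, supported on
  \<open>{a..a + 2 * d}\<close>.\<close>

definition ramp' :: "real \<Rightarrow> real \<Rightarrow> real \<Rightarrow> real" where
 "ramp' a d x = hat ((x - a) / d) / d"

lemma hat_measurable [measurable]: "hat \<in> borel_measurable borel"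
 unfolding hat_def[abs_def] by measurable

lemma ramp_measurable [measurable]: "ramp a d \<in> borel_measurable borel" "ramp' a d \<in> borel_measurable borel"
 unfolding ramp_def[abs_def] ramp1_def ramp'_def[abs_def] by measurable

lemma DERIV_ramp: "0 < d \<Longrightarrow> (ramp a d has_real_derivative ramp' a d x) (at x)"
proof -
 have "((\<lambda>x. (x - a) / d) has_real_derivative 1 / d) (at x)"
  by (rule DERIV_cdivide) (auto intro!: derivative_eq_intros)
 from DERIV_chain2[OF DERIV_ramp1 this] show ?thesis by (simp add: ramp_def[abs_def] ramp'_def)
qed

lemma ramp'_bounds:
 assumes "0 < d"
 shows "0 \<le> ramp' a d x" "\<bar>ramp' a d x\<bar> \<le> 1 / d" "\<bar>ramp' a d x - ramp' a d y\<bar> \<le> 4 / d^2 * \<bar>x - y\<bar>"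
proof -
 show "0 \<le> ramp' a d x" "\<bar>ramp' a d x\<bar> \<le> 1 / d"
  using hat_bounds[of "(x - a) / d"] assms by (auto simp: ramp'_def divide_right_mono)
 have "\<bar>hat ((x - a) / d) - hat ((y - a) / d)\<bar> / d \<le> 4 * \<bar>(x - a) / d - (y - a) / d\<bar> / d"
  using assms by (intro divide_right_mono hat_lipschitz) auto
 also have "(x - a) / d - (y - a) / d = (x - y) / d" by (simp add: diff_divide_distrib)
 also have "4 * \<bar>(x - y) / d\<bar> / d = 4 / d^2 * \<bar>x - y\<bar>" using assms by (simp add: power2_eq_square)
 finally show "\<bar>ramp' a d x - ramp' a d y\<bar> \<le> 4 / d^2 * \<bar>x - y\<bar>"
  using assms by (simp add: ramp'_def abs_divide diff_divide_distrib[symmetric])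
qed

text \<open>The squared difference is at most 1 and vanishes off an interval of length
  \<open>2 * d\<close>.\<close>

lemma ramp_approximates_step:
 assumes d: "0 < d"
 shows "(\<integral>\<^sup>+x\<in>S. ennreal ((indicator {a<..} x - ramp a d x)^2) \<partial>lborel) \<le> ennreal (2 * d)"
proof -
 have "(\<integral>\<^sup>+x\<in>S. ennreal ((indicator {a<..} x - ramp a d x)^2) \<partial>lborel) \<le> (\<integral>\<^sup>+x. indicator {a..a + 2 * d} x \<partial>lborel)"
 proof (rule nn_integral_mono)
  fix x
  have "x \<in> {a..a + 2 * d} \<or> indicator {a<..} x = ramp a d x"
  proof (cases "x < a \<or> a + 2 * d < x")
   case True
   then have "(x - a) / d \<le> 0 \<and> x < a \<or> 2 \<le> (x - a) / d \<and> a < x"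
    using d by (auto simp: divide_le_0_iff pos_le_divide_eq)
   then show ?thesis using ramp1_bounds(3,4)[of "(x - a) / d"] by (auto simp: ramp_def)
  qed auto
  moreover have "(indicator {a<..} x - ramp a d x)^2 \<le> 1"
  proof -
   have "\<bar>indicator {a<..} x - ramp a d x\<bar> \<le> 1"
    using ramp1_bounds(1,2)[of "(x - a) / d"] by (auto simp: ramp_def split: split_indicator)
   then show ?thesis by (simp add: abs_square_le_1)
  qed
  ultimately show "ennreal ((indicator {a<..} x - ramp a d x)^2) * indicator S x \<le> indicator {a..a + 2 * d} x"
   by (auto simp: ennreal_le_1 split: split_indicator)
 qed
 then show ?thesis using d by simp
qed

lemma L2loc_ramp: "L2loc (ramp a d)"
 by (rule L2loc_bounded[where c=1]) (use ramp1_bounds in \<open>auto simp: ramp_def abs_le_iff intro: order_trans\<close>)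

lemma L2loc_indicator: "A \<in> sets borel \<Longrightarrow> L2loc (indicator A)"
 by (rule L2loc_bounded[where c=1]) (auto split: split_indicator)

lemma elem_fun_steps:
 assumes "is_elementary (l, a, c)"
 shows "elem_fun (l, a, c) x = (\<Sum>j=1..l. c j * (1 * indicator {a (j - 1)<..} x + (-1) * indicator {a j<..} x))"
 unfolding elem_fun_eq
proof (rule sum.cong[OF refl])
 fix j assume j: "j \<in> {1..l}"
 have "a (j - 1) < a j" using assms j by (auto simp: is_elementary_def strict_mono_on_def)
 then show "c j * indicator {a (j - 1)<..a j} x = c j * (1 * indicator {a (j - 1)<..} x + (-1) * indicator {a j<..} x)"
  by (auto split: split_indicator)
qed

lemma finite_borel_interval: "finite_borel (density lborel (indicator {-N..N::real}))"
proof -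
 have "finite_measure (density lborel (indicator {-N..N::real}))"
 proof (rule finite_measureI)
  have "emeasure (density lborel (indicator {-N..N::real})) UNIV = (\<integral>\<^sup>+x. indicator {-N..N} x * indicator UNIV x \<partial>lborel)"
   by (rule emeasure_density) auto
  also have "... = emeasure lborel {-N..N}" by simp
  finally show "emeasure (density lborel (indicator {-N..N::real})) (space (density lborel (indicator {-N..N}))) \<noteq> \<infinity>"
   by (simp add: emeasure_lborel_Icc_eq)
 qed
 then show ?thesis unfolding finite_borel_def finite_borel_axioms_def by simp
qed

section \<open>Linearity and closure properties of the covariation\<close>

context fbm
begin

lemma near_refl: "0 \<le> \<eta> \<Longrightarrow> near T X X \<eta>"
 unfolding near_def by (intro bexI[of _ "{}"]) auto

text \<open>The 2 in the constant pays for the union of the two exceptional events, the coefficients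
  for the values.\<close>

lemma near_lincomb:
 assumes "near T X Y \<eta>" "near T X' Y' \<eta>" and "0 \<le> \<eta>"
 shows "near T (\<lambda>t w. c * X t w + d * X' t w) (\<lambda>t w. c * Y t w + d * Y' t w) ((\<bar>c\<bar> + \<bar>d\<bar> + 2) * \<eta>)"
proof -
 obtain A where A: "A \<in> events" "prob A \<le> \<eta>" "\<And>w t. w \<in> space M - A \<Longrightarrow> t \<in> {0..T} \<Longrightarrow> \<bar>X t w - Y t w\<bar> \<le> \<eta>"
  using assms(1) unfolding near_def by blast
 obtain C where C: "C \<in> events" "prob C \<le> \<eta>" "\<And>w t. w \<in> space M - C \<Longrightarrow> t \<in> {0..T} \<Longrightarrow> \<bar>X' t w - Y' t w\<bar> \<le> \<eta>"
  using assms(2) unfolding near_def by blast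
 have cd: "0 \<le> (\<bar>c\<bar> + \<bar>d\<bar>) * \<eta>" using assms(3) by simp
 have "prob (A \<union> C) \<le> (\<bar>c\<bar> + \<bar>d\<bar> + 2) * \<eta>" using measure_Un_le[OF A(1) C(1)] A(2) C(2) cd by (simp add: distrib_right)
 moreover have "\<bar>c * X t w + d * X' t w - (c * Y t w + d * Y' t w)\<bar> \<le> (\<bar>c\<bar> + \<bar>d\<bar> + 2) * \<eta>"
  if "w \<in> space M - (A \<union> C)" "t \<in> {0..T}" for w t
 proof -
  have "c * X t w + d * X' t w - (c * Y t w + d * Y' t w) = c * (X t w - Y t w) + d * (X' t w - Y' t w)"
   by (simp add: algebra_simps)
  also have "\<bar>...\<bar> \<le> \<bar>c\<bar> * \<bar>X t w - Y t w\<bar> + \<bar>d\<bar> * \<bar>X' t w - Y' t w\<bar>"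
   by (intro order_trans[OF abs_triangle_ineq]) (simp add: abs_mult)
  also have "... \<le> \<bar>c\<bar> * \<eta> + \<bar>d\<bar> * \<eta>" using A(3)[of w t] C(3)[of w t] that by (intro add_mono mult_left_mono) auto
  also have "... \<le> (\<bar>c\<bar> + \<bar>d\<bar> + 2) * \<eta>" using assms(3) by (simp add: distrib_right)
  finally show ?thesis .
 qed
 ultimately show ?thesis unfolding near_def using A(1) C(1) by blast
qed

abbreviation has_qc :: "real \<Rightarrow> (real \<Rightarrow> real) \<Rightarrow> (real \<Rightarrow> 'a \<Rightarrow> real) \<Rightarrow> bool" where
 "has_qc T f Q \<equiv> is_generalized_qc M H T B f Q"

lemma has_qc_iff: "has_qc T f Q \<longleftrightarrow> (\<forall>t\<in>{0..T}. Q t \<in> borel_measurable M) \<and>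
  (\<forall>\<eta>>0. eventually (\<lambda>\<epsilon>. near T (qc_approx H B f \<epsilon>) Q \<eta>) (at_right 0))"
 unfolding is_generalized_qc_def ucp_limit_iff_near ..

lemma eventually_small: "eventually (\<lambda>\<epsilon>::real. \<epsilon> \<in> {0<..1}) (at_right 0)"
 unfolding eventually_at_right_field by (auto intro!: exI[of _ 1])

lemma eventually_at_right_obtain:
 assumes "eventually P (at_right (0::real))" obtains \<epsilon> where "P \<epsilon>" "\<epsilon> \<in> {0<..1}"
 using eventually_happens'[OF _ eventually_conj[OF assms eventually_small]] by auto

lemma has_qc_close:
 assumes f: "has_qc T f Q" and g: "has_qc T g Q'" and \<kappa>: "0 < \<kappa>"
  and n: "\<And>\<epsilon>. \<epsilon> \<in> {0<..1} \<Longrightarrow> near T (qc_approx H B f \<epsilon>) (qc_approx H B g \<epsilon>) \<eta>"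
 shows "near T Q Q' (\<eta> + \<kappa>)"
proof -
 have "eventually (\<lambda>\<epsilon>. near T (qc_approx H B f \<epsilon>) Q (\<kappa> / 2)) (at_right 0)" using f \<kappa> unfolding has_qc_iff by simp
 moreover have "eventually (\<lambda>\<epsilon>. near T (qc_approx H B g \<epsilon>) Q' (\<kappa> / 2)) (at_right 0)" using g \<kappa> unfolding has_qc_iff by simp
 ultimately obtain \<epsilon> where e: "near T (qc_approx H B f \<epsilon>) Q (\<kappa> / 2) \<and> near T (qc_approx H B g \<epsilon>) Q' (\<kappa> / 2)" "\<epsilon> \<in> {0<..1}"
  using eventually_at_right_obtain[OF eventually_conj] by blast
 have "near T Q Q' (\<kappa> / 2 + (\<eta> + \<kappa> / 2))" by (rule near_triangle[OF near_sym near_triangle[OF n]]) (use e in auto)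
 moreover have "\<kappa> / 2 + (\<eta> + \<kappa> / 2) = \<eta> + \<kappa>" by simp
 ultimately show ?thesis by (simp only:)
qed

lemma has_qc_lincomb:
 assumes f: "has_qc T f Q" "L2loc f" and g: "has_qc T g Q'" "L2loc g" and T: "0 < T"
 shows "has_qc T (\<lambda>x. c * f x + d * g x) (\<lambda>t w. c * Q t w + d * Q' t w)"
 unfolding has_qc_iff
proof (intro conjI ballI allI impI)
 fix t assume "t \<in> {0..T}"
 then have [measurable]: "Q t \<in> borel_measurable M" "Q' t \<in> borel_measurable M" using f g unfolding has_qc_iff by auto
 show "(\<lambda>w. c * Q t w + d * Q' t w) \<in> borel_measurable M" by measurable
next
 fix \<eta> :: real assume \<eta>: "0 < \<eta>"
 define k where "k = \<bar>c\<bar> + \<bar>d\<bar> + 2"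
 have k: "0 < k" by (simp add: k_def add_nonneg_pos)
 have "eventually (\<lambda>\<epsilon>. near T (qc_approx H B f \<epsilon>) Q (\<eta> / k)) (at_right 0)" "eventually (\<lambda>\<epsilon>. near T (qc_approx H B g \<epsilon>) Q' (\<eta> / k)) (at_right 0)"
  using f g \<eta> k unfolding has_qc_iff by simp_all
 then show "eventually (\<lambda>\<epsilon>. near T (qc_approx H B (\<lambda>x. c * f x + d * g x) \<epsilon>) (\<lambda>t w. c * Q t w + d * Q' t w) \<eta>) (at_right 0)"
  using eventually_small
 proof eventually_elim
  case (elim \<epsilon>)
  have "near T (\<lambda>t w. c * qc_approx H B f \<epsilon> t w + d * qc_approx H B g \<epsilon> t w) (\<lambda>t w. c * Q t w + d * Q' t w) (k * (\<eta> / k))"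
   unfolding k_def by (rule near_lincomb) (use elim \<eta> k in \<open>auto simp: k_def\<close>)
  then have "near T (\<lambda>t w. c * qc_approx H B f \<epsilon> t w + d * qc_approx H B g \<epsilon> t w) (\<lambda>t w. c * Q t w + d * Q' t w) \<eta>"
   using k by simp
  moreover have "AE w in M. \<forall>t\<in>{0..T}. qc_approx H B (\<lambda>x. c * f x + d * g x) \<epsilon> t w
    = c * qc_approx H B f \<epsilon> t w + d * qc_approx H B g \<epsilon> t w \<and> c * Q t w + d * Q' t w = c * Q t w + d * Q' t w"
   using qc_approx_lincomb[OF f(2) g(2) T, of \<epsilon> c d] elim by simp
  ultimately show ?case by (rule near_AE_cong)
 qed
qed

text \<open>The estimate of \<open>qc_approx_near\<close> is uniform in \<open>\<epsilon>\<close>,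
  so the covariations of approximating functions \<open>g n\<close> form a Cauchy sequence, and its
  limit is also the covariation of \<open>f\<close>. Level \<open>n + 3\<close> leaves the room
  needed: \<open>1/8 + 1/16 + 1/8 \<le> 1\<close>.\<close>

lemma has_qc_exists_limit:
 assumes T: "0 < T" and f: "L2loc f"
  and g: "\<And>(N::nat) d. 0 < d \<Longrightarrow> \<exists>g Q. L2loc g \<and> has_qc T g Q \<and> (\<integral>\<^sup>+x\<in>{-real N..real N}. ennreal ((f x - g x)^2) \<partial>lborel) \<le> ennreal d"
 shows "\<exists>Q. has_qc T f Q"
proof -
 have "\<exists>g Q. has_qc T g Q \<and> (\<forall>\<epsilon>\<in>{0<..1}. near T (qc_approx H B f \<epsilon>) (qc_approx H B g \<epsilon>) (1 / 2 ^ (n + 3)))" for n :: nat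
 proof -
  obtain N d where d: "0 < d" and nr: "\<forall>f g. L2loc f \<longrightarrow> L2loc g \<longrightarrow> (\<integral>\<^sup>+x\<in>{-real N..real N}. ennreal ((f x - g x)^2) \<partial>lborel) \<le> ennreal d \<longrightarrow>
   (\<forall>\<epsilon>\<in>{0<..1}. near T (qc_approx H B f \<epsilon>) (qc_approx H B g \<epsilon>) (1 / 2 ^ (n + 3)))"
   using qc_approx_near[OF T, of "1 / 2 ^ (n + 3)"] by auto
  obtain g Q where "L2loc g" "has_qc T g Q" "(\<integral>\<^sup>+x\<in>{-real N..real N}. ennreal ((f x - g x)^2) \<partial>lborel) \<le> ennreal d"
   using g[OF d, of N] by blast
  then show ?thesis using nr f by blast
 qed
 then obtain g Q where gQ: "\<And>n. has_qc T (g n) (Q n)"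
  and nr: "\<And>n \<epsilon>. \<epsilon> \<in> {0<..1} \<Longrightarrow> near T (qc_approx H B f \<epsilon>) (qc_approx H B (g n) \<epsilon>) (1 / 2 ^ (n + 3))"
  by metis
 have half: "1 / 2 ^ (n + 3) = (1 / 2 ^ n) / (8::real)" for n :: nat by (simp add: power_add)
 have "near T (Q n) (Q (Suc n)) (1 / 2 ^ n)" for n
 proof -
  have "near T (qc_approx H B (g n) \<epsilon>) (qc_approx H B (g (Suc n)) \<epsilon>) (1 / 2 ^ (n + 3) + 1 / 2 ^ (Suc n + 3))"
   if "\<epsilon> \<in> {0<..1}" for \<epsilon> by (rule near_triangle[OF near_sym[OF nr[OF that]] nr[OF that]])
  then have "near T (Q n) (Q (Suc n)) (1 / 2 ^ (n + 3) + 1 / 2 ^ (Suc n + 3) + 1 / 2 ^ (n + 3))"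
   by (intro has_qc_close[OF gQ gQ]) simp_all
  have "1 / (8 * y) + 1 / (16 * y) + 1 / (8 * y) \<le> 1 / y" if "0 < y" for y :: real
   using that by (simp add: field_simps)
  from this[of "2 ^ n"] have "1 / 2 ^ (n + 3) + 1 / 2 ^ (Suc n + 3) + 1 / 2 ^ (n + 3) \<le> 1 / (2::real) ^ n"
   by (simp add: power_add mult.commute)
  then show ?thesis using \<open>near T (Q n) (Q (Suc n)) _\<close> by (rule near_mono[rotated])
 qed
 then obtain Q' where Q': "\<And>t. t \<in> {0..T} \<Longrightarrow> Q' t \<in> borel_measurable M" "\<And>n. near T (Q n) Q' (2 / 2 ^ n)"
  using near_complete[of T Q] gQ unfolding has_qc_iff by blast
 have "has_qc T f Q'" unfolding has_qc_iff
 proof (intro conjI ballI allI impI Q'(1))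
  fix \<eta> :: real assume \<eta>: "0 < \<eta>"
  obtain n where n: "(1/2) ^ n < \<eta> / 4" using real_arch_pow_inv[of "\<eta> / 4" "1/2"] \<eta> by auto
  have "eventually (\<lambda>\<epsilon>. near T (qc_approx H B (g n) \<epsilon>) (Q n) (1 / 2 ^ (n + 3))) (at_right 0)"
   using gQ[of n] unfolding has_qc_iff by simp
  then show "eventually (\<lambda>\<epsilon>. near T (qc_approx H B f \<epsilon>) Q' \<eta>) (at_right 0)" using eventually_small
  proof eventually_elim
   case (elim \<epsilon>)
   have "near T (qc_approx H B f \<epsilon>) Q' (1 / 2 ^ (n + 3) + (1 / 2 ^ (n + 3) + 2 / 2 ^ n))"
    by (rule near_triangle[OF nr[OF elim(2)] near_triangle[OF elim(1) Q'(2)]])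
   then show ?case
   proof (rule near_mono)
    define x where "x = (1/2::real) ^ n"
    have "1 / 2 ^ (n + 3) = x / 8" "2 / 2 ^ n = 2 * x" unfolding x_def half by (simp_all add: power_one_over)
    moreover have "0 < x" "x < \<eta> / 4" using n by (simp_all add: x_def)
    ultimately show "1 / 2 ^ (n + 3) + (1 / 2 ^ (n + 3) + 2 / 2 ^ n) \<le> \<eta>" by linarith
   qed
  qed
 qed
 then show ?thesis by blast
qed

lemma has_qc_ramp:
 assumes T: "0 < T" and d: "0 < d"
 shows "has_qc T (ramp a d) (\<lambda>t w. 2 * H * (LINT s:{0..t}|lborel. ramp' a d (B s w) * s powr (2*H - 1)))"
 unfolding has_qc_iff
proof (intro conjI ballI allI impI)
 fix t :: real
 have [measurable]: "(\<lambda>z. B (snd z) (fst z)) \<in> borel_measurable (M \<Otimes>\<^sub>M lborel)"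
  using measurable_pair_swap[OF B_jointly_measurable] by (simp add: split_beta)
 show "(\<lambda>w. 2 * H * (LINT s:{0..t}|lborel. ramp' a d (B s w) * s powr (2*H - 1))) \<in> borel_measurable M"
  unfolding set_lebesgue_integral_def
  by (intro borel_measurable_times borel_measurable_const lborel.borel_measurable_lebesgue_integral) (simp add: split_beta)
next
 fix \<eta> :: real assume "0 < \<eta>"
 then show "eventually (\<lambda>\<epsilon>. near T (qc_approx H B (ramp a d) \<epsilon>)
   (\<lambda>t w. 2 * H * (LINT s:{0..t}|lborel. ramp' a d (B s w) * s powr (2*H - 1))) \<eta>) (at_right 0)"
  by (rule qc_smooth_limit[OF T _ DERIV_ramp[OF d] ramp'_bounds(3,2)[OF d]])
qed

lemma has_qc_step_exists:
 assumes T: "0 < T"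
 shows "\<exists>Q. has_qc T (indicator {a<..}) Q"
proof (rule has_qc_exists_limit[OF T])
 show "L2loc (indicator {a<..})" by (rule L2loc_indicator) simp
 fix N :: nat and d :: real assume d: "0 < d"
 show "\<exists>g Q. L2loc g \<and> has_qc T g Q \<and> (\<integral>\<^sup>+x\<in>{-real N..real N}. ennreal ((indicator {a<..} x - g x)^2) \<partial>lborel) \<le> ennreal d"
  using has_qc_ramp[OF T, of "d / 2" a] L2loc_ramp[of a "d / 2"] ramp_approximates_step[of "d / 2" a "{-real N..real N}"] d by auto
qed

lemma has_qc_sum:
 fixes l :: nat
 assumes T: "0 < T" and Q: "\<And>j. j \<in> {1..l} \<Longrightarrow> has_qc T (f j) (Q j)" and f: "\<And>j. j \<in> {1..l} \<Longrightarrow> L2loc (f j)"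
 shows "has_qc T (\<lambda>x. \<Sum>j=1..l. c j * f j x) (\<lambda>t w. \<Sum>j=1..l. c j * Q j t w) \<and> L2loc (\<lambda>x. \<Sum>j=1..l. c j * f j x)"
 using Q f
proof (induction l)
 case 0
 have z: "qc_approx H B (\<lambda>x. 0) \<epsilon> = (\<lambda>t w. 0)" for \<epsilon> by (intro ext) (simp add: qc_approx_def set_lebesgue_integral_def)
 have "L2loc (\<lambda>x. 0)" by (rule L2loc_bounded[where c=0]) auto
 moreover have "has_qc T (\<lambda>x. 0) (\<lambda>t w. 0)" unfolding has_qc_iff z by (auto intro!: always_eventually near_refl)
 ultimately show ?case by simp
next
 case (Suc l)
 have "has_qc T (f (Suc l)) (Q (Suc l))" "L2loc (f (Suc l))" using Suc.prems by auto
 moreover have "has_qc T (\<lambda>x. \<Sum>j=1..l. c j * f j x) (\<lambda>t w. \<Sum>j=1..l. c j * Q j t w) \<and> L2loc (\<lambda>x. \<Sum>j=1..l. c j * f j x)"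
  using Suc by auto
 ultimately show ?case
  using has_qc_lincomb[of T "\<lambda>x. \<Sum>j=1..l. c j * f j x" "\<lambda>t w. \<Sum>j=1..l. c j * Q j t w" "f (Suc l)" "Q (Suc l)" 1 "c (Suc l)"]
   L2loc_lincomb[of "\<lambda>x. \<Sum>j=1..l. c j * f j x" "f (Suc l)" 1 "c (Suc l)"] T by simp
qed

lemma has_qc_elem_fun:
 assumes T: "0 < T" and g: "is_elementary (l, a, c)" and Q: "\<And>y. has_qc T (indicator {y<..}) (Q y)"
 shows "has_qc T (elem_fun (l, a, c)) (\<lambda>t w. \<Sum>j=1..l. c j * (1 * Q (a (j - 1)) t w + (-1) * Q (a j) t w))"
  and "L2loc (elem_fun (l, a, c))"
proof -
 have eq: "elem_fun (l, a, c) = (\<lambda>x. \<Sum>j=1..l. c j * (1 * indicator {a (j - 1)<..} x + (-1) * indicator {a j<..} x))"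
  by (rule ext) (rule elem_fun_steps[OF g])
 have L: "L2loc (indicator {y<..})" for y :: real by (rule L2loc_indicator) simp
 have E: "has_qc T (\<lambda>x. \<Sum>j=1..l. c j * (1 * indicator {a (j - 1)<..} x + (-1) * indicator {a j<..} x))
   (\<lambda>t w. \<Sum>j=1..l. c j * (1 * Q (a (j - 1)) t w + (-1) * Q (a j) t w))
  \<and> L2loc (\<lambda>x. \<Sum>j=1..l. c j * (1 * indicator {a (j - 1)<..} x + (-1) * indicator {a j<..} x))"
  by (rule has_qc_sum[OF T has_qc_lincomb[OF Q L Q L T] L2loc_lincomb[OF L L]])
 show "has_qc T (elem_fun (l, a, c)) (\<lambda>t w. \<Sum>j=1..l. c j * (1 * Q (a (j - 1)) t w + (-1) * Q (a j) t w))"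
  unfolding eq by (rule conjunct1[OF E])
 show "L2loc (elem_fun (l, a, c))" unfolding eq by (rule conjunct2[OF E])
qed

text \<open>Elementary functions are combinations of steps, whose covariations are limits of those
  in \<open>has_qc_ramp\<close>, and they are dense in square mean on each
  \<open>{-N..N}\<close>.\<close>

theorem has_qc_exists:
 assumes T: "0 < T" and f: "L2loc f"
 shows "\<exists>Q. has_qc T f Q"
proof (rule has_qc_exists_limit[OF T f])
 fix N :: nat and d :: real assume d: "0 < d"
 note [measurable] = f
 let ?\<nu> = "density lborel (indicator {-real N..real N})"
 interpret finite_borel ?\<nu> by (rule finite_borel_interval)
 have I: "(\<integral>\<^sup>+x. ennreal (h x) \<partial>?\<nu>) = (\<integral>\<^sup>+x\<in>{-real N..real N}. ennreal (h x) \<partial>lborel)" if [measurable]: "h \<in> borel_measurable borel" for h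
  by (subst nn_integral_density) (auto simp: mult.commute)
 have "(\<integral>\<^sup>+x. ennreal ((f x)^2) \<partial>?\<nu>) < \<infinity>" using f by (subst I) (auto simp: L2loc_def)
 from elementary_dense[OF L2loc_measurable[OF f] this d]
 obtain g0 where g0: "is_elementary g0" "(\<integral>\<^sup>+x. ennreal ((elem_fun g0 x - f x)^2) \<partial>?\<nu>) \<le> ennreal d" by blast
 obtain l a c where lac: "g0 = (l, a, c)" by (metis prod_cases3)
 note g = g0[unfolded lac]
 obtain Q where Q: "\<And>y. has_qc T (indicator {y<..}) (Q y)" using has_qc_step_exists[OF T] by metis
 note E = has_qc_elem_fun[OF T g(1) Q]
 note [measurable] = E(2)
 have "(\<integral>\<^sup>+x\<in>{-real N..real N}. ennreal ((f x - elem_fun (l, a, c) x)^2) \<partial>lborel) \<le> ennreal d"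
  using g(2) by (subst (asm) I) (auto simp: power2_commute[of "f _"])
 then show "\<exists>g Q. L2loc g \<and> has_qc T g Q \<and> (\<integral>\<^sup>+x\<in>{-real N..real N}. ennreal ((f x - g x)^2) \<partial>lborel) \<le> ennreal d"
  using E by blast
qed

end

section \<open>Second moments and the weighted norm\<close>

context fbm
begin

text \<open>The inner integral of the norm without its normalising constant. In contrast to the
  Gaussian density, this weight increases with time, which allows comparing different times.\<close>

definition gauss_mass :: "(real \<Rightarrow> real) \<Rightarrow> real \<Rightarrow> ennreal" where
 "gauss_mass h s = (\<integral>\<^sup>+x. ennreal ((h x)^2 * exp (- (x^2 / (2 * s powr (2*H))))) \<partial>lborel)"

definition end_mass :: "real \<Rightarrow> (real \<Rightarrow> real) \<Rightarrow> ennreal" where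
 "end_mass T h = (\<integral>\<^sup>+s\<in>{0..T}. gauss_mass h s * ennreal ((T - s) powr (H - 1)) \<partial>lborel)"

lemma gauss_mass_measurable [measurable]:
 assumes [measurable]: "h \<in> borel_measurable borel"
 shows "gauss_mass h \<in> borel_measurable borel"
proof -
 have "(\<lambda>(s, x). ennreal ((h x)^2 * exp (- (x^2 / (2 * s powr (2*H)))))) \<in> borel_measurable (borel \<Otimes>\<^sub>M lborel)"
  by measurable
 then show ?thesis unfolding gauss_mass_def[abs_def] by (rule lborel.borel_measurable_nn_integral)
qed

lemma gauss_mass_mono:
 assumes "0 < s" "s \<le> s'"
 shows "gauss_mass h s \<le> gauss_mass h s'"
 unfolding gauss_mass_def
proof (intro nn_integral_mono ennreal_leI mult_left_mono)
 fix x :: real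
 have "s powr (2*H) \<le> s' powr (2*H)" using assms H by (intro powr_mono2) auto
 then have "x^2 / (2 * s' powr (2*H)) \<le> x^2 / (2 * s powr (2*H))" using assms by (intro divide_left_mono) auto
 then show "exp (- (x^2 / (2 * s powr (2*H)))) \<le> exp (- (x^2 / (2 * s' powr (2*H))))" by simp
qed simp

text \<open>The exponents at times \<open>p\<close> and \<open>P\<close> differ by the factor
  \<open>(p / P) powr (2*H) \<le> 1 - \<kappa>\<close>, from the tangent at 1, with
  \<open>\<kappa> = 2 * H * (P - p) / P\<close>. The spare portion \<open>\<kappa>\<close> absorbs
  the quadratic factor of \<open>weighted_square\<close>; its reciprocal is the price of the
  gap.\<close>

lemma weighted_square_gap:
 assumes p: "0 < p" "p < P" and [measurable]: "h \<in> borel_measurable borel" and N: "gauss_mass h P \<le> ennreal N" "0 \<le> N"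
 shows "admissible h (B p)" and "\<Psi> h p \<le> 3 * P / (2 * H * (P - p)) * p powr (-H) * N"
proof -
 define \<kappa> where "\<kappa> = 2 * H * (P - p) / P"
 have P: "0 < P" using p by simp
 have \<kappa>: "0 < \<kappa>" "\<kappa> \<le> 1"
 proof -
  show "0 < \<kappa>" using p H by (simp add: \<kappa>_def)
  have "2 * H * (P - p) \<le> 1 * P" using H p by (intro mult_mono) auto
  then show "\<kappa> \<le> 1" using P by (simp add: \<kappa>_def)
 qed
 have gap: "(p / P) powr (2*H) \<le> 1 - \<kappa>" using powr_le_tangent[of "2*H" "p / P"] H p P by (simp add: \<kappa>_def field_simps)
 have e: "exp (- (x^2 / (2 * p powr (2*H)))) \<le> exp (- (x^2 / (2 * P powr (2*H)))) * exp (- (\<kappa> * x^2 / (2 * p powr (2*H))))" for x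
 proof -
  define y where "y = x^2 / (2 * p powr (2*H))"
  have y: "0 \<le> y" by (simp add: y_def)
  have "x^2 / (2 * P powr (2*H)) = (p / P) powr (2*H) * y" using p P by (simp add: y_def powr_divide)
  also have "... \<le> (1 - \<kappa>) * y" using gap y by (rule mult_right_mono)
  finally have "x^2 / (2 * P powr (2*H)) + \<kappa> * y \<le> y" by (simp add: algebra_simps)
  then have "exp (- y) \<le> exp (- (x^2 / (2 * P powr (2*H))) + - (\<kappa> * y))" by simp
  then show ?thesis unfolding exp_add by (simp add: y_def)
 qed
 have m: "(\<lambda>x. exp (- (x^2 / (2 * P powr (2*H))))) \<in> borel_measurable borel" by measurable
 note W = weighted_square_le[OF p(1) \<kappa> assms(3) m _ e N(1)[unfolded gauss_mass_def] N(2)]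
 show "admissible h (B p)" by (rule W(1)) simp
 have "\<Psi> h p \<le> 3 / \<kappa> * p powr (-H) * N" by (rule W(2)) simp
 also have "3 / \<kappa> = 3 * P / (2 * H * (P - p))" using P by (simp add: \<kappa>_def)
 finally show "\<Psi> h p \<le> 3 * P / (2 * H * (P - p)) * p powr (-H) * N" .
qed

text \<open>Without the quadratic factor nothing is lost when \<open>P\<close> is close to
  \<open>p\<close>. This matters since \<open>\<Phi>\<close> multiplies the singular
  \<open>(r - s) powr (-2*H)\<close> in the kernel bound, while \<open>\<Psi>\<close> multiplies
  only a power that is bounded away from time 0.\<close>

lemma \<Phi>_le:
 assumes p: "0 < p" "p \<le> P" and [measurable]: "h \<in> borel_measurable borel" and a: "admissible h (B p)"
  and N: "gauss_mass h P \<le> ennreal N" "0 \<le> N"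
 shows "\<Phi> h p \<le> p powr (-H) * N"
proof -
 define v where "v = p powr (2*H)"
 have v: "0 < v" using p by (simp add: v_def)
 have sv: "sqrt v = p powr H" unfolding v_def using powr_half_sqrt[of "p powr (2*H)"] by (simp add: powr_powr)
 have nd: "normal_density 0 (p powr H) x \<le> p powr (-H) * exp (- (x^2 / (2 * p powr (2*H))))" for x
 proof -
  have "normal_density 0 (p powr H) x = 1 / sqrt (2 * pi * v) * exp (- (x^2 / (2 * v)))"
   unfolding normal_density_def by (simp add: sv[symmetric] v less_imp_le)
  also have "... \<le> 1 / sqrt v * exp (- (x^2 / (2 * v)))"
  proof (intro mult_right_mono divide_left_mono)
   have "1 * v \<le> 2 * pi * v" using v pi_gt3 by (intro mult_right_mono) auto
   then show "sqrt v \<le> sqrt (2 * pi * v)" by simp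
  qed (use v in \<open>auto intro!: mult_pos_pos\<close>)
  also have "1 / sqrt v = p powr (-H)" by (simp add: sv powr_minus_divide)
  finally show ?thesis by (simp add: v_def)
 qed
 have "ennreal (\<Phi> h p) = (\<integral>\<^sup>+w. ennreal ((h (B p w))^2) \<partial>M)"
  unfolding \<Phi>_def using admissible_integrable(1)[OF a] by (subst nn_integral_eq_integral) auto
 also have "... = (\<integral>\<^sup>+x. ennreal (normal_density 0 (p powr H) x) * ennreal ((h x)^2) \<partial>lborel)"
  by (rule distributed_nn_integral[OF distributed_B[OF p(1)], symmetric]) measurable
 also have "... \<le> (\<integral>\<^sup>+x. ennreal (p powr (-H)) * ennreal ((h x)^2 * exp (- (x^2 / (2 * p powr (2*H))))) \<partial>lborel)"
 proof (rule nn_integral_mono)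
  fix x
  have "normal_density 0 (p powr H) x * (h x)^2 \<le> p powr (-H) * exp (- (x^2 / (2 * p powr (2*H)))) * (h x)^2"
   by (intro mult_right_mono nd) simp
  then show "ennreal (normal_density 0 (p powr H) x) * ennreal ((h x)^2) \<le> ennreal (p powr (-H)) * ennreal ((h x)^2 * exp (- (x^2 / (2 * p powr (2*H)))))"
   by (simp add: ennreal_mult[symmetric] ac_simps ennreal_leI)
 qed
 also have "... = ennreal (p powr (-H)) * gauss_mass h p"
  unfolding gauss_mass_def by (rule nn_integral_cmult) measurable
 also have "... \<le> ennreal (p powr (-H)) * ennreal N"
  using order_trans[OF gauss_mass_mono[OF p] N(1)] by (intro mult_left_mono) auto
 also have "... = ennreal (p powr (-H) * N)" by (simp add: ennreal_mult')
 finally show ?thesis using N(2) by simp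
qed

text \<open>Since \<open>gauss_mass\<close> increases in time, its value at \<open>P\<close> is at
  most its weighted average over \<open>{P..T}\<close>, where the total weight is
  \<open>(T - P) powr H / H\<close>.\<close>

lemma end_mass_bounds:
 assumes T: "0 < T" and [measurable]: "h \<in> borel_measurable borel" and n: "end_mass T h \<le> ennreal n" "0 \<le> n" and P: "0 < P" "P < T"
 shows "gauss_mass h P \<le> ennreal (H / (T - P) powr H * n)"
proof -
 define k where "k = (T - P) powr H / H"
 have k: "0 < k" using P H by (simp add: k_def)
 have I: "(\<integral>\<^sup>+s\<in>{P..T}. ennreal ((T - s) powr (H - 1)) \<partial>lborel) = ennreal k"
 proof -
  define f where "f y = ennreal (y powr (H - 1)) * indicator {0..T - P} y" for y :: real
  have [measurable]: "f \<in> borel_measurable borel" unfolding f_def by measurable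
  have "(\<integral>\<^sup>+s\<in>{P..T}. ennreal ((T - s) powr (H - 1)) \<partial>lborel) = (\<integral>\<^sup>+s. f (T + (-1) * s) \<partial>lborel)"
   by (intro nn_integral_cong) (auto simp: f_def split: split_indicator)
  also have "... = (\<integral>\<^sup>+y. f y \<partial>lborel)" using nn_integral_real_affine[of f "-1" T] by simp
  also have "... = ennreal k" unfolding f_def using nn_integral_powr_from_0[of "H - 1" "T - P"] H P by (simp add: k_def)
  finally show ?thesis .
 qed
 have "gauss_mass h P * ennreal k = (\<integral>\<^sup>+s. gauss_mass h P * (ennreal ((T - s) powr (H - 1)) * indicator {P..T} s) \<partial>lborel)"
  unfolding I[symmetric] by (rule nn_integral_cmult[symmetric]) measurable
 also have "... \<le> end_mass T h" unfolding end_mass_def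
  using P by (intro nn_integral_mono) (auto intro!: mult_right_mono gauss_mass_mono split: split_indicator)
 also note n(1)
 finally have le: "gauss_mass h P * ennreal k \<le> ennreal n" .
 show ?thesis
 proof (cases "gauss_mass h P")
  case (real r)
  then have "r * k \<le> n" using le k n(2) by (simp add: ennreal_mult''[symmetric])
  then have "r \<le> n / k" using k by (simp add: pos_le_divide_eq)
  also have "n / k = H / (T - P) powr H * n" using H by (simp add: k_def)
  finally show ?thesis using real by (simp add: ennreal_leI)
 next
  case top
  then show ?thesis using le k by (simp add: ennreal_top_mult top_unique)
 qed
qed

text \<open>Let \<open>x = T - p\<close>. If \<open>T - q \<le> x / 2\<close> then
  \<open>\<bar>p - q\<bar>\<close> is at least \<open>x / 2\<close>; otherwise \<open>T - q\<close>
  itself exceeds \<open>x / 2\<close>. The two singularities thus never meet, and each case leaves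
  one integrable singularity, with integrals bounded by \<open>c1\<close> and \<open>c2\<close>.
  Powers of \<open>x\<close> are brought to the exponent \<open>H - 1\<close> using
  \<open>x \<le> T\<close>.\<close>

lemma kernel_weight_integral:
 assumes T: "0 < T"
 shows "\<exists>C\<ge>0. \<forall>p. 0 < p \<longrightarrow> p < T \<longrightarrow>
  (\<integral>\<^sup>+q\<in>{0..T}. ennreal ((T - p) powr H * (T - q) powr (-H) * (1 / (T - p) + \<bar>p - q\<bar> powr (-2*H))) \<partial>lborel)
   \<le> ennreal (C * (T - p) powr (H - 1))"
proof -
 define c1 where "c1 = T powr (1 - H) / (1 - H)"
 define c2 where "c2 = 2 * T powr (1 - 2*H) / (1 - 2*H)"
 have c: "0 \<le> c1" "0 \<le> c2" using H by (auto simp: c1_def c2_def)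
 define C where "C = c1 + (2 powr H * T powr (1 - H)) * c2 + (2 powr (2*H) * T powr (1 - 2*H)) * c1"
 have C: "0 \<le> C" using c by (simp add: C_def)
 have I1: "(\<integral>\<^sup>+q\<in>{0..T}. ennreal ((T - q) powr (-H)) \<partial>lborel) = ennreal c1"
 proof -
  define f where "f y = ennreal (y powr (-H)) * indicator {0..T} y" for y :: real
  have [measurable]: "f \<in> borel_measurable borel" unfolding f_def by measurable
  have "(\<integral>\<^sup>+q\<in>{0..T}. ennreal ((T - q) powr (-H)) \<partial>lborel) = (\<integral>\<^sup>+q. f (T + (-1) * q) \<partial>lborel)"
   by (intro nn_integral_cong) (auto simp: f_def split: split_indicator)
  also have "... = (\<integral>\<^sup>+y. f y \<partial>lborel)" using nn_integral_real_affine[of f "-1" T] by simp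
  also have "... = ennreal c1" unfolding f_def using nn_integral_powr_from_0[of "-H" T] H T by (simp add: c1_def)
  finally show ?thesis .
 qed
 have "(\<integral>\<^sup>+q\<in>{0..T}. ennreal ((T - p) powr H * (T - q) powr (-H) * (1 / (T - p) + \<bar>p - q\<bar> powr (-2*H))) \<partial>lborel)
   \<le> ennreal (C * (T - p) powr (H - 1))" if p: "0 < p" "p < T" for p
 proof -
  define x where "x = T - p"
  have x: "0 < x" "x \<le> T" using p by (auto simp: x_def)
  define u where "u = x powr (H - 1) + x powr H * (x / 2) powr (-2*H)"
  define w where "w = x powr H * (x / 2) powr (-H)"
  have uw: "0 \<le> u" "0 \<le> w" by (auto simp: u_def w_def)
  have pt: "x powr H * (T - q) powr (-H) * (1 / x + \<bar>p - q\<bar> powr (-2*H)) \<le> u * (T - q) powr (-H) + w * \<bar>p - q\<bar> powr (-2*H)"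
   if q: "q \<in> {0..T}" for q
  proof -
   have "(T - q) powr (-H) * \<bar>p - q\<bar> powr (-2*H) \<le> (x / 2) powr (-2*H) * (T - q) powr (-H) + (x / 2) powr (-H) * \<bar>p - q\<bar> powr (-2*H)"
   proof (cases "T - q \<le> x / 2")
    case True
    then have "x / 2 \<le> \<bar>p - q\<bar>" using q by (auto simp: x_def)
    then have "\<bar>p - q\<bar> powr (-2*H) \<le> (x / 2) powr (-2*H)" using x H by (intro powr_mono2') auto
    then have "(T - q) powr (-H) * \<bar>p - q\<bar> powr (-2*H) \<le> (x / 2) powr (-2*H) * (T - q) powr (-H)"
     by (subst (2) mult.commute) (rule mult_left_mono, simp_all)
    moreover have "0 \<le> (x / 2) powr (-H) * \<bar>p - q\<bar> powr (-2*H)" by simp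
    ultimately show ?thesis by linarith
   next
    case False
    then have "(T - q) powr (-H) \<le> (x / 2) powr (-H)" using x H by (intro powr_mono2') auto
    then have "(T - q) powr (-H) * \<bar>p - q\<bar> powr (-2*H) \<le> (x / 2) powr (-H) * \<bar>p - q\<bar> powr (-2*H)" by (rule mult_right_mono) simp
    moreover have "0 \<le> (x / 2) powr (-2*H) * (T - q) powr (-H)" by simp
    ultimately show ?thesis by linarith
   qed
   then have "x powr H * ((T - q) powr (-H) * \<bar>p - q\<bar> powr (-2*H)) \<le> x powr H * ((x / 2) powr (-2*H) * (T - q) powr (-H) + (x / 2) powr (-H) * \<bar>p - q\<bar> powr (-2*H))"
    by (rule mult_left_mono) simp
   moreover have "x powr H * (1 / x) = x powr (H - 1)" using x by (simp add: powr_diff)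
   moreover have "X * a * (1 / x + e) \<le> (Y + X * b) * a + X * c * e"
    if "X * (a * e) \<le> X * (b * a + c * e)" "X * (1 / x) = Y" for X Y a b c e :: real
    using that(1) unfolding that(2)[symmetric] by (simp add: algebra_simps)
   ultimately show ?thesis unfolding u_def w_def by blast
  qed
  have "(\<integral>\<^sup>+q\<in>{0..T}. ennreal (x powr H * (T - q) powr (-H) * (1 / x + \<bar>p - q\<bar> powr (-2*H))) \<partial>lborel)
   \<le> (\<integral>\<^sup>+q. ennreal u * (ennreal ((T - q) powr (-H)) * indicator {0..T} q) + ennreal w * (ennreal (\<bar>p - q\<bar> powr (-2*H)) * indicator {0..T} q) \<partial>lborel)"
   using pt uw by (intro nn_integral_mono) (auto simp: ennreal_mult'[symmetric] ennreal_plus[symmetric] simp del: ennreal_plus split: split_indicator intro!: ennreal_leI)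
  also have "... = ennreal u * ennreal c1 + ennreal w * (\<integral>\<^sup>+q\<in>{0..T}. ennreal (\<bar>p - q\<bar> powr (-2*H)) \<partial>lborel)"
   by (simp add: nn_integral_add nn_integral_cmult I1)
  also have "... \<le> ennreal u * ennreal c1 + ennreal w * ennreal c2"
  proof (intro add_left_mono mult_left_mono)
   show "(\<integral>\<^sup>+q\<in>{0..T}. ennreal (\<bar>p - q\<bar> powr (-2*H)) \<partial>lborel) \<le> ennreal c2"
    using nn_integral_abs_powr_le[of "-2*H" p 0 T] H p by (simp add: c2_def)
  qed simp
  also have "... = ennreal (u * c1 + w * c2)" using uw c by (simp add: ennreal_mult)
  also have "... \<le> ennreal (C * x powr (H - 1))"
  proof (rule ennreal_leI)
   have xx: "x powr e \<le> T powr (e - (H - 1)) * x powr (H - 1)" if "H - 1 \<le> e" for e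
   proof -
    have "x powr e = x powr (e - (H - 1)) * x powr (H - 1)" using x by (simp add: powr_add[symmetric])
    also have "... \<le> T powr (e - (H - 1)) * x powr (H - 1)" using x that by (intro mult_right_mono powr_mono2) auto
    finally show ?thesis .
   qed
   have h: "(x / 2) powr (-e) = 2 powr e * x powr (-e)" for e :: real using x by (simp add: powr_divide powr_minus field_simps)
   have "u = x powr (H - 1) + 2 powr (2*H) * x powr (-H)"
    unfolding u_def using h[of "2*H"] x by (simp add: powr_add[symmetric] mult.left_commute[of "x powr H"])
   also have "... \<le> x powr (H - 1) + 2 powr (2*H) * (T powr (1 - 2*H) * x powr (H - 1))"
    using xx[of "-H"] H by (intro add_left_mono mult_left_mono) (auto simp: algebra_simps)
   finally have u: "u \<le> (1 + 2 powr (2*H) * T powr (1 - 2*H)) * x powr (H - 1)" by (simp add: algebra_simps)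
   have "w = 2 powr H" unfolding w_def using h[of H] x by (simp add: powr_add[symmetric] mult.left_commute[of "x powr H"])
   also have "... \<le> 2 powr H * (T powr (1 - H) * x powr (H - 1))" using xx[of 0] x H by simp
   finally have w: "w \<le> 2 powr H * T powr (1 - H) * x powr (H - 1)" by simp
   have "u * c1 + w * c2 \<le> ((1 + 2 powr (2*H) * T powr (1 - 2*H)) * x powr (H - 1)) * c1 + (2 powr H * T powr (1 - H) * x powr (H - 1)) * c2"
    using u w c by (intro add_mono mult_right_mono)
   also have "... = C * x powr (H - 1)" unfolding C_def by (simp add: algebra_simps)
   finally show "u * c1 + w * c2 \<le> C * x powr (H - 1)" .
  qed
  finally show ?thesis by (simp add: x_def)
 qed
 then show ?thesis using C by blast
qed

text \<open>The later time is the midpoint \<open>(p + T) / 2\<close>, so the gap is proportional to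
  \<open>T - p\<close> and the price in \<open>weighted_square_gap\<close> becomes
  \<open>1 / (T - p)\<close> up to constants.\<close>

lemma end_mass_admissible:
 assumes T: "0 < T" and [measurable]: "h \<in> borel_measurable borel" and n: "end_mass T h \<le> ennreal n" "0 \<le> n"
  and p: "T / 2 \<le> p" "p < T"
 defines "N \<equiv> enn2real (gauss_mass h ((p + T) / 2))"
 shows "admissible h (B p)" and "\<Psi> h p \<le> 3 * T / H * (T / 2) powr (-H) * (N / (T - p))"
  and "\<Phi> h p \<le> (T / 2) powr (-H) * N" and "gauss_mass h ((p + T) / 2) = ennreal N"
proof -
 have "gauss_mass h ((p + T) / 2) \<le> ennreal (H / (T - (p + T) / 2) powr H * n)"
  using p T by (intro end_mass_bounds n T) auto
 then have "gauss_mass h ((p + T) / 2) < \<top>" using ennreal_less_top order_le_less_trans by blast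
 then show N: "gauss_mass h ((p + T) / 2) = ennreal N" unfolding N_def by simp
 have N0: "0 \<le> N" by (simp add: N_def)
 have p0: "0 < p" "p < (p + T) / 2" "p \<le> (p + T) / 2" using p T by auto
 note W = weighted_square_gap[OF p0(1,2) assms(2) eq_refl[OF N] N0]
 show a: "admissible h (B p)" by (rule W(1))
 have w: "p powr (-H) \<le> (T / 2) powr (-H)" using p T H by (intro powr_mono2') auto
 have "\<Psi> h p \<le> 3 * ((p + T) / 2) / (2 * H * ((p + T) / 2 - p)) * p powr (-H) * N" by (rule W(2))
 also have "... \<le> 3 * T / (2 * H * ((p + T) / 2 - p)) * (T / 2) powr (-H) * N"
  using p p0 H N0 w by (intro mult_mono divide_right_mono) auto
 also have "2 * H * ((p + T) / 2 - p) = H * (T - p)" by (simp add: field_simps)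
 finally show "\<Psi> h p \<le> 3 * T / H * (T / 2) powr (-H) * (N / (T - p))" by simp
 have "\<Phi> h p \<le> p powr (-H) * N" by (rule \<Phi>_le[OF p0(1,3) assms(2) a eq_refl[OF N] N0])
 also have "... \<le> (T / 2) powr (-H) * N" using w N0 by (rule mult_right_mono)
 finally show "\<Phi> h p \<le> (T / 2) powr (-H) * N" .
qed

text \<open>One of the two sides of the kernel bound after balancing; the mass depends only on
  \<open>p\<close>, so that \<open>q\<close> can be integrated out first. The term
  \<open>1 / (T - p)\<close> is the price of the gap, \<open>\<bar>p - q\<bar> powr (-2*H)\<close>
  that of the determinant.\<close>

definition end_kernel :: "real \<Rightarrow> (real \<Rightarrow> real) \<Rightarrow> real \<Rightarrow> real \<Rightarrow> ennreal" where
 "end_kernel T h p q = gauss_mass h ((p + T) / 2)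
   * ennreal ((T - p) powr H * (T - q) powr (-H) * (1 / (T - p) + \<bar>p - q\<bar> powr (-2*H)))"

lemma end_kernel_measurable [measurable]:
 assumes [measurable]: "h \<in> borel_measurable borel"
 shows "(\<lambda>(p, q). end_kernel T h p q) \<in> borel_measurable (borel \<Otimes>\<^sub>M borel)"
proof -
 have [measurable]: "(\<lambda>x :: real \<times> real. gauss_mass h ((fst x + T) / 2)) \<in> borel_measurable (borel \<Otimes>\<^sub>M borel)"
  by (rule measurable_compose[OF _ gauss_mass_measurable[OF assms]]) measurable
 show ?thesis unfolding end_kernel_def split_beta' by measurable
qed

text \<open>Integrating out \<open>q\<close> leaves \<open>(T - p) powr (H - 1)\<close> against the
  mass at the midpoint \<open>P = (p + T) / 2\<close>. Since \<open>H - 1 < 0\<close>, the distance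
  \<open>T - p\<close> may be replaced by the smaller \<open>T - P\<close>, and the substitution
  from \<open>p\<close> to \<open>P\<close>, with Jacobian 2, yields
  \<open>end_mass\<close>.\<close>

lemma end_kernel_integral:
 assumes T: "0 < T"
 shows "\<exists>C\<ge>0. \<forall>h n. h \<in> borel_measurable borel \<longrightarrow> 0 \<le> n \<longrightarrow> end_mass T h \<le> ennreal n \<longrightarrow>
  (\<integral>\<^sup>+p\<in>{T/2..T}. (\<integral>\<^sup>+q\<in>{T/2..T}. end_kernel T h p q \<partial>lborel) \<partial>lborel) \<le> ennreal (C * n)"
proof -
 obtain C where C: "0 \<le> C" and Cb: "\<And>p. 0 < p \<Longrightarrow> p < T \<Longrightarrow>
  (\<integral>\<^sup>+q\<in>{0..T}. ennreal ((T - p) powr H * (T - q) powr (-H) * (1 / (T - p) + \<bar>p - q\<bar> powr (-2*H))) \<partial>lborel)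
   \<le> ennreal (C * (T - p) powr (H - 1))" using kernel_weight_integral[OF T] by blast
 have "(\<integral>\<^sup>+p\<in>{T/2..T}. (\<integral>\<^sup>+q\<in>{T/2..T}. end_kernel T h p q \<partial>lborel) \<partial>lborel) \<le> ennreal (2 * C * n)"
  if [measurable]: "h \<in> borel_measurable borel" and n: "0 \<le> n" "end_mass T h \<le> ennreal n" for h n
 proof -
  define f where "f P = gauss_mass h P * ennreal ((T - P) powr (H - 1)) * indicator {0..T} P" for P
  have [measurable]: "f \<in> borel_measurable borel" unfolding f_def by measurable
  have inner: "(\<integral>\<^sup>+q\<in>{T/2..T}. end_kernel T h p q \<partial>lborel) * indicator {T/2..T} p \<le> ennreal C * f (T / 2 + 1 / 2 * p)" for p
  proof (cases "p \<in> {T/2..T}")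
   case True
   define k where "k q = ennreal ((T - p) powr H * (T - q) powr (-H) * (1 / (T - p) + \<bar>p - q\<bar> powr (-2*H)))" for q
   have [measurable]: "k \<in> borel_measurable borel" unfolding k_def by measurable
   have "(\<integral>\<^sup>+q\<in>{T/2..T}. end_kernel T h p q \<partial>lborel) \<le> (\<integral>\<^sup>+q. gauss_mass h ((p + T) / 2) * (k q * indicator {0..T} q) \<partial>lborel)"
    using T by (intro nn_integral_mono) (auto simp: end_kernel_def k_def split: split_indicator)
   also have "... = gauss_mass h ((p + T) / 2) * (\<integral>\<^sup>+q\<in>{0..T}. k q \<partial>lborel)" by (rule nn_integral_cmult) measurable
   also have "... \<le> gauss_mass h ((p + T) / 2) * ennreal (C * (T - p) powr (H - 1))"
   \<comment> \<open>At \<open>p = T\<close> both sides are 0, because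
     \<open>0 powr y = 0\<close>.\<close>
   proof (rule mult_left_mono)
    show "(\<integral>\<^sup>+q\<in>{0..T}. k q \<partial>lborel) \<le> ennreal (C * (T - p) powr (H - 1))"
     using Cb[of p] True T by (cases "p = T") (auto simp: k_def)
   qed simp
   also have "... \<le> gauss_mass h ((p + T) / 2) * ennreal (C * (T - (p + T) / 2) powr (H - 1))"
   proof (cases "p = T")
    case False
    then show ?thesis using True H C by (intro mult_left_mono ennreal_leI powr_mono2') (auto simp: field_simps)
   qed simp
   also have "... = ennreal C * f (T / 2 + 1 / 2 * p)"
    using True T C by (simp add: f_def ennreal_mult' add_divide_distrib ac_simps)
   finally show ?thesis using True by simp
  qed simp
  have "(\<integral>\<^sup>+p\<in>{T/2..T}. (\<integral>\<^sup>+q\<in>{T/2..T}. end_kernel T h p q \<partial>lborel) \<partial>lborel) \<le> (\<integral>\<^sup>+p. ennreal C * f (T / 2 + 1 / 2 * p) \<partial>lborel)"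
   by (rule nn_integral_mono) (rule inner)
  also have "... = ennreal C * (\<integral>\<^sup>+p. f (T / 2 + 1 / 2 * p) \<partial>lborel)" by (rule nn_integral_cmult) measurable
  also have "(\<integral>\<^sup>+p. f (T / 2 + 1 / 2 * p) \<partial>lborel) = ennreal 2 * (\<integral>\<^sup>+P. f P \<partial>lborel)"
  proof -
   have "(\<integral>\<^sup>+P. f P \<partial>lborel) = ennreal (1/2) * (\<integral>\<^sup>+p. f (T / 2 + 1 / 2 * p) \<partial>lborel)"
    using nn_integral_real_affine[of f "1/2" "T/2"] by simp
   then have "ennreal 2 * (\<integral>\<^sup>+P. f P \<partial>lborel) = ennreal (2 * (1/2)) * (\<integral>\<^sup>+p. f (T / 2 + 1 / 2 * p) \<partial>lborel)"
    by (simp only: ennreal_mult' mult.assoc)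
   then show ?thesis by simp
  qed
  also have "(\<integral>\<^sup>+P. f P \<partial>lborel) = end_mass T h" by (simp add: f_def end_mass_def)
  also have "ennreal C * (ennreal 2 * end_mass T h) \<le> ennreal C * (ennreal 2 * ennreal n)"
   using n by (intro mult_left_mono) auto
  also have "... = ennreal (2 * C * n)" using C n by (simp only: ennreal_mult'[symmetric]) (simp add: ac_simps)
  finally show ?thesis .
 qed
 then show ?thesis using C by (intro exI[of _ "2 * C"]) auto
qed

text \<open>Choosing \<open>l = ((T - p) / (T - q)) powr H\<close> balances the two sides of the kernel bound
 against the weight \<open>(T - s) powr (H - 1)\<close>.\<close>

lemma incr_end_kernel:
 assumes T: "0 < T" and [measurable]: "h \<in> borel_measurable borel" and n: "end_mass T h \<le> ennreal n" "0 \<le> n"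
  and e: "0 < \<epsilon>" "0 \<le> \<delta>" and s: "T / 2 \<le> s" "s < r" "r + \<delta> < T"
 defines "c \<equiv> ((T / 2) powr (2*H - 1))^2 * ((T / 2) powr (-2*H) * (3 * T / H * (T / 2) powr (-H)) + 17 * (T / 2) powr (-H))"
 shows "ennreal \<bar>expectation (\<lambda>w. incr h \<epsilon> \<delta> s w * incr h \<epsilon> \<delta> r w)\<bar>
  \<le> ennreal c * (end_kernel T h (s + \<delta>) (r + \<delta>) + end_kernel T h (r + \<delta>) (s + \<delta>))"
proof -
 define p q where "p = s + \<delta>" and "q = r + \<delta>"
 have pq: "T / 2 \<le> p" "p < T" "T / 2 \<le> q" "q < T" using s e by (auto simp: p_def q_def)
 define N where "N x = enn2real (gauss_mass h ((x + T) / 2))" for x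
 define b where "b = (r - s) powr (-2*H)"
 define c1 c2 c3 c4 where "c1 = (T / 2) powr (2*H - 1)" and "c2 = 3 * T / H * (T / 2) powr (-H)"
  and "c3 = (T / 2) powr (-2*H)" and "c4 = (T / 2) powr (-H)"
 have c0: "0 \<le> c1" "0 \<le> c2" "0 \<le> c3" "0 \<le> c4" using T H by (auto simp: c1_def c2_def c3_def c4_def)
 have ceq: "c1^2 * (c3 * c2 + 17 * c4) = c" by (simp only: c_def c1_def c2_def c3_def c4_def)
 note A = end_mass_admissible[OF T assms(2) n]
 define l where "l = (T - p) powr H * (T - q) powr (-H)"
 have l: "0 < l" and l': "1 / l = (T - q) powr H * (T - p) powr (-H)" using pq by (auto simp: l_def powr_minus_divide)
 \<comment> \<open>Here 33 is rounded up to \<open>34 = 2 * 17\<close>, so that a factor 2 can be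
   pulled out; it cancels the halves in \<open>l / 2\<close> and \<open>1 / (2 * l)\<close>.\<close>
 have half: "2 * x powr (-2*H) * \<Psi> h x + 33 * b * \<Phi> h x \<le> 2 * ((c3 * c2 + 17 * c4) * (N x * (1 / (T - x) + b)))"
  if x: "T / 2 \<le> x" "x < T" for x
 proof -
  have "x powr (-2*H) \<le> c3" unfolding c3_def using x T H by (intro powr_mono2') auto
  then have "x powr (-2*H) * \<Psi> h x \<le> c3 * (c2 * (N x / (T - x)))"
   using A(2)[OF x] \<Phi>_le_\<Psi>(3)[OF A(1)[OF x]] c0 by (intro mult_mono) (auto simp: c2_def N_def)
  moreover have "b * \<Phi> h x \<le> b * (c4 * N x)"
   using A(3)[OF x] by (intro mult_left_mono) (auto simp: c4_def N_def b_def)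
  moreover have "0 \<le> c3 * (c2 * (N x * b))" "0 \<le> c4 * (N x / (T - x))" "0 \<le> b * (c4 * N x)"
   using c0 x by (auto simp: b_def N_def)
  moreover have "2 * ((c3 * c2 + 17 * c4) * (N x * (1 / (T - x) + b)))
   = 2 * (c3 * (c2 * (N x / (T - x)))) + 2 * (c3 * (c2 * (N x * b))) + 34 * (c4 * (N x / (T - x))) + 34 * (b * (c4 * N x))"
   by (simp add: algebra_simps)
  ultimately show ?thesis unfolding mult.assoc by linarith
 qed
 define E where "E = expectation (\<lambda>w. h (B (s + \<delta>) w) * h (B (r + \<delta>) w) * (D \<epsilon> s w * D \<epsilon> r w))"
 define Z where "Z = N p * ((T - p) powr H * (T - q) powr (-H) * (1 / (T - p) + b))
  + N q * ((T - q) powr H * (T - p) powr (-H) * (1 / (T - q) + b))"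
 have Z: "0 \<le> N p * ((T - p) powr H * (T - q) powr (-H) * (1 / (T - p) + b))"
  "0 \<le> N q * ((T - q) powr H * (T - p) powr (-H) * (1 / (T - q) + b))"
  using pq by (auto simp: N_def b_def)
 have "\<bar>E\<bar> \<le> \<epsilon> powr (4*H) * (l / 2 * (2 * p powr (-2*H) * \<Psi> h p + 33 * b * \<Phi> h p)
   + 1 / (2 * l) * (2 * q powr (-2*H) * \<Psi> h q + 33 * b * \<Phi> h q))" unfolding E_def p_def q_def b_def
  using s e T pq l by (intro increment_kernel_bound A(1)) (auto simp: p_def q_def)
 also have "... \<le> \<epsilon> powr (4*H) * (l / 2 * (2 * ((c3 * c2 + 17 * c4) * (N p * (1 / (T - p) + b))))
   + 1 / (2 * l) * (2 * ((c3 * c2 + 17 * c4) * (N q * (1 / (T - q) + b)))))"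
  using l by (intro mult_left_mono add_mono half pq) auto
 also have "... = \<epsilon> powr (4*H) * ((c3 * c2 + 17 * c4) * (N p * (l * (1 / (T - p) + b)) + N q * (1 / l * (1 / (T - q) + b))))"
  by (simp add: algebra_simps)
 also have "... = \<epsilon> powr (4*H) * ((c3 * c2 + 17 * c4) * Z)" unfolding l' Z_def by (simp only: l_def)
 finally have E: "\<bar>E\<bar> \<le> \<epsilon> powr (4*H) * ((c3 * c2 + 17 * c4) * Z)" .
 have ee: "(\<epsilon> powr (2*H))^2 = \<epsilon> powr (4*H)" by (simp add: power2_eq_square powr_add[symmetric])
 have y: "s powr (2*H - 1) * r powr (2*H - 1) \<le> c1^2"
 proof -
  have "s powr (2*H - 1) \<le> c1" "r powr (2*H - 1) \<le> c1" unfolding c1_def using s T H by (auto intro!: powr_mono2')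
  then show ?thesis unfolding power2_eq_square by (intro mult_mono) (auto simp: c1_def)
 qed
 have "\<bar>expectation (\<lambda>w. incr h \<epsilon> \<delta> s w * incr h \<epsilon> \<delta> r w)\<bar> = s powr (2*H - 1) * r powr (2*H - 1) * (\<bar>E\<bar> / \<epsilon> powr (4*H))"
  unfolding expectation_incr E_def[symmetric] ee by (simp add: abs_mult)
 also have "... \<le> c1^2 * ((c3 * c2 + 17 * c4) * Z)"
  using E e y by (intro mult_mono) (auto simp: pos_divide_le_eq mult.commute)
 also have "... = c * Z" unfolding ceq[symmetric] by (simp only: mult.assoc)
 finally have "ennreal \<bar>expectation (\<lambda>w. incr h \<epsilon> \<delta> s w * incr h \<epsilon> \<delta> r w)\<bar> \<le> ennreal (c * Z)" by (rule ennreal_leI)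
 also have "... = ennreal c * ennreal Z"
 proof (rule ennreal_mult)
  show "0 \<le> c" using c0 unfolding ceq[symmetric] by simp
  show "0 \<le> Z" using Z by (simp add: Z_def)
 qed
 also have "ennreal Z = end_kernel T h p q + end_kernel T h q p"
 proof -
  have d: "\<bar>p - q\<bar> = r - s" "\<bar>q - p\<bar> = r - s" using s by (auto simp: p_def q_def)
  have N0: "0 \<le> N x" for x by (simp add: N_def)
  have g: "gauss_mass h ((p + T) / 2) = ennreal (N p)" "gauss_mass h ((q + T) / 2) = ennreal (N q)"
   unfolding N_def by (rule A(4)[OF pq(1,2)], rule A(4)[OF pq(3,4)])
  show ?thesis
   unfolding Z_def ennreal_plus[OF Z] end_kernel_def g d b_def[symmetric] ennreal_mult'[OF N0] by (rule refl)
 qed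
 finally show ?thesis by (simp add: p_def q_def)
qed

text \<open>The bound comes from \<open>end_kernel_integral\<close> and is uniform up to
  \<open>T\<close>; the auxiliary \<open>\<Gamma>\<close>, whose bound blows up as
  \<open>t + \<delta>\<close> approaches \<open>T\<close>, serves integrability only. The two sides
  of the kernel have the same double integral after exchanging the variables.\<close>

lemma incr_upper_second_moment:
 assumes T: "0 < T"
 shows "\<exists>C\<ge>0. \<forall>h n \<epsilon> \<delta> t. h \<in> borel_measurable borel \<longrightarrow> 0 \<le> n \<longrightarrow> end_mass T h \<le> ennreal n \<longrightarrow>
  0 < \<epsilon> \<longrightarrow> 0 \<le> \<delta> \<longrightarrow> T / 2 \<le> t \<longrightarrow> t + \<delta> < T \<longrightarrow>
  (AE w in M. set_integrable lborel {T/2..t} (\<lambda>s. incr h \<epsilon> \<delta> s w)) \<and>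
  (\<integral>\<^sup>+w. ennreal ((LINT s:{T/2..t}|lborel. incr h \<epsilon> \<delta> s w)^2) \<partial>M) \<le> ennreal (C * n)"
proof -
 obtain C where C: "0 \<le> C" and Cb: "\<And>h n. h \<in> borel_measurable borel \<Longrightarrow> 0 \<le> n \<Longrightarrow> end_mass T h \<le> ennreal n \<Longrightarrow>
  (\<integral>\<^sup>+p\<in>{T/2..T}. (\<integral>\<^sup>+q\<in>{T/2..T}. end_kernel T h p q \<partial>lborel) \<partial>lborel) \<le> ennreal (C * n)"
  using end_kernel_integral[OF T] by blast
 define c where "c = ((T / 2) powr (2*H - 1))^2 * ((T / 2) powr (-2*H) * (3 * T / H * (T / 2) powr (-H)) + 17 * (T / 2) powr (-H))"
 have c: "0 \<le> c" unfolding c_def using T H by (intro mult_nonneg_nonneg add_nonneg_nonneg) auto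
 have "(AE w in M. set_integrable lborel {T/2..t} (\<lambda>s. incr h \<epsilon> \<delta> s w)) \<and>
  (\<integral>\<^sup>+w. ennreal ((LINT s:{T/2..t}|lborel. incr h \<epsilon> \<delta> s w)^2) \<partial>M) \<le> ennreal (2 * c * C * n)"
  if h [measurable]: "h \<in> borel_measurable borel" and n: "0 \<le> n" "end_mass T h \<le> ennreal n"
   and e: "0 < \<epsilon>" "0 \<le> \<delta>" and t: "T / 2 \<le> t" "t + \<delta> < T" for h n \<epsilon> \<delta> t
 proof -
  note A = end_mass_admissible[OF T h n(2,1)]
  define K where "K p q = ennreal c * (end_kernel T h p q + end_kernel T h q p)" for p q
  have [measurable]: "(\<lambda>(p, q). K p q) \<in> borel_measurable (borel \<Otimes>\<^sub>M borel)" unfolding K_def by measurable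
  define P where "P = t + \<delta>"
  have P: "T / 2 \<le> P" "P < T" using t e by (auto simp: P_def)
  define \<Gamma> where "\<Gamma> = 3 * T / H * (T / 2) powr (-H) * (enn2real (gauss_mass h ((P + T) / 2)) / (T - P))"
  have \<Gamma>: "0 \<le> \<Gamma>" using T H P by (auto simp: \<Gamma>_def)
  have \<Gamma>b: "\<Psi> h x \<le> \<Gamma>" if x: "T / 2 \<le> x" "x \<le> P" for x
  proof -
   have "gauss_mass h ((x + T) / 2) \<le> gauss_mass h ((P + T) / 2)" using x T by (intro gauss_mass_mono) auto
   then have "enn2real (gauss_mass h ((x + T) / 2)) \<le> enn2real (gauss_mass h ((P + T) / 2))"
    by (rule enn2real_mono) (subst A(4)[OF P], rule ennreal_less_top)
   then have "enn2real (gauss_mass h ((x + T) / 2)) / (T - x) \<le> enn2real (gauss_mass h ((P + T) / 2)) / (T - P)"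
    using x P by (intro frac_le) auto
   then have "3 * T / H * (T / 2) powr (-H) * (enn2real (gauss_mass h ((x + T) / 2)) / (T - x)) \<le> \<Gamma>"
    unfolding \<Gamma>_def using T H by (intro mult_left_mono) auto
   with A(2)[of x] x P show ?thesis by linarith
  qed
  have \<psi>: "set_integrable lborel {T/2..t} (\<lambda>s. s powr (2*H - 1) / \<epsilon> powr H * sqrt \<Gamma>)"
  proof -
   have "set_integrable lborel {0..t} (\<lambda>s::real. s powr (2*H - 1))" using H t T by (intro set_integrable_powr) auto
   then have "set_integrable lborel {T/2..t} (\<lambda>s::real. s powr (2*H - 1))" by (rule set_integrable_subset) (use T in auto)
   then show ?thesis by simp
  qed
  note S = second_moment_set_integral_le[OF incr_measurable[OF h], of "T/2" t "\<lambda>s. s powr (2*H - 1) / \<epsilon> powr H * sqrt \<Gamma>" \<epsilon> \<delta> "\<lambda>s r. K (s + \<delta>) (r + \<delta>)"]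
  have sq: "(\<integral>\<^sup>+w. ennreal ((incr h \<epsilon> \<delta> s w)^2) \<partial>M) \<le> ennreal ((s powr (2*H - 1) / \<epsilon> powr H * sqrt \<Gamma>)^2)" if "s \<in> {T/2..t}" for s
   using that e T t \<Gamma> by (intro incr_second_moment A(1) \<Gamma>b) (auto simp: P_def)
  have k1: "ennreal \<bar>expectation (\<lambda>w. incr h \<epsilon> \<delta> s w * incr h \<epsilon> \<delta> r w)\<bar> \<le> K (s + \<delta>) (r + \<delta>)"
   if "s \<in> {T/2..t}" "r \<in> {T/2..t}" "s < r" for s r
   unfolding K_def c_def using that t e by (intro incr_end_kernel[OF T h n(2,1)]) auto
  have k: "ennreal \<bar>expectation (\<lambda>w. incr h \<epsilon> \<delta> s w * incr h \<epsilon> \<delta> r w)\<bar> \<le> K (s + \<delta>) (r + \<delta>)"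
   if "s \<in> {T/2..t}" "r \<in> {T/2..t}" "s \<noteq> r" for s r
  proof (cases "s < r")
   case False
   then have "ennreal \<bar>expectation (\<lambda>w. incr h \<epsilon> \<delta> r w * incr h \<epsilon> \<delta> s w)\<bar> \<le> K (r + \<delta>) (s + \<delta>)" using that by (intro k1) auto
   then show ?thesis by (simp add: K_def ac_simps)
  qed (use k1 that in auto)
  have \<psi>0: "0 \<le> s powr (2*H - 1) / \<epsilon> powr H * sqrt \<Gamma>" for s using \<Gamma> by simp
  have "(\<integral>\<^sup>+w. ennreal ((LINT s:{T/2..t}|lborel. incr h \<epsilon> \<delta> s w)^2) \<partial>M)
   \<le> (\<integral>\<^sup>+s\<in>{T/2..t}. (\<integral>\<^sup>+r\<in>{T/2..t}. K (s + \<delta>) (r + \<delta>) \<partial>lborel) \<partial>lborel)" by (rule S(2)[OF \<psi>0 \<psi> sq k])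
  also have "... \<le> (\<integral>\<^sup>+p\<in>{T/2..T}. (\<integral>\<^sup>+q\<in>{T/2..T}. K p q \<partial>lborel) \<partial>lborel)"
  proof -
   define J where "J p = (\<integral>\<^sup>+q\<in>{T/2..T}. K p q \<partial>lborel)" for p
   have [measurable]: "J \<in> borel_measurable borel" unfolding J_def by measurable
   have shift: "(\<integral>\<^sup>+s\<in>{T/2..t}. f (s + \<delta>) \<partial>lborel) \<le> (\<integral>\<^sup>+p\<in>{T/2..T}. f p \<partial>lborel)"
    if [measurable]: "f \<in> borel_measurable borel" for f :: "real \<Rightarrow> ennreal"
   proof -
    have "(\<integral>\<^sup>+s\<in>{T/2..t}. f (s + \<delta>) \<partial>lborel) \<le> (\<integral>\<^sup>+s. f (\<delta> + 1 * s) * indicator {T/2..T} (\<delta> + 1 * s) \<partial>lborel)"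
     using t e by (intro nn_integral_mono) (auto simp: add.commute split: split_indicator)
    also have "... = (\<integral>\<^sup>+p\<in>{T/2..T}. f p \<partial>lborel)"
     using nn_integral_real_affine[of "\<lambda>p. f p * indicator {T/2..T} p" 1 \<delta>] by simp
    finally show ?thesis .
   qed
   have "(\<integral>\<^sup>+s\<in>{T/2..t}. (\<integral>\<^sup>+r\<in>{T/2..t}. K (s + \<delta>) (r + \<delta>) \<partial>lborel) \<partial>lborel) \<le> (\<integral>\<^sup>+s\<in>{T/2..t}. J (s + \<delta>) \<partial>lborel)"
    unfolding J_def by (intro nn_integral_mono mult_right_mono shift) auto
   also have "... \<le> (\<integral>\<^sup>+p\<in>{T/2..T}. J p \<partial>lborel)" by (rule shift) measurable
   finally show ?thesis by (simp add: J_def)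
  qed
  also have "... = ennreal c * ((\<integral>\<^sup>+p\<in>{T/2..T}. (\<integral>\<^sup>+q\<in>{T/2..T}. end_kernel T h p q \<partial>lborel) \<partial>lborel)
    + (\<integral>\<^sup>+p\<in>{T/2..T}. (\<integral>\<^sup>+q\<in>{T/2..T}. end_kernel T h q p \<partial>lborel) \<partial>lborel))"
  proof -
   define U V where "U p = (\<integral>\<^sup>+q\<in>{T/2..T}. end_kernel T h p q \<partial>lborel)" and "V p = (\<integral>\<^sup>+q\<in>{T/2..T}. end_kernel T h q p \<partial>lborel)" for p
   have [measurable]: "U \<in> borel_measurable borel" "V \<in> borel_measurable borel" unfolding U_def V_def by measurable
   have "(\<integral>\<^sup>+q\<in>{T/2..T}. K p q \<partial>lborel) = ennreal c * (U p + V p)" for p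
   proof -
    have "(\<integral>\<^sup>+q\<in>{T/2..T}. K p q \<partial>lborel) = (\<integral>\<^sup>+q. ennreal c * (end_kernel T h p q * indicator {T/2..T} q + end_kernel T h q p * indicator {T/2..T} q) \<partial>lborel)"
     unfolding K_def by (intro nn_integral_cong) (auto split: split_indicator)
    also have "... = ennreal c * (U p + V p)" unfolding U_def V_def
     by (subst nn_integral_cmult, measurable) (subst nn_integral_add, measurable)
    finally show ?thesis .
   qed
   then have "(\<integral>\<^sup>+p\<in>{T/2..T}. (\<integral>\<^sup>+q\<in>{T/2..T}. K p q \<partial>lborel) \<partial>lborel) = (\<integral>\<^sup>+p. ennreal c * (U p * indicator {T/2..T} p + V p * indicator {T/2..T} p) \<partial>lborel)"
    by (intro nn_integral_cong) (auto split: split_indicator)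
   also have "... = ennreal c * ((\<integral>\<^sup>+p\<in>{T/2..T}. U p \<partial>lborel) + (\<integral>\<^sup>+p\<in>{T/2..T}. V p \<partial>lborel))"
    by (subst nn_integral_cmult, measurable) (subst nn_integral_add, measurable)
   finally show ?thesis by (simp add: U_def V_def)
  qed
  also have "(\<integral>\<^sup>+p\<in>{T/2..T}. (\<integral>\<^sup>+q\<in>{T/2..T}. end_kernel T h q p \<partial>lborel) \<partial>lborel)
    = (\<integral>\<^sup>+p\<in>{T/2..T}. (\<integral>\<^sup>+q\<in>{T/2..T}. end_kernel T h p q \<partial>lborel) \<partial>lborel)"
  proof -
   define W where "W p q = end_kernel T h p q * indicator {T/2..T} p * indicator {T/2..T} q" for p q
   have [measurable]: "(\<lambda>(p, q). W p q) \<in> borel_measurable (lborel \<Otimes>\<^sub>M lborel)" unfolding W_def by measurable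
   have pull: "(\<integral>\<^sup>+p\<in>{T/2..T}. (\<integral>\<^sup>+q\<in>{T/2..T}. f p q \<partial>lborel) \<partial>lborel) = (\<integral>\<^sup>+p. (\<integral>\<^sup>+q. f p q * indicator {T/2..T} p * indicator {T/2..T} q \<partial>lborel) \<partial>lborel)"
    for f :: "real \<Rightarrow> real \<Rightarrow> ennreal" by (intro nn_integral_cong) (auto split: split_indicator)
   have "(\<integral>\<^sup>+p. (\<integral>\<^sup>+q. W q p \<partial>lborel) \<partial>lborel) = (\<integral>\<^sup>+p. (\<integral>\<^sup>+q. W p q \<partial>lborel) \<partial>lborel)"
    by (rule lborel_pair.Fubini') measurable
   then show ?thesis unfolding pull W_def by (simp add: ac_simps)
  qed
  also have "ennreal c * ((\<integral>\<^sup>+p\<in>{T/2..T}. (\<integral>\<^sup>+q\<in>{T/2..T}. end_kernel T h p q \<partial>lborel) \<partial>lborel)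
    + (\<integral>\<^sup>+p\<in>{T/2..T}. (\<integral>\<^sup>+q\<in>{T/2..T}. end_kernel T h p q \<partial>lborel) \<partial>lborel)) \<le> ennreal c * (ennreal (C * n) + ennreal (C * n))"
   by (intro mult_left_mono add_mono Cb h n) auto
  also have "... = ennreal (2 * c * C * n)"
   using c C n by (simp add: ennreal_plus[symmetric] ennreal_mult[symmetric] algebra_simps del: ennreal_plus)
  finally have 2: "(\<integral>\<^sup>+w. ennreal ((LINT s:{T/2..t}|lborel. incr h \<epsilon> \<delta> s w)^2) \<partial>M) \<le> ennreal (2 * c * C * n)" .
  have "AE w in M. set_integrable lborel {T/2..t} (\<lambda>s. incr h \<epsilon> \<delta> s w)" by (rule S(1)[OF \<psi>0 \<psi> sq k])
  then show ?thesis using 2 by (rule conjI)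
 qed
 then show ?thesis using c C by (intro exI[of _ "2 * c * C"]) auto
qed

lemma incr_measurable_swap:
 assumes "h \<in> borel_measurable borel"
 shows "(\<lambda>(w, s). incr h \<epsilon> \<delta> s w) \<in> borel_measurable (M \<Otimes>\<^sub>M lborel)"
proof -
 have "(\<lambda>(s, w). incr h \<epsilon> \<delta> s w) \<circ> (\<lambda>(w, s). (s, w)) \<in> borel_measurable (M \<Otimes>\<^sub>M lborel)"
  by (intro measurable_comp[OF _ incr_measurable[OF assms]]) measurable
 then show ?thesis by (simp add: comp_def split_beta')
qed

lemma incr_integral_measurable:
 assumes [measurable]: "h \<in> borel_measurable borel"
 shows "(\<lambda>w. LINT s:{a..b}|lborel. incr h \<epsilon> \<delta> s w) \<in> borel_measurable M"
proof -
 note [measurable] = incr_measurable_swap[OF assms]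
 show ?thesis unfolding set_lebesgue_integral_def by (rule lborel.borel_measurable_lebesgue_integral) measurable
qed

text \<open>For \<open>s \<le> T / 2\<close> and \<open>\<delta> \<le> T / 4\<close> the time
  \<open>s + \<delta>\<close> stays below \<open>7 * T / 8\<close> by at least \<open>T / 8\<close>,
  so the price of the gap is a constant and \<open>incr_maximal\<close> applies on
  \<open>{0..T/2}\<close>. The number \<open>21 / 2\<close> comes from
  \<open>3 * P / (2 * H * (P - p))\<close> with \<open>P = 7 * T / 8\<close> and gap
  \<open>T / 8\<close>, times the factor \<open>H\<close> of \<open>end_mass_bounds\<close>.\<close>

lemma incr_lower_second_moment:
 assumes T: "0 < T"
 shows "\<exists>C\<ge>0. \<forall>h n \<epsilon> \<delta>. h \<in> borel_measurable borel \<longrightarrow> 0 \<le> n \<longrightarrow> end_mass T h \<le> ennreal n \<longrightarrow>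
  0 < \<epsilon> \<longrightarrow> 0 \<le> \<delta> \<longrightarrow> \<delta> \<le> T / 4 \<longrightarrow>
  (AE w in M. set_integrable lborel {0..T/2} (\<lambda>s. incr h \<epsilon> \<delta> s w)) \<and>
  (\<forall>t\<in>{0..T/2}. (\<integral>\<^sup>+w. ennreal ((LINT s:{0..t}|lborel. incr h \<epsilon> \<delta> s w)^2) \<partial>M) \<le> ennreal (C * n))"
proof -
 define k where "k = 21 / 2 / (T / 8) powr H"
 have k: "0 \<le> k" by (simp add: k_def)
 have "(AE w in M. set_integrable lborel {0..T/2} (\<lambda>s. incr h \<epsilon> \<delta> s w)) \<and>
  (\<forall>t\<in>{0..T/2}. (\<integral>\<^sup>+w. ennreal ((LINT s:{0..t}|lborel. incr h \<epsilon> \<delta> s w)^2) \<partial>M) \<le> ennreal (\<bar>max_const H (T / 2)\<bar> * 35 * k * n))"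
  if h [measurable]: "h \<in> borel_measurable borel" and n: "0 \<le> n" "end_mass T h \<le> ennreal n"
   and e: "0 < \<epsilon>" "0 \<le> \<delta>" "\<delta> \<le> T / 4" for h n \<epsilon> \<delta>
 proof -
  define N where "N = H / (T - 7 * T / 8) powr H * n"
  have N0: "0 \<le> N" using H n by (simp add: N_def)
  have N: "gauss_mass h (7 * T / 8) \<le> ennreal N" unfolding N_def using T by (intro end_mass_bounds n) auto
  have adm: "admissible h (B p)" and le: "\<Psi> h p \<le> k * n * p powr (-H)" if p: "0 < p" "p \<le> T / 2 + \<delta>" for p
  proof -
   have p': "p < 7 * T / 8" "T / 8 \<le> 7 * T / 8 - p" using p e T by auto
   note W = weighted_square_gap[OF p(1) p'(1) h N N0]
   show "admissible h (B p)" by (rule W(1))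
   have "\<Psi> h p \<le> 3 * (7 * T / 8) / (2 * H * (7 * T / 8 - p)) * p powr (-H) * N" by (rule W(2))
   also have "... \<le> 3 * (7 * T / 8) / (2 * H * (T / 8)) * p powr (-H) * N"
    using p' T H N0 by (intro mult_right_mono divide_left_mono mult_left_mono mult_pos_pos) auto
   also have "... = k * n * p powr (-H)" using T H by (simp add: k_def N_def)
   finally show "\<Psi> h p \<le> k * n * p powr (-H)" .
  qed
  obtain S where [measurable]: "S \<in> borel_measurable M" and S: "(\<integral>\<^sup>+w. S w \<partial>M) \<le> ennreal (max_const H (T / 2) * (35 * (k * n)))"
   and AE: "AE w in M. set_integrable lborel {0..T/2} (\<lambda>s. incr h \<epsilon> \<delta> s w) \<and>
    (\<forall>t\<in>{0..T/2}. ennreal ((LINT s:{0..t}|lborel. incr h \<epsilon> \<delta> s w)^2) \<le> S w)"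
   using incr_maximal[of "T/2" \<epsilon> \<delta> "k * n" h, OF _ e(1,2) _ h adm le] T k n by auto
  have "max_const H (T / 2) * (35 * (k * n)) \<le> \<bar>max_const H (T / 2)\<bar> * (35 * (k * n))"
   using k n by (intro mult_right_mono) auto
  then have S': "(\<integral>\<^sup>+w. S w \<partial>M) \<le> ennreal (\<bar>max_const H (T / 2)\<bar> * 35 * k * n)"
   unfolding mult.assoc by (rule order_trans[OF S ennreal_leI])
  have "(\<integral>\<^sup>+w. ennreal ((LINT s:{0..t}|lborel. incr h \<epsilon> \<delta> s w)^2) \<partial>M) \<le> ennreal (\<bar>max_const H (T / 2)\<bar> * 35 * k * n)" if "t \<in> {0..T/2}" for t
  proof (rule order_trans[OF nn_integral_mono_AE S'])
   show "AE w in M. ennreal ((LINT s:{0..t}|lborel. incr h \<epsilon> \<delta> s w)^2) \<le> S w" using AE that by auto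
  qed
  moreover have "AE w in M. set_integrable lborel {0..T/2} (\<lambda>s. incr h \<epsilon> \<delta> s w)" using AE by auto
  ultimately show ?thesis by blast
 qed
 then show ?thesis using k by (intro exI[of _ "\<bar>max_const H (T / 2)\<bar> * 35 * k"]) auto
qed

lemma square_sum_integral:
 assumes [measurable]: "X \<in> borel_measurable M" "Y \<in> borel_measurable M"
  and X: "(\<integral>\<^sup>+w. ennreal ((X w)^2) \<partial>M) \<le> ennreal a" and Y: "(\<integral>\<^sup>+w. ennreal ((Y w)^2) \<partial>M) \<le> ennreal b"
  and ab: "0 \<le> a" "0 \<le> b" and Z: "AE w in M. \<bar>Z w\<bar> \<le> \<bar>X w\<bar> + \<bar>Y w\<bar>"
 shows "(\<integral>\<^sup>+w. ennreal ((Z w)^2) \<partial>M) \<le> ennreal (2 * a + 2 * b)"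
proof -
 have "(\<integral>\<^sup>+w. ennreal ((Z w)^2) \<partial>M) \<le> (\<integral>\<^sup>+w. ennreal ((1 * \<bar>X w\<bar> + 1 * \<bar>Y w\<bar>)^2) \<partial>M)"
  using Z by (intro nn_integral_mono_AE) (auto elim!: eventually_mono intro!: ennreal_leI simp: abs_le_square_iff[symmetric])
 also have "... \<le> ennreal (2 * 1^2) * (\<integral>\<^sup>+w. ennreal (\<bar>X w\<bar>^2) \<partial>M) + ennreal (2 * 1^2) * (\<integral>\<^sup>+w. ennreal (\<bar>Y w\<bar>^2) \<partial>M)"
  by (rule nn_integral_square_lincomb) measurable
 also have "... \<le> ennreal (2 * 1^2) * ennreal a + ennreal (2 * 1^2) * ennreal b"
  unfolding power2_abs by (intro add_mono mult_left_mono X Y) simp_all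
 also have "... = ennreal (2 * a + 2 * b)" using ab by (simp add: ennreal_mult)
 finally show ?thesis .
qed

lemma incr_second_moment_end:
 assumes T: "0 < T"
 shows "\<exists>C\<ge>0. \<forall>h n \<epsilon> \<delta> t. h \<in> borel_measurable borel \<longrightarrow> 0 \<le> n \<longrightarrow> end_mass T h \<le> ennreal n \<longrightarrow>
  0 < \<epsilon> \<longrightarrow> 0 \<le> \<delta> \<longrightarrow> \<delta> \<le> T / 4 \<longrightarrow> 0 \<le> t \<longrightarrow> t + \<delta> < T \<longrightarrow>
  (AE w in M. set_integrable lborel {0..t} (\<lambda>s. incr h \<epsilon> \<delta> s w)) \<and>
  (\<integral>\<^sup>+w. ennreal ((LINT s:{0..t}|lborel. incr h \<epsilon> \<delta> s w)^2) \<partial>M) \<le> ennreal (C * n)"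
proof -
 obtain C1 where C1: "0 \<le> C1" and low: "\<And>h n \<epsilon> \<delta>. h \<in> borel_measurable borel \<Longrightarrow> 0 \<le> n \<Longrightarrow> end_mass T h \<le> ennreal n \<Longrightarrow>
  0 < \<epsilon> \<Longrightarrow> 0 \<le> \<delta> \<Longrightarrow> \<delta> \<le> T / 4 \<Longrightarrow>
  (AE w in M. set_integrable lborel {0..T/2} (\<lambda>s. incr h \<epsilon> \<delta> s w)) \<and>
  (\<forall>t\<in>{0..T/2}. (\<integral>\<^sup>+w. ennreal ((LINT s:{0..t}|lborel. incr h \<epsilon> \<delta> s w)^2) \<partial>M) \<le> ennreal (C1 * n))"
  using incr_lower_second_moment[OF T] by blast
 obtain C2 where C2: "0 \<le> C2" and up: "\<And>h n \<epsilon> \<delta> t. h \<in> borel_measurable borel \<Longrightarrow> 0 \<le> n \<Longrightarrow> end_mass T h \<le> ennreal n \<Longrightarrow>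
  0 < \<epsilon> \<Longrightarrow> 0 \<le> \<delta> \<Longrightarrow> T / 2 \<le> t \<Longrightarrow> t + \<delta> < T \<Longrightarrow>
  (AE w in M. set_integrable lborel {T/2..t} (\<lambda>s. incr h \<epsilon> \<delta> s w)) \<and>
  (\<integral>\<^sup>+w. ennreal ((LINT s:{T/2..t}|lborel. incr h \<epsilon> \<delta> s w)^2) \<partial>M) \<le> ennreal (C2 * n)"
  using incr_upper_second_moment[OF T] by blast
 have "(AE w in M. set_integrable lborel {0..t} (\<lambda>s. incr h \<epsilon> \<delta> s w)) \<and>
  (\<integral>\<^sup>+w. ennreal ((LINT s:{0..t}|lborel. incr h \<epsilon> \<delta> s w)^2) \<partial>M) \<le> ennreal ((2 * C1 + 2 * C2) * n)"
  if h: "h \<in> borel_measurable borel" and n: "0 \<le> n" "end_mass T h \<le> ennreal n"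
   and e: "0 < \<epsilon>" "0 \<le> \<delta>" "\<delta> \<le> T / 4" and t: "0 \<le> t" "t + \<delta> < T" for h n \<epsilon> \<delta> t
 proof (cases "t \<le> T / 2")
  case True
  have "AE w in M. set_integrable lborel {0..t} (\<lambda>s. incr h \<epsilon> \<delta> s w)"
   using conjunct1[OF low[OF h n e]] by eventually_elim (erule set_integrable_subset, use True in auto)
  moreover have "(\<integral>\<^sup>+w. ennreal ((LINT s:{0..t}|lborel. incr h \<epsilon> \<delta> s w)^2) \<partial>M) \<le> ennreal (C1 * n)"
   using low[OF h n e] True t by auto
  moreover have "ennreal (C1 * n) \<le> ennreal ((2 * C1 + 2 * C2) * n)"
   using C1 C2 n by (intro ennreal_leI mult_right_mono) auto
  ultimately show ?thesis using order_trans by blast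
 next
  case False
  then have t': "T / 2 \<le> t" by simp
  note U = up[OF h n e(1,2) t' t(2)] and L = low[OF h n e]
  have Lt: "(\<integral>\<^sup>+w. ennreal ((LINT s:{0..T/2}|lborel. incr h \<epsilon> \<delta> s w)^2) \<partial>M) \<le> ennreal (C1 * n)" using L T by auto
  have I: "AE w in M. set_integrable lborel {0..t} (\<lambda>s. incr h \<epsilon> \<delta> s w)" using conjunct1[OF L] conjunct1[OF U]
  proof eventually_elim
   case (elim w)
   have "set_integrable lborel ({0..T/2} \<union> {T/2..t}) (\<lambda>s. incr h \<epsilon> \<delta> s w)" by (rule set_integrable_Un[OF elim]) auto
   moreover have "{0..T/2} \<union> {T/2..t} = {0..t}" using T t' by auto
   ultimately show ?case by simp
  qed
  have "(\<integral>\<^sup>+w. ennreal ((LINT s:{0..t}|lborel. incr h \<epsilon> \<delta> s w)^2) \<partial>M) \<le> ennreal (2 * (C1 * n) + 2 * (C2 * n))"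
  proof (rule square_sum_integral[OF incr_integral_measurable[OF h] incr_integral_measurable[OF h] Lt conjunct2[OF U]])
   show "AE w in M. \<bar>LINT s:{0..t}|lborel. incr h \<epsilon> \<delta> s w\<bar> \<le> \<bar>LINT s:{0..T/2}|lborel. incr h \<epsilon> \<delta> s w\<bar> + \<bar>LINT s:{T/2..t}|lborel. incr h \<epsilon> \<delta> s w\<bar>"
    using I
   proof eventually_elim
    case (elim w)
    show ?case using set_lebesgue_integral_continuous(2)[OF elim, of "T/2" t] T t' by simp
   qed
  qed (use C1 C2 n in auto)
  then show ?thesis using I by (simp add: algebra_simps)
 qed
 then show ?thesis using C1 C2 by (intro exI[of _ "2 * C1 + 2 * C2"]) auto
qed

lemma qc_approx_second_moment:
 assumes T: "0 < T"
 shows "\<exists>C\<ge>0. \<forall>h n \<epsilon> t. h \<in> borel_measurable borel \<longrightarrow> 0 \<le> n \<longrightarrow> end_mass T h \<le> ennreal n \<longrightarrow>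
  0 < \<epsilon> \<longrightarrow> \<epsilon> \<le> T / 4 \<longrightarrow> 0 \<le> t \<longrightarrow> t + \<epsilon> < T \<longrightarrow>
  (\<integral>\<^sup>+w. ennreal ((qc_approx H B h \<epsilon> t w)^2) \<partial>M) \<le> ennreal (C * n)"
proof -
 obtain C where C: "0 \<le> C" and b: "\<And>h n \<epsilon> \<delta> t. h \<in> borel_measurable borel \<Longrightarrow> 0 \<le> n \<Longrightarrow> end_mass T h \<le> ennreal n \<Longrightarrow>
  0 < \<epsilon> \<Longrightarrow> 0 \<le> \<delta> \<Longrightarrow> \<delta> \<le> T / 4 \<Longrightarrow> 0 \<le> t \<Longrightarrow> t + \<delta> < T \<Longrightarrow>
  (AE w in M. set_integrable lborel {0..t} (\<lambda>s. incr h \<epsilon> \<delta> s w)) \<and>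
  (\<integral>\<^sup>+w. ennreal ((LINT s:{0..t}|lborel. incr h \<epsilon> \<delta> s w)^2) \<partial>M) \<le> ennreal (C * n)"
  using incr_second_moment_end[OF T] by blast
 have "(\<integral>\<^sup>+w. ennreal ((qc_approx H B h \<epsilon> t w)^2) \<partial>M) \<le> ennreal (4 * C * n)"
  if h: "h \<in> borel_measurable borel" and n: "0 \<le> n" "end_mass T h \<le> ennreal n"
   and e: "0 < \<epsilon>" "\<epsilon> \<le> T / 4" and t: "0 \<le> t" "t + \<epsilon> < T" for h n \<epsilon> t
 proof -
  have b0: "(AE w in M. set_integrable lborel {0..t} (\<lambda>s. incr h \<epsilon> 0 s w)) \<and>
   (\<integral>\<^sup>+w. ennreal ((LINT s:{0..t}|lborel. incr h \<epsilon> 0 s w)^2) \<partial>M) \<le> ennreal (C * n)" using e t T by (intro b h n) auto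
  have be: "(AE w in M. set_integrable lborel {0..t} (\<lambda>s. incr h \<epsilon> \<epsilon> s w)) \<and>
   (\<integral>\<^sup>+w. ennreal ((LINT s:{0..t}|lborel. incr h \<epsilon> \<epsilon> s w)^2) \<partial>M) \<le> ennreal (C * n)" using e t T by (intro b h n) auto
  have "(\<integral>\<^sup>+w. ennreal ((qc_approx H B h \<epsilon> t w)^2) \<partial>M) \<le> ennreal (2 * (C * n) + 2 * (C * n))"
  proof (rule square_sum_integral[OF incr_integral_measurable[OF h] incr_integral_measurable[OF h] conjunct2[OF be] conjunct2[OF b0]])
   show "AE w in M. \<bar>qc_approx H B h \<epsilon> t w\<bar> \<le> \<bar>LINT s:{0..t}|lborel. incr h \<epsilon> \<epsilon> s w\<bar> + \<bar>LINT s:{0..t}|lborel. incr h \<epsilon> 0 s w\<bar>"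
    using conjunct1[OF be] conjunct1[OF b0]
   proof eventually_elim
    case (elim w)
    define y z where "y = (LINT s:{0..t}|lborel. incr h \<epsilon> \<epsilon> s w)" and "z = (LINT s:{0..t}|lborel. incr h \<epsilon> 0 s w)"
    have "qc_approx H B h \<epsilon> t w = 2 * H * (y - z)"
     unfolding qc_approx_incr y_def z_def by (subst set_integral_diff(2)[OF elim]) simp
    then have "\<bar>qc_approx H B h \<epsilon> t w\<bar> = 2 * H * \<bar>y - z\<bar>" using H by (simp add: abs_mult)
    also have "... \<le> 1 * \<bar>y - z\<bar>" using H by (intro mult_right_mono) auto
    also have "... \<le> \<bar>y\<bar> + \<bar>z\<bar>" by simp
    finally show ?case unfolding y_def z_def .
   qed
  qed (use C n in auto)
  then show ?thesis by (simp add: algebra_simps)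
 qed
 then show ?thesis using C by (intro exI[of _ "4 * C"]) auto
qed

section \<open>Second moment of the limit process\<close>

lemma near_constant: "near T X Y \<eta> \<Longrightarrow> t \<in> {0..T} \<Longrightarrow> near T (\<lambda>_. X t) (\<lambda>_. Y t) \<eta>"
 unfolding near_def by blast

text \<open>Borel-Cantelli turns the rates \<open>1 / 2 ^ n\<close> into almost sure convergence;
  Fatou's lemma concludes.\<close>

lemma second_moment_limit:
 assumes [measurable]: "\<And>n. X n \<in> borel_measurable M" and n: "\<And>n::nat. near T (\<lambda>_. X n) (\<lambda>_. Y) (1 / 2 ^ n)"
  and T: "0 \<le> T" and b: "\<And>n. (\<integral>\<^sup>+w. ennreal ((X n w)^2) \<partial>M) \<le> c"
 shows "(\<integral>\<^sup>+w. ennreal ((Y w)^2) \<partial>M) \<le> c"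
proof -
 have lim: "AE w in M. (\<lambda>n. X n w) \<longlonglongrightarrow> Y w" using near_limsup_null[OF n]
 proof eventually_elim
  case (elim w)
  then obtain k where k: "\<And>m. k \<le> m \<Longrightarrow> \<bar>X m w - Y w\<bar> \<le> 1 / 2 ^ m" using T by auto
  have "(\<lambda>m. X m w - Y w) \<longlonglongrightarrow> 0"
  proof (rule Lim_null_comparison)
   show "\<forall>\<^sub>F m in sequentially. norm (X m w - Y w) \<le> (1 / 2) ^ m"
    using k by (intro eventually_sequentiallyI[of k]) (auto simp: power_one_over)
   show "(\<lambda>m. (1 / 2 :: real) ^ m) \<longlonglongrightarrow> 0" by (rule LIMSEQ_realpow_zero) auto
  qed
  then show ?case by (rule LIM_zero_cancel)
 qed
 have "(\<integral>\<^sup>+w. ennreal ((Y w)^2) \<partial>M) = (\<integral>\<^sup>+w. liminf (\<lambda>n. ennreal ((X n w)^2)) \<partial>M)"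
 proof (rule nn_integral_cong_AE)
  show "AE w in M. ennreal ((Y w)^2) = liminf (\<lambda>n. ennreal ((X n w)^2))" using lim
  proof eventually_elim
   case (elim w)
   have "(\<lambda>n. ennreal ((X n w)^2)) \<longlonglongrightarrow> ennreal ((Y w)^2)" by (intro tendsto_intros elim)
   then show ?case by (intro lim_imp_Liminf[symmetric]) auto
  qed
 qed
 also have "... \<le> liminf (\<lambda>n. \<integral>\<^sup>+w. ennreal ((X n w)^2) \<partial>M)" by (rule nn_integral_liminf) measurable
 also have "... \<le> c" by (rule Liminf_le) (use b in auto)
 finally show ?thesis .
qed

lemma qc_approx_measurable:
 assumes [measurable]: "h \<in> borel_measurable borel"
 shows "qc_approx H B h \<epsilon> t \<in> borel_measurable M"
proof -
 note [measurable] = incr_measurable_swap[OF assms]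
 show ?thesis unfolding qc_approx_incr[abs_def] set_lebesgue_integral_def
  by (intro borel_measurable_times borel_measurable_const lborel.borel_measurable_lebesgue_integral) measurable
qed

text \<open>For \<open>t < T\<close> the approximations with \<open>t + \<epsilon> < T\<close> have
  bounded second moments, which pass to the limit. At \<open>t = T\<close> no such
  \<open>\<epsilon>\<close> exists, and \<open>Q T\<close> is reached through earlier times.\<close>

theorem has_qc_second_moment:
 assumes T: "0 < T"
 shows "\<exists>C\<ge>0. \<forall>h n Q t. L2loc h \<longrightarrow> 0 \<le> n \<longrightarrow> end_mass T h \<le> ennreal n \<longrightarrow> has_qc T h Q \<longrightarrow> t \<in> {0..T} \<longrightarrow>
  (\<integral>\<^sup>+w. ennreal ((Q t w)^2) \<partial>M) \<le> ennreal (C * n)"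
proof -
 obtain C where C: "0 \<le> C" and b: "\<And>h n \<epsilon> t. h \<in> borel_measurable borel \<Longrightarrow> 0 \<le> n \<Longrightarrow> end_mass T h \<le> ennreal n \<Longrightarrow>
  0 < \<epsilon> \<Longrightarrow> \<epsilon> \<le> T / 4 \<Longrightarrow> 0 \<le> t \<Longrightarrow> t + \<epsilon> < T \<Longrightarrow>
  (\<integral>\<^sup>+w. ennreal ((qc_approx H B h \<epsilon> t w)^2) \<partial>M) \<le> ennreal (C * n)" using qc_approx_second_moment[OF T] by blast
 have "(\<integral>\<^sup>+w. ennreal ((Q t w)^2) \<partial>M) \<le> ennreal (C * n)"
  if h: "L2loc h" and n: "0 \<le> n" "end_mass T h \<le> ennreal n" and Q: "has_qc T h Q" and t: "t \<in> {0..T}" for h n Q t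
 proof -
  note hm = L2loc_measurable[OF h]
  have QM: "\<And>t. t \<in> {0..T} \<Longrightarrow> Q t \<in> borel_measurable M" and Qn: "\<And>\<eta>. 0 < \<eta> \<Longrightarrow> eventually (\<lambda>\<epsilon>. near T (qc_approx H B h \<epsilon>) Q \<eta>) (at_right 0)"
   using Q[unfolded has_qc_iff] by auto
  have inner: "(\<integral>\<^sup>+w. ennreal ((Q t w)^2) \<partial>M) \<le> ennreal (C * n)" if t: "0 \<le> t" "t < T" for t
  proof -
   have "\<exists>\<epsilon>. near T (qc_approx H B h \<epsilon>) Q (1 / 2 ^ k) \<and> 0 < \<epsilon> \<and> \<epsilon> \<le> T / 4 \<and> t + \<epsilon> < T" for k :: nat
   proof -
    have "eventually (\<lambda>\<epsilon>. \<epsilon> \<in> {0<..<min (T/4) (T - t)}) (at_right (0::real))"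
     using T t by (intro eventually_at_right_real) auto
    then have "eventually (\<lambda>\<epsilon>. near T (qc_approx H B h \<epsilon>) Q (1 / 2 ^ k) \<and> \<epsilon> \<in> {0<..<min (T/4) (T - t)}) (at_right 0)"
     by (intro eventually_conj Qn) simp_all
    then show ?thesis by (rule eventually_at_right_obtain) (auto simp: algebra_simps)
   qed
   then obtain \<epsilon> where \<epsilon>: "\<And>k::nat. near T (qc_approx H B h (\<epsilon> k)) Q (1 / 2 ^ k)" "\<And>k. 0 < \<epsilon> k" "\<And>k. \<epsilon> k \<le> T / 4" "\<And>k. t + \<epsilon> k < T"
    by metis
   show ?thesis
   proof (rule second_moment_limit)
    show "qc_approx H B h (\<epsilon> k) t \<in> borel_measurable M" for k by (rule qc_approx_measurable[OF hm])
    show "near T (\<lambda>_. qc_approx H B h (\<epsilon> k) t) (\<lambda>_. Q t) (1 / 2 ^ k)" for k by (rule near_constant[OF \<epsilon>(1)]) (use t in auto)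
    show "(\<integral>\<^sup>+w. ennreal ((qc_approx H B h (\<epsilon> k) t w)^2) \<partial>M) \<le> ennreal (C * n)" for k by (intro b hm n \<epsilon> t)
   qed (use T in auto)
  qed
  show ?thesis
  proof (cases "t = T")
   case True
   \<comment> \<open>For a fixed \<open>\<epsilon>\<close> the approximation is continuous in time
     and near \<open>Q\<close> uniformly in time, so a third of the tolerance goes to each passage:
     from \<open>Q u\<close> to the approximation, along it to time \<open>T\<close>, and back to
     \<open>Q T\<close>.\<close>
   have "\<exists>u. 0 \<le> u \<and> u < T \<and> near T (\<lambda>_. Q u) (\<lambda>_. Q T) (1 / 2 ^ k)" for k :: nat
   proof -
    define \<eta> where "\<eta> = 1 / 2 ^ k / (3::real)"
    have \<eta>: "0 < \<eta>" "\<eta> + \<eta> + \<eta> = 1 / 2 ^ k" by (auto simp: \<eta>_def)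
    obtain \<epsilon> where \<epsilon>: "near T (qc_approx H B h \<epsilon>) Q \<eta>" "\<epsilon> \<in> {0<..1}" using eventually_at_right_obtain[OF Qn[OF \<eta>(1)]] by blast
    have e01: "0 < \<epsilon>" "\<epsilon> \<le> 1" using \<epsilon>(2) by auto
    define X where "X = qc_approx H B h \<epsilon>"
    define u where "u m = T - T / Suc m" for m :: nat
    have u: "0 \<le> u m" "u m < T" for m using T by (auto simp: u_def field_simps)
    have "AE w in M. (\<lambda>m. X (u m) w) \<longlonglongrightarrow> X T w" using qc_approx_continuous[OF h T e01]
    proof eventually_elim
     case (elim w)
     have "(\<lambda>m. T - T * (1 / real (Suc m))) \<longlonglongrightarrow> T - T * 0" using LIMSEQ_inverse_real_of_nat by (intro tendsto_intros) (simp add: inverse_eq_divide)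
     then have "u \<longlonglongrightarrow> T" by (simp add: u_def[abs_def])
     moreover have "continuous_on {0..T} (\<lambda>t. X t w)" using elim by (simp add: X_def)
     ultimately show ?case using T u by (elim continuous_on_tendsto_compose) (auto simp: less_imp_le)
    qed
    then have "eventually (\<lambda>m. near T (\<lambda>_. X (u m)) (\<lambda>_. X T) \<eta>) sequentially"
     unfolding X_def by (intro near_of_AE_tendsto qc_approx_measurable hm \<eta>)
    then obtain m where m: "near T (\<lambda>_. X (u m)) (\<lambda>_. X T) \<eta>" by (auto simp: eventually_sequentially)
    have "near T (\<lambda>_. Q (u m)) (\<lambda>_. X (u m)) \<eta>" unfolding X_def by (rule near_sym[OF near_constant[OF \<epsilon>(1)]]) (use u[of m] in auto)
    moreover have "near T (\<lambda>_. X T) (\<lambda>_. Q T) \<eta>" unfolding X_def by (rule near_constant[OF \<epsilon>(1)]) (use T in auto)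
    ultimately have "near T (\<lambda>_. Q (u m)) (\<lambda>_. Q T) (\<eta> + \<eta> + \<eta>)" using m by (blast intro: near_triangle)
    then show ?thesis using u \<eta> by auto
   qed
   then obtain u where u: "\<And>k::nat. 0 \<le> u k" "\<And>k. u k < T" "\<And>k. near T (\<lambda>_. Q (u k)) (\<lambda>_. Q T) (1 / 2 ^ k)" by metis
   show ?thesis unfolding True
   proof (rule second_moment_limit[OF _ u(3)])
    show "Q (u k) \<in> borel_measurable M" for k using u[of k] by (intro QM) auto
    show "(\<integral>\<^sup>+w. ennreal ((Q (u k) w)^2) \<partial>M) \<le> ennreal (C * n)" for k by (intro inner u)
   qed (use T in auto)
  qed (use inner t in auto)
 qed
 then show ?thesis using C by blast
qed

end

lemma nn_integral_powr_reflect: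
 fixes T p :: real
 assumes T: "0 \<le> T" and p: "-1 < p"
 shows "(\<integral>\<^sup>+s\<in>{0..T}. ennreal ((T - s) powr p) \<partial>lborel) = ennreal (T powr (p + 1) / (p + 1))"
proof -
 define f where "f y = ennreal (y powr p) * indicator {0..T} y" for y :: real
 have [measurable]: "f \<in> borel_measurable borel" unfolding f_def by measurable
 have "(\<integral>\<^sup>+s\<in>{0..T}. ennreal ((T - s) powr p) \<partial>lborel) = (\<integral>\<^sup>+s. f (T + (-1) * s) \<partial>lborel)"
  by (intro nn_integral_cong) (auto simp: f_def split: split_indicator)
 also have "... = (\<integral>\<^sup>+y. f y \<partial>lborel)" using nn_integral_real_affine[of f "-1" T] by simp
 also have "... = ennreal (T powr (p + 1) / (p + 1))" unfolding f_def using nn_integral_powr_from_0[OF p T] .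
 finally show ?thesis .
qed

lemma ennreal_sqrt_square: "a < \<infinity> \<Longrightarrow> (ennreal_sqrt a)^2 = a"
 by (cases a) (auto simp: ennreal_sqrt_def ennreal_power)

lemma ennreal_sqrt_le: "a \<le> ennreal e \<Longrightarrow> ennreal_sqrt a \<le> ennreal (sqrt e)"
 by (cases a) (auto simp: ennreal_sqrt_def top_unique ennreal_le_iff2 intro!: ennreal_leI)

lemma elem_fun_measurable: "elem_fun g \<in> borel_measurable borel"
proof -
 obtain l a c where g: "g = (l, a, c)" by (metis prod_cases3)
 have "elem_fun g = (\<lambda>x. \<Sum>j=1..l. c j * indicator {a (j - 1)<..a j} x)" by (simp add: fun_eq_iff g elem_fun_eq)
 also have "... \<in> borel_measurable borel" by measurable
 finally show ?thesis .
qed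

section \<open>The norm as a weighted square norm on the line\<close>

context fbm
begin

definition start_mass :: "real \<Rightarrow> (real \<Rightarrow> real) \<Rightarrow> ennreal" where
 "start_mass T h = (\<integral>\<^sup>+s\<in>{0..T}. gauss_mass h s * ennreal (s powr (H - 1)) \<partial>lborel)"

lemma H_norm_masses:
 assumes [measurable]: "h \<in> borel_measurable borel"
 shows "H_norm H T h = ennreal_sqrt (ennreal (1 / sqrt (2*pi)) * start_mass T h)
  + ennreal_sqrt (ennreal (1 / sqrt (2*pi)) * end_mass T h)"
proof -
 have eq: "(\<integral>\<^sup>+s\<in>{0..T}. (\<integral>\<^sup>+x. ennreal (\<bar>h x\<bar>^2 * exp (- (x^2 / (2 * s powr (2*H)))) / (sqrt (2*pi) * a s powr (1 - H))) \<partial>lborel) \<partial>lborel)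
  = ennreal (1 / sqrt (2*pi)) * (\<integral>\<^sup>+s\<in>{0..T}. gauss_mass h s * ennreal (a s powr (H - 1)) \<partial>lborel)"
  if [measurable]: "a \<in> borel_measurable borel" for a :: "real \<Rightarrow> real"
 proof -
  have "(\<integral>\<^sup>+x. ennreal (\<bar>h x\<bar>^2 * exp (- (x^2 / (2 * s powr (2*H)))) / (sqrt (2*pi) * a s powr (1 - H))) \<partial>lborel)
   = ennreal (1 / sqrt (2*pi)) * (gauss_mass h s * ennreal (a s powr (H - 1)))" for s
  proof -
   have w: "1 / a s powr (1 - H) = a s powr (H - 1)" using powr_minus_divide[of "a s" "1 - H"] by simp
   have "(\<integral>\<^sup>+x. ennreal (\<bar>h x\<bar>^2 * exp (- (x^2 / (2 * s powr (2*H)))) / (sqrt (2*pi) * a s powr (1 - H))) \<partial>lborel)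
    = (\<integral>\<^sup>+x. ennreal (1 / sqrt (2*pi) * a s powr (H - 1)) * ennreal ((h x)^2 * exp (- (x^2 / (2 * s powr (2*H))))) \<partial>lborel)"
    by (intro nn_integral_cong) (simp add: ennreal_mult[symmetric] w[symmetric])
   also have "... = ennreal (1 / sqrt (2*pi) * a s powr (H - 1)) * gauss_mass h s"
    unfolding gauss_mass_def by (rule nn_integral_cmult) measurable
   also have "... = ennreal (1 / sqrt (2*pi)) * (gauss_mass h s * ennreal (a s powr (H - 1)))"
    by (subst ennreal_mult) (auto simp: ac_simps)
   finally show ?thesis .
  qed
  then have "(\<integral>\<^sup>+s\<in>{0..T}. (\<integral>\<^sup>+x. ennreal (\<bar>h x\<bar>^2 * exp (- (x^2 / (2 * s powr (2*H)))) / (sqrt (2*pi) * a s powr (1 - H))) \<partial>lborel) \<partial>lborel)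
   = (\<integral>\<^sup>+s. ennreal (1 / sqrt (2*pi)) * (gauss_mass h s * ennreal (a s powr (H - 1)) * indicator {0..T} s) \<partial>lborel)"
   by (simp add: mult.assoc)
  also have "... = ennreal (1 / sqrt (2*pi)) * (\<integral>\<^sup>+s\<in>{0..T}. gauss_mass h s * ennreal (a s powr (H - 1)) \<partial>lborel)"
   by (rule nn_integral_cmult) measurable
  finally show ?thesis .
 qed
 show ?thesis unfolding H_norm_def start_mass_def end_mass_def by (subst (1 2) eq) auto
qed

lemma end_mass_le_H_norm:
 assumes [measurable]: "h \<in> borel_measurable borel" and n: "H_norm H T h \<le> ennreal n" "0 \<le> n"
 shows "end_mass T h \<le> ennreal (sqrt (2*pi) * n^2)"
proof -
 define W where "W = ennreal (1 / sqrt (2*pi)) * end_mass T h"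
 have "ennreal_sqrt W \<le> H_norm H T h" unfolding H_norm_masses[OF assms(1)] W_def by simp
 with n have le: "ennreal_sqrt W \<le> ennreal n" by simp
 then have "W < \<infinity>" by (cases W) (auto simp: ennreal_sqrt_def top_unique)
 then have "W = (ennreal_sqrt W)^2" by (simp add: ennreal_sqrt_square)
 also have "... \<le> (ennreal n)^2" by (rule power_mono[OF le]) simp
 also have "... = ennreal (n^2)" using n by (simp add: ennreal_power)
 finally have W: "W \<le> ennreal (n^2)" .
 have "end_mass T h = ennreal (sqrt (2*pi) * (1 / sqrt (2*pi))) * end_mass T h" by simp
 also have "... = ennreal (sqrt (2*pi)) * W" unfolding W_def by (subst ennreal_mult) (auto simp: mult.assoc)
 also have "... \<le> ennreal (sqrt (2*pi)) * ennreal (n^2)" using W by (rule mult_left_mono) simp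
 also have "... = ennreal (sqrt (2*pi) * n^2)" by (simp add: ennreal_mult')
 finally show ?thesis .
qed

text \<open>On \<open>{-N..N}\<close> the Gaussian weight of time \<open>T / 2\<close> is bounded
  below by \<open>k\<close>, and the mass at that time is finite by
  \<open>end_mass_bounds\<close>.\<close>

lemma H_space_L2loc:
 assumes T: "0 < T" and f: "f \<in> H_space H T"
 shows "L2loc f"
 unfolding L2loc_def
proof (intro conjI allI)
 show [measurable]: "f \<in> borel_measurable borel" using f by (simp add: H_space_def)
 fix N :: real
 obtain n where n: "H_norm H T f \<le> ennreal n" "0 \<le> n" using f by (cases "H_norm H T f") (auto simp: H_space_def)
 define v where "v = 2 * (T / 2) powr (2*H)"
 have v: "0 < v" using T by (simp add: v_def)
 define k where "k = exp (- (N^2 / v))"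
 have k: "0 < k" by (simp add: k_def)
 have "(\<integral>\<^sup>+x\<in>{-N..N}. ennreal ((f x)^2) \<partial>lborel) \<le> (\<integral>\<^sup>+x. ennreal (1 / k) * ennreal ((f x)^2 * exp (- (x^2 / v))) \<partial>lborel)"
 proof (rule nn_integral_mono)
  fix x
  show "ennreal ((f x)^2) * indicator {-N..N} x \<le> ennreal (1 / k) * ennreal ((f x)^2 * exp (- (x^2 / v)))"
  proof (cases "x \<in> {-N..N}")
   case True
   then have "x^2 \<le> N^2" by (auto simp: abs_le_square_iff[symmetric])
   then have "k \<le> exp (- (x^2 / v))" using v by (simp add: k_def divide_right_mono)
   then have "1 \<le> 1 / k * exp (- (x^2 / v))" using k by (simp add: pos_le_divide_eq)
   then have "(f x)^2 * 1 \<le> (f x)^2 * (1 / k * exp (- (x^2 / v)))" by (rule mult_left_mono) simp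
   then show ?thesis using True k by (simp add: ennreal_mult[symmetric] ac_simps ennreal_leI)
  qed simp
 qed
 also have "... = ennreal (1 / k) * gauss_mass f (T / 2)"
  unfolding gauss_mass_def v_def by (rule nn_integral_cmult) measurable
 also have "... \<le> ennreal (1 / k) * ennreal (H / (T - T / 2) powr H * (sqrt (2*pi) * n^2))"
  using T n by (intro mult_left_mono end_mass_bounds end_mass_le_H_norm) auto
 also have "... < \<infinity>" by (simp add: ennreal_mult_less_top)
 finally show "(\<integral>\<^sup>+x\<in>{-N..N}. ennreal ((f x)^2) \<partial>lborel) < \<infinity>" .
qed

text \<open>By Tonelli, the sum of \<open>start_mass\<close> and \<open>end_mass\<close> is a square
  integral against one measure on the line, with this density. The norm is equivalent to the root of
  that integral, so density of the elementary functions becomes a statement about a single finite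
  measure.\<close>

definition norm_weight :: "real \<Rightarrow> real \<Rightarrow> ennreal" where
 "norm_weight T x = (\<integral>\<^sup>+s\<in>{0..T}. ennreal (exp (- (x^2 / (2 * s powr (2*H)))))
   * (ennreal (s powr (H - 1)) + ennreal ((T - s) powr (H - 1))) \<partial>lborel)"

lemma norm_weight_measurable [measurable]: "norm_weight T \<in> borel_measurable borel"
proof -
 have "(\<lambda>(x, s). ennreal (exp (- (x^2 / (2 * s powr (2*H)))))
   * (ennreal (s powr (H - 1)) + ennreal ((T - s) powr (H - 1))) * indicator {0..T} s) \<in> borel_measurable (borel \<Otimes>\<^sub>M lborel)"
  by measurable
 then show ?thesis unfolding norm_weight_def[abs_def] by (rule lborel.borel_measurable_nn_integral)
qed

lemma norm_weight_integral:
 assumes [measurable]: "h \<in> borel_measurable borel"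
 shows "(\<integral>\<^sup>+x. ennreal ((h x)^2) \<partial>density lborel (norm_weight T)) = start_mass T h + end_mass T h"
proof -
 define w where "w s = ennreal (s powr (H - 1)) + ennreal ((T - s) powr (H - 1))" for s
 have [measurable]: "w \<in> borel_measurable borel" unfolding w_def by measurable
 define e where "e x s = ennreal (exp (- (x^2 / (2 * s powr (2*H)))))" for x s
 have [measurable]: "(\<lambda>(x, s). e x s) \<in> borel_measurable (borel \<Otimes>\<^sub>M borel)" unfolding e_def by measurable
 have "(\<integral>\<^sup>+x. ennreal ((h x)^2) \<partial>density lborel (norm_weight T)) = (\<integral>\<^sup>+x. norm_weight T x * ennreal ((h x)^2) \<partial>lborel)"
  by (subst nn_integral_density) auto
 also have "... = (\<integral>\<^sup>+x. (\<integral>\<^sup>+s. e x s * w s * indicator {0..T} s * ennreal ((h x)^2) \<partial>lborel) \<partial>lborel)"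
  unfolding norm_weight_def e_def[symmetric] w_def[symmetric] by (intro nn_integral_cong nn_integral_multc[symmetric]) measurable
 also have "... = (\<integral>\<^sup>+s. (\<integral>\<^sup>+x. e x s * w s * indicator {0..T} s * ennreal ((h x)^2) \<partial>lborel) \<partial>lborel)"
  by (rule lborel_pair.Fubini'[symmetric]) measurable
 also have "... = (\<integral>\<^sup>+s. gauss_mass h s * ennreal (s powr (H - 1)) * indicator {0..T} s + gauss_mass h s * ennreal ((T - s) powr (H - 1)) * indicator {0..T} s \<partial>lborel)"
 proof (rule nn_integral_cong)
  fix s
  have "(\<integral>\<^sup>+x. e x s * w s * indicator {0..T} s * ennreal ((h x)^2) \<partial>lborel)
   = (\<integral>\<^sup>+x. w s * indicator {0..T} s * ennreal ((h x)^2 * exp (- (x^2 / (2 * s powr (2*H))))) \<partial>lborel)"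
   by (intro nn_integral_cong) (simp add: e_def ennreal_mult ac_simps)
  also have "... = w s * indicator {0..T} s * gauss_mass h s" unfolding gauss_mass_def by (rule nn_integral_cmult) measurable
  also have "... = gauss_mass h s * ennreal (s powr (H - 1)) * indicator {0..T} s + gauss_mass h s * ennreal ((T - s) powr (H - 1)) * indicator {0..T} s"
   unfolding w_def by (simp add: distrib_left distrib_right ac_simps)
  finally show "(\<integral>\<^sup>+x. e x s * w s * indicator {0..T} s * ennreal ((h x)^2) \<partial>lborel) = ..." .
 qed
 also have "... = start_mass T h + end_mass T h" unfolding start_mass_def end_mass_def by (rule nn_integral_add) measurable
 finally show ?thesis .
qed

text \<open>The total mass is that of the constant function 1, whose \<open>gauss_mass\<close> is at
  most \<open>sqrt (2*pi) * T powr H\<close> for \<open>0 < s \<le> T\<close>; both time weights are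
  integrable since \<open>H - 1 > -1\<close>.\<close>

lemma norm_weight_finite:
 assumes T: "0 < T"
 shows "finite_borel (density lborel (norm_weight T))"
proof -
 define c where "c = sqrt (2*pi) * T powr H"
 have g: "gauss_mass (\<lambda>_. 1) s \<le> ennreal c" if s: "0 < s" "s \<le> T" for s
 proof -
  have sH: "0 < s powr H" using s by simp
  have "gauss_mass (\<lambda>_. 1) s = (\<integral>\<^sup>+x. ennreal (sqrt (2*pi) * s powr H) * ennreal (normal_density 0 (s powr H) x) \<partial>lborel)"
   unfolding gauss_mass_def
  proof (intro nn_integral_cong)
   fix x
   define u where "u = s powr H"
   have u: "0 < u" "s powr (2*H) = u^2" using sH by (auto simp: u_def power2_eq_square powr_add[symmetric])
   have "sqrt (2 * pi * u^2) = sqrt (2*pi) * u" using u by (subst real_sqrt_mult) simp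
   then have "sqrt (2*pi) * s powr H * normal_density 0 (s powr H) x = exp (- (x^2 / (2 * s powr (2*H))))"
    unfolding normal_density_def u_def[symmetric] u(2) using u(1) by simp
   then show "ennreal (1^2 * exp (- (x^2 / (2 * s powr (2*H))))) = ennreal (sqrt (2*pi) * s powr H) * ennreal (normal_density 0 (s powr H) x)"
    by (simp add: ennreal_mult[symmetric])
  qed
  also have "... = ennreal (sqrt (2*pi) * s powr H) * (\<integral>\<^sup>+x. ennreal (normal_density 0 (s powr H) x) \<partial>lborel)"
   by (rule nn_integral_cmult) measurable
  also have "(\<integral>\<^sup>+x. ennreal (normal_density 0 (s powr H) x) \<partial>lborel) = 1"
   using integral_normal_density[OF sH, of 0] integrable_normal_density[OF sH, of 0] by (subst nn_integral_eq_integral) auto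
  also have "ennreal (sqrt (2*pi) * s powr H) * 1 \<le> ennreal c"
   unfolding c_def using s H by (auto intro!: ennreal_leI mult_left_mono powr_mono2)
  finally show ?thesis .
 qed
 have bound: "(\<integral>\<^sup>+s\<in>{0..T}. gauss_mass (\<lambda>_. 1) s * ennreal (a s) \<partial>lborel) < \<infinity>"
  if [measurable]: "a \<in> borel_measurable borel" and fin: "(\<integral>\<^sup>+s\<in>{0..T}. ennreal (a s) \<partial>lborel) < \<infinity>" for a :: "real \<Rightarrow> real"
 proof -
  have "(\<integral>\<^sup>+s\<in>{0..T}. gauss_mass (\<lambda>_. 1) s * ennreal (a s) \<partial>lborel) \<le> (\<integral>\<^sup>+s. ennreal c * (ennreal (a s) * indicator {0..T} s) \<partial>lborel)"
  proof (rule nn_integral_mono_AE)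
   show "AE s in lborel. gauss_mass (\<lambda>_. 1) s * ennreal (a s) * indicator {0..T} s \<le> ennreal c * (ennreal (a s) * indicator {0..T} s)"
    using AE_lborel_singleton[of 0]
   proof eventually_elim
    case (elim s)
    then show ?case using g[of s] by (auto simp: mult_right_mono split: split_indicator)
   qed
  qed
  also have "... = ennreal c * (\<integral>\<^sup>+s\<in>{0..T}. ennreal (a s) \<partial>lborel)" by (rule nn_integral_cmult) measurable
  also have "... < \<infinity>" using fin by (simp add: ennreal_mult_less_top)
  finally show ?thesis .
 qed
 have s: "start_mass T (\<lambda>_. 1) < \<infinity>" unfolding start_mass_def
  using nn_integral_powr_from_0[of "H - 1" T] H T by (intro bound) auto
 have e: "end_mass T (\<lambda>_. 1) < \<infinity>" unfolding end_mass_def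
  using nn_integral_powr_reflect[of T "H - 1"] H T by (intro bound) auto
 have "emeasure (density lborel (norm_weight T)) UNIV = (\<integral>\<^sup>+x. ennreal (1^2) \<partial>density lborel (norm_weight T))" by simp
 also have "... = start_mass T (\<lambda>_. 1) + end_mass T (\<lambda>_. 1)" by (rule norm_weight_integral) simp
 also have "... < \<infinity>" using s e by simp
 finally have "emeasure (density lborel (norm_weight T)) UNIV < \<infinity>" .
 then show ?thesis by (intro finite_borel.intro finite_measureI finite_borel_axioms.intro) (auto simp: space_density)
qed

theorem approximates_exists:
 assumes T: "0 < T" and f: "f \<in> H_space H T"
 shows "\<exists>g. approximates H T g f"
proof -
 have fm [measurable]: "f \<in> borel_measurable borel" using f by (simp add: H_space_def)
 interpret \<nu>: finite_borel "density lborel (norm_weight T)" by (rule norm_weight_finite[OF T])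
 define k where "k = 1 / sqrt (2 * pi)"
 have k: "0 < k" "k \<le> 1" using pi_gt3 by (auto simp: k_def real_le_rsqrt)
 have fin: "start_mass T f < \<infinity>" "end_mass T f < \<infinity>"
 proof -
  have *: "a < \<infinity>" if "ennreal_sqrt (ennreal k * a) < \<infinity>" for a
   using that k by (cases a) (auto simp: ennreal_sqrt_def ennreal_mult_top)
  have "H_norm H T f < \<infinity>" using f by (simp add: H_space_def)
  then have "ennreal_sqrt (ennreal k * start_mass T f) < \<infinity>" "ennreal_sqrt (ennreal k * end_mass T f) < \<infinity>"
   unfolding H_norm_masses[OF fm] k_def[symmetric] by auto
  then show "start_mass T f < \<infinity>" "end_mass T f < \<infinity>" using * by auto
 qed
 have sq: "(\<integral>\<^sup>+x. ennreal ((f x)^2) \<partial>density lborel (norm_weight T)) < \<infinity>"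
  unfolding norm_weight_integral[OF fm] using fin by simp
 have "\<exists>g. is_elementary g \<and> H_norm H T (\<lambda>x. elem_fun g x - f x) \<le> ennreal (2 * (1 / Suc n))" for n
 proof -
  define e where "e = (1 / real (Suc n))^2"
  have e: "0 < e" by (simp add: e_def)
  obtain g where g: "is_elementary g" "(\<integral>\<^sup>+x. ennreal ((elem_fun g x - f x)^2) \<partial>density lborel (norm_weight T)) \<le> ennreal e"
   using \<nu>.elementary_dense[OF fm sq e] by blast
  have [measurable]: "elem_fun g \<in> borel_measurable borel" by (rule elem_fun_measurable)
  define d where "d x = elem_fun g x - f x" for x
  have dm [measurable]: "d \<in> borel_measurable borel" unfolding d_def by measurable
  have le: "start_mass T d + end_mass T d \<le> ennreal e" using g(2) unfolding norm_weight_integral[OF dm, symmetric] by (simp add: d_def)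
  have "ennreal_sqrt (ennreal k * a) \<le> ennreal (1 / Suc n)" if "a \<le> start_mass T d + end_mass T d" for a
  proof -
   have "ennreal k * a \<le> 1 * ennreal e" using k that le by (intro mult_mono) auto
   then have "ennreal_sqrt (ennreal k * a) \<le> ennreal (sqrt e)" by (intro ennreal_sqrt_le) simp
   then show ?thesis by (simp add: e_def)
  qed
  from add_mono[OF this this] have "H_norm H T d \<le> ennreal (1 / Suc n) + ennreal (1 / Suc n)"
   unfolding H_norm_masses[OF dm] k_def[symmetric] by simp
  also have "... = ennreal (2 * (1 / Suc n))" by (simp add: ennreal_plus[symmetric] del: ennreal_plus)
  finally have "H_norm H T d \<le> ennreal (2 * (1 / Suc n))" .
  then show ?thesis using g(1) unfolding d_def[abs_def] by blast
 qed
 then obtain g where g: "\<And>n. is_elementary (g n)" "\<And>n. H_norm H T (\<lambda>x. elem_fun (g n) x - f x) \<le> ennreal (2 * (1 / Suc n))" by metis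
 have "(\<lambda>n. 2 * inverse (real (Suc n))) \<longlonglongrightarrow> 2 * 0" by (intro tendsto_mult tendsto_const LIMSEQ_inverse_real_of_nat)
 then have "(\<lambda>n. ennreal (2 * (1 / Suc n))) \<longlonglongrightarrow> ennreal (2 * 0)" unfolding inverse_eq_divide by (rule tendsto_ennrealI)
 then have lim: "(\<lambda>n. ennreal (2 * (1 / Suc n))) \<longlonglongrightarrow> 0" by simp
 have "(\<lambda>n. H_norm H T (\<lambda>x. elem_fun (g n) x - f x)) \<longlonglongrightarrow> 0"
 proof (rule tendsto_sandwich[OF _ _ tendsto_const lim])
  show "\<forall>\<^sub>F n in sequentially. 0 \<le> H_norm H T (\<lambda>x. elem_fun (g n) x - f x)" by (rule always_eventually) simp
  show "\<forall>\<^sub>F n in sequentially. H_norm H T (\<lambda>x. elem_fun (g n) x - f x) \<le> ennreal (2 * (1 / Suc n))"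
   by (rule always_eventually) (rule allI, rule g(2))
 qed
 then show ?thesis using g(1) unfolding approximates_def by blast
qed

end

section \<open>Local time\<close>

text \<open>Integration by parts for a measure: \<open>s powr p\<close> is \<open>t powr p\<close>
  plus the integral of \<open>- p * w powr (p - 1)\<close> over \<open>w\<close> from
  \<open>s\<close> to \<open>t\<close>, and Tonelli exchanges the integrals. Only masses of
  intervals \<open>{r<..w}\<close> remain, whose limits are accessible; \<open>0 < r\<close> keeps
  the singularity at 0 away.\<close>

lemma powr_weight_integral:
 fixes p r t :: real
 assumes p: "p < 0" and r: "0 < r" "r \<le> t" and "sigma_finite_measure \<mu>" and sets [measurable_cong]: "sets \<mu> = sets borel"
 shows "(\<integral>\<^sup>+s\<in>{r<..t}. ennreal (s powr p) \<partial>\<mu>)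
  = ennreal (t powr p) * emeasure \<mu> {r<..t} + (\<integral>\<^sup>+w\<in>{r..t}. ennreal (- p * w powr (p - 1)) * emeasure \<mu> {r<..w} \<partial>lborel)"
proof -
 interpret sigma_finite_measure \<mu> by fact
 interpret pair_sigma_finite \<mu> lborel by unfold_locales
 define c where "c w = ennreal (- p * w powr (p - 1))" for w
 have [measurable]: "c \<in> borel_measurable borel" unfolding c_def by measurable
 define k where "k s w = c w * (if r < s \<and> s \<le> w \<and> w \<le> t then 1 else 0)" for s w
 have k [measurable]: "case_prod k \<in> borel_measurable (\<mu> \<Otimes>\<^sub>M lborel)" unfolding k_def by measurable
 have ftc: "ennreal (s powr p) * indicator {r<..t} s = ennreal (t powr p) * indicator {r<..t} s + (\<integral>\<^sup>+w. k s w \<partial>lborel)" for s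
 proof (cases "s \<in> {r<..t}")
  case True
  have "(\<integral>\<^sup>+w. k s w \<partial>lborel) = (\<integral>\<^sup>+w. ennreal (- p * w powr (p - 1)) * indicator {s..t} w \<partial>lborel)"
   using True by (intro nn_integral_cong) (auto simp: k_def c_def split: split_indicator)
  also have "... = ennreal (- (t powr p) - - (s powr p))"
  proof (rule nn_integral_FTC_Icc)
   show "((\<lambda>w. - (w powr p)) has_real_derivative - p * x powr (p - 1)) (at x)" if "x \<in> {s..t}" for x
    using that True r by (auto intro!: derivative_eq_intros)
   show "0 \<le> - p * x powr (p - 1)" for x using p by (simp add: mult_nonpos_nonneg)
  qed (use True in auto)
  finally have "ennreal (t powr p) + (\<integral>\<^sup>+w. k s w \<partial>lborel) = ennreal (t powr p + (s powr p - t powr p))"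
   using True r p by (subst ennreal_plus) (auto intro!: powr_mono2')
  then show ?thesis using True by simp
 next
  case False
  then have "k s w = 0" for w using r by (auto simp: k_def)
  then show ?thesis using False by simp
 qed
 have inner: "(\<integral>\<^sup>+s. k s w \<partial>\<mu>) = c w * emeasure \<mu> {r<..w} * indicator {r..t} w" for w
 proof -
  have "k s w = c w * indicator {r..t} w * indicator {r<..w} s" for s using r by (auto simp: k_def split: split_indicator)
  then have "(\<integral>\<^sup>+s. k s w \<partial>\<mu>) = c w * indicator {r..t} w * emeasure \<mu> {r<..w}"
   by (simp add: nn_integral_cmult_indicator)
  then show ?thesis by (simp add: ac_simps)
 qed
 have "(\<integral>\<^sup>+s\<in>{r<..t}. ennreal (s powr p) \<partial>\<mu>) = (\<integral>\<^sup>+s. ennreal (t powr p) * indicator {r<..t} s + (\<integral>\<^sup>+w. k s w \<partial>lborel) \<partial>\<mu>)"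
  by (intro nn_integral_cong ftc)
 also have "... = ennreal (t powr p) * emeasure \<mu> {r<..t} + (\<integral>\<^sup>+s. (\<integral>\<^sup>+w. k s w \<partial>lborel) \<partial>\<mu>)"
  by (subst nn_integral_add) (auto simp: nn_integral_cmult_indicator)
 also have "(\<integral>\<^sup>+s. (\<integral>\<^sup>+w. k s w \<partial>lborel) \<partial>\<mu>) = (\<integral>\<^sup>+w. (\<integral>\<^sup>+s. k s w \<partial>\<mu>) \<partial>lborel)" by (rule Fubini'[symmetric, OF k])
 finally show ?thesis unfolding inner c_def .
qed

lemma hat_integral: "(\<integral>\<^sup>+z. ennreal (hat z) \<partial>lborel) = 1"
proof -
 have "(\<integral>\<^sup>+z. ennreal (hat z) \<partial>lborel) = (\<integral>\<^sup>+z. ennreal (hat z) * indicator {0..2} z \<partial>lborel)"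
 proof (intro nn_integral_cong)
  show "ennreal (hat z) = ennreal (hat z) * indicator {0..2} z" for z
   using hat_bounds(3)[of z] by (cases "hat z = 0") auto
 qed
 also have "... = ennreal (ramp1 2 - ramp1 0)"
  by (intro nn_integral_FTC_Icc DERIV_ramp1 hat_bounds hat_measurable) auto
 also have "... = 1" by (simp add: ramp1_bounds)
 finally show ?thesis .
qed

text \<open>The almost sure properties of the process and its local time, for one fixed path;
  everything in this locale is deterministic.\<close>

locale local_time_path =
 fixes b :: "real \<Rightarrow> real" and l :: "real \<Rightarrow> real \<Rightarrow> real"
 assumes path: "continuous_on UNIV b"
  and joint: "continuous_on (UNIV \<times> {0..}) (\<lambda>(x, t). l x t)"
  and nonneg: "0 \<le> t \<Longrightarrow> 0 \<le> l x t"
  and occupation: "0 \<le> t \<Longrightarrow> A \<in> sets borel \<Longrightarrow>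
   emeasure lborel {s\<in>{0..t}. b s \<in> A} = (\<integral>\<^sup>+x\<in>A. ennreal (l x t) \<partial>lborel)"
begin

lemma path_measurable [measurable]: "b \<in> borel_measurable borel"
 using path by (rule borel_measurable_continuous_onI)

lemma continuous_space: "0 \<le> t \<Longrightarrow> continuous_on UNIV (\<lambda>x. l x t)"
 using continuous_on_compose2[OF joint, of UNIV "\<lambda>x. (x, t)"] by (auto simp: continuous_on_Pair)

lemma continuous_time: "continuous_on {0..} (l x)"
 using continuous_on_compose2[OF joint, of "{0..}" "\<lambda>t. (x, t)"] by (auto simp: continuous_on_Pair)

lemma space_measurable: "0 \<le> t \<Longrightarrow> (\<lambda>x. l x t) \<in> borel_measurable borel"
 by (rule borel_measurable_continuous_onI[OF continuous_space])

lemma occupation_integral: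
 assumes t: "0 \<le> t" and [measurable]: "g \<in> borel_measurable borel"
 shows "(\<integral>\<^sup>+s\<in>{0..t}. g (b s) \<partial>lborel) = (\<integral>\<^sup>+x. ennreal (l x t) * g x \<partial>lborel)"
proof -
 note [measurable] = space_measurable[OF t]
 have "distr (density lborel (indicator {0..t})) borel b = density lborel (\<lambda>x. ennreal (l x t))" (is "?P = ?R")
 proof (rule measure_eqI)
  fix A assume "A \<in> sets ?P"
  then have A [measurable]: "A \<in> sets borel" by simp
  have "emeasure ?P A = emeasure (density lborel (indicator {0..t})) (b -` A)" by (subst emeasure_distr) auto
  also have "... = (\<integral>\<^sup>+s. indicator {0..t} s * indicator (b -` A) s \<partial>lborel)"
   by (rule emeasure_density) (auto intro: measurable_sets_borel[OF path_measurable])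
  also have "... = (\<integral>\<^sup>+s. indicator {s\<in>{0..t}. b s \<in> A} s \<partial>lborel)"
   by (intro nn_integral_cong) (auto split: split_indicator)
  also have "... = emeasure lborel {s\<in>{0..t}. b s \<in> A}" by (rule nn_integral_indicator) measurable
  also have "... = emeasure ?R A" unfolding occupation[OF t A] by (simp add: emeasure_density)
  finally show "emeasure ?P A = emeasure ?R A" .
 qed simp
 then have "(\<integral>\<^sup>+x. g x \<partial>?P) = (\<integral>\<^sup>+x. g x \<partial>?R)" by simp
 then show ?thesis by (simp add: nn_integral_distr nn_integral_density ac_simps)
qed

text \<open>The local time averaged near \<open>a\<close> by \<open>hat\<close> at scale
  \<open>d\<close>, after substituting \<open>x = a + d * z\<close>. It equals the time integral of
  \<open>ramp' a d\<close> along the path (\<open>smeared_eq\<close>) and tends to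
  \<open>l a w\<close> as \<open>d\<close> tends to 0.\<close>

definition smeared :: "real \<Rightarrow> real \<Rightarrow> real \<Rightarrow> ennreal" where
 "smeared a d w = (\<integral>\<^sup>+z. ennreal (hat z * l (a + d * z) w) \<partial>lborel)"

lemma smeared_eq:
 assumes d: "0 < d" and w: "0 \<le> w"
 shows "(\<integral>\<^sup>+s\<in>{0..w}. ennreal (ramp' a d (b s)) \<partial>lborel) = smeared a d w"
proof -
 note [measurable] = space_measurable[OF w]
 have "(\<integral>\<^sup>+s\<in>{0..w}. ennreal (ramp' a d (b s)) \<partial>lborel) = (\<integral>\<^sup>+x. ennreal (l x w) * ennreal (ramp' a d x) \<partial>lborel)"
  by (rule occupation_integral[OF w]) measurable
 also have "... = ennreal \<bar>d\<bar> * (\<integral>\<^sup>+z. ennreal (l (a + d * z) w) * ennreal (ramp' a d (a + d * z)) \<partial>lborel)"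
  using d by (intro nn_integral_real_affine) auto
 also have "... = (\<integral>\<^sup>+z. ennreal \<bar>d\<bar> * (ennreal (l (a + d * z) w) * ennreal (ramp' a d (a + d * z))) \<partial>lborel)"
  by (rule nn_integral_cmult[symmetric]) measurable
 also have "... = smeared a d w"
  unfolding smeared_def using d by (intro nn_integral_cong) (simp add: ramp'_def ennreal_mult[symmetric] nonneg w hat_bounds ac_simps)
 finally show ?thesis .
qed

lemma local_time_bounded:
 obtains K where "0 \<le> K" "\<And>x w. x \<in> {a..a + 2} \<Longrightarrow> w \<in> {0..t} \<Longrightarrow> l x w \<le> K"
proof -
 have "compact ((\<lambda>(x, t). l x t) ` ({a..a + 2} \<times> {0..t}))"
  by (intro compact_continuous_image continuous_on_subset[OF joint] compact_Times) auto
 then obtain K where K: "\<And>y. y \<in> (\<lambda>(x, t). l x t) ` ({a..a + 2} \<times> {0..t}) \<Longrightarrow> \<bar>y\<bar> \<le> K"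
  by (force dest!: compact_imp_bounded simp: bounded_iff)
 have "l x w \<le> \<bar>K\<bar>" if "x \<in> {a..a + 2}" "w \<in> {0..t}" for x w using K[of "l x w"] that by force
 then show ?thesis using that[of "\<bar>K\<bar>"] by auto
qed

lemma smeared_le:
 assumes K: "0 \<le> K" "\<And>x. x \<in> {a..a + 2} \<Longrightarrow> l x w \<le> K" and d: "0 < d" "d \<le> 1"
 shows "ennreal (hat z * l (a + d * z) w) \<le> ennreal (hat z) * ennreal K" and "smeared a d w \<le> ennreal K"
proof -
 have le: "ennreal (hat z * l (a + d * z) w) \<le> ennreal (hat z) * ennreal K" for z
 proof (cases "hat z = 0")
  case False
  then have z: "0 \<le> z" "z \<le> 2" using hat_bounds(3)[of z] by auto
  then have "d * z \<le> 1 * 2" using d by (intro mult_mono) auto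
  moreover have "0 \<le> d * z" using z d by simp
  ultimately have "0 \<le> d * z" "d * z \<le> 2" by auto
  then have "hat z * l (a + d * z) w \<le> hat z * K" by (intro mult_left_mono K hat_bounds) auto
  then show ?thesis using K by (simp add: ennreal_mult'[symmetric] hat_bounds ennreal_mult[symmetric] ennreal_leI)
 qed simp
 then show "ennreal (hat z * l (a + d * z) w) \<le> ennreal (hat z) * ennreal K" .
 have "smeared a d w \<le> (\<integral>\<^sup>+z. ennreal (hat z) * ennreal K \<partial>lborel)" unfolding smeared_def by (intro nn_integral_mono le)
 also have "... = ennreal K" by (simp add: nn_integral_multc hat_integral)
 finally show "smeared a d w \<le> ennreal K" .
qed

lemma smeared_tendsto:
 assumes d: "\<And>n::nat. 0 < d n" "\<And>n. d n \<le> 1" "d \<longlonglongrightarrow> 0" and w: "0 \<le> w"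
 shows "(\<lambda>n. smeared a (d n) w) \<longlonglongrightarrow> ennreal (l a w)"
proof -
 note [measurable] = space_measurable[OF w]
 obtain K where K: "0 \<le> K" "\<And>x u. x \<in> {a..a + 2} \<Longrightarrow> u \<in> {0..w} \<Longrightarrow> l x u \<le> K" using local_time_bounded by blast
 have "(\<lambda>n. \<integral>\<^sup>+z. ennreal (hat z * l (a + d n * z) w) \<partial>lborel) \<longlonglongrightarrow> (\<integral>\<^sup>+z. ennreal (hat z) * ennreal (l a w) \<partial>lborel)"
 proof (rule nn_integral_dominated_convergence)
  show "AE z in lborel. ennreal (hat z * l (a + d n * z) w) \<le> ennreal (hat z) * ennreal K" for n
   using smeared_le(1)[OF K(1,2) d(1,2)] w by auto
  show "(\<integral>\<^sup>+z. ennreal (hat z) * ennreal K \<partial>lborel) < \<infinity>" by (simp add: nn_integral_multc hat_integral)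
  show "AE z in lborel. (\<lambda>n. ennreal (hat z * l (a + d n * z) w)) \<longlonglongrightarrow> ennreal (hat z) * ennreal (l a w)"
  proof (rule AE_I2)
   fix z
   have "(\<lambda>n. a + d n * z) \<longlonglongrightarrow> a + 0 * z" by (intro tendsto_intros d)
   then have "(\<lambda>n. l (a + d n * z) w) \<longlonglongrightarrow> l a w"
    by (intro continuous_on_tendsto_compose[OF continuous_space[OF w]]) auto
   then have "(\<lambda>n. ennreal (hat z * l (a + d n * z) w)) \<longlonglongrightarrow> ennreal (hat z * l a w)"
    by (intro tendsto_ennrealI tendsto_mult tendsto_const)
   then show "(\<lambda>n. ennreal (hat z * l (a + d n * z) w)) \<longlonglongrightarrow> ennreal (hat z) * ennreal (l a w)"
    by (simp add: ennreal_mult hat_bounds nonneg w)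
  qed
 qed measurable
 then show ?thesis by (simp add: smeared_def nn_integral_multc hat_integral)
qed

lemma smeared_increment:
 assumes d: "0 < d" and r: "0 \<le> r" "r \<le> w"
 shows "smeared a d w = smeared a d r + (\<integral>\<^sup>+s\<in>{r<..w}. ennreal (ramp' a d (b s)) \<partial>lborel)"
proof -
 have w: "0 \<le> w" using r by simp
 have "smeared a d w = (\<integral>\<^sup>+s. ennreal (ramp' a d (b s)) * indicator {0..r} s + ennreal (ramp' a d (b s)) * indicator {r<..w} s \<partial>lborel)"
  unfolding smeared_eq[OF d w, symmetric] using r by (intro nn_integral_cong) (auto split: split_indicator)
 also have "... = smeared a d r + (\<integral>\<^sup>+s\<in>{r<..w}. ennreal (ramp' a d (b s)) \<partial>lborel)"
  unfolding smeared_eq[OF d r(1), symmetric] by (rule nn_integral_add) measurable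
 finally show ?thesis .
qed

text \<open>Monotonicity in time is derived rather than assumed: \<open>smeared\<close> increases in
  \<open>w\<close>, being an integral over \<open>{0..w}\<close>, and its limit inherits this at
  every point \<open>a\<close>. It is what makes the Stieltjes measure \<open>clock\<close>
  meaningful.\<close>

lemma local_time_mono:
 assumes "0 \<le> r" "r \<le> w"
 shows "l a r \<le> l a w"
proof -
 define d where "d n = 1 / real (Suc n)" for n
 have d: "0 < d n" "d n \<le> 1" for n by (auto simp: d_def)
 have d0: "d \<longlonglongrightarrow> 0" using LIMSEQ_inverse_real_of_nat by (simp add: d_def[abs_def] inverse_eq_divide)
 have w: "0 \<le> w" using assms by simp
 have "ennreal (l a r) \<le> ennreal (l a w)"
  by (rule LIMSEQ_le[OF smeared_tendsto[OF d d0 assms(1)] smeared_tendsto[OF d d0 w]])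
    (use smeared_increment[OF d(1) assms] in auto)
 then show ?thesis using nonneg[OF w] by simp
qed

definition clock :: "real \<Rightarrow> real measure" where
 "clock a = interval_measure (\<lambda>s. l a (max 0 s))"

lemma clock_facts:
 shows "sigma_finite_measure (clock a)" and "sets (clock a) = sets borel"
  and "0 \<le> r \<Longrightarrow> r \<le> w \<Longrightarrow> emeasure (clock a) {r<..w} = ennreal (l a w - l a r)"
proof -
 have mono: "l a (max 0 x) \<le> l a (max 0 y)" if "x \<le> y" for x y using that by (intro local_time_mono) auto
 have "continuous_on UNIV (\<lambda>s. l a (max 0 s))"
  by (rule continuous_on_compose2[OF continuous_time]) (auto intro!: continuous_intros)
 then have rc: "continuous (at_right x) (\<lambda>s. l a (max 0 s))" for x
  by (meson UNIV_I continuous_at_imp_continuous_at_within continuous_on_eq_continuous_at open_UNIV)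
 show "sigma_finite_measure (clock a)" unfolding clock_def by (rule sigma_finite_interval_measure[OF mono rc])
 show "sets (clock a) = sets borel" by (simp add: clock_def)
 show "0 \<le> r \<Longrightarrow> r \<le> w \<Longrightarrow> emeasure (clock a) {r<..w} = ennreal (l a w - l a r)"
  unfolding clock_def by (subst emeasure_interval_measure_Ioc[OF _ mono rc]) auto
qed

text \<open>Both sides are rewritten by \<open>powr_weight_integral\<close>. The cumulative masses
  of \<open>ramp' a (d n) (b s)\<close> are differences of \<open>smeared\<close>, hence converge
  for each \<open>w\<close> and are bounded by \<open>K\<close>; dominated convergence
  concludes.\<close>

lemma ramp_powr_tendsto:
 fixes p r t :: real
 assumes d: "\<And>n::nat. 0 < d n" "\<And>n. d n \<le> 1" "d \<longlonglongrightarrow> 0" and p: "p < 0" and r: "0 < r" "r \<le> t"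
 shows "(\<lambda>n. \<integral>\<^sup>+s\<in>{r<..t}. ennreal (ramp' a (d n) (b s) * s powr p) \<partial>lborel) \<longlonglongrightarrow> (\<integral>\<^sup>+s\<in>{r<..t}. ennreal (s powr p) \<partial>clock a)"
proof -
 obtain K where K: "0 \<le> K" "\<And>x u. x \<in> {a..a + 2} \<Longrightarrow> u \<in> {0..t} \<Longrightarrow> l x u \<le> K" using local_time_bounded by blast
 define \<mu> where "\<mu> n = density lborel (\<lambda>s. ennreal (ramp' a (d n) (b s)))" for n
 have sf: "sigma_finite_measure (\<mu> n)" for n
  unfolding \<mu>_def by (subst sigma_finite_measure.sigma_finite_iff_density_finite[OF lborel.sigma_finite_measure_axioms]) auto
 have sets: "sets (\<mu> n) = sets borel" for n by (simp add: \<mu>_def)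
 define m where "m n w = emeasure (\<mu> n) {r<..w}" for n w
 have m: "m n w = (\<integral>\<^sup>+s\<in>{r<..w}. ennreal (ramp' a (d n) (b s)) \<partial>lborel)" for n w
  unfolding m_def \<mu>_def by (rule emeasure_density) measurable
 have msm: "m n \<in> borel_measurable borel" for n
 proof -
  have "(\<lambda>(w, s). ennreal (ramp' a (d n) (b s)) * (if r < s \<and> s \<le> w then 1 else 0)) \<in> borel_measurable (borel \<Otimes>\<^sub>M lborel)"
   by measurable
  then have "(\<lambda>w. \<integral>\<^sup>+s. ennreal (ramp' a (d n) (b s)) * (if r < s \<and> s \<le> w then 1 else 0) \<partial>lborel) \<in> borel_measurable borel"
   by (rule lborel.borel_measurable_nn_integral)
  also have "(\<lambda>w. \<integral>\<^sup>+s. ennreal (ramp' a (d n) (b s)) * (if r < s \<and> s \<le> w then 1 else 0) \<partial>lborel) = m n"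
   unfolding m by (intro ext nn_integral_cong) (auto split: split_indicator)
  finally show ?thesis .
 qed
 have sm: "smeared a (d n) w \<le> ennreal K" if "w \<in> {0..t}" for n w by (rule smeared_le(2)[OF K(1) K(2) d(1,2)]) (use that in auto)
 have m_le: "m n w \<le> ennreal K" if w: "w \<in> {r..t}" for n w
 proof -
  have "m n w \<le> smeared a (d n) w" unfolding m using smeared_increment[OF d(1), of r w] r w by simp
  also have "... \<le> ennreal K" using w r by (intro sm) auto
  finally show ?thesis .
 qed
 have m_lim: "(\<lambda>n. m n w) \<longlonglongrightarrow> emeasure (clock a) {r<..w}" if w: "w \<in> {r..t}" for w
 proof -
  have rw: "0 \<le> r" "r \<le> w" "0 \<le> w" using r w by auto
  \<comment> \<open>Finiteness turns the truncated subtraction of \<open>ennreal\<close> into a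
    genuine difference.\<close>
  have fin: "smeared a (d n) r \<noteq> \<top>" for n using sm[of r n] r by (auto simp: top_unique)
  have "m n w = smeared a (d n) w - smeared a (d n) r" for n
   unfolding m smeared_increment[OF d(1) rw(1,2)] using fin by simp
  moreover have "(\<lambda>n. smeared a (d n) w - smeared a (d n) r) \<longlonglongrightarrow> ennreal (l a w) - ennreal (l a r)"
   by (intro tendsto_diff_ennreal smeared_tendsto d rw) auto
  ultimately show ?thesis using rw by (simp add: clock_facts ennreal_minus nonneg)
 qed
 define c where "c w = ennreal (- p * w powr (p - 1))" for w
 have [measurable]: "c \<in> borel_measurable borel" unfolding c_def by measurable
 have "(\<integral>\<^sup>+s\<in>{r<..t}. ennreal (ramp' a (d n) (b s) * s powr p) \<partial>lborel) = (\<integral>\<^sup>+s\<in>{r<..t}. ennreal (s powr p) \<partial>\<mu> n)" for n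
  unfolding \<mu>_def by (subst nn_integral_density, measurable) (simp add: ennreal_mult ramp'_bounds d ac_simps)
 then have eq: "(\<integral>\<^sup>+s\<in>{r<..t}. ennreal (ramp' a (d n) (b s) * s powr p) \<partial>lborel)
   = ennreal (t powr p) * m n t + (\<integral>\<^sup>+w\<in>{r..t}. c w * m n w \<partial>lborel)" for n
  unfolding m_def c_def using powr_weight_integral[OF p r sf sets] by simp
 have "(\<lambda>n. \<integral>\<^sup>+w. c w * m n w * indicator {r..t} w \<partial>lborel) \<longlonglongrightarrow> (\<integral>\<^sup>+w. c w * emeasure (clock a) {r<..w} * indicator {r..t} w \<partial>lborel)"
 proof (rule nn_integral_dominated_convergence)
  have "(\<lambda>w. if r \<le> w \<and> w \<le> t then ennreal (l a (max 0 w) - l a r) else 0) \<in> borel_measurable borel"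
  proof -
   have "continuous_on UNIV (\<lambda>s. l a (max 0 s))"
    by (rule continuous_on_compose2[OF continuous_time]) (auto intro!: continuous_intros)
   then have [measurable]: "(\<lambda>s. l a (max 0 s)) \<in> borel_measurable borel" by (rule borel_measurable_continuous_onI)
   show ?thesis by measurable
  qed
  then have "(\<lambda>w. c w * (if r \<le> w \<and> w \<le> t then ennreal (l a (max 0 w) - l a r) else 0)) \<in> borel_measurable borel" by measurable
  also have "(\<lambda>w. c w * (if r \<le> w \<and> w \<le> t then ennreal (l a (max 0 w) - l a r) else 0)) = (\<lambda>w. c w * emeasure (clock a) {r<..w} * indicator {r..t} w)"
   using r by (auto simp: fun_eq_iff clock_facts max_def split: split_indicator)
  finally show "(\<lambda>w. c w * emeasure (clock a) {r<..w} * indicator {r..t} w) \<in> borel_measurable lborel" by simp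
  show "(\<lambda>w. c w * m n w * indicator {r..t} w) \<in> borel_measurable lborel" for n using msm[of n] by measurable
  show "AE w in lborel. c w * m n w * indicator {r..t} w \<le> ennreal K * (c w * indicator {r..t} w)" for n
   using m_le by (auto intro!: AE_I2 mult_left_mono simp: mult.commute[of "ennreal K"] split: split_indicator)
  have "(\<integral>\<^sup>+w. c w * indicator {r..t} w \<partial>lborel) = ennreal (- (t powr p) - - (r powr p))" unfolding c_def
  proof (rule nn_integral_FTC_Icc)
   show "((\<lambda>w. - (w powr p)) has_real_derivative - p * x powr (p - 1)) (at x)" if "x \<in> {r..t}" for x
    using that r by (auto intro!: derivative_eq_intros)
   show "0 \<le> - p * x powr (p - 1)" for x using p by (simp add: mult_nonpos_nonneg)
  qed (use r in auto)
  then show "(\<integral>\<^sup>+w. ennreal K * (c w * indicator {r..t} w) \<partial>lborel) < \<infinity>"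
   by (subst nn_integral_cmult) (auto simp: ennreal_mult_less_top)
  show "AE w in lborel. (\<lambda>n. c w * m n w * indicator {r..t} w) \<longlonglongrightarrow> c w * emeasure (clock a) {r<..w} * indicator {r..t} w"
  proof (rule AE_I2)
   fix w
   show "(\<lambda>n. c w * m n w * indicator {r..t} w) \<longlonglongrightarrow> c w * emeasure (clock a) {r<..w} * indicator {r..t} w"
   proof (cases "w \<in> {r..t}")
    case True
    have "(\<lambda>n. c w * m n w) \<longlonglongrightarrow> c w * emeasure (clock a) {r<..w}"
     by (intro ennreal_tendsto_cmult m_lim True) (simp add: c_def)
    then show ?thesis using True by simp
   qed simp
  qed
 qed measurable
 moreover have "(\<lambda>n. ennreal (t powr p) * m n t) \<longlonglongrightarrow> ennreal (t powr p) * emeasure (clock a) {r<..t}"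
  using r by (intro ennreal_tendsto_cmult m_lim) auto
 ultimately have "(\<lambda>n. ennreal (t powr p) * m n t + (\<integral>\<^sup>+w\<in>{r..t}. c w * m n w \<partial>lborel))
   \<longlonglongrightarrow> ennreal (t powr p) * emeasure (clock a) {r<..t} + (\<integral>\<^sup>+w\<in>{r..t}. c w * emeasure (clock a) {r<..w} \<partial>lborel)"
  by (intro tendsto_add)
 then show ?thesis unfolding eq powr_weight_integral[OF p r clock_facts(1,2)] c_def .
qed

text \<open>On \<open>{r<..t}\<close> with \<open>0 < r\<close> the limit is identified by
  \<open>ramp_powr_tendsto\<close>. No mass is lost at 0 as \<open>r\<close> tends to 0: each
  \<open>R m\<close> is continuous and vanishes at 0, and convergence to \<open>q\<close> is uniform
  in time, so \<open>q (r n)\<close> tends to 0, while monotone convergence handles the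
  clock.\<close>

lemma ramp_limit_unique:
 fixes H T :: real and q :: "real \<Rightarrow> real"
 assumes H: "0 < H" "H < 1/2" and d: "\<And>n::nat. 0 < d n" "\<And>n. d n \<le> 1" "d \<longlonglongrightarrow> 0"
  and near: "\<And>m t. k \<le> m \<Longrightarrow> t \<in> {0..T} \<Longrightarrow>
   \<bar>2 * H * (LINT s:{0..t}|lborel. ramp' a (d m) (b s) * s powr (2*H - 1)) - q t\<bar> \<le> 1 / 2 ^ m"
  and t: "t \<in> {0..T}"
 shows "q t = 2 * H * (LINT s:{0..t}|clock a. s powr (2*H - 1))"
proof -
 define F where "F m s = ramp' a (d m) (b s) * s powr (2*H - 1)" for m s
 define R where "R m u = 2 * H * (LINT s:{0..u}|lborel. F m s)" for m u
 have F0: "0 \<le> F m s" for m s using ramp'_bounds(1)[OF d(1)] by (simp add: F_def)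
 have int: "set_integrable lborel {0..T} (F m)" for m unfolding F_def[abs_def]
 proof (rule set_integrable_bounded_mult)
  show "set_integrable lborel {0..T} (\<lambda>s. s powr (2*H - 1))" using H t by (intro set_integrable_powr) auto
  show "continuous_on {0..T} (\<lambda>s. ramp' a (d m) (b s))"
   unfolding ramp'_def hat_def using d(1)[of m] by (intro continuous_intros continuous_on_subset[OF path]) auto
  show "\<bar>ramp' a (d m) (b s)\<bar> \<le> 1 / d m" for s by (rule ramp'_bounds(2)[OF d(1)])
 qed
 have R0: "R m 0 = 0" for m
 proof -
  have "(\<lambda>s. indicator {0..0} s *\<^sub>R F m s) = (\<lambda>s. 0)" by (auto simp: fun_eq_iff F_def split: split_indicator)
  then show ?thesis unfolding R_def set_lebesgue_integral_def by (simp only: integral_zero mult_zero_right)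
 qed
 have Rc: "continuous_on {0..T} (R m)" for m
  unfolding R_def[abs_def] by (intro continuous_intros set_lebesgue_integral_continuous(1) int)
 have lim: "(\<lambda>m. R m u) \<longlonglongrightarrow> q u" if u: "u \<in> {0..T}" for u
 proof (rule LIM_zero_cancel, rule Lim_null_comparison)
  show "\<forall>\<^sub>F m in sequentially. norm (R m u - q u) \<le> (1 / 2) ^ m"
   using near u by (intro eventually_sequentiallyI[of k]) (auto simp: R_def F_def power_one_over)
  show "(\<lambda>m. (1 / 2 :: real) ^ m) \<longlonglongrightarrow> 0" by (rule LIMSEQ_realpow_zero) auto
 qed
 have q0: "q 0 = 0" using lim[of 0] t by (auto simp: R0 LIMSEQ_const_iff)
 have incr: "(\<integral>\<^sup>+s\<in>{r<..t}. ennreal (s powr (2*H - 1)) \<partial>clock a) = ennreal ((q t - q r) / (2 * H))" and mono: "q r \<le> q t"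
  if r: "0 < r" "r \<le> t" for r
 proof -
  have eq: "(\<integral>\<^sup>+s\<in>{r<..t}. ennreal (F m s) \<partial>lborel) = ennreal ((R m t - R m r) / (2 * H))" and le: "R m r \<le> R m t" for m
  proof -
   have I: "set_integrable lborel {r..t} (F m)" by (rule set_integrable_subset[OF int]) (use r t in auto)
   have "R m t - R m r = 2 * H * (LINT s:{r..t}|lborel. F m s)"
    using set_lebesgue_integral_continuous(2)[OF int, of r t m] r t by (simp add: R_def algebra_simps)
   then have E: "R m t - R m r = 2 * H * (LINT s:{r..t}|lborel. F m s)" .
   then have D: "(R m t - R m r) / (2 * H) = (LINT s:{r..t}|lborel. F m s)" using H by simp
   have "0 \<le> (LINT s:{r..t}|lborel. F m s)"
    unfolding set_lebesgue_integral_def using F0 by (intro integral_nonneg_AE) auto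
   then have "0 \<le> R m t - R m r" unfolding E using H by simp
   then show "R m r \<le> R m t" by simp
   have "(\<integral>\<^sup>+s\<in>{r<..t}. ennreal (F m s) \<partial>lborel) = (\<integral>\<^sup>+s. ennreal (indicator {r..t} s *\<^sub>R F m s) \<partial>lborel)"
   proof (rule nn_integral_cong_AE)
    show "AE s in lborel. ennreal (F m s) * indicator {r<..t} s = ennreal (indicator {r..t} s *\<^sub>R F m s)"
     using AE_lborel_singleton[of r] by eventually_elim (auto split: split_indicator)
   qed
   also have "... = ennreal (LINT s:{r..t}|lborel. F m s)"
    unfolding set_lebesgue_integral_def using I F0 by (intro nn_integral_eq_integral) (auto simp: set_integrable_def)
   finally show "(\<integral>\<^sup>+s\<in>{r<..t}. ennreal (F m s) \<partial>lborel) = ennreal ((R m t - R m r) / (2 * H))" unfolding D .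
  qed
  have l: "(\<lambda>m. R m t - R m r) \<longlonglongrightarrow> q t - q r" using r t by (intro tendsto_diff lim) auto
  have "(\<lambda>m. ennreal ((R m t - R m r) / (2 * H))) \<longlonglongrightarrow> ennreal ((q t - q r) / (2 * H))"
   using H by (intro tendsto_ennrealI tendsto_divide l tendsto_const) auto
  moreover have "(\<lambda>m. \<integral>\<^sup>+s\<in>{r<..t}. ennreal (F m s) \<partial>lborel) \<longlonglongrightarrow> (\<integral>\<^sup>+s\<in>{r<..t}. ennreal (s powr (2*H - 1)) \<partial>clock a)"
   unfolding F_def using H by (intro ramp_powr_tendsto d r) auto
  ultimately show "(\<integral>\<^sup>+s\<in>{r<..t}. ennreal (s powr (2*H - 1)) \<partial>clock a) = ennreal ((q t - q r) / (2 * H))"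
   unfolding eq using LIMSEQ_unique by blast
  have "0 \<le> q t - q r" by (rule LIMSEQ_le_const[OF l]) (use le in auto)
  then show "q r \<le> q t" by simp
 qed
 show ?thesis
 proof (cases "t = 0")
  case True
  have "(LINT s:{0..0}|clock a. s powr (2*H - 1)) = (LINT s|clock a. 0)" unfolding set_lebesgue_integral_def
   by (rule Bochner_Integration.integral_cong) (auto split: split_indicator)
  then show ?thesis unfolding True q0 by (simp only: integral_zero mult_zero_right)
 next
  case False
  then have t0: "0 < t" using t by simp
  define r where "r n = t / real (Suc n)" for n
  have r: "0 < r n" "r n \<le> t" for n using t0 by (auto simp: r_def field_simps)
  have r0: "r \<longlonglongrightarrow> 0"
   using tendsto_mult_right_zero[OF LIMSEQ_inverse_real_of_nat, of t] by (simp add: r_def[abs_def] divide_inverse)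
  have qr: "(\<lambda>n. q (r n)) \<longlonglongrightarrow> 0"
  proof (rule LIMSEQ_I)
   fix e :: real assume e: "0 < e"
   obtain m0 where m0: "(1 / 2 :: real) ^ m0 < e / 2" using real_arch_pow_inv[of "e / 2" "1 / 2"] e by auto
   define m where "m = max k m0"
   have "(1 / 2 :: real) ^ m \<le> (1 / 2) ^ m0" unfolding m_def by (rule power_decreasing) auto
   then have m: "k \<le> m" "1 / 2 ^ m < e / 2" using m0 by (auto simp: m_def power_one_over)
   have "(\<lambda>n. R m (r n)) \<longlonglongrightarrow> R m 0"
    by (rule continuous_on_tendsto_compose[OF Rc r0]) (use r t in \<open>auto intro!: always_eventually simp: less_imp_le intro: order_trans\<close>)
   then have "\<forall>\<^sub>F n in sequentially. dist (R m (r n)) (R m 0) < e / 2" using e by (intro tendstoD) auto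
   then obtain n0 where n0: "\<And>n. n0 \<le> n \<Longrightarrow> \<bar>R m (r n)\<bar> < e / 2" by (auto simp: eventually_sequentially R0 dist_real_def)
   have "norm (q (r n) - 0) < e" if "n0 \<le> n" for n
   proof -
    have "\<bar>R m (r n) - q (r n)\<bar> \<le> 1 / 2 ^ m" unfolding R_def F_def by (rule near[OF m(1)]) (use r[of n] t in auto)
    moreover have "norm (y - 0) < e" if "\<bar>x - y\<bar> \<le> c" "\<bar>x\<bar> < e / 2" "c < e / 2" for x y c :: real
     using that unfolding real_norm_def diff_0_right by linarith
    ultimately show ?thesis using n0[OF that] m(2) by blast
   qed
   then show "\<exists>n0. \<forall>n\<ge>n0. norm (q (r n) - 0) < e" by blast
  qed
  have "(\<lambda>n. (q t - q (r n)) / (2 * H)) \<longlonglongrightarrow> (q t - 0) / (2 * H)"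
   using H by (intro tendsto_divide tendsto_diff tendsto_const qr) auto
  then have "(\<lambda>n. \<integral>\<^sup>+s\<in>{r n<..t}. ennreal (s powr (2*H - 1)) \<partial>clock a) \<longlonglongrightarrow> ennreal (q t / (2 * H))"
   unfolding incr[OF r] by (simp add: tendsto_ennrealI)
  moreover have "(\<lambda>n. \<integral>\<^sup>+s\<in>{r n<..t}. ennreal (s powr (2*H - 1)) \<partial>clock a) \<longlonglongrightarrow> (\<integral>\<^sup>+s\<in>{0<..t}. ennreal (s powr (2*H - 1)) \<partial>clock a)"
  proof (rule nn_integral_LIMSEQ)
   have anti: "r j \<le> r i" if "i \<le> j" for i j using that t0 by (auto simp: r_def intro!: divide_left_mono)
   show "incseq (\<lambda>n s. ennreal (s powr (2*H - 1)) * indicator {r n<..t} s)"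
    using anti by (force simp: incseq_def le_fun_def split: split_indicator)
   show "(\<lambda>s. ennreal (s powr (2*H - 1)) * indicator {r n<..t} s) \<in> borel_measurable (clock a)" for n
    unfolding measurable_cong_sets[OF clock_facts(2) refl] by measurable
   show "(\<lambda>n. ennreal (s powr (2*H - 1)) * indicator {r n<..t} s) \<longlonglongrightarrow> ennreal (s powr (2*H - 1)) * indicator {0<..t} s" for s
   proof (rule tendsto_eventually)
    show "\<forall>\<^sub>F n in sequentially. ennreal (s powr (2*H - 1)) * indicator {r n<..t} s = ennreal (s powr (2*H - 1)) * indicator {0<..t} s"
    proof (cases "0 < s")
     case True
     from order_tendstoD(2)[OF r0 True] show ?thesis by eventually_elim (use True in \<open>auto split: split_indicator\<close>)
    next
     case False
     have "indicator {r n<..t} s = (0 :: ennreal)" for n using r(1)[of n] False by (auto split: split_indicator)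
     then show ?thesis using False by simp
    qed
   qed
  qed
  ultimately have W: "(\<integral>\<^sup>+s\<in>{0<..t}. ennreal (s powr (2*H - 1)) \<partial>clock a) = ennreal (q t / (2 * H))"
   using LIMSEQ_unique by blast
  have "0 \<le> q t" by (rule LIMSEQ_le_const2[OF qr]) (use mono[OF r] in auto)
  have "(LINT s:{0..t}|clock a. s powr (2*H - 1)) = enn2real (\<integral>\<^sup>+s. ennreal (indicator {0..t} s *\<^sub>R s powr (2*H - 1)) \<partial>clock a)"
   unfolding set_lebesgue_integral_def
   by (rule integral_eq_nn_integral) (auto simp: measurable_cong_sets[OF clock_facts(2) refl])
  \<comment> \<open>The point \<open>s = 0\<close> contributes nothing, since
    \<open>0 powr (2*H - 1) = 0\<close>.\<close>
  also have "(\<integral>\<^sup>+s. ennreal (indicator {0..t} s *\<^sub>R s powr (2*H - 1)) \<partial>clock a) = (\<integral>\<^sup>+s\<in>{0<..t}. ennreal (s powr (2*H - 1)) \<partial>clock a)"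
   by (intro nn_integral_cong) (auto split: split_indicator)
  finally show ?thesis using W \<open>0 \<le> q t\<close> H by simp
 qed
qed

end

section \<open>Covariation of a step function as weighted local time\<close>

context fbm
begin

text \<open>The scales \<open>d k\<close> make the covariations of the smoothed steps lie within
  \<open>1 / 2 ^ k\<close> of \<open>Q\<close>, uniformly in time. Borel-Cantelli then gives, for
  almost every path, the uniform closeness that the deterministic \<open>ramp_limit_unique\<close>
  asks for, so the exceptional null set does not depend on \<open>t\<close>.\<close>

theorem step_qc_local_time:
 assumes T: "0 < T" and L: "is_local_time M B L" and Q: "has_qc T (indicator {a<..}) Q"
 shows "AE w in M. \<forall>t\<in>{0..T}. Q t w = weighted_local_time H L a t w"
proof -
 define R where "R d t w = 2 * H * (LINT s:{0..t}|lborel. ramp' a d (B s w) * s powr (2*H - 1))" for d t w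
 have "\<exists>d. 0 < d \<and> d \<le> 1 / Suc k \<and> near T (R d) Q (1 / 2 ^ k)" for k
 proof -
  define \<eta> where "\<eta> = 1 / 2 ^ k / (2::real)"
  have \<eta>: "0 < \<eta>" "\<eta> + \<eta> = 1 / 2 ^ k" by (auto simp: \<eta>_def)
  obtain N :: nat and e where e: "0 < e" and near: "\<And>f g \<epsilon>. L2loc f \<Longrightarrow> L2loc g \<Longrightarrow>
   (\<integral>\<^sup>+x\<in>{-real N..real N}. ennreal ((f x - g x)^2) \<partial>lborel) \<le> ennreal e \<Longrightarrow> \<epsilon> \<in> {0<..1} \<Longrightarrow>
   near T (qc_approx H B f \<epsilon>) (qc_approx H B g \<epsilon>) \<eta>" using qc_approx_near[OF T \<eta>(1)] by blast
  define d where "d = min (1 / real (Suc k)) (e / 2)"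
  have d: "0 < d" "d \<le> 1 / Suc k" "2 * d \<le> e" using e by (auto simp: d_def)
  have "near T Q (R d) (\<eta> + \<eta>)"
  proof (rule has_qc_close[OF Q _ \<eta>(1)])
   show "has_qc T (ramp a d) (R d)" unfolding R_def[abs_def] by (rule has_qc_ramp[OF T d(1)])
   show "near T (qc_approx H B (indicator {a<..}) \<epsilon>) (qc_approx H B (ramp a d) \<epsilon>) \<eta>" if "\<epsilon> \<in> {0<..1}" for \<epsilon>
    by (intro near that L2loc_indicator L2loc_ramp order_trans[OF ramp_approximates_step[OF d(1)] ennreal_leI[OF d(3)]]) simp
  qed
  then show ?thesis using d near_sym unfolding \<eta>(2) by blast
 qed
 then obtain d where d: "\<And>k::nat. 0 < d k" "\<And>k. d k \<le> 1 / Suc k" and n: "\<And>k. near T (R (d k)) Q (1 / 2 ^ k)" by metis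
 have d1: "d k \<le> 1" for k using d(2)[of k] by (rule order_trans) simp
 have "d \<longlonglongrightarrow> 0"
 proof (rule tendsto_sandwich[OF _ _ tendsto_const LIMSEQ_inverse_real_of_nat])
  show "\<forall>\<^sub>F k in sequentially. 0 \<le> d k" by (rule always_eventually) (auto intro: less_imp_le d(1))
  show "\<forall>\<^sub>F k in sequentially. d k \<le> inverse (real (Suc k))" by (rule always_eventually) (use d(2) in \<open>auto simp: inverse_eq_divide\<close>)
 qed
 note d0 = this
 have "AE w in M. continuous_on (UNIV \<times> {0..}) (\<lambda>(x, t). L x t w) \<and> (\<forall>x. \<forall>t\<ge>0. 0 \<le> L x t w) \<and>
  (\<forall>t\<ge>0. \<forall>A\<in>sets borel. emeasure lborel {s\<in>{0..t}. B s w \<in> A} = (\<integral>\<^sup>+x\<in>A. ennreal (L x t w) \<partial>lborel))"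
  using L by (simp add: is_local_time_def)
 with near_limsup_null[OF n] show ?thesis
 proof eventually_elim
  case (elim w)
  from elim(1) obtain k where k: "\<And>m t. k \<le> m \<Longrightarrow> t \<in> {0..T} \<Longrightarrow> \<bar>R (d m) t w - Q t w\<bar> \<le> 1 / 2 ^ m" by blast
  interpret local_time_path "\<lambda>s. B s w" "\<lambda>x t. L x t w" using elim(2) paths by unfold_locales auto
  have "Q t w = weighted_local_time H L a t w" if "t \<in> {0..T}" for t
   unfolding weighted_local_time_def clock_def[symmetric]
   by (rule ramp_limit_unique[OF H d(1) d1 d0 k[unfolded R_def] that])
  then show ?case by blast
 qed
qed

end

section \<open>The Bouleau-Yor identity\<close>

lemma completion_measurable_AE:
 assumes X: "X \<in> borel_measurable M" and eq: "AE w in M. X w = Y w"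
 shows "Y \<in> borel_measurable (completion M)"
proof (rule measurableI)
 fix A :: "'b set" assume A: "A \<in> sets borel"
 show "Y -` A \<inter> space (completion M) \<in> sets (completion M)"
 proof (rule completion.in_sets_AE)
  show "X -` A \<inter> space (completion M) \<in> sets (completion M)" by (rule measurable_sets[OF measurable_completion[OF X] A])
  show "AE w in completion M. w \<in> X -` A \<inter> space (completion M) \<longleftrightarrow> w \<in> Y -` A \<inter> space (completion M)"
   unfolding AE_completion_iff using eq by eventually_elim auto
 qed auto
qed simp

lemma L2_limit_unique:
 assumes Y: "L2_limit M X Y" and Z: "L2_limit M X Z"
 shows "AE w in M. Y w = Z w"
proof -
 have [measurable]: "X n \<in> borel_measurable (completion M)" "Y \<in> borel_measurable (completion M)" "Z \<in> borel_measurable (completion M)" for n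
  using Y Z by (auto simp: L2_limit_def square_integrable_def)
 define S where "S U V = (\<integral>\<^sup>+w. ennreal ((U w - V w)^2) \<partial>completion M)" for U V :: "'a \<Rightarrow> real"
 have "S Y Z \<le> 2 * S (X n) Y + 2 * S (X n) Z" for n
  using nn_integral_square_lincomb[of "\<lambda>w. X n w - Y w" "completion M" "\<lambda>w. X n w - Z w" "-1" 1] by (simp add: S_def)
 moreover have "(\<lambda>n. 2 * S (X n) Y + 2 * S (X n) Z) \<longlonglongrightarrow> 2 * 0 + 2 * 0"
  using Y Z by (intro tendsto_add ennreal_tendsto_cmult) (auto simp: S_def L2_limit_def)
 ultimately have "S Y Z \<le> 0" by (intro LIMSEQ_le_const[of _ 0]) auto
 then have "S Y Z = 0" by simp
 then have "AE w in completion M. ennreal ((Y w - Z w)^2) = 0"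
  unfolding S_def by (subst nn_integral_0_iff_AE[symmetric]) auto
 then show ?thesis unfolding AE_completion_iff by eventually_elim (simp add: ennreal_eq_0_iff)
qed

context fbm
begin

lemma elem_fun_end_mass:
 assumes T: "0 < T"
 shows "end_mass T (elem_fun g) < \<infinity>"
proof -
 obtain l a c where g: "g = (l, a, c)" by (metis prod_cases3)
 note [measurable] = elem_fun_measurable[of g]
 interpret \<nu>: finite_borel "density lborel (norm_weight T)" by (rule norm_weight_finite[OF T])
 define k where "k = (\<Sum>j=1..l. \<bar>c j\<bar>)"
 have k: "\<bar>elem_fun g x\<bar> \<le> k" for x
  unfolding g elem_fun_eq k_def by (rule order_trans[OF sum_abs sum_mono]) (simp add: abs_mult split: split_indicator)
 have "end_mass T (elem_fun g) \<le> (\<integral>\<^sup>+x. ennreal ((elem_fun g x)^2) \<partial>density lborel (norm_weight T))"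
  by (subst norm_weight_integral) auto
 also have "... \<le> (\<integral>\<^sup>+x. ennreal (k^2) \<partial>density lborel (norm_weight T))"
  by (intro nn_integral_mono ennreal_leI) (rule power2_le_iff_abs_le[THEN iffD2], use k in \<open>auto intro: order_trans[OF abs_ge_zero]\<close>)
 also have "... = ennreal (k^2) * emeasure (density lborel (norm_weight T)) UNIV" by simp
 also have "... < \<infinity>"
 proof -
  have "emeasure (density lborel (norm_weight T)) UNIV < \<infinity>" by (metis \<nu>.emeasure_finite infinity_ennreal_def less_top)
  then show ?thesis by (simp add: ennreal_mult_less_top)
 qed
 finally show ?thesis .
qed

text \<open>The minus sign of the identity arises here: the indicator of
  \<open>{a (j - 1)<..a j}\<close> is the step at \<open>a (j - 1)\<close> minus the step at
  \<open>a j\<close>, opposite to the increment of the weighted local time in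
  \<open>elem_integral\<close>.\<close>

lemma elem_integral_qc:
 assumes T: "0 < T" and L: "is_local_time M B L" and g: "is_elementary g"
 shows "\<exists>Q. has_qc T (elem_fun g) Q \<and> L2loc (elem_fun g) \<and> (AE w in M. \<forall>t\<in>{0..T}. - Q t w = elem_integral H L g t w)"
proof -
 obtain l a c where g': "g = (l, a, c)" by (metis prod_cases3)
 obtain S where S: "\<And>y. has_qc T (indicator {y<..}) (S y)" using has_qc_step_exists[OF T] by metis
 define Q where "Q t w = (\<Sum>j=1..l. c j * (1 * S (a (j - 1)) t w + (-1) * S (a j) t w))" for t w
 note E = has_qc_elem_fun[OF T g[unfolded g'] S]
 have "AE w in M. \<forall>j\<in>{0..l}. \<forall>t\<in>{0..T}. S (a j) t w = weighted_local_time H L (a j) t w"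
  by (intro AE_finite_allI step_qc_local_time[OF T L S]) simp
 then have "AE w in M. \<forall>t\<in>{0..T}. - Q t w = elem_integral H L g t w"
 proof eventually_elim
  case (elim w)
  show ?case unfolding Q_def g' elem_integral_def prod.case sum_negf[symmetric]
   using elim by (intro ballI sum.cong refl) (auto simp: algebra_simps)
 qed
 then show ?thesis using E unfolding Q_def[abs_def] g' by blast
qed

lemma qc_square_integrable:
 assumes T: "0 < T" and h: "L2loc h" and Q: "has_qc T h Q" and e: "end_mass T h < \<infinity>" and t: "t \<in> {0..T}"
  and X: "AE w in M. - Q t w = X w"
 shows "square_integrable M X"
proof -
 have [measurable]: "Q t \<in> borel_measurable M" using Q t by (simp add: has_qc_iff)
 obtain n where n: "end_mass T h \<le> ennreal n" "0 \<le> n" using e by (cases "end_mass T h") auto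
 have "(\<integral>\<^sup>+w. ennreal ((X w)^2) \<partial>completion M) = (\<integral>\<^sup>+w. ennreal ((Q t w)^2) \<partial>M)" unfolding nn_integral_completion
 proof (rule nn_integral_cong_AE)
  show "AE w in M. ennreal ((X w)^2) = ennreal ((Q t w)^2)" using X
  proof eventually_elim
   case (elim w)
   show ?case unfolding elim[symmetric] by simp
  qed
 qed
 also obtain C where "(\<integral>\<^sup>+w. ennreal ((Q t w)^2) \<partial>M) \<le> ennreal (C * n)" using has_qc_second_moment[OF T] h n Q t by blast
 then have "(\<integral>\<^sup>+w. ennreal ((Q t w)^2) \<partial>M) < \<infinity>" by (simp add: order_le_less_trans)
 finally show ?thesis unfolding square_integrable_def using completion_measurable_AE[OF _ X] by simp
qed

text \<open>By linearity \<open>R n - Q\<close> is the covariation of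
  \<open>elem_fun (g n) - f\<close>, whose second moment is controlled by the squared norm through
  \<open>has_qc_second_moment\<close>. The limit is therefore the same along every approximating
  sequence.\<close>

lemma elem_integral_limit:
 assumes T: "0 < T" and L: "is_local_time M B L" and f: "f \<in> H_space H T" and Q: "has_qc T f Q"
  and g: "approximates H T g f" and t: "t \<in> {0..T}"
 shows "L2_limit M (\<lambda>n. elem_integral H L (g n) t) (\<lambda>w. - Q t w)"
proof -
 have fm: "f \<in> borel_measurable borel" using f by (simp add: H_space_def)
 note f2 = H_space_L2loc[OF T f]
 define N where "N n = H_norm H T (\<lambda>x. elem_fun (g n) x - f x)" for n
 have N: "N \<longlonglongrightarrow> 0" and el: "is_elementary (g n)" for n using g by (auto simp: approximates_def N_def[abs_def])
 have "\<forall>n. \<exists>R. has_qc T (elem_fun (g n)) R \<and> L2loc (elem_fun (g n)) \<and> (AE w in M. \<forall>t\<in>{0..T}. - R t w = elem_integral H L (g n) t w)"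
  by (rule allI) (rule elem_integral_qc[OF T L el])
 from choice[OF this] obtain R where "\<forall>n. has_qc T (elem_fun (g n)) (R n) \<and> L2loc (elem_fun (g n)) \<and> (AE w in M. \<forall>t\<in>{0..T}. - R n t w = elem_integral H L (g n) t w)"
  by (rule exE) blast
 then have R: "has_qc T (elem_fun (g n)) (R n)" "L2loc (elem_fun (g n))"
  "AE w in M. \<forall>t\<in>{0..T}. - R n t w = elem_integral H L (g n) t w" for n by simp_all
 have Rt: "AE w in M. - R n t w = elem_integral H L (g n) t w" for n using R(3)[of n] t by (auto elim: eventually_mono)
 obtain C where C: "0 \<le> C" and Cb: "\<And>h n Q t. L2loc h \<Longrightarrow> 0 \<le> n \<Longrightarrow> end_mass T h \<le> ennreal n \<Longrightarrow> has_qc T h Q \<Longrightarrow> t \<in> {0..T} \<Longrightarrow>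
  (\<integral>\<^sup>+w. ennreal ((Q t w)^2) \<partial>M) \<le> ennreal (C * n)" using has_qc_second_moment[OF T] by blast
 define k where "k = C * sqrt (2*pi)"
 have k: "0 \<le> k" using C by (simp add: k_def)
 define I where "I n = (\<integral>\<^sup>+w. ennreal ((elem_integral H L (g n) t w - - Q t w)^2) \<partial>completion M)" for n
 have I: "I n \<le> ennreal k * N n" if N1: "N n < 1" for n
 proof -
  obtain x where x: "N n = ennreal x" "0 \<le> x" using N1 by (cases "N n") auto
  then have x1: "x \<le> 1" using N1 by (simp add: ennreal_less_one_iff)
  define h where "h = (\<lambda>x. 1 * elem_fun (g n) x + (-1) * f x)"
  have qc: "has_qc T h (\<lambda>t w. 1 * R n t w + (-1) * Q t w)" unfolding h_def by (rule has_qc_lincomb[OF R(1,2) Q f2 T])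
  have h2: "L2loc h" unfolding h_def by (rule L2loc_lincomb[OF R(2) f2])
  have "end_mass T h \<le> ennreal (sqrt (2*pi) * x^2)"
   using x(1) by (intro end_mass_le_H_norm L2loc_measurable h2 x) (simp add: N_def h_def)
  from Cb[OF h2 _ this qc t] have b: "(\<integral>\<^sup>+w. ennreal ((1 * R n t w + (-1) * Q t w)^2) \<partial>M) \<le> ennreal (C * (sqrt (2*pi) * x^2))" by simp
  have "I n = (\<integral>\<^sup>+w. ennreal ((1 * R n t w + (-1) * Q t w)^2) \<partial>M)" unfolding I_def nn_integral_completion
  proof (rule nn_integral_cong_AE)
   show "AE w in M. ennreal ((elem_integral H L (g n) t w - - Q t w)^2) = ennreal ((1 * R n t w + (-1) * Q t w)^2)"
    using Rt[of n]
   proof eventually_elim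
    case (elim w)
    show ?case unfolding elim[symmetric] by (simp add: power2_eq_square algebra_simps)
   qed
  qed
  also note b
  also have "C * (sqrt (2*pi) * x^2) = k * x^2" by (simp add: k_def)
  \<comment> \<open>For a norm at most 1 the square is bounded by the norm itself, so the
    convergence of \<open>N\<close> can be used directly.\<close>
  also have "ennreal (k * x^2) \<le> ennreal (k * x)"
   using k x x1 by (intro ennreal_leI mult_left_mono) (auto simp: power2_eq_square intro: mult_left_le)
  also have "... = ennreal k * N n" using k x by (simp add: ennreal_mult)
  finally show ?thesis .
 qed
 have "(\<lambda>n. ennreal k * N n) \<longlonglongrightarrow> ennreal k * 0" by (intro ennreal_tendsto_cmult N) simp
 then have lim: "(\<lambda>n. ennreal k * N n) \<longlonglongrightarrow> 0" by simp
 have "I \<longlonglongrightarrow> 0"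
 proof (rule tendsto_sandwich[OF _ _ tendsto_const lim])
  have "\<forall>\<^sub>F n in sequentially. N n < 1" using order_tendstoD(2)[OF N, of 1] by simp
  then show "\<forall>\<^sub>F n in sequentially. I n \<le> ennreal k * N n" by eventually_elim (rule I)
 qed simp
 moreover have "square_integrable M (elem_integral H L (g n) t)" for n
  by (rule qc_square_integrable[OF T R(2,1) elem_fun_end_mass[OF T] t Rt])
 moreover have "square_integrable M (\<lambda>w. - Q t w)"
 proof (rule qc_square_integrable[OF T f2 Q _ t])
  obtain n where n: "H_norm H T f \<le> ennreal n" "0 \<le> n" using f by (cases "H_norm H T f") (auto simp: H_space_def)
  show "end_mass T f < \<infinity>" using end_mass_le_H_norm[OF fm n] by (simp add: order_le_less_trans)
 qed simp
 ultimately show ?thesis by (simp add: L2_limit_def I_def[abs_def])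
qed

theorem bouleau_yor:
 assumes T: "0 < T" and L: "is_local_time M B L" and f: "f \<in> H_space H T"
 shows "\<exists>Q. has_qc T f Q"
  and "has_qc T f Q \<Longrightarrow> t \<in> {0..T} \<Longrightarrow> has_local_time_integral M H T L f t (\<lambda>w. - Q t w)"
  and "has_qc T f Q \<Longrightarrow> t \<in> {0..T} \<Longrightarrow> has_local_time_integral M H T L f t I \<Longrightarrow> AE w in M. Q t w = - I w"
proof -
 show "\<exists>Q. has_qc T f Q" by (rule has_qc_exists[OF T H_space_L2loc[OF T f]])
 show "has_local_time_integral M H T L f t (\<lambda>w. - Q t w)" if "has_qc T f Q" "t \<in> {0..T}"
  unfolding has_local_time_integral_def
  using approximates_exists[OF T f] elem_integral_limit[OF T L f that(1) _ that(2)] by blast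
 show "AE w in M. Q t w = - I w" if Q: "has_qc T f Q" "t \<in> {0..T}" and I: "has_local_time_integral M H T L f t I"
 proof -
  obtain g where g: "approximates H T g f" using approximates_exists[OF T f] by blast
  have "AE w in M. - Q t w = I w"
   using I g by (intro L2_limit_unique[OF elem_integral_limit[OF T L f Q(1) g Q(2)]]) (auto simp: has_local_time_integral_def)
  then show ?thesis by eventually_elim auto
 qed
qed

end

section \<open>Reduction to a version with continuous paths\<close>

lemma gaussian_rv_AE_cong:
 assumes X: "gaussian_rv M X" and eq: "AE w in M. X w = Y w" and Y: "Y \<in> borel_measurable M"
 shows "gaussian_rv M Y"
proof -
 have "distr M lborel X = distr M lborel Y" using X Y eq by (intro distr_cong_AE) (auto simp: gaussian_rv_def)
 then have d: "distributed M lborel X p \<Longrightarrow> distributed M lborel Y p" for p using Y by (simp add: distributed_def)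
 have c: "AE w in M. Y w = m" if "AE w in M. X w = m" for m using eq that by eventually_elim simp
 show ?thesis using X Y d c unfolding gaussian_rv_def by blast
qed

text \<open>The process is set to 0 on a null set that contains all discontinuous paths, and frozen
  at its value at time 0 for negative times; this makes every path continuous on the whole line
  without changing finite-dimensional laws at times \<open>t \<ge> 0\<close>.\<close>

lemma fbm_regular_version:
 assumes M: "prob_space M" and H: "0 < H" "H < 1/2" and B: "fractional_brownian_motion M H B"
 shows "\<exists>B'. fbm M H B' \<and> (AE w in M. \<forall>t\<ge>0. B' t w = B t w)"
proof -
 interpret prob_space M by fact
 have G: "gaussian_rv M (\<lambda>w. \<Sum>t\<in>J. c t * B t w)" if "finite J" "J \<subseteq> {0..}" for J c
  using B that by (simp add: fractional_brownian_motion_def gaussian_process_def)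
 have Bm: "B t \<in> borel_measurable M" if "0 \<le> t" for t using G[of "{t}" "\<lambda>_. 1"] that by (simp add: gaussian_rv_def)
 have "AE w in M. continuous_on {0..} (\<lambda>t. B t w)" using B by (simp add: fractional_brownian_motion_def)
 then obtain N where N: "\<And>w. w \<in> space M - N \<Longrightarrow> continuous_on {0..} (\<lambda>t. B t w)" "N \<in> null_sets M" by (elim AE_E3) blast
 define B' where "B' t w = (if w \<in> space M - N then B (max 0 t) w else 0)" for t w
 have [measurable]: "space M - N \<in> sets M" using N(2) by auto
 have B'm [measurable]: "B' t \<in> borel_measurable M" for t
 proof -
  have [measurable]: "B (max 0 t) \<in> borel_measurable M" by (rule Bm) simp
  show ?thesis unfolding B'_def[abs_def] by measurable
 qed
 have eq: "AE w in M. \<forall>t\<ge>0. B' t w = B t w"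
  using AE_not_in[OF N(2)] AE_space by eventually_elim (simp add: B'_def max_def)
 have "fbm M H B'"
 proof
  show "0 < H" "H < 1/2" by fact+
  show "gaussian_rv M (\<lambda>w. \<Sum>t\<in>J. c t * B' t w)" if "finite J" "J \<subseteq> {0..}" for J c
  proof (rule gaussian_rv_AE_cong[OF G[OF that]])
   show "AE w in M. (\<Sum>t\<in>J. c t * B t w) = (\<Sum>t\<in>J. c t * B' t w)"
    using eq by eventually_elim (use that in \<open>auto intro!: sum.cong\<close>)
  qed measurable
  show "expectation (B' t) = 0" if "0 \<le> t" for t
  proof -
   have "expectation (B' t) = expectation (B t)"
    using Bm[OF that] eq that by (intro integral_cong_AE) (auto elim: eventually_mono)
   then show ?thesis using B that by (simp add: fractional_brownian_motion_def)
  qed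
  show "expectation (\<lambda>w. B' t w * B' s w) = 1/2 * (t powr (2*H) + s powr (2*H) - \<bar>t - s\<bar> powr (2*H))" if "0 \<le> t" "0 \<le> s" for t s
  proof -
   note [measurable] = Bm[OF that(1)] Bm[OF that(2)]
   have "expectation (\<lambda>w. B' t w * B' s w) = expectation (\<lambda>w. B t w * B s w)"
    using eq that by (intro integral_cong_AE) (auto elim: eventually_mono)
   then show ?thesis using B that by (simp add: fractional_brownian_motion_def)
  qed
  show "continuous_on UNIV (\<lambda>t. B' t w)" for w
  proof (cases "w \<in> space M - N")
   case True
   have "continuous_on UNIV (\<lambda>t. B (max 0 t) w)"
    by (rule continuous_on_compose2[OF N(1)[OF True]]) (auto intro!: continuous_intros)
   then show ?thesis using True by (simp add: B'_def)
  next
   case False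
   then have "B' t w = 0" for t by (simp only: B'_def if_False)
   then show ?thesis by simp
  qed
  show "B' t \<in> borel_measurable M" for t by (rule B'm)
 qed
 then show ?thesis using eq by blast
qed

lemma qc_AE_cong:
 assumes M: "prob_space M" and eq: "AE w in M. \<forall>t\<ge>0. B' t w = B t w" and Q: "is_generalized_qc M H T B' f Q"
 shows "is_generalized_qc M H T B f Q"
proof -
 interpret prob_space M by fact
 have "eventually (\<lambda>\<epsilon>. near T (qc_approx H B f \<epsilon>) Q \<eta>) (at_right 0)" if "0 < \<eta>" for \<eta>
 proof -
  have "eventually (\<lambda>\<epsilon>. near T (qc_approx H B' f \<epsilon>) Q \<eta>) (at_right 0)"
   using Q that by (simp add: is_generalized_qc_def ucp_limit_iff_near)
  moreover have "eventually (\<lambda>\<epsilon>::real. 0 < \<epsilon>) (at_right 0)" by (simp add: eventually_at_right_less)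
  ultimately show ?thesis
  proof eventually_elim
   case (elim \<epsilon>)
   show ?case
   proof (rule near_AE_cong[OF elim(1)])
    show "AE w in M. \<forall>t\<in>{0..T}. qc_approx H B f \<epsilon> t w = qc_approx H B' f \<epsilon> t w \<and> Q t w = Q t w" using eq
    proof eventually_elim
     case E: (elim w)
     have "qc_approx H B f \<epsilon> t w = qc_approx H B' f \<epsilon> t w" for t
      unfolding qc_approx_def using E elim(2) by (intro arg_cong2[where f = "(*)"] refl set_lebesgue_integral_cong) auto
     then show ?case by simp
    qed
   qed
  qed
 qed
 then show ?thesis using Q by (simp add: is_generalized_qc_def ucp_limit_iff_near)
qed

lemma local_time_AE_cong:
 assumes eq: "AE w in M. \<forall>t\<ge>0. B' t w = B t w" and L: "is_local_time M B L"
 shows "is_local_time M B' L"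
proof -
 have "AE w in M. continuous_on (UNIV \<times> {0..}) (\<lambda>(x, t). L x t w) \<and> (\<forall>x. \<forall>t\<ge>0. 0 \<le> L x t w) \<and>
  (\<forall>t\<ge>0. \<forall>A\<in>sets borel. emeasure lborel {s\<in>{0..t}. B s w \<in> A} = (\<integral>\<^sup>+x\<in>A. ennreal (L x t w) \<partial>lborel))"
  using L by (simp add: is_local_time_def)
 with eq have "AE w in M. continuous_on (UNIV \<times> {0..}) (\<lambda>(x, t). L x t w) \<and> (\<forall>x. \<forall>t\<ge>0. 0 \<le> L x t w) \<and>
  (\<forall>t\<ge>0. \<forall>A\<in>sets borel. emeasure lborel {s\<in>{0..t}. B' s w \<in> A} = (\<integral>\<^sup>+x\<in>A. ennreal (L x t w) \<partial>lborel))"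
 proof eventually_elim
  case (elim w)
  have "{s\<in>{0..t}. B' s w \<in> A} = {s\<in>{0..t}. B s w \<in> A}" for t A using elim(1) by auto
  then show ?case using elim(2) by simp
 qed
 then show ?thesis using L by (simp add: is_local_time_def)
qed

theorem mainTheorem3:
  fixes M :: "'a measure" and H T :: real
    and B :: "real \<Rightarrow> 'a \<Rightarrow> real" and L :: "real \<Rightarrow> real \<Rightarrow> 'a \<Rightarrow> real" and f :: "real \<Rightarrow> real"
  assumes "prob_space M"
    and "0 < T"
    and "0 < H" and "H < 1/2"
    and "fractional_brownian_motion M H B"
    and "is_local_time M B L"
    and "f \<in> H_space H T"
  shows "(\<forall>t\<in>{0..T}. \<exists>I. has_local_time_integral M H T L f t I) \<and>
    (\<exists>Q. is_generalized_qc M H T B f Q) \<and>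
    (\<forall>Q. is_generalized_qc M H T B f Q \<longrightarrow>
       (\<forall>t\<in>{0..T}. \<forall>I. has_local_time_integral M H T L f t I \<longrightarrow>
          (AE \<omega> in M. Q t \<omega> = - I \<omega>)))"
proof -
  obtain B' where B': "fbm M H B'" and eq: "AE \<omega> in M. \<forall>t\<ge>0. B' t \<omega> = B t \<omega>"
    using fbm_regular_version[OF assms(1,3-5)] by blast
  interpret fbm M H B' by fact
  note BY = bouleau_yor[OF assms(2) local_time_AE_cong[OF eq assms(6)] assms(7)]
  have sym: "AE \<omega> in M. \<forall>t\<ge>0. B t \<omega> = B' t \<omega>" using eq by eventually_elim simp
  have qc: "is_generalized_qc M H T B f Q \<longleftrightarrow> has_qc T f Q" for Q
    using qc_AE_cong[OF assms(1) eq] qc_AE_cong[OF assms(1) sym] by blast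
  show ?thesis unfolding qc using BY by blast
qed

end
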